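(* Let $\Lambda(\Omega)\subset\mathbb{R}^m$ be a simple generic model set with $\Omega$ symmetric around the origin, let $\Delta\subset\mathbb{R}^m$ be relatively dense and uniformly discrete, and let $g_l,h_l\in W(L^2,\ell^1)$ for $l=1,\dots,L$. Write $\mathcal{G}(g,\Lambda(\Omega),\Delta)=\{T_\lambda M_\beta g_l: l=1,\dots,L,\ \lambda\in\Lambda(\Omega),\ \beta\in\Delta\}$ and similarly $\mathcal{G}(h,\Lambda(\Omega),\Delta)$, and assume that both are Bessel sequences for $L^2(\mathbb{R}^m)$. Then $\mathcal{G}(h,\Lambda(\Omega),\Delta)$ is a dual system to $\mathcal{G}(g,\Lambda(\Omega),\Delta)$ if and only if, for each $\eta\in\Gamma^*$, $$D(\Lambda(\Omega))\,\Phi(-p_2^*(\eta))\sum_{l=1}^L\sum_{\beta\in\Delta}\overline{\widehat{g_l}(t-\beta)}\,\widehat{h_l}(t-\beta-p_1^*(\eta))=\delta_{\eta,0}\quad\text{for a.e. } t\in\mathbb{R}^m,$$ where $\delta$ is the Kronecker delta.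
   Context: Notation: $T_\lambda f(t)=f(t-\lambda)$, $M_\beta f(t)=e^{2\pi i\beta\cdot t}f(t)$; $\widehat f(\omega)=\int_{\mathbb{R}^m} f(t)e^{-2\pi i t\cdot\omega}\,dt$. $W(L^p,\ell^q)$ is the space of measurable functions $f$ on $\mathbb{R}^m$ with $\|f\|_{p,q}=\big(\sum_{k\in\mathbb{Z}^m}\|f\mathbf{1}_{k+[0,1]^m}\|_p^q\big)^{1/q}<\infty$. A family $\{e_j\}$ is a Bessel sequence if for some $B<\infty$, $\sum_j|\langle f,e_j\rangle|^2\le B\|f\|_2^2$ for all $f\in L^2(\mathbb{R}^m)$. For Bessel sequences, $\mathcal{G}(h,\Lambda(\Omega),\Delta)$ is a dual system to $\mathcal{G}(g,\Lambda(\Omega),\Delta)$ if $f=\sum_{l}\sum_{\lambda\in\Lambda(\Omega)}\sum_{\beta\in\Delta}\langle f,T_\lambda M_\beta g_l\rangle T_\lambda M_\beta h_l$ for all $f\in L^2(\mathbb{R}^m)$. A set is uniformly discrete if distinct points are at distance at least some $r>0$, and relatively dense if for some $r>0$ it meets every cube $t+r[0,1]^m$. Model sets: let $\Gamma\subset\mathbb{R}^m\times\mathbb{R}$ be a lattice and $p_1:\mathbb{R}^m\times\mathbb{R}\to\mathbb{R}^m$, $p_2:\mathbb{R}^m\times\mathbb{R}\to\mathbb{R}$ the orthogonal projections; assume $p_1|_\Gamma$ and $p_2|_\Gamma$ are injective with dense images. $\Gamma^*=\{y:\gamma\cdot y\in\mathbb{Z}\ \forall\gamma\in\Gamma\}$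 is the dual lattice and $p_1^*,p_2^*$ are the same projections used on $\Gamma^*$ (also injective on $\Gamma^*$ with dense images). For a compact interval $\Omega\subset\mathbb{R}$ with non-empty interior, $\Lambda(\Omega)=\{p_1(\gamma):\gamma\in\Gamma,\ p_2(\gamma)\in\Omega\}$ is a simple model set; it is generic if $p_2(\Gamma)\cap\partial\Omega=\emptyset$. Standing assumption: also $p_2^*(\Gamma^* )\cap\partial\Omega=\emptyset$. Its density is $D(\Lambda(\Omega))=\lim_{R\to\infty}\#(\Lambda(\Omega)\cap(x+R[0,1]^m))/R^m=|\Omega|/\mathrm{vol}(\Gamma)$. The function $\Phi$: fix $0<\epsilon<1$, put $\Omega_n=(1-\epsilon^n)\Omega$ and let $\psi_n$ be the infinite convolution product over $s=0,1,2,\dots$ of the functions $\mathbf{1}_{\epsilon^{ns}\Omega_n}/|\epsilon^{ns}\Omega_n|$ (convergent in $L^1(\mathbb{R})$), so that $\widehat{\psi_n}(t)=\prod_{s=0}^\infty\mathrm{sinc}(t|\epsilon^{ns}\Omega_n|)$ with $\mathrm{sinc}(t)=\sin(\pi t)/(\pi t)$. Let $\Psi$ be the uniform limit of $\widehat{\psi_n}$ as $n\to\infty$ (namely $\Psi(t)=\mathrm{sinc}(|\Omega|t)$, the Fourier transform of $\mathbf{1}_\Omega/|\Omega|$), and set $\Phi=|\Omega|\cdot(\Psi*\Psi)$. Then $\Phi(0)=1$. *)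

theory Defs
  imports "HOL-Analysis.Analysis"
begin

definition L2 :: "('a::euclidean_space \<Rightarrow> complex) set" where
  "L2 = {f \<in> borel_measurable lebesgue. integrable lebesgue (\<lambda>x. (norm (f x))\<^sup>2)}"

definition L2_inner :: "('a::euclidean_space \<Rightarrow> complex) \<Rightarrow> ('a \<Rightarrow> complex) \<Rightarrow> complex" where
  "L2_inner f g = (LINT x|lebesgue. f x * cnj (g x))"

definition Lp_norm :: "real \<Rightarrow> ('a::euclidean_space \<Rightarrow> complex) \<Rightarrow> real" where
  "Lp_norm p f = (LINT x|lebesgue. norm (f x) powr p) powr (1 / p)"

definition fourier :: "('a::euclidean_space \<Rightarrow> complex) \<Rightarrow> 'a \<Rightarrow> complex" where
  "fourier f w = (LINT t|lebesgue. f t * cis (- 2 * pi * (t \<bullet> w)))"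

definition transl :: "'a::euclidean_space \<Rightarrow> ('a \<Rightarrow> complex) \<Rightarrow> 'a \<Rightarrow> complex" where
  "transl a f t = f (t - a)"

definition modul :: "'a::euclidean_space \<Rightarrow> ('a \<Rightarrow> complex) \<Rightarrow> 'a \<Rightarrow> complex" where
  "modul b f t = cis (2 * pi * (b \<bullet> t)) * f t"

definition cube :: "'a::euclidean_space \<Rightarrow> real \<Rightarrow> 'a set" where
  "cube x R = (\<lambda>y. x + R *\<^sub>R y) ` cbox 0 One"

definition integer_points :: "'a::euclidean_space set" where
  "integer_points = {k. \<forall>b\<in>Basis. k \<bullet> b \<in> \<int>}"

text \<open>Only finite exponents p and q are covered: Lebesgue integrals and real sums return 0 where
  they diverge, so both finiteness conditions are stated explicitly.\<close>

definition Wiener_amalgam :: "real \<Rightarrow> real \<Rightarrow> ('a::euclidean_space \<Rightarrow> complex) set" where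
  "Wiener_amalgam p q = {f \<in> borel_measurable lebesgue.
     (\<forall>k\<in>integer_points. integrable lebesgue (\<lambda>x. norm (f x * indicator (cube k 1) x) powr p)) \<and>
     (\<lambda>k. Lp_norm p (\<lambda>x. f x * indicator (cube k 1) x) powr q) summable_on integer_points}"

definition Bessel_sequence :: "'i set \<Rightarrow> ('i \<Rightarrow> 'a::euclidean_space \<Rightarrow> complex) \<Rightarrow> bool" where
  "Bessel_sequence I e \<longleftrightarrow> (\<forall>j\<in>I. e j \<in> L2) \<and>
     (\<exists>B. \<forall>f\<in>L2. (\<lambda>j. (norm (L2_inner f (e j)))\<^sup>2) summable_on I \<and>
        (\<Sum>\<^sub>\<infinity>j\<in>I. (norm (L2_inner f (e j)))\<^sup>2) \<le> B * (Lp_norm 2 f)\<^sup>2)"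

text \<open>The expansion of \<open>f\<close> converges in the norm of \<open>L2\<close>, along the finite subsets of the index
  set; for Bessel sequences such series always converge unconditionally.\<close>

definition dual_system ::
  "'i set \<Rightarrow> ('i \<Rightarrow> 'a::euclidean_space \<Rightarrow> complex) \<Rightarrow> ('i \<Rightarrow> 'a \<Rightarrow> complex) \<Rightarrow> bool" where
  "dual_system I d e \<longleftrightarrow> (\<forall>f\<in>L2.
     ((\<lambda>F. Lp_norm 2 (\<lambda>t. f t - (\<Sum>j\<in>F. L2_inner f (e j) * d j t))) \<longlongrightarrow> 0)
       (finite_subsets_at_top I))"

text \<open>The Gabor system is treated as a family, indexed by \<open>(l, \<lambda>, \<beta>)\<close>: an element that arises
  from several indices is counted with multiplicity.\<close>

definition gabor :: "(nat \<Rightarrow> 'a::euclidean_space \<Rightarrow> complex) \<Rightarrow> nat \<times> 'a \<times> 'a \<Rightarrow> 'a \<Rightarrow> complex" where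
  "gabor g = (\<lambda>(l, a, b). transl a (modul b (g l)))"

definition relatively_dense :: "'a::euclidean_space set \<Rightarrow> bool" where
  "relatively_dense S \<longleftrightarrow> (\<exists>r>0. \<forall>t. S \<inter> cube t r \<noteq> {})"

definition is_lattice :: "'a::euclidean_space set \<Rightarrow> bool" where
  "is_lattice S \<longleftrightarrow> (\<exists>B. independent B \<and> span B = UNIV \<and>
     S = range (\<lambda>c :: 'a \<Rightarrow> int. \<Sum>b\<in>B. of_int (c b) *\<^sub>R b))"

definition dual_lattice :: "'a::euclidean_space set \<Rightarrow> 'a set" where
  "dual_lattice S = {y. \<forall>x\<in>S. x \<bullet> y \<in> \<int>}"

definition model_set :: "('a::euclidean_space \<times> real) set \<Rightarrow> real set \<Rightarrow> 'a set" where
  "model_set \<Gamma> \<Omega> = fst ` {x \<in> \<Gamma>. snd x \<in> \<Omega>}"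

definition point_density :: "'a::euclidean_space set \<Rightarrow> real" where
  "point_density S =
     (THE d. \<forall>x. ((\<lambda>R. real (card (S \<inter> cube x R)) / R ^ DIM('a)) \<longlongrightarrow> d) at_top)"

definition normalized_indicator :: "real set \<Rightarrow> real \<Rightarrow> complex" where
  "normalized_indicator A x = of_real (indicator A x / measure lebesgue A)"

definition fconv :: "(real \<Rightarrow> complex) \<Rightarrow> (real \<Rightarrow> complex) \<Rightarrow> real \<Rightarrow> complex" where
  "fconv f g x = (LINT y|lebesgue. f y * g (x - y))"

primrec partial_fconv :: "(nat \<Rightarrow> real \<Rightarrow> complex) \<Rightarrow> nat \<Rightarrow> real \<Rightarrow> complex" where
  "partial_fconv u 0 = u 0"
| "partial_fconv u (Suc k) = fconv (partial_fconv u k) (u (Suc k))"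

text \<open>The \<open>L1\<close>-limit, which is determined up to a null set.\<close>

definition infinite_fconv :: "(nat \<Rightarrow> real \<Rightarrow> complex) \<Rightarrow> real \<Rightarrow> complex" where
  "infinite_fconv u = (SOME f. integrable lebesgue f \<and>
     (\<forall>k. integrable lebesgue (partial_fconv u k)) \<and>
     ((\<lambda>k. LINT x|lebesgue. norm (partial_fconv u k x - f x)) \<longlonglongrightarrow> 0))"

definition shrunk_window :: "real \<Rightarrow> real set \<Rightarrow> nat \<Rightarrow> real set" where
  "shrunk_window \<epsilon> \<Omega> n = (\<lambda>x. (1 - \<epsilon> ^ n) * x) ` \<Omega>"

text \<open>Meaningful for \<open>n > 0\<close> only, since \<open>shrunk_window \<epsilon> \<Omega> 0\<close> is a null set; only the limit
  as \<open>n\<close> tends to infinity is used.\<close>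

definition psi :: "real \<Rightarrow> real set \<Rightarrow> nat \<Rightarrow> real \<Rightarrow> complex" where
  "psi \<epsilon> \<Omega> n =
     infinite_fconv (\<lambda>s. normalized_indicator ((\<lambda>x. \<epsilon> ^ (n * s) * x) ` shrunk_window \<epsilon> \<Omega> n))"

definition Psi :: "real \<Rightarrow> real set \<Rightarrow> real \<Rightarrow> complex" where
  "Psi \<epsilon> \<Omega> = (THE P. uniform_limit UNIV (\<lambda>n. fourier (psi \<epsilon> \<Omega> n)) P sequentially)"

definition Phi :: "real \<Rightarrow> real set \<Rightarrow> real \<Rightarrow> complex" where
  "Phi \<epsilon> \<Omega> t = of_real (measure lebesgue \<Omega>) * fconv (Psi \<epsilon> \<Omega>) (Psi \<epsilon> \<Omega>) t"

end

theory Submission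
  imports Defs "HOL-Probability.Probability"
begin

text \<open>Write \<open>\<Omega> = {- a..a}\<close>. Because both systems are Bessel, duality only has to be tested weakly
  against continuous functions \<open>f\<close>, \<open>k\<close> of compact support. For such a pair let \<open>F(y)\<close> be the sum over
  \<open>l\<close> and \<open>\<beta> \<in> \<Delta>\<close> of \<open>\<langle>f, T\<^sub>y M\<^sub>\<beta> g\<^sub>l\<rangle> \<langle>T\<^sub>y M\<^sub>\<beta> h\<^sub>l, k\<rangle>\<close>, and periodize \<open>F(x) 1\<^sub>\<Omega>(y)\<close> along \<open>\<Gamma>\<close> to a bounded function
  \<open>H(x, y)\<close> on the torus. Duality says \<open>H(0) = \<langle>f, k\<rangle>\<close> for all \<open>f\<close>, \<open>k\<close>. Translating \<open>f\<close> and \<open>k\<close> gives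
  \<open>H(x, 0) = \<langle>f, k\<rangle>\<close> for all \<open>x\<close>; since \<open>p\<^sub>2(\<Gamma>)\<close> is dense and \<open>H\<close> is continuous at every \<open>(x, y)\<close> for which
  \<open>y + p\<^sub>2(\<Gamma>)\<close> avoids the endpoints of \<open>\<Omega>\<close>, periodicity forces \<open>H\<close> to be constant almost everywhere. By
  genericity the origin is such a point, so conversely the value \<open>H(0)\<close> is determined by the Fourier
  coefficients of \<open>H\<close>. Parseval turns the coefficient at \<open>\<eta>\<close> into the integral of
  \<open>fourier f \<omega> * cnj (fourier k (\<omega> - p\<^sub>1(\<eta>)))\<close> against \<open>2 a sinc(2 a p\<^sub>2(\<eta>))\<close> times the sum over \<open>l\<close> and \<open>\<beta>\<close> in the statement. That
  sum is a bounded continuous function of \<open>\<omega>\<close>, hence determined by these integrals.\<close>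

section \<open>Integrals over Euclidean space and Parseval's identity\<close>

text \<open>The window is a sharp cutoff, so the Fourier coefficients of \<open>H\<close> decay in
  its direction only like a sinc, and the Fourier series of \<open>H\<close> need not converge
  absolutely. Its value at the origin is therefore not found by summing over the dual lattice:
  \<open>H\<close> is compared with a constant through uniqueness of Fourier coefficients at a point
  of continuity. The function \<Phi> is \<Psi> in disguise: \<Psi> is the transform of the uniform
  density on \<Omega>, whose square is the density itself divided by the length of \<Omega>, and
  Parseval turns the convolution square of \<Psi> into the transform of that square. The amalgam
  condition enters through one uniform estimate. On all balls of a fixed radius, trigonometric
  polynomials with frequencies in \<Delta> have norms bounded by the \<open>l2\<close> norm of their
  coefficients, independently of the center. By duality, and by \<open>l1\<close>-summation over
  unit cubes, the samples of the transforms of \<open>g l\<close> and \<open>h l\<close> on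
  translates of \<Delta> are square summable with a uniform bound and depend continuously on the
  translate.\<close>

lemma Cauchy_Schwarz_integrable:
  fixes f g :: "'a \<Rightarrow> 'b::{real_normed_algebra, banach, second_countable_topology}"
  assumes [measurable]: "f \<in> borel_measurable M" "g \<in> borel_measurable M"
    and "integrable M (\<lambda>x. (norm (f x))\<^sup>2)" "integrable M (\<lambda>x. (norm (g x))\<^sup>2)"
  shows "integrable M (\<lambda>x. f x * g x)"
proof (rule Bochner_Integration.integrable_bound)
  show "integrable M (\<lambda>x. (norm (f x))\<^sup>2 + (norm (g x))\<^sup>2)" using assms by simp
  have "norm (f x * g x) \<le> norm ((norm (f x))\<^sup>2 + (norm (g x))\<^sup>2)" for x
  proof -
    have "0 \<le> (norm (f x))\<^sup>2 + (norm (g x))\<^sup>2 - 2 * (norm (f x) * norm (g x))"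
      using zero_le_power2[of "norm (f x) - norm (g x)"] by (simp add: power2_diff algebra_simps)
    then have "norm (f x) * norm (g x) \<le> (norm (f x))\<^sup>2 + (norm (g x))\<^sup>2"
      using mult_nonneg_nonneg[OF norm_ge_zero norm_ge_zero, of "f x" "g x"] by linarith
    then show ?thesis using norm_mult_ineq[of "f x" "g x"] by simp
  qed
  then show "AE x in M. norm (f x * g x) \<le> norm ((norm (f x))\<^sup>2 + (norm (g x))\<^sup>2)" by simp
qed simp

lemma Cauchy_Schwarz_integral_norm:
  fixes f g :: "'a \<Rightarrow> 'b::{real_normed_div_algebra, banach, second_countable_topology}"
  assumes [measurable]: "f \<in> borel_measurable M" "g \<in> borel_measurable M"
    and f: "integrable M (\<lambda>x. (norm (f x))\<^sup>2)" and g: "integrable M (\<lambda>x. (norm (g x))\<^sup>2)"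
  shows "(\<integral>x. norm (f x) * norm (g x) \<partial>M)\<^sup>2 \<le> (\<integral>x. (norm (f x))\<^sup>2 \<partial>M) * (\<integral>x. (norm (g x))\<^sup>2 \<partial>M)"
proof -
  have i: "integrable M (\<lambda>x. norm (f x) * norm (g x))"
    using Cauchy_Schwarz_integrable[OF assms, THEN integrable_norm] by (simp add: norm_mult)
  have "(\<integral>\<^sup>+x. ennreal (norm (f x)) * ennreal (norm (g x)) \<partial>M)\<^sup>2 \<le>
      (\<integral>\<^sup>+x. (ennreal (norm (f x)))\<^sup>2 \<partial>M) * (\<integral>\<^sup>+x. (ennreal (norm (g x)))\<^sup>2 \<partial>M)"
    by (rule Cauchy_Schwarz_nn_integral) auto
  then show ?thesis
    by (simp add: ennreal_mult'[symmetric] ennreal_power nn_integral_eq_integral[OF i]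
      nn_integral_eq_integral[OF f] nn_integral_eq_integral[OF g])
qed

lemma Cauchy_Schwarz_integral:
  fixes f g :: "'a \<Rightarrow> 'b::{real_normed_field, banach, second_countable_topology}"
  assumes [measurable]: "f \<in> borel_measurable M" "g \<in> borel_measurable M"
    and f: "integrable M (\<lambda>x. (norm (f x))\<^sup>2)" and g: "integrable M (\<lambda>x. (norm (g x))\<^sup>2)"
  shows "(norm (\<integral>x. f x * g x \<partial>M))\<^sup>2 \<le> (\<integral>x. (norm (f x))\<^sup>2 \<partial>M) * (\<integral>x. (norm (g x))\<^sup>2 \<partial>M)"
proof -
  have "norm (\<integral>x. f x * g x \<partial>M) \<le> (\<integral>x. norm (f x) * norm (g x) \<partial>M)"
    using integral_norm_bound[of M "\<lambda>x. f x * g x"] by (simp add: norm_mult)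
  from power_mono[OF this norm_ge_zero, of 2] show ?thesis
    using Cauchy_Schwarz_integral_norm[OF assms] by linarith
qed

section \<open>Affine changes of variable and measurability rules\<close>

lemma lborel_integral_affine:
  fixes f :: "'a::euclidean_space \<Rightarrow> 'b::{banach, second_countable_topology}"
  assumes [measurable]: "f \<in> borel_measurable borel" and "c \<noteq> 0"
  shows "(\<integral>x. f x \<partial>lborel) = \<bar>c\<bar> ^ DIM('a) *\<^sub>R (\<integral>x. f (t + c *\<^sub>R x) \<partial>lborel)"
  by (subst lborel_affine[OF \<open>c \<noteq> 0\<close>, of t])
     (simp add: integral_density integral_distr)

lemma lborel_integrable_affine:
  fixes f :: "'a::euclidean_space \<Rightarrow> 'b::{banach, second_countable_topology}"
  assumes [measurable]: "f \<in> borel_measurable borel" and "c \<noteq> 0"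
  shows "integrable lborel (\<lambda>x. f (t + c *\<^sub>R x)) \<longleftrightarrow> integrable lborel f"
proof -
  have "integrable lborel f \<longleftrightarrow> integrable lborel (\<lambda>x. \<bar>c\<bar> ^ DIM('a) *\<^sub>R f (t + c *\<^sub>R x))"
    by (subst lborel_affine[OF \<open>c \<noteq> 0\<close>, of t])
       (simp add: integrable_density integrable_distr_eq)
  also have "\<dots> \<longleftrightarrow> integrable lborel (\<lambda>x. f (t + c *\<^sub>R x))"
  proof
    assume "integrable lborel (\<lambda>x. \<bar>c\<bar> ^ DIM('a) *\<^sub>R f (t + c *\<^sub>R x))"
    from integrable_scaleR_right[OF this, of "inverse (\<bar>c\<bar> ^ DIM('a))"]
    show "integrable lborel (\<lambda>x. f (t + c *\<^sub>R x))" using \<open>c \<noteq> 0\<close> by simp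
  qed (rule integrable_scaleR_right)
  finally show ?thesis ..
qed

lemma lborel_integral_shift:
  fixes f :: "'a::euclidean_space \<Rightarrow> 'b::{banach, second_countable_topology}"
  assumes "f \<in> borel_measurable borel"
  shows "(\<integral>x. f (x + t) \<partial>lborel) = (\<integral>x. f x \<partial>lborel)" "(\<integral>x. f (x - t) \<partial>lborel) = (\<integral>x. f x \<partial>lborel)"
    "(\<integral>x. f (t - x) \<partial>lborel) = (\<integral>x. f x \<partial>lborel)"
  using lborel_integral_affine[OF assms, of 1 t] lborel_integral_affine[OF assms, of 1 "-t"]
    lborel_integral_affine[OF assms, of "-1" t]
  by (simp_all add: add.commute)

lemma lborel_integrable_shift:
  fixes f :: "'a::euclidean_space \<Rightarrow> 'b::{banach, second_countable_topology}"
  assumes "f \<in> borel_measurable borel"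
  shows "integrable lborel (\<lambda>x. f (x + t)) \<longleftrightarrow> integrable lborel f"
    "integrable lborel (\<lambda>x. f (x - t)) \<longleftrightarrow> integrable lborel f"
    "integrable lborel (\<lambda>x. f (t - x)) \<longleftrightarrow> integrable lborel f"
  using lborel_integrable_affine[OF assms, of 1 t] lborel_integrable_affine[OF assms, of 1 "-t"]
    lborel_integrable_affine[OF assms, of "-1" t]
  by (simp_all add: add.commute)

lemma borel_measurable_cis [measurable (raw)]:
  "f \<in> borel_measurable M \<Longrightarrow> (\<lambda>x. cis (f x)) \<in> borel_measurable M"
  by (rule measurable_compose[where g = cis, OF _ borel_measurable_continuous_onI])
     (auto intro!: continuous_intros simp: cis_conv_exp)

lemma borel_measurable_cnj [measurable (raw)]:
  "f \<in> borel_measurable M \<Longrightarrow> (\<lambda>x. cnj (f x)) \<in> borel_measurable M"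
  by (rule measurable_compose[where g = cnj, OF _ borel_measurable_continuous_onI])
     (auto intro!: continuous_intros)

section \<open>Gaussians and their Fourier transforms\<close>

lemma lborel_integral_prod:
  fixes f :: "'a::euclidean_space \<Rightarrow> real \<Rightarrow> complex"
  assumes f: "\<And>b. b \<in> Basis \<Longrightarrow> integrable lborel (f b)"
  shows "integrable lborel (\<lambda>x::'a. \<Prod>b\<in>Basis. f b (x \<bullet> b))"
    and "(\<integral>x. (\<Prod>b\<in>Basis. f b (x \<bullet> b)) \<partial>(lborel :: 'a measure)) = (\<Prod>b\<in>Basis. \<integral>x. f b x \<partial>lborel)"
proof -
  interpret product_sigma_finite "\<lambda>_. lborel :: real measure" ..
  have m [measurable]: "b \<in> Basis \<Longrightarrow> f b \<in> borel_measurable borel" for b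
    using borel_measurable_integrable[OF f] by simp
  have s: "(\<Prod>b\<in>Basis. f b ((\<Sum>c\<in>Basis. x c *\<^sub>R c) \<bullet> b)) = (\<Prod>b\<in>Basis. f b (x b))" for x :: "'a \<Rightarrow> real"
    by (rule prod.cong) auto
  show "integrable lborel (\<lambda>x::'a. \<Prod>b\<in>Basis. f b (x \<bullet> b))"
    by (subst lborel_def, subst integrable_distr_eq)
       (auto simp: s lborel_eq_real[symmetric] intro!: product_integrable_prod f)
  show "(\<integral>x. (\<Prod>b\<in>Basis. f b (x \<bullet> b)) \<partial>(lborel :: 'a measure)) = (\<Prod>b\<in>Basis. \<integral>x. f b x \<partial>lborel)"
    by (subst lborel_def, subst integral_distr)
       (auto simp: s lborel_eq_real[symmetric] intro!: product_integral_prod f)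
qed

text \<open>The value is the characteristic function of the standard normal distribution. This
  explains the kernel \<open>cis (x * t)\<close> without the factor \<open>2 * pi\<close> of
  \<open>fourier\<close>; the constant \<open>sqrt (2 * pi)\<close> undoes the normalization of the
  density.\<close>

lemma gaussian_fourier_real:
  "integrable lborel (\<lambda>x::real. of_real (exp (- x\<^sup>2 / 2)) * cis (x * t))"
  "(\<integral>x. of_real (exp (- x\<^sup>2 / 2)) * cis (x * t) \<partial>lborel) = of_real (sqrt (2 * pi)) * of_real (exp (- t\<^sup>2 / 2))"
proof -
  have i0: "integrable lborel (\<lambda>x::real. of_real (std_normal_density x) * cis (x * t))"
  proof (rule Bochner_Integration.integrable_bound)
    show "integrable lborel std_normal_density" by (rule integrable_normal_density) simp
  qed (auto simp: norm_mult)
  have eq: "of_real (exp (- x\<^sup>2 / 2)) * cis (x * t) =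
      of_real (sqrt (2 * pi)) * (of_real (std_normal_density x) * cis (x * t))" for x
    by (simp add: std_normal_density_def)
  show "integrable lborel (\<lambda>x::real. of_real (exp (- x\<^sup>2 / 2)) * cis (x * t))"
    unfolding eq using i0 by simp
  have "of_real (exp (- t\<^sup>2 / 2)) = char std_normal_distribution t"
    by (simp add: char_std_normal_distribution)
  also have "\<dots> = (\<integral>x. of_real (std_normal_density x) * cis (x * t) \<partial>lborel)"
    unfolding char_def
    by (subst integral_density) (auto simp: scaleR_conv_of_real cis_conv_exp mult_ac)
  finally show "(\<integral>x. of_real (exp (- x\<^sup>2 / 2)) * cis (x * t) \<partial>lborel) =
      of_real (sqrt (2 * pi)) * of_real (exp (- t\<^sup>2 / 2))"
    unfolding eq using i0 by simp
qed

lemma gaussian_fourier: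
  fixes y :: "'a::euclidean_space"
  shows "integrable lborel (\<lambda>x::'a. of_real (exp (- (norm x)\<^sup>2 / 2)) * cis (x \<bullet> y))"
    and "(\<integral>x. of_real (exp (- (norm x)\<^sup>2 / 2)) * cis (x \<bullet> y) \<partial>lborel) =
      of_real (sqrt (2 * pi) ^ DIM('a)) * of_real (exp (- (norm y)\<^sup>2 / 2))"
proof -
  have n2: "(norm x)\<^sup>2 = (\<Sum>b\<in>Basis. (x \<bullet> b)\<^sup>2)" for x :: 'a
    unfolding power2_norm_eq_inner by (subst euclidean_inner) (simp add: power2_eq_square)
  have e1: "exp (- (norm x)\<^sup>2 / 2) = (\<Prod>b\<in>Basis. exp (- (x \<bullet> b)\<^sup>2 / 2))" for x :: 'a
    by (simp add: n2 exp_sum[symmetric] sum_negf sum_divide_distrib)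
  have cs: "cis (\<Sum>b\<in>A. u b) = (\<Prod>b\<in>A. cis (u b))" if "finite A" for u and A :: "'a set"
    using that by (induction A) (auto simp: cis_mult[symmetric])
  have e2: "cis (x \<bullet> y) = (\<Prod>b\<in>Basis. cis ((x \<bullet> b) * (y \<bullet> b)))" for x :: 'a
    by (subst euclidean_inner) (simp add: cs)
  have e3: "of_real (exp (- (norm x)\<^sup>2 / 2)) * cis (x \<bullet> y) =
      (\<Prod>b\<in>Basis. of_real (exp (- (x \<bullet> b)\<^sup>2 / 2)) * cis ((x \<bullet> b) * (y \<bullet> b)))" for x :: 'a
    unfolding e1 e2 by (simp add: prod.distrib of_real_prod)
  show "integrable lborel (\<lambda>x::'a. of_real (exp (- (norm x)\<^sup>2 / 2)) * cis (x \<bullet> y))"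
    unfolding e3 by (rule lborel_integral_prod) (rule gaussian_fourier_real)
  show "(\<integral>x. of_real (exp (- (norm x)\<^sup>2 / 2)) * cis (x \<bullet> y) \<partial>lborel) =
      of_real (sqrt (2 * pi) ^ DIM('a)) * of_real (exp (- (norm y)\<^sup>2 / 2))"
    unfolding e3 lborel_integral_prod(2)[OF gaussian_fourier_real(1)] gaussian_fourier_real(2) e1[of y]
    by (simp only: prod.distrib of_real_prod prod_constant of_real_power)
qed

lemma gaussian_integral:
  "integrable lborel (\<lambda>x::'a::euclidean_space. exp (- (norm x)\<^sup>2 / 2))"
  "(\<integral>x. exp (- (norm x)\<^sup>2 / 2) \<partial>(lborel :: 'a::euclidean_space measure)) = sqrt (2 * pi) ^ DIM('a)"
proof -
  show "integrable lborel (\<lambda>x::'a. exp (- (norm x)\<^sup>2 / 2))"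
    using integrable_norm[OF gaussian_fourier(1)[of "0::'a"]]
    by (simp only: norm_mult norm_cis norm_of_real abs_exp_cancel mult_1_right)
  have "complex_of_real (\<integral>x. exp (- (norm x)\<^sup>2 / 2) \<partial>(lborel :: 'a measure)) = of_real (sqrt (2 * pi) ^ DIM('a))"
    using gaussian_fourier(2)[of "0::'a"]
    by (simp only: integral_complex_of_real[symmetric] inner_zero_right cis_zero mult_1_right norm_zero)
       simp
  then show "(\<integral>x. exp (- (norm x)\<^sup>2 / 2) \<partial>(lborel :: 'a::euclidean_space measure)) = sqrt (2 * pi) ^ DIM('a)"
    by (simp only: of_real_eq_iff)
qed

lemma gaussian_fourier_scaled:
  fixes y :: "'a::euclidean_space"
  assumes "\<epsilon> > 0"
  shows "integrable lborel (\<lambda>x::'a. of_real (exp (- (norm (\<epsilon> *\<^sub>R x))\<^sup>2 / 2)) * cis (x \<bullet> y))"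
    and "(\<integral>x. of_real (exp (- (norm (\<epsilon> *\<^sub>R x))\<^sup>2 / 2)) * cis (x \<bullet> y) \<partial>lborel) =
      of_real (sqrt (2 * pi) ^ DIM('a) / \<epsilon> ^ DIM('a)) * of_real (exp (- (norm (y /\<^sub>R \<epsilon>))\<^sup>2 / 2))"
proof -
  let ?f = "\<lambda>x::'a. of_real (exp (- (norm x)\<^sup>2 / 2)) * cis (x \<bullet> (y /\<^sub>R \<epsilon>))"
  have f: "?f (0 + \<epsilon> *\<^sub>R x) = of_real (exp (- (norm (\<epsilon> *\<^sub>R x))\<^sup>2 / 2)) * cis (x \<bullet> y)" for x
    using assms by (simp flip: mult.assoc)
  have m: "?f \<in> borel_measurable borel"
    using borel_measurable_integrable[OF gaussian_fourier(1)] by simp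
  show "integrable lborel (\<lambda>x::'a. of_real (exp (- (norm (\<epsilon> *\<^sub>R x))\<^sup>2 / 2)) * cis (x \<bullet> y))"
    using lborel_integrable_affine[OF m, of \<epsilon> 0] gaussian_fourier(1)[of "y /\<^sub>R \<epsilon>"] assms
    unfolding f by simp
  show "(\<integral>x. of_real (exp (- (norm (\<epsilon> *\<^sub>R x))\<^sup>2 / 2)) * cis (x \<bullet> y) \<partial>lborel) =
      of_real (sqrt (2 * pi) ^ DIM('a) / \<epsilon> ^ DIM('a)) * of_real (exp (- (norm (y /\<^sub>R \<epsilon>))\<^sup>2 / 2))"
    using lborel_integral_affine[OF m, of \<epsilon> 0] gaussian_fourier(2)[of "y /\<^sub>R \<epsilon>"] assms
    unfolding f by (simp add: scaleR_conv_of_real field_simps)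
qed

text \<open>Fubini for an absolutely integrable kernel. The parameter \<open>s\<close> leaves scale
  and sign open because the formula is applied with both \<open>2 * pi\<close> and
  \<open>- 2 * pi\<close>.\<close>

lemma fourier_multiplication:
  fixes P R :: "'a::euclidean_space \<Rightarrow> complex"
  assumes P: "integrable lborel P" and R: "integrable lborel R"
  shows "(\<integral>\<omega>. (\<integral>x. P x * cis (s * (x \<bullet> \<omega>)) \<partial>lborel) * R \<omega> \<partial>lborel) =
    (\<integral>x. P x * (\<integral>\<omega>. R \<omega> * cis (s * (x \<bullet> \<omega>)) \<partial>lborel) \<partial>lborel)"
proof -
  have [measurable]: "P \<in> borel_measurable borel" "R \<in> borel_measurable borel"
    using borel_measurable_integrable[OF P] borel_measurable_integrable[OF R] by auto
  let ?f = "\<lambda>x \<omega>. P x * (R \<omega> * cis (s * (x \<bullet> \<omega>)))"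
  have [measurable]: "(\<lambda>(x, \<omega>). ?f x \<omega>) \<in> borel_measurable (lborel \<Otimes>\<^sub>M lborel)"
    unfolding cis_conv_exp by measurable
  have iR: "integrable lborel (\<lambda>\<omega>. ?f x \<omega>)" for x
    by (rule Bochner_Integration.integrable_bound[of _ "\<lambda>\<omega>. P x * R \<omega>"])
      (use R in \<open>auto simp: norm_mult cis_conv_exp\<close>)
  have n: "(\<integral>\<omega>. norm (?f x \<omega>) \<partial>lborel) = norm (P x) * (\<integral>\<omega>. norm (R \<omega>) \<partial>lborel)" for x
    by (simp add: norm_mult)
  have i: "integrable (lborel \<Otimes>\<^sub>M lborel) (\<lambda>(x, \<omega>). ?f x \<omega>)"
    by (rule lborel_pair.Fubini_integrable)
      (use iR P in \<open>auto simp: n simp del: norm_mult intro!: integrable_mult_left\<close>)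
  have "(\<integral>\<omega>. (\<integral>x. ?f x \<omega> \<partial>lborel) \<partial>lborel) = (\<integral>x. (\<integral>\<omega>. ?f x \<omega> \<partial>lborel) \<partial>lborel)"
    using i by (rule lborel_pair.Fubini_integral)
  moreover have "(\<integral>x. ?f x \<omega> \<partial>lborel) = (\<integral>x. P x * cis (s * (x \<bullet> \<omega>)) \<partial>lborel) * R \<omega>" for \<omega>
    by (subst integral_mult_left_zero[symmetric]) (simp add: mult_ac)
  ultimately show ?thesis by simp
qed

text \<open>\<open>fourier\<close> integrates over the completed measure. For Borel functions the
  integral passes to \<open>lborel\<close>, where Fubini's theorem and the substitution rules are at
  hand; this is also why the windows are later replaced by Borel representatives.\<close>

lemma fourier_lborel:
  assumes "P \<in> borel_measurable borel"
  shows "fourier P w = (\<integral>t. P t * cis (- 2 * pi * (t \<bullet> w)) \<partial>lborel)"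
  unfolding fourier_def using assms
  by (intro integral_completion) (simp add: cis_conv_exp)

lemma fourier_measurable [measurable]:
  fixes P :: "'a::euclidean_space \<Rightarrow> complex"
  assumes [measurable]: "P \<in> borel_measurable borel"
  shows "fourier P \<in> borel_measurable borel"
proof -
  have "(\<lambda>w. \<integral>t. P t * cis (- 2 * pi * (t \<bullet> w)) \<partial>lborel) \<in> borel_measurable borel"
    unfolding cis_conv_exp by measurable
  then show ?thesis by (subst fourier_lborel[OF assms, abs_def]) 
qed

lemma norm_fourier_le:
  assumes "P \<in> borel_measurable borel"
  shows "norm (fourier P w) \<le> (\<integral>t. norm (P t) \<partial>lborel)"
  unfolding fourier_lborel[OF assms]
  using integral_norm_bound[of lborel "\<lambda>t. P t * cis (- 2 * pi * (t \<bullet> w))"]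
  by (simp add: norm_mult)

text \<open>A Gaussian weight on the frequency side makes every integral absolutely convergent. Two
  applications of the multiplication formula move it to the space side, where it becomes an
  approximate identity of width \<open>\<epsilon> / (2 * pi)\<close> acting on \<open>Q\<close>. The
  factor \<open>2 * pi\<close> is the one in the exponent of \<open>fourier\<close>.\<close>

lemma parseval_gaussian:
  fixes P Q :: "'a::euclidean_space \<Rightarrow> complex"
  assumes P: "integrable lborel P" and Q: "integrable lborel Q" and "\<epsilon> > 0"
  defines "g \<equiv> \<lambda>w::'a. complex_of_real (exp (- (norm w)\<^sup>2 / 2))"
  shows "integrable lborel (\<lambda>w. fourier P w * cnj (fourier Q w) * g (\<epsilon> *\<^sub>R w))"
    and "(\<integral>w. fourier P w * cnj (fourier Q w) * g (\<epsilon> *\<^sub>R w) \<partial>lborel) =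
      (\<integral>x. P x * (\<integral>v. cnj (Q (x + (\<epsilon> / (2 * pi)) *\<^sub>R v)) * g v \<partial>lborel) \<partial>lborel) / of_real (sqrt (2 * pi) ^ DIM('a))"
proof -
  have mP [measurable]: "P \<in> borel_measurable borel" and mQ [measurable]: "Q \<in> borel_measurable borel"
    using borel_measurable_integrable[OF P] borel_measurable_integrable[OF Q] by auto
  let ?C = "complex_of_real (sqrt (2 * pi) ^ DIM('a))"
  have gi: "integrable lborel (\<lambda>w. g (\<epsilon> *\<^sub>R w))"
    using gaussian_fourier_scaled(1)[OF \<open>\<epsilon> > 0\<close>, of "0::'a"] by (simp add: g_def)
  have [measurable]: "g \<in> borel_measurable borel" unfolding g_def by measurable
  let ?K = "(\<integral>t. norm (P t) \<partial>lborel) * (\<integral>t. norm (Q t) \<partial>lborel)"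
  have K0: "0 \<le> (\<integral>t. norm (Q t) \<partial>lborel)" by (rule integral_nonneg_AE) simp
  have b1: "integrable lborel (\<lambda>w. cnj (fourier Q w) * g (\<epsilon> *\<^sub>R w))"
  proof (rule Bochner_Integration.integrable_bound)
    show "integrable lborel (\<lambda>w. (\<integral>t. norm (Q t) \<partial>lborel) *\<^sub>R g (\<epsilon> *\<^sub>R w))" using gi by simp
    show "AE w in lborel. norm (cnj (fourier Q w) * g (\<epsilon> *\<^sub>R w)) \<le> norm ((\<integral>t. norm (Q t) \<partial>lborel) *\<^sub>R g (\<epsilon> *\<^sub>R w))"
      using norm_fourier_le[OF mQ] K0 by (auto simp: norm_mult intro!: mult_right_mono)
  qed measurable
  show "integrable lborel (\<lambda>w. fourier P w * cnj (fourier Q w) * g (\<epsilon> *\<^sub>R w))"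
  proof (rule Bochner_Integration.integrable_bound)
    show "integrable lborel (\<lambda>w. (\<integral>t. norm (P t) \<partial>lborel) *\<^sub>R (cnj (fourier Q w) * g (\<epsilon> *\<^sub>R w)))"
      using b1 by simp
    have "0 \<le> (\<integral>t. norm (P t) \<partial>lborel)" by (rule integral_nonneg_AE) simp
    then show "AE w in lborel. norm (fourier P w * cnj (fourier Q w) * g (\<epsilon> *\<^sub>R w)) \<le>
        norm ((\<integral>t. norm (P t) \<partial>lborel) *\<^sub>R (cnj (fourier Q w) * g (\<epsilon> *\<^sub>R w)))"
      using norm_fourier_le[OF mP] by (auto simp: norm_mult mult.assoc intro!: mult_right_mono)
  qed measurable
  have in2: "(\<integral>w. (cnj (fourier Q w) * g (\<epsilon> *\<^sub>R w)) * cis (- 2 * pi * (x \<bullet> w)) \<partial>lborel) =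
     (\<integral>v. cnj (Q (x + (\<epsilon> / (2 * pi)) *\<^sub>R v)) * g v \<partial>lborel) / ?C" for x
  proof -
    let ?S = "\<lambda>w. g (\<epsilon> *\<^sub>R w) * cis (- 2 * pi * (x \<bullet> w))"
    have S: "integrable lborel ?S"
      by (rule Bochner_Integration.integrable_bound[OF gi]) (auto simp: norm_mult cis_conv_exp)
    have cQ: "cnj (fourier Q w) = (\<integral>y. cnj (Q y) * cis (2 * pi * (y \<bullet> w)) \<partial>lborel)" for w
      unfolding fourier_lborel[OF mQ] by (subst Bochner_Integration.integral_cnj[symmetric]) (simp add: cis_cnj)
    have "(\<integral>w. (cnj (fourier Q w) * g (\<epsilon> *\<^sub>R w)) * cis (- 2 * pi * (x \<bullet> w)) \<partial>lborel) =
        (\<integral>w. (\<integral>y. cnj (Q y) * cis (2 * pi * (y \<bullet> w)) \<partial>lborel) * ?S w \<partial>lborel)"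
      by (simp add: cQ mult_ac)
    also have "\<dots> = (\<integral>y. cnj (Q y) * (\<integral>w. ?S w * cis (2 * pi * (y \<bullet> w)) \<partial>lborel) \<partial>lborel)"
      by (rule fourier_multiplication) (use Q S in auto)
    also have "(\<lambda>y. \<integral>w. ?S w * cis (2 * pi * (y \<bullet> w)) \<partial>lborel) =
        (\<lambda>y. ?C / of_real (\<epsilon> ^ DIM('a)) * g ((2 * pi / \<epsilon>) *\<^sub>R (y - x)))"
    proof
      fix y
      have c: "cis (- 2 * pi * (x \<bullet> w)) * cis (2 * pi * (y \<bullet> w)) = cis (w \<bullet> ((2 * pi) *\<^sub>R (y - x)))" for w
        by (simp add: cis_mult inner_diff_right inner_commute[of w] right_diff_distrib)
      have eq: "(\<lambda>w. ?S w * cis (2 * pi * (y \<bullet> w))) = (\<lambda>w. g (\<epsilon> *\<^sub>R w) * cis (w \<bullet> ((2 * pi) *\<^sub>R (y - x))))"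
        by (rule ext, subst mult.assoc, subst c, rule refl)
      have v: "((2 * pi) *\<^sub>R (y - x)) /\<^sub>R \<epsilon> = (2 * pi / \<epsilon>) *\<^sub>R (y - x)"
        by (simp add: divide_inverse mult.commute)
      show "(\<integral>w. ?S w * cis (2 * pi * (y \<bullet> w)) \<partial>lborel) =
          ?C / of_real (\<epsilon> ^ DIM('a)) * g ((2 * pi / \<epsilon>) *\<^sub>R (y - x))"
        unfolding eq unfolding g_def gaussian_fourier_scaled(2)[OF \<open>\<epsilon> > 0\<close>] v of_real_divide ..
    qed
    \<comment> \<open>The substitution \<open>y = x + (\<epsilon> / (2 * pi)) *\<^sub>R v\<close>
      turns the rescaled Gaussian back into the fixed \<open>g\<close>, so that afterwards
      \<epsilon> occurs only in the argument of \<open>Q\<close> and in constants.\<close>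
    also have "(\<integral>y. cnj (Q y) * (?C / of_real (\<epsilon> ^ DIM('a)) * g ((2 * pi / \<epsilon>) *\<^sub>R (y - x))) \<partial>lborel) =
       \<bar>\<epsilon> / (2 * pi)\<bar> ^ DIM('a) *\<^sub>R (\<integral>v. cnj (Q (x + (\<epsilon> / (2 * pi)) *\<^sub>R v)) * (?C / of_real (\<epsilon> ^ DIM('a)) * g ((2 * pi / \<epsilon>) *\<^sub>R ((x + (\<epsilon> / (2 * pi)) *\<^sub>R v) - x))) \<partial>lborel)"
      by (rule lborel_integral_affine) (use \<open>\<epsilon> > 0\<close> in auto)
    also have "\<dots> = \<bar>\<epsilon> / (2 * pi)\<bar> ^ DIM('a) *\<^sub>R ((?C / of_real (\<epsilon> ^ DIM('a))) * (\<integral>v. cnj (Q (x + (\<epsilon> / (2 * pi)) *\<^sub>R v)) * g v \<partial>lborel))"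
      using \<open>\<epsilon> > 0\<close> by (subst integral_mult_right_zero[symmetric]) (simp add: mult_ac)
    also have "\<dots> = (of_real (\<bar>\<epsilon> / (2 * pi)\<bar> ^ DIM('a)) * ?C / of_real (\<epsilon> ^ DIM('a))) * (\<integral>v. cnj (Q (x + (\<epsilon> / (2 * pi)) *\<^sub>R v)) * g v \<partial>lborel)"
      by (simp add: scaleR_conv_of_real)
    also have "of_real (\<bar>\<epsilon> / (2 * pi)\<bar> ^ DIM('a)) * ?C / of_real (\<epsilon> ^ DIM('a)) = 1 / ?C"
    proof -
      \<comment> \<open>The Jacobian has \<open>(2 * pi) ^ DIM('a)\<close> in its denominator, which
        is the square of the Gaussian constant \<open>?C\<close>. One copy cancels; the other
        remains and normalizes the mass of \<open>g\<close> to one.\<close>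
      have "?C * ?C = of_real ((2 * pi) ^ DIM('a))"
        by (simp only: of_real_mult[symmetric] power_mult_distrib[symmetric]) simp
      moreover have "of_real (\<bar>\<epsilon> / (2 * pi)\<bar> ^ DIM('a)) = complex_of_real (\<epsilon> ^ DIM('a)) / of_real ((2 * pi) ^ DIM('a))"
        using \<open>\<epsilon> > 0\<close> by (simp add: power_divide)
      ultimately show ?thesis using \<open>\<epsilon> > 0\<close> by (simp add: divide_simps)
    qed
    finally show ?thesis by simp
  qed
  have "(\<integral>w. fourier P w * cnj (fourier Q w) * g (\<epsilon> *\<^sub>R w) \<partial>lborel) =
     (\<integral>w. (\<integral>x. P x * cis ((- 2 * pi) * (x \<bullet> w)) \<partial>lborel) * (cnj (fourier Q w) * g (\<epsilon> *\<^sub>R w)) \<partial>lborel)"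
    by (simp add: fourier_lborel[OF mP] mult.assoc)
  also have "\<dots> = (\<integral>x. P x * (\<integral>w. (cnj (fourier Q w) * g (\<epsilon> *\<^sub>R w)) * cis (- 2 * pi * (x \<bullet> w)) \<partial>lborel) \<partial>lborel)"
    by (rule fourier_multiplication[OF P b1])
  also have "\<dots> = (\<integral>x. P x * (\<integral>v. cnj (Q (x + (\<epsilon> / (2 * pi)) *\<^sub>R v)) * g v \<partial>lborel) / ?C \<partial>lborel)"
    by (simp only: in2 times_divide_eq_right)
  also have "\<dots> = (\<integral>x. P x * (\<integral>v. cnj (Q (x + (\<epsilon> / (2 * pi)) *\<^sub>R v)) * g v \<partial>lborel) \<partial>lborel) / ?C"
    by (simp only: integral_divide_zero)
  finally show "(\<integral>w. fourier P w * cnj (fourier Q w) * g (\<epsilon> *\<^sub>R w) \<partial>lborel) =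
      (\<integral>x. P x * (\<integral>v. cnj (Q (x + (\<epsilon> / (2 * pi)) *\<^sub>R v)) * g v \<partial>lborel) \<partial>lborel) / ?C" .
qed

text \<open>Gaussian averages of the bounded function \<open>Q\<close> at scales tending to zero
  converge to \<open>Q x\<close> at every point of continuity. Continuity almost everywhere is
  therefore enough, which admits indicators of intervals; this case is needed for the evaluation of
  \<Phi>.\<close>

lemma parseval_gaussian_limit:
  fixes P Q :: "'a::euclidean_space \<Rightarrow> complex"
  assumes P: "integrable lborel P" and Q: "integrable lborel Q"
    and B: "\<And>x. norm (Q x) \<le> B" and cont: "AE x in lborel. isCont Q x"
  shows "(\<lambda>n. \<integral>w. fourier P w * cnj (fourier Q w) * of_real (exp (- (norm ((1 / real (Suc n)) *\<^sub>R w))\<^sup>2 / 2)) \<partial>lborel)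
    \<longlonglongrightarrow> (\<integral>x. P x * cnj (Q x) \<partial>lborel)"
proof -
  have [measurable]: "P \<in> borel_measurable borel" "Q \<in> borel_measurable borel"
    using borel_measurable_integrable[OF P] borel_measurable_integrable[OF Q] by auto
  let ?C = "complex_of_real (sqrt (2 * pi) ^ DIM('a))"
  define g where "g = (\<lambda>w::'a. complex_of_real (exp (- (norm w)\<^sup>2 / 2)))"
  have [measurable]: "g \<in> borel_measurable borel" unfolding g_def by measurable
  have gi: "integrable lborel g" and gC: "(\<integral>v. g v \<partial>lborel) = ?C"
    using gaussian_integral[where 'a='a] by (auto simp: g_def integral_complex_of_real)
  have gn: "norm (g v) = exp (- (norm v)\<^sup>2 / 2)" for v by (simp add: g_def)
  define d where "d n = 1 / real (Suc n) / (2 * pi)" for n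
  have d0: "d \<longlonglongrightarrow> 0"
    unfolding d_def using tendsto_divide[OF lim_1_over_n[THEN LIMSEQ_Suc] tendsto_const[of "2 * pi"]] by simp
  have B0: "0 \<le> B" using order_trans[OF norm_ge_zero B] .
  define I where "I n x = (\<integral>v. cnj (Q (x + d n *\<^sub>R v)) * g v \<partial>lborel)" for n x
  have lim: "(\<lambda>n. I n x) \<longlonglongrightarrow> (\<integral>v. cnj (Q x) * g v \<partial>lborel)" if "isCont Q x" for x
    unfolding I_def
  proof (rule integral_dominated_convergence)
    show "integrable lborel (\<lambda>v. B * norm (g v))" using gi by simp
    show "AE v in lborel. (\<lambda>n. cnj (Q (x + d n *\<^sub>R v)) * g v) \<longlonglongrightarrow> cnj (Q x) * g v"
    proof (rule AE_I2)
      fix v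
      have "(\<lambda>n. x + d n *\<^sub>R v) \<longlonglongrightarrow> x + 0 *\<^sub>R v" by (intro tendsto_intros d0)
      then have "(\<lambda>n. Q (x + d n *\<^sub>R v)) \<longlonglongrightarrow> Q x"
        using isCont_tendsto_compose[OF that] by simp
      then show "(\<lambda>n. cnj (Q (x + d n *\<^sub>R v)) * g v) \<longlonglongrightarrow> cnj (Q x) * g v"
        by (intro tendsto_intros)
    qed
    show "AE v in lborel. norm (cnj (Q (x + d n *\<^sub>R v)) * g v) \<le> B * norm (g v)" for n
      using B by (auto simp: norm_mult intro!: mult_right_mono)
  qed auto
  have Ib: "norm (I n x) \<le> B * norm ?C" for n x
  proof -
    have "norm (I n x) \<le> (\<integral>v. norm (cnj (Q (x + d n *\<^sub>R v)) * g v) \<partial>lborel)"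
      unfolding I_def by (rule integral_norm_bound)
    also have "\<dots> \<le> (\<integral>v. B * norm (g v) \<partial>lborel)"
      by (rule integral_mono') (use gi B B0 in \<open>auto simp: norm_mult intro!: mult_right_mono\<close>)
    also have "\<dots> = B * norm ?C"
      using gaussian_integral(2)[where 'a='a] by (simp add: gn norm_power)
    finally show ?thesis .
  qed
  have [measurable]: "I n \<in> borel_measurable borel" for n unfolding I_def by measurable
  have "(\<lambda>n. \<integral>x. P x * I n x \<partial>lborel) \<longlonglongrightarrow> (\<integral>x. P x * (cnj (Q x) * ?C) \<partial>lborel)"
  proof (rule integral_dominated_convergence)
    show "integrable lborel (\<lambda>x. norm (P x) * (B * norm ?C))" using P by auto
    show "AE x in lborel. (\<lambda>n. P x * I n x) \<longlonglongrightarrow> P x * (cnj (Q x) * ?C)"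
      using cont by eventually_elim (use lim in \<open>auto simp: gC intro!: tendsto_intros\<close>)
    show "AE x in lborel. norm (P x * I n x) \<le> norm (P x) * (B * norm ?C)" for n
      unfolding norm_mult[of "P _"] by (intro AE_I2 mult_left_mono Ib) simp
  qed auto
  from tendsto_divide[OF this tendsto_const, of ?C]
  have "(\<lambda>n. (\<integral>x. P x * I n x \<partial>lborel) / ?C) \<longlonglongrightarrow> (\<integral>x. P x * (cnj (Q x) * ?C) \<partial>lborel) / ?C" by simp
  moreover have "(\<integral>x. P x * (cnj (Q x) * ?C) \<partial>lborel) / ?C = (\<integral>x. P x * cnj (Q x) \<partial>lborel)"
    by (simp add: mult.assoc[symmetric])
  moreover have "(\<integral>x. P x * I n x \<partial>lborel) / ?C =
      (\<integral>w. fourier P w * cnj (fourier Q w) * g ((1 / real (Suc n)) *\<^sub>R w) \<partial>lborel)" for n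
    unfolding g_def I_def d_def by (subst parseval_gaussian(2)[OF P Q]) auto
  ultimately show ?thesis by (simp add: g_def)
qed

text \<open>For \<open>Q = P\<close> the weighted integrands are nonnegative and increase with
  \<open>n\<close>, so convergence of their integrals already gives integrability of the limit. Only
  with this in hand is a dominating function available for the general Parseval identity.\<close>

theorem plancherel_integrable:
  fixes P :: "'a::euclidean_space \<Rightarrow> complex"
  assumes P: "integrable lborel P" and B: "\<And>x. norm (P x) \<le> B" and cont: "AE x in lborel. isCont P x"
  shows "integrable lborel (\<lambda>w. (norm (fourier P w))\<^sup>2)"
proof -
  have mP [measurable]: "P \<in> borel_measurable borel"
    using borel_measurable_integrable[OF P] by auto
  let ?f = "\<lambda>n w. (norm (fourier P w))\<^sup>2 * exp (- (norm ((1 / real (Suc n)) *\<^sub>R w))\<^sup>2 / 2)"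
  have eq: "fourier P w * cnj (fourier P w) * of_real (exp (- (norm ((1 / real (Suc n)) *\<^sub>R w))\<^sup>2 / 2)) = complex_of_real (?f n w)" for n w
    by (simp only: complex_norm_square of_real_mult)
  have i: "integrable lborel (?f n)" for n
    using parseval_gaussian(1)[OF P P, of "1 / real (Suc n)"]
    unfolding eq complex_of_real_integrable_eq by simp
  show ?thesis
  proof (rule integrable_monotone_convergence)
    show "integrable lborel (?f n)" for n by (rule i)
    have "mono (\<lambda>n. ?f n w)" for w
    proof (intro monoI mult_left_mono)
      fix m n :: nat assume "m \<le> n"
      then have "(1 / real (Suc n) * norm w)\<^sup>2 \<le> (1 / real (Suc m) * norm w)\<^sup>2"
        by (intro power_mono mult_right_mono) (auto simp: frac_le)
      then show "exp (- (norm ((1 / real (Suc m)) *\<^sub>R w))\<^sup>2 / 2) \<le> exp (- (norm ((1 / real (Suc n)) *\<^sub>R w))\<^sup>2 / 2)"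
        by simp
    qed simp
    then show "AE w in lborel. mono (\<lambda>n. ?f n w)" by simp
    have "(\<lambda>n. ?f n w) \<longlonglongrightarrow> (norm (fourier P w))\<^sup>2 * exp (- (norm (0 *\<^sub>R w))\<^sup>2 / 2)" for w
      by (intro tendsto_intros lim_1_over_n[THEN LIMSEQ_Suc]) auto
    then show "AE w in lborel. (\<lambda>n. ?f n w) \<longlonglongrightarrow> (norm (fourier P w))\<^sup>2" by simp
    have "(\<lambda>n. complex_of_real (\<integral>w. ?f n w \<partial>lborel)) \<longlonglongrightarrow> (\<integral>x. P x * cnj (P x) \<partial>lborel)"
      using parseval_gaussian_limit[OF P P B cont] unfolding eq integral_complex_of_real .
    from tendsto_Re[OF this]
    show "(\<lambda>n. \<integral>w. ?f n w \<partial>lborel) \<longlonglongrightarrow> Re (\<integral>x. P x * cnj (P x) \<partial>lborel)" by simp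
  qed measurable
qed

theorem parseval:
  fixes P Q :: "'a::euclidean_space \<Rightarrow> complex"
  assumes P: "integrable lborel P" "\<And>x. norm (P x) \<le> A" "AE x in lborel. isCont P x"
    and Q: "integrable lborel Q" "\<And>x. norm (Q x) \<le> B" "AE x in lborel. isCont Q x"
  shows "integrable lborel (\<lambda>w. fourier P w * cnj (fourier Q w))"
    and "(\<integral>w. fourier P w * cnj (fourier Q w) \<partial>lborel) = (\<integral>x. P x * cnj (Q x) \<partial>lborel)"
proof -
  have mP [measurable]: "P \<in> borel_measurable borel" and mQ [measurable]: "Q \<in> borel_measurable borel"
    using borel_measurable_integrable[OF P(1)] borel_measurable_integrable[OF Q(1)] by auto
  show i: "integrable lborel (\<lambda>w. fourier P w * cnj (fourier Q w))"
    by (rule Cauchy_Schwarz_integrable) (use plancherel_integrable[OF P] plancherel_integrable[OF Q] in auto)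
  have "(\<lambda>n. \<integral>w. fourier P w * cnj (fourier Q w) * of_real (exp (- (norm ((1 / real (Suc n)) *\<^sub>R w))\<^sup>2 / 2)) \<partial>lborel)
      \<longlonglongrightarrow> (\<integral>w. fourier P w * cnj (fourier Q w) \<partial>lborel)"
  proof (rule integral_dominated_convergence)
    show "integrable lborel (\<lambda>w. norm (fourier P w * cnj (fourier Q w)))" using i by (rule integrable_norm)
    have "(\<lambda>n. fourier P w * cnj (fourier Q w) * of_real (exp (- (norm ((1 / real (Suc n)) *\<^sub>R w))\<^sup>2 / 2))) \<longlonglongrightarrow>
        fourier P w * cnj (fourier Q w) * of_real (exp (- (norm (0 *\<^sub>R w))\<^sup>2 / 2))" for w
      by (intro tendsto_intros lim_1_over_n[THEN LIMSEQ_Suc]) auto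
    then show "AE w in lborel. (\<lambda>n. fourier P w * cnj (fourier Q w) * of_real (exp (- (norm ((1 / real (Suc n)) *\<^sub>R w))\<^sup>2 / 2))) \<longlonglongrightarrow>
        fourier P w * cnj (fourier Q w)" by simp
    show "AE w in lborel. norm (fourier P w * cnj (fourier Q w) * of_real (exp (- (norm ((1 / real (Suc n)) *\<^sub>R w))\<^sup>2 / 2)))
        \<le> norm (fourier P w * cnj (fourier Q w))" for n
      by (intro AE_I2) (auto simp: norm_mult mult_le_cancel_left1 intro!: mult_left_le)
  qed measurable
  from LIMSEQ_unique[OF this parseval_gaussian_limit[OF P(1) Q]]
  show "(\<integral>w. fourier P w * cnj (fourier Q w) \<partial>lborel) = (\<integral>x. P x * cnj (Q x) \<partial>lborel)" .
qed

section \<open>Infinite sums and square-summable families\<close>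

text \<open>An enumeration of the index set carries the unordered sum to a series over the natural
  numbers, where integration term by term applies. Absolute summability is assumed at every point
  and not merely almost everywhere, so that the unordered sum and the series agree without
  exceptions.\<close>

lemma integral_infsum:
  fixes f :: "'i \<Rightarrow> 'a \<Rightarrow> 'b::{banach, second_countable_topology}"
  assumes I: "countable I" and i: "\<And>i. i \<in> I \<Longrightarrow> integrable M (f i)"
    and s: "\<And>x. x \<in> space M \<Longrightarrow> (\<lambda>i. norm (f i x)) summable_on I"
    and n: "(\<lambda>i. \<integral>x. norm (f i x) \<partial>M) summable_on I"
  shows "integrable M (\<lambda>x. \<Sum>\<^sub>\<infinity>i\<in>I. f i x)"
    and "((\<lambda>i. \<integral>x. f i x \<partial>M) has_sum (\<integral>x. (\<Sum>\<^sub>\<infinity>i\<in>I. f i x) \<partial>M)) I"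
proof -
  have "integrable M (\<lambda>x. \<Sum>\<^sub>\<infinity>i\<in>I. f i x) \<and>
    ((\<lambda>i. \<integral>x. f i x \<partial>M) has_sum (\<integral>x. (\<Sum>\<^sub>\<infinity>i\<in>I. f i x) \<partial>M)) I"
  proof (cases "finite I")
    case True
    then show ?thesis using i by (simp add: has_sum_finite_iff)
  next
    case False
    define e where "e = from_nat_into I"
    have e: "bij_betw e UNIV I" unfolding e_def using I False by (rule bij_betw_from_nat_into)
    have eI: "e k \<in> I" for k using e by (auto simp: bij_betw_def)
    have ie: "integrable M (f (e k))" for k using i[OF eI] .
    have se: "(\<lambda>k. norm (f (e k) x)) summable_on UNIV" if "x \<in> space M" for x
      using s[OF that] summable_on_reindex_bij_betw[OF e, of "\<lambda>i. norm (f i x)"] by simp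
    have se': "summable (\<lambda>k. norm (f (e k) x))" if "x \<in> space M" for x
      using summable_on_imp_summable[OF se[OF that]] .
    have eq: "(\<Sum>\<^sub>\<infinity>i\<in>I. f i x) = (\<Sum>k. f (e k) x)" if "x \<in> space M" for x
    proof -
      have "(f i x) = f i x" for i by simp
      have "((\<lambda>k. f (e k) x) has_sum (\<Sum>\<^sub>\<infinity>k. f (e k) x)) UNIV"
        by (rule has_sum_infsum, rule abs_summable_summable) (rule se[OF that])
      from has_sum_imp_sums[OF this] have "(\<Sum>k. f (e k) x) = (\<Sum>\<^sub>\<infinity>k. f (e k) x)"
        by (rule sums_unique[symmetric])
      then show ?thesis using infsum_reindex_bij_betw[OF e, of "\<lambda>i. f i x"] by simp
    qed
    have ne: "(\<lambda>k. \<integral>x. norm (f (e k) x) \<partial>M) summable_on UNIV"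
      using n summable_on_reindex_bij_betw[OF e, of "\<lambda>i. \<integral>x. norm (f i x) \<partial>M"] by simp
    have ne': "summable (\<lambda>k. \<integral>x. norm (f (e k) x) \<partial>M)"
      using summable_on_imp_summable[OF ne] .
    have ae: "AE x in M. summable (\<lambda>k. norm (f (e k) x))" using se' by (auto intro: AE_I2)
    have 1: "integrable M (\<lambda>x. \<Sum>k. f (e k) x)" by (rule integrable_suminf[OF ie ae ne'])
    have 2: "(\<lambda>k. \<integral>x. f (e k) x \<partial>M) sums (\<integral>x. (\<Sum>k. f (e k) x) \<partial>M)"
      by (rule sums_integral[OF ie ae ne'])
    have "summable (\<lambda>k. norm (\<integral>x. f (e k) x \<partial>M))"
      by (rule summable_comparison_test'[OF ne', of 0]) simp
    from norm_summable_imp_has_sum[OF this 2]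
    have "((\<lambda>k. \<integral>x. f (e k) x \<partial>M) has_sum (\<integral>x. (\<Sum>k. f (e k) x) \<partial>M)) UNIV" .
    then have "((\<lambda>i. \<integral>x. f i x \<partial>M) has_sum (\<integral>x. (\<Sum>k. f (e k) x) \<partial>M)) I"
      using has_sum_reindex_bij_betw[OF e, of "\<lambda>i. \<integral>x. f i x \<partial>M"] by simp
    moreover have "integrable M (\<lambda>x. \<Sum>\<^sub>\<infinity>i\<in>I. f i x)"
      using 1 by (subst Bochner_Integration.integrable_cong[OF refl eq]) auto
    moreover have "(\<integral>x. (\<Sum>\<^sub>\<infinity>i\<in>I. f i x) \<partial>M) = (\<integral>x. (\<Sum>k. f (e k) x) \<partial>M)"
      by (intro Bochner_Integration.integral_cong refl eq)
    ultimately show ?thesis by simp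
  qed
  then show "integrable M (\<lambda>x. \<Sum>\<^sub>\<infinity>i\<in>I. f i x)"
    "((\<lambda>i. \<integral>x. f i x \<partial>M) has_sum (\<integral>x. (\<Sum>\<^sub>\<infinity>i\<in>I. f i x) \<partial>M)) I" by auto
qed

lemma infsum_diff:
  fixes f g :: "'i \<Rightarrow> 'a::{topological_ab_group_add, t2_space}"
  assumes "f summable_on A" "g summable_on A"
  shows "(\<Sum>\<^sub>\<infinity>i\<in>A. f i - g i) = (\<Sum>\<^sub>\<infinity>i\<in>A. f i) - (\<Sum>\<^sub>\<infinity>i\<in>A. g i)"
proof -
  have "(\<lambda>i. - g i) summable_on A" using assms(2) by (simp add: summable_on_uminus)
  from infsum_add[OF assms(1) this] show ?thesis by (simp add: infsum_uminus)
qed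

section \<open>Square-summable families with explicit bounds\<close>

lemma bounded_sums_summable:
  fixes f :: "'i \<Rightarrow> real"
  assumes "\<And>x. x \<in> A \<Longrightarrow> 0 \<le> f x" and "\<And>F. finite F \<Longrightarrow> F \<subseteq> A \<Longrightarrow> sum f F \<le> K"
  shows "f summable_on A" and "infsum f A \<le> K"
proof -
  show s: "f summable_on A"
    using assms by (intro nonneg_bdd_above_summable_on) (auto intro!: bdd_aboveI[of _ K])
  show "infsum f A \<le> K"
    using assms by (intro infsum_le_finite_sums[OF s]) auto
qed

text \<open>Bounding all finite partial sums, and not an infinite sum, builds summability into the
  predicate. It passes to subsets of the index set at once, and it is the form in which the duality
  argument below delivers its estimate.\<close>

definition l2_bound :: "'i set \<Rightarrow> real \<Rightarrow> ('i \<Rightarrow> complex) \<Rightarrow> bool" where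
  "l2_bound A K a \<longleftrightarrow> (\<forall>F. finite F \<longrightarrow> F \<subseteq> A \<longrightarrow> (\<Sum>i\<in>F. (norm (a i))\<^sup>2) \<le> K)"

lemma l2_boundD: "l2_bound A K a \<Longrightarrow> finite F \<Longrightarrow> F \<subseteq> A \<Longrightarrow> (\<Sum>i\<in>F. (norm (a i))\<^sup>2) \<le> K"
  unfolding l2_bound_def by blast

lemma l2_bound_nonneg: "l2_bound A K a \<Longrightarrow> 0 \<le> K"
  using l2_boundD[of A K a "{}"] by simp

lemma l2_bound_summable:
  assumes "l2_bound A K a"
  shows "(\<lambda>i. (norm (a i))\<^sup>2) summable_on A" "(\<Sum>\<^sub>\<infinity>i\<in>A. (norm (a i))\<^sup>2) \<le> K"
  by (rule bounded_sums_summable; use l2_boundD[OF assms] in auto)+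

lemma l2_bound_infsum:
  assumes "(\<lambda>i. (norm (a i))\<^sup>2) summable_on A"
  shows "l2_bound A (\<Sum>\<^sub>\<infinity>i\<in>A. (norm (a i))\<^sup>2) a"
  unfolding l2_bound_def using finite_sum_le_infsum[OF assms] by auto

lemma l2_bound_norm_cong: "l2_bound A K a \<Longrightarrow> (\<And>i. i \<in> A \<Longrightarrow> norm (b i) = norm (a i)) \<Longrightarrow> l2_bound A K b"
  unfolding l2_bound_def by (metis (mono_tags, lifting) subsetD sum.cong)

lemma l2_bound_finite_product:
  assumes a: "l2_bound A K a" and b: "l2_bound A M b" and F: "finite F" "F \<subseteq> A"
  shows "(\<Sum>i\<in>F. norm (a i * b i)) \<le> sqrt (K * M)"
proof -
  have "(\<Sum>i\<in>F. norm (a i) * norm (b i))\<^sup>2 \<le> (\<Sum>i\<in>F. (norm (a i))\<^sup>2) * (\<Sum>i\<in>F. (norm (b i))\<^sup>2)"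
    by (rule Cauchy_Schwarz_ineq_sum)
  also have "\<dots> \<le> K * M"
    using l2_boundD[OF a F] l2_boundD[OF b F] l2_bound_nonneg[OF a] by (intro mult_mono) (auto intro: sum_nonneg)
  finally show ?thesis by (intro real_le_rsqrt) (simp add: norm_mult)
qed

lemma l2_bound_product:
  assumes a: "l2_bound A K a" and b: "l2_bound A M b"
  shows "(\<lambda>i. norm (a i * b i)) summable_on A"
    and "(\<lambda>i. a i * b i) summable_on A"
    and "(\<Sum>\<^sub>\<infinity>i\<in>A. norm (a i * b i)) \<le> sqrt (K * M)"
    and "norm (\<Sum>\<^sub>\<infinity>i\<in>A. a i * b i) \<le> sqrt (K * M)"
proof -
  show 1: "(\<lambda>i. norm (a i * b i)) summable_on A" and 2: "(\<Sum>\<^sub>\<infinity>i\<in>A. norm (a i * b i)) \<le> sqrt (K * M)"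
    by (rule bounded_sums_summable; use l2_bound_finite_product[OF a b] in auto)+
  show "(\<lambda>i. a i * b i) summable_on A" by (rule abs_summable_summable[OF 1])
  show "norm (\<Sum>\<^sub>\<infinity>i\<in>A. a i * b i) \<le> sqrt (K * M)"
    using norm_infsum_bound[OF 1] 2 by linarith
qed

lemma l2_bound_mono: "l2_bound A K a \<Longrightarrow> K \<le> M \<Longrightarrow> l2_bound A M a"
  unfolding l2_bound_def by (meson order_trans)

lemma l2_bound_eventually:
  assumes "\<And>x. l2_bound A (V x) (u x)" and V: "(V \<longlongrightarrow> 0) F" and e: "e > 0"
  shows "\<forall>\<^sub>F x in F. l2_bound A e (u x)"
  using order_tendstoD(2)[OF V e] by eventually_elim (rule l2_bound_mono[OF assms(1)], simp)

text \<open>The bilinear pairing of \<open>l2\<close> families is jointly continuous: the difference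
  is split as \<open>(a x - a x0) * b x + a x0 * (b x - b x0)\<close> and Cauchy-Schwarz is applied
  to each part. Convergence in \<open>l2\<close> is phrased as an eventual \<open>l2_bound\<close>
  by every positive number.\<close>

lemma tendsto_infsum_l2:
  fixes a b :: "'x \<Rightarrow> 'i \<Rightarrow> complex"
  assumes a: "\<And>x. l2_bound A K (a x)" and b: "\<And>x. l2_bound A M (b x)"
    and da: "\<And>e. e > 0 \<Longrightarrow> \<forall>\<^sub>F x in F. l2_bound A e (\<lambda>i. a x i - a x0 i)"
    and db: "\<And>e. e > 0 \<Longrightarrow> \<forall>\<^sub>F x in F. l2_bound A e (\<lambda>i. b x i - b x0 i)"
  shows "((\<lambda>x. \<Sum>\<^sub>\<infinity>i\<in>A. a x i * b x i) \<longlongrightarrow> (\<Sum>\<^sub>\<infinity>i\<in>A. a x0 i * b x0 i)) F"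
proof (rule tendstoI)
  fix e :: real assume e: "e > 0"
  have K: "0 \<le> K" and M: "0 \<le> M" using l2_bound_nonneg[OF a] l2_bound_nonneg[OF b] by auto
  \<comment> \<open>Chosen so that \<open>s * M\<close> and \<open>K * s\<close> are both at most
    \<open>(e / 3)\<^sup>2\<close>; the two error terms then add up to at most
    \<open>2 * e / 3\<close>. The summand 1 keeps the denominator positive.\<close>
  define s where "s = (e / 3)\<^sup>2 / (K + M + 1)"
  have s: "s > 0" using e K M by (simp add: s_def)
  have "s * M \<le> (e / 3)\<^sup>2" "K * s \<le> (e / 3)\<^sup>2" using K M e by (auto simp: s_def divide_le_eq mult_right_mono algebra_simps)
  then have "sqrt (s * M) \<le> sqrt ((e / 3)\<^sup>2)" "sqrt (K * s) \<le> sqrt ((e / 3)\<^sup>2)"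
    by (simp_all only: real_sqrt_le_iff)
  moreover have "sqrt ((e / 3)\<^sup>2) = e / 3" using e by (simp only: real_sqrt_abs)
  ultimately have q: "sqrt (s * M) \<le> e / 3" "sqrt (K * s) \<le> e / 3" by simp_all
  show "\<forall>\<^sub>F x in F. dist (\<Sum>\<^sub>\<infinity>i\<in>A. a x i * b x i) (\<Sum>\<^sub>\<infinity>i\<in>A. a x0 i * b x0 i) < e"
    using da[OF s] db[OF s]
  proof eventually_elim
    case (elim x)
    note sm = l2_bound_product(2)[OF a[of x] b[of x]] l2_bound_product(2)[OF a[of x0] b[of x0]]
      l2_bound_product(2)[OF elim(1) b[of x]] l2_bound_product(2)[OF a[of x0] elim(2)]
    have "(\<Sum>\<^sub>\<infinity>i\<in>A. a x i * b x i) - (\<Sum>\<^sub>\<infinity>i\<in>A. a x0 i * b x0 i) =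
       (\<Sum>\<^sub>\<infinity>i\<in>A. a x i * b x i - a x0 i * b x0 i)"
      by (rule infsum_diff[symmetric]) (use sm in auto)
    also have "\<dots> = (\<Sum>\<^sub>\<infinity>i\<in>A. (a x i - a x0 i) * b x i + a x0 i * (b x i - b x0 i))"
      by (rule infsum_cong) (simp add: algebra_simps)
    also have "\<dots> = (\<Sum>\<^sub>\<infinity>i\<in>A. (a x i - a x0 i) * b x i) + (\<Sum>\<^sub>\<infinity>i\<in>A. a x0 i * (b x i - b x0 i))"
      by (rule infsum_add) (use sm in auto)
    finally have "norm ((\<Sum>\<^sub>\<infinity>i\<in>A. a x i * b x i) - (\<Sum>\<^sub>\<infinity>i\<in>A. a x0 i * b x0 i)) \<le> sqrt (s * M) + sqrt (K * s)"
      using l2_bound_product(4)[OF elim(1) b[of x]] l2_bound_product(4)[OF a[of x0] elim(2)]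
        norm_triangle_ineq[of "\<Sum>\<^sub>\<infinity>i\<in>A. (a x i - a x0 i) * b x i" "\<Sum>\<^sub>\<infinity>i\<in>A. a x0 i * (b x i - b x0 i)"]
      by simp
    then show ?case using q e by (simp add: dist_norm)
  qed
qed

section \<open>Sampling of Fourier transforms on uniformly discrete sets\<close>

text \<open>The balls of radius \<open>r\<close> around the points of \<Delta> are disjoint. On each
  of them the value at the center is dominated by a wider Gaussian evaluated anywhere in the ball,
  so the sum is at most the integral of the wider Gaussian over the whole space divided by the
  volume of one ball. Translation invariance removes the dependence on \<omega>.\<close>

lemma gaussian_sum_bound:
  fixes \<Delta> :: "'a::euclidean_space set"
  assumes \<Delta>: "uniform_discrete \<Delta>" and c: "c > 0"
  obtains S where "S \<ge> 0"
    "\<And>\<omega> F. finite F \<Longrightarrow> F \<subseteq> \<Delta> \<Longrightarrow> (\<Sum>\<beta>\<in>F. exp (- (c * (norm (\<beta> - \<omega>))\<^sup>2))) \<le> S"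
proof -
  obtain e where e: "e > 0" "\<And>x y. x \<in> \<Delta> \<Longrightarrow> y \<in> \<Delta> \<Longrightarrow> dist x y < e \<Longrightarrow> x = y"
    using \<Delta> unfolding uniform_discrete_def by blast
  define r where "r = e / 2"
  have r: "r > 0" using e by (simp add: r_def)
  define V where "V = measure lborel (ball (0::'a) r)"
  have Vb: "measure lborel (ball \<beta> r) = V" for \<beta> :: 'a
    unfolding V_def using r by (simp add: content_ball)
  have V0: "V > 0" unfolding V_def using r by (simp add: content_ball_pos)
  \<comment> \<open>For \<open>t\<close> within \<open>r\<close> of \<beta>, the square of
    \<open>norm (t - \<omega>)\<close> is at most twice that of
    \<open>norm (\<beta> - \<omega>)\<close> plus \<open>2 * r\<^sup>2\<close>. Halving the exponent
    and paying the factor \<open>exp (c * r\<^sup>2)\<close> therefore dominates the value at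
    \<beta> on the whole ball.\<close>
  define K where "K t = exp (c * r\<^sup>2) * exp (- (norm (sqrt c *\<^sub>R t))\<^sup>2 / 2)" for t :: 'a
  have gm: "(\<lambda>t::'a. exp (- (norm t)\<^sup>2 / 2)) \<in> borel_measurable borel" by measurable
  have Ki: "integrable lborel K"
    unfolding K_def using lborel_integrable_affine[OF gm, of "sqrt c" 0] gaussian_integral(1)[where 'a='a] c
    by (intro integrable_mult_right) simp
  have Km [measurable]: "K \<in> borel_measurable borel" using borel_measurable_integrable[OF Ki] by simp
  have K0: "0 \<le> K t" for t by (simp add: K_def)
  define J where "J = (\<integral>t. K t \<partial>lborel)"
  have J0: "0 \<le> J" unfolding J_def using K0 by (intro integral_nonneg_AE) simp
  have pt: "exp (- (c * (norm (\<beta> - \<omega>))\<^sup>2)) \<le> K (t - \<omega>)" if "t \<in> ball \<beta> r" for \<beta> \<omega> t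
  proof -
    have "norm (t - \<omega>) \<le> norm (\<beta> - \<omega>) + norm (t - \<beta>)"
      using norm_triangle_ineq[of "\<beta> - \<omega>" "t - \<beta>"] by simp
    also have "\<dots> \<le> norm (\<beta> - \<omega>) + r" using that by (simp add: dist_norm norm_minus_commute)
    finally have "(norm (t - \<omega>))\<^sup>2 \<le> (norm (\<beta> - \<omega>) + r)\<^sup>2" by (intro power_mono) auto
    also have "\<dots> \<le> 2 * (norm (\<beta> - \<omega>))\<^sup>2 + 2 * r\<^sup>2"
      using zero_le_power2[of "norm (\<beta> - \<omega>) - r"] by (simp add: power2_sum power2_diff)
    finally have "c * (norm (t - \<omega>))\<^sup>2 \<le> c * (2 * (norm (\<beta> - \<omega>))\<^sup>2 + 2 * r\<^sup>2)"
      using c by (intro mult_left_mono) auto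
    moreover have "(norm (sqrt c *\<^sub>R (t - \<omega>)))\<^sup>2 = c * (norm (t - \<omega>))\<^sup>2"
      using c by (simp add: power_mult_distrib)
    ultimately show ?thesis
      unfolding K_def exp_add[symmetric] exp_le_cancel_iff by (simp add: algebra_simps)
  qed
  have le: "(\<Sum>\<beta>\<in>F. exp (- (c * (norm (\<beta> - \<omega>))\<^sup>2))) \<le> J / V" if F: "finite F" "F \<subseteq> \<Delta>" for F \<omega>
  proof -
    have dj: "disjoint_family_on (\<lambda>\<beta>. ball \<beta> r) F"
      unfolding disjoint_family_on_def
    proof (intro ballI impI)
      fix x y assume xy: "x \<in> F" "y \<in> F" "x \<noteq> y"
      show "ball x r \<inter> ball y r = {}"
      proof (rule ccontr)
        assume "ball x r \<inter> ball y r \<noteq> {}"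
        then obtain t where "dist x t < r" "dist y t < r" by auto
        then have "dist x y < e" using dist_triangle[of x y t] by (simp add: r_def dist_commute)
        then show False using e(2)[of x y] xy F by auto
      qed
    qed
    have ib: "integrable lborel (\<lambda>t. indicator (ball \<beta> r) t * exp (- (c * (norm (\<beta> - \<omega>))\<^sup>2)))" for \<beta> :: 'a
      using emeasure_bounded_finite[of "ball \<beta> r"] by (intro integrable_mult_left) (simp add: integrable_indicator_iff)
    have iK: "integrable lborel (\<lambda>t. K (t - \<omega>))" using lborel_integrable_shift(2)[OF Km] Ki by simp
    have "(\<Sum>\<beta>\<in>F. exp (- (c * (norm (\<beta> - \<omega>))\<^sup>2))) * V = (\<Sum>\<beta>\<in>F. \<integral>t. indicator (ball \<beta> r) t * exp (- (c * (norm (\<beta> - \<omega>))\<^sup>2)) \<partial>lborel)"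
      by (simp add: Vb sum_distrib_left mult.commute)
    also have "\<dots> = (\<integral>t. (\<Sum>\<beta>\<in>F. indicator (ball \<beta> r) t * exp (- (c * (norm (\<beta> - \<omega>))\<^sup>2))) \<partial>lborel)"
      by (rule Bochner_Integration.integral_sum[symmetric]) (rule ib)
    also have "\<dots> \<le> (\<integral>t. K (t - \<omega>) \<partial>lborel)"
    proof (rule integral_mono')
      fix t
      have "(\<Sum>\<beta>\<in>F. indicator (ball \<beta> r) t * exp (- (c * (norm (\<beta> - \<omega>))\<^sup>2))) \<le> (\<Sum>\<beta>\<in>F. indicator (ball \<beta> r) t * K (t - \<omega>))"
        by (rule sum_mono) (use pt in \<open>auto simp: indicator_def\<close>)
      also have "\<dots> = indicator (\<Union>\<beta>\<in>F. ball \<beta> r) t * K (t - \<omega>)"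
        by (simp add: indicator_UN_disjoint[OF F(1) dj] sum_distrib_right)
      also have "\<dots> \<le> K (t - \<omega>)" using K0 by (simp add: indicator_def)
      finally show "(\<Sum>\<beta>\<in>F. indicator (ball \<beta> r) t * exp (- (c * (norm (\<beta> - \<omega>))\<^sup>2))) \<le> K (t - \<omega>)" .
    qed (use iK K0 in auto)
    also have "\<dots> = J" unfolding J_def by (rule lborel_integral_shift(2)[OF Km])
    finally show ?thesis using V0 by (simp add: field_simps)
  qed
  show thesis by (rule that[of "J / V"]) (use J0 V0 le in auto)
qed

section \<open>Trigonometric polynomials with uniformly discrete frequencies\<close>

definition trig_poly :: "'a::euclidean_space set \<Rightarrow> ('a \<Rightarrow> complex) \<Rightarrow> 'a \<Rightarrow> complex" where
  "trig_poly F c t = (\<Sum>\<beta>\<in>F. c \<beta> * cis (2 * pi * (\<beta> \<bullet> t)))"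

lemma trig_poly_measurable [measurable]: "trig_poly F c \<in> borel_measurable borel"
  unfolding trig_poly_def by measurable

lemma trig_poly_le: "norm (trig_poly F c t) \<le> (\<Sum>\<beta>\<in>F. norm (c \<beta>))"
  unfolding trig_poly_def by (rule sum_norm_le) (simp add: norm_mult)

text \<open>Against a Gaussian weight the exponentials are almost orthogonal: the entries of their
  Gram matrix decay like a Gaussian in the distance of the frequencies, so its rows have bounded
  sums, and the arithmetic-geometric inequality finishes as in Schur's test. Moving the center
  \<open>t0\<close> only changes the phases of the entries, whence a constant independent of
  it.\<close>

lemma trig_poly_gaussian_bound:
  fixes \<Delta> :: "'a::euclidean_space set"
  assumes \<Delta>: "uniform_discrete \<Delta>"
  obtains C where "C \<ge> 0"
    "\<And>t0 F c. finite F \<Longrightarrow> F \<subseteq> \<Delta> \<Longrightarrow>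
      (\<integral>t. exp (- (norm (t - t0))\<^sup>2 / 2) * (norm (trig_poly F c t))\<^sup>2 \<partial>lborel) \<le> C * (\<Sum>\<beta>\<in>F. (norm (c \<beta>))\<^sup>2)"
proof -
  \<comment> \<open>The exponent \<open>2 * pi\<^sup>2\<close> arises when the transformed Gaussian
    \<open>exp (- (norm y)\<^sup>2 / 2)\<close> is evaluated at
    \<open>y = (2 * pi) *\<^sub>R (\<beta> - \<beta>')\<close>.\<close>
  obtain S where S: "S \<ge> 0"
    "\<And>\<omega> F. finite F \<Longrightarrow> F \<subseteq> \<Delta> \<Longrightarrow> (\<Sum>\<beta>\<in>F. exp (- (2 * pi\<^sup>2 * (norm (\<beta> - \<omega>))\<^sup>2))) \<le> S"
    using gaussian_sum_bound[OF \<Delta>, of "2 * pi\<^sup>2"] by auto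
  define D where "D = sqrt (2 * pi) ^ DIM('a)"
  have D0: "D \<ge> 0" by (simp add: D_def)
  show thesis
  proof (rule that[of "D * S"])
    show "0 \<le> D * S" using D0 S by simp
    fix t0 :: 'a and F and c :: "'a \<Rightarrow> complex"
    assume F: "finite F" "F \<subseteq> \<Delta>"
    define E where "E t = complex_of_real (exp (- (norm (t - t0))\<^sup>2 / 2))" for t
    define k where "k \<beta> \<beta>' = exp (- (2 * pi\<^sup>2 * (norm (\<beta> - \<beta>'))\<^sup>2))" for \<beta> \<beta>' :: 'a
    have ft: "integrable lborel (\<lambda>t. E t * cis (2 * pi * ((\<beta> - \<beta>') \<bullet> t))) \<and>
        norm (\<integral>t. E t * cis (2 * pi * ((\<beta> - \<beta>') \<bullet> t)) \<partial>lborel) = D * k \<beta> \<beta>'" for \<beta> \<beta>'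
    proof -
      define y where "y = (2 * pi) *\<^sub>R (\<beta> - \<beta>')"
      define f where "f = (\<lambda>x. complex_of_real (exp (- (norm x)\<^sup>2 / 2)) * cis (x \<bullet> y) * cis (t0 \<bullet> y))"
      have [measurable]: "f \<in> borel_measurable borel" unfolding f_def by measurable
      have f: "E t * cis (2 * pi * ((\<beta> - \<beta>') \<bullet> t)) = f (t - t0)" for t
        by (simp add: E_def f_def y_def mult.assoc cis_mult inner_diff_left inner_commute[of t] inner_commute[of t0] algebra_simps)
      have "integrable lborel f" unfolding f_def using gaussian_fourier(1)[of y] by (rule integrable_mult_left)
      moreover have "(\<integral>x. f x \<partial>lborel) = of_real D * of_real (exp (- (norm y)\<^sup>2 / 2)) * cis (t0 \<bullet> y)"
        unfolding f_def integral_mult_left_zero gaussian_fourier(2) D_def ..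
      moreover have "- (norm y)\<^sup>2 / 2 = - (2 * pi\<^sup>2 * (norm (\<beta> - \<beta>'))\<^sup>2)"
        by (simp add: y_def power_mult_distrib)
      ultimately show ?thesis
        unfolding f using lborel_integrable_shift(2)[of f t0] lborel_integral_shift(2)[of f t0] D0
        by (simp add: norm_mult k_def)
    qed
    have sq: "of_real (exp (- (norm (t - t0))\<^sup>2 / 2) * (norm (trig_poly F c t))\<^sup>2) =
       (\<Sum>\<beta>\<in>F. \<Sum>\<beta>'\<in>F. (c \<beta> * cnj (c \<beta>')) * (E t * cis (2 * pi * ((\<beta> - \<beta>') \<bullet> t))))" for t
    proof -
      have "of_real (exp (- (norm (t - t0))\<^sup>2 / 2) * (norm (trig_poly F c t))\<^sup>2) = E t * (trig_poly F c t * cnj (trig_poly F c t))"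
        by (simp only: of_real_mult complex_norm_square E_def)
      also have "\<dots> = (\<Sum>\<beta>\<in>F. \<Sum>\<beta>'\<in>F. E t * ((c \<beta> * cis (2 * pi * (\<beta> \<bullet> t))) * cnj (c \<beta>' * cis (2 * pi * (\<beta>' \<bullet> t)))))"
        unfolding trig_poly_def cnj_sum sum_product by (simp only: sum_distrib_left)
      also have "\<dots> = (\<Sum>\<beta>\<in>F. \<Sum>\<beta>'\<in>F. (c \<beta> * cnj (c \<beta>')) * (E t * cis (2 * pi * ((\<beta> - \<beta>') \<bullet> t))))"
      proof (intro sum.cong refl)
        fix \<beta> \<beta>'
        have "cis (2 * pi * ((\<beta> - \<beta>') \<bullet> t)) = cis (2 * pi * (\<beta> \<bullet> t)) * cis (- (2 * pi * (\<beta>' \<bullet> t)))"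
          by (simp add: cis_mult inner_diff_left right_diff_distrib)
        then show "E t * ((c \<beta> * cis (2 * pi * (\<beta> \<bullet> t))) * cnj (c \<beta>' * cis (2 * pi * (\<beta>' \<bullet> t)))) =
            (c \<beta> * cnj (c \<beta>')) * (E t * cis (2 * pi * ((\<beta> - \<beta>') \<bullet> t)))"
          by (simp add: cis_cnj)
      qed
      finally show ?thesis .
    qed
    have "of_real (\<integral>t. exp (- (norm (t - t0))\<^sup>2 / 2) * (norm (trig_poly F c t))\<^sup>2 \<partial>lborel) =
        (\<integral>t. (\<Sum>\<beta>\<in>F. \<Sum>\<beta>'\<in>F. (c \<beta> * cnj (c \<beta>')) * (E t * cis (2 * pi * ((\<beta> - \<beta>') \<bullet> t)))) \<partial>lborel)"
      unfolding integral_complex_of_real[symmetric] sq ..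
    also have "\<dots> = (\<Sum>\<beta>\<in>F. \<Sum>\<beta>'\<in>F. (c \<beta> * cnj (c \<beta>')) * (\<integral>t. E t * cis (2 * pi * ((\<beta> - \<beta>') \<bullet> t)) \<partial>lborel))"
      using ft by (subst Bochner_Integration.integral_sum; (intro Bochner_Integration.integrable_sum integrable_mult_right)?; simp?)+
    finally have "norm (complex_of_real (\<integral>t. exp (- (norm (t - t0))\<^sup>2 / 2) * (norm (trig_poly F c t))\<^sup>2 \<partial>lborel)) =
      norm (\<Sum>\<beta>\<in>F. \<Sum>\<beta>'\<in>F. (c \<beta> * cnj (c \<beta>')) * (\<integral>t. E t * cis (2 * pi * ((\<beta> - \<beta>') \<bullet> t)) \<partial>lborel))" by (rule arg_cong)
    also have "\<dots> \<le> (\<Sum>\<beta>\<in>F. \<Sum>\<beta>'\<in>F. norm (c \<beta>) * norm (c \<beta>') * (D * k \<beta> \<beta>'))"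
      by (intro sum_norm_le) (use ft in \<open>simp add: norm_mult\<close>)
    also have "\<dots> \<le> (\<Sum>\<beta>\<in>F. \<Sum>\<beta>'\<in>F. ((norm (c \<beta>))\<^sup>2 / 2 + (norm (c \<beta>'))\<^sup>2 / 2) * (D * k \<beta> \<beta>'))"
    proof (intro sum_mono mult_right_mono)
      show "norm (c \<beta>) * norm (c \<beta>') \<le> (norm (c \<beta>))\<^sup>2 / 2 + (norm (c \<beta>'))\<^sup>2 / 2" for \<beta> \<beta>'
        using zero_le_power2[of "norm (c \<beta>) - norm (c \<beta>')"] by (simp add: power2_diff)
      show "0 \<le> D * k \<beta> \<beta>'" for \<beta> \<beta>' using D0 by (simp add: k_def)
    qed
    also have "\<dots> = (\<Sum>\<beta>\<in>F. (norm (c \<beta>))\<^sup>2 / 2 * (D * (\<Sum>\<beta>'\<in>F. k \<beta> \<beta>'))) + (\<Sum>\<beta>'\<in>F. (norm (c \<beta>'))\<^sup>2 / 2 * (D * (\<Sum>\<beta>\<in>F. k \<beta> \<beta>')))"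
      unfolding distrib_right sum.distrib sum_distrib_left by (subst (2) sum.swap) simp
    also have "\<dots> \<le> (\<Sum>\<beta>\<in>F. (norm (c \<beta>))\<^sup>2 / 2 * (D * S)) + (\<Sum>\<beta>'\<in>F. (norm (c \<beta>'))\<^sup>2 / 2 * (D * S))"
    proof (intro add_mono sum_mono mult_left_mono)
      show "(\<Sum>\<beta>'\<in>F. k \<beta> \<beta>') \<le> S" for \<beta> using S(2)[OF F, of \<beta>] by (simp add: k_def norm_minus_commute)
      show "(\<Sum>\<beta>\<in>F. k \<beta> \<beta>') \<le> S" for \<beta>' using S(2)[OF F, of \<beta>'] by (simp add: k_def)
    qed (use D0 in auto)
    also have "\<dots> = D * S * (\<Sum>\<beta>\<in>F. (norm (c \<beta>))\<^sup>2)"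
      by (simp add: sum.distrib[symmetric] sum_distrib_left mult.commute mult.assoc)
    finally show "(\<integral>t. exp (- (norm (t - t0))\<^sup>2 / 2) * (norm (trig_poly F c t))\<^sup>2 \<partial>lborel) \<le> D * S * (\<Sum>\<beta>\<in>F. (norm (c \<beta>))\<^sup>2)"
      by (simp only: norm_of_real abs_le_iff)
  qed
qed

text \<open>The Gaussian centered at \<open>t0\<close> is at least
  \<open>exp (- \<rho>\<^sup>2 / 2)\<close> on the ball of radius \<rho> about \<open>t0\<close>, so
  the weighted estimate loses only this factor. The constant depends on \<rho> but not on the
  position of the ball; this uniformity permits the later summation over unit cubes.\<close>

lemma trig_poly_local_bound:
  fixes \<Delta> :: "'a::euclidean_space set"
  assumes \<Delta>: "uniform_discrete \<Delta>"
  obtains C where "C \<ge> 0"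
    "\<And>t0 F c A. finite F \<Longrightarrow> F \<subseteq> \<Delta> \<Longrightarrow> A \<in> sets borel \<Longrightarrow> A \<subseteq> cball t0 \<rho> \<Longrightarrow>
      integrable lborel (\<lambda>t. (norm (indicator A t *\<^sub>R trig_poly F c t))\<^sup>2) \<and>
      (\<integral>t. (norm (indicator A t *\<^sub>R trig_poly F c t))\<^sup>2 \<partial>lborel) \<le> C * (\<Sum>\<beta>\<in>F. (norm (c \<beta>))\<^sup>2)"
proof -
  obtain C where C: "C \<ge> 0" "\<And>t0 F c. finite F \<Longrightarrow> F \<subseteq> \<Delta> \<Longrightarrow>
      (\<integral>t. exp (- (norm (t - t0))\<^sup>2 / 2) * (norm (trig_poly F c t))\<^sup>2 \<partial>lborel) \<le> C * (\<Sum>\<beta>\<in>F. (norm (c \<beta>))\<^sup>2)"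
    by (rule trig_poly_gaussian_bound[OF \<Delta>]) (rule that, assumption, blast)
  define R where "R = exp (\<rho>\<^sup>2 / 2)"
  show thesis
  proof (rule that[of "R * C"])
    show "0 \<le> R * C" using C by (simp add: R_def)
    fix t0 F c and A :: "'a set" assume F: "finite F" "F \<subseteq> \<Delta>" and A [measurable]: "A \<in> sets borel" and sub: "A \<subseteq> cball t0 \<rho>"
    let ?w = "\<lambda>t. exp (- (norm (t - t0))\<^sup>2 / 2) * (norm (trig_poly F c t))\<^sup>2"
    have gm: "(\<lambda>t::'a. exp (- (norm t)\<^sup>2 / 2)) \<in> borel_measurable borel" by measurable
    have gi: "integrable lborel (\<lambda>t. exp (- (norm (t - t0))\<^sup>2 / 2))"
      using lborel_integrable_shift(2)[OF gm, of t0] gaussian_integral(1)[where 'a='a] by simp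
    have wi: "integrable lborel ?w"
    proof (rule Bochner_Integration.integrable_bound)
      show "integrable lborel (\<lambda>t. exp (- (norm (t - t0))\<^sup>2 / 2) * (\<Sum>\<beta>\<in>F. norm (c \<beta>))\<^sup>2)"
        using gi by (rule integrable_mult_left)
      show "AE t in lborel. norm (?w t) \<le> norm (exp (- (norm (t - t0))\<^sup>2 / 2) * (\<Sum>\<beta>\<in>F. norm (c \<beta>))\<^sup>2)"
        using trig_poly_le[of F c] by (auto simp: norm_mult intro!: mult_left_mono power_mono)
    qed measurable
    have pt: "(norm (indicator A t *\<^sub>R trig_poly F c t))\<^sup>2 \<le> R * ?w t" for t
    proof (cases "t \<in> A")
      case True
      then have "norm (t - t0) \<le> \<rho>" using sub by (auto simp: dist_norm norm_minus_commute)
      then have "(norm (t - t0))\<^sup>2 \<le> \<rho>\<^sup>2" by (intro power_mono) auto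
      then have "1 \<le> R * exp (- (norm (t - t0))\<^sup>2 / 2)" unfolding R_def exp_add[symmetric] by simp
      from mult_right_mono[OF this zero_le_power2[of "norm (trig_poly F c t)"]]
      show ?thesis using True by (simp add: mult.assoc)
    qed (simp add: R_def)
    have i: "integrable lborel (\<lambda>t. (norm (indicator A t *\<^sub>R trig_poly F c t))\<^sup>2)"
    proof (rule Bochner_Integration.integrable_bound)
      show "integrable lborel (\<lambda>t. R * ?w t)" using wi by (rule integrable_mult_right)
      show "AE t in lborel. norm ((norm (indicator A t *\<^sub>R trig_poly F c t))\<^sup>2) \<le> norm (R * ?w t)"
        using pt by (intro AE_I2) (simp add: order_trans[OF _ abs_ge_self])
    qed measurable
    have "(\<integral>t. (norm (indicator A t *\<^sub>R trig_poly F c t))\<^sup>2 \<partial>lborel) \<le> (\<integral>t. R * ?w t \<partial>lborel)"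
      by (rule integral_mono[OF i integrable_mult_right[OF wi] pt])
    also have "\<dots> = R * (\<integral>t. ?w t \<partial>lborel)" by simp
    also have "\<dots> \<le> R * (C * (\<Sum>\<beta>\<in>F. (norm (c \<beta>))\<^sup>2))"
      by (intro mult_left_mono C(2) F) (simp add: R_def)
    finally show "integrable lborel (\<lambda>t. (norm (indicator A t *\<^sub>R trig_poly F c t))\<^sup>2) \<and>
      (\<integral>t. (norm (indicator A t *\<^sub>R trig_poly F c t))\<^sup>2 \<partial>lborel) \<le> R * C * (\<Sum>\<beta>\<in>F. (norm (c \<beta>))\<^sup>2)"
      using i by (simp add: mult.assoc)
  qed
qed

text \<open>Duality: testing against the trigonometric polynomial whose coefficients are the conjugated
  Fourier coefficients turns a bound for trigonometric polynomials into a Bessel bound.\<close>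

lemma l2_bound_by_duality:
  assumes u: "integrable lborel u" and K: "K \<ge> 0"
    and dual: "\<And>F c. finite F \<Longrightarrow> F \<subseteq> \<Delta> \<Longrightarrow> (norm (\<integral>t. u t * trig_poly F c t \<partial>lborel))\<^sup>2 \<le> K * (\<Sum>\<beta>\<in>F. (norm (c \<beta>))\<^sup>2)"
  shows "l2_bound \<Delta> K (\<lambda>\<beta>. \<integral>t. u t * cis (2 * pi * (\<beta> \<bullet> t)) \<partial>lborel)"
  unfolding l2_bound_def
proof (intro allI impI)
  fix F assume F: "finite F" "F \<subseteq> \<Delta>"
  define a where "a \<beta> = (\<integral>t. u t * cis (2 * pi * (\<beta> \<bullet> t)) \<partial>lborel)" for \<beta>
  have ui: "integrable lborel (\<lambda>t. u t * cis (2 * pi * (\<beta> \<bullet> t)))" for \<beta>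
    by (rule Bochner_Integration.integrable_bound[OF u]) (use borel_measurable_integrable[OF u] in \<open>auto simp: norm_mult\<close>)
  have eq: "u t * trig_poly F (\<lambda>\<beta>. cnj (a \<beta>)) t = (\<Sum>\<beta>\<in>F. cnj (a \<beta>) * (u t * cis (2 * pi * (\<beta> \<bullet> t))))" for t
    unfolding trig_poly_def sum_distrib_left by (intro sum.cong refl) (simp only: mult_ac)
  have "(\<integral>t. u t * trig_poly F (\<lambda>\<beta>. cnj (a \<beta>)) t \<partial>lborel) = (\<Sum>\<beta>\<in>F. cnj (a \<beta>) * a \<beta>)"
    unfolding eq by (subst Bochner_Integration.integral_sum) (auto simp: a_def ui)
  also have "\<dots> = of_real (\<Sum>\<beta>\<in>F. (norm (a \<beta>))\<^sup>2)"
    unfolding of_real_sum complex_norm_square by (simp add: mult.commute)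
  finally have e: "(\<integral>t. u t * trig_poly F (\<lambda>\<beta>. cnj (a \<beta>)) t \<partial>lborel) = of_real (\<Sum>\<beta>\<in>F. (norm (a \<beta>))\<^sup>2)" .
  have "(\<Sum>\<beta>\<in>F. (norm (a \<beta>))\<^sup>2)\<^sup>2 \<le> K * (\<Sum>\<beta>\<in>F. (norm (a \<beta>))\<^sup>2)"
    using dual[OF F, of "\<lambda>\<beta>. cnj (a \<beta>)"] unfolding e norm_of_real by simp
  then have "(\<Sum>\<beta>\<in>F. (norm (a \<beta>))\<^sup>2) * (\<Sum>\<beta>\<in>F. (norm (a \<beta>))\<^sup>2) \<le> K * (\<Sum>\<beta>\<in>F. (norm (a \<beta>))\<^sup>2)"
    by (simp add: power2_eq_square)
  moreover have "0 \<le> (\<Sum>\<beta>\<in>F. (norm (a \<beta>))\<^sup>2)" by (rule sum_nonneg) simp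
  ultimately show "(\<Sum>\<beta>\<in>F. (norm (\<integral>t. u t * cis (2 * pi * (\<beta> \<bullet> t)) \<partial>lborel))\<^sup>2) \<le> K"
    unfolding a_def[symmetric] using K by (metis antisym_conv2 mult_le_cancel_right not_less)
qed

text \<open>Duality and Cauchy-Schwarz: since \<open>u\<close> vanishes off the ball, the test
  polynomial may be cut off there, where its norm is controlled by its coefficients independently of
  the center.\<close>

lemma local_sampling:
  fixes \<Delta> :: "'a::euclidean_space set"
  assumes \<Delta>: "uniform_discrete \<Delta>"
  obtains C where "C \<ge> 0"
    "\<And>u t0. u \<in> borel_measurable borel \<Longrightarrow> integrable lborel (\<lambda>t. (norm (u t))\<^sup>2) \<Longrightarrow> (\<And>t. t \<notin> cball t0 \<rho> \<Longrightarrow> u t = 0) \<Longrightarrow>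
      l2_bound \<Delta> (C * (\<integral>t. (norm (u t))\<^sup>2 \<partial>lborel)) (\<lambda>\<beta>. \<integral>t. u t * cis (2 * pi * (\<beta> \<bullet> t)) \<partial>lborel)"
proof -
  obtain C where C: "C \<ge> 0" "\<And>t0 F c A. finite F \<Longrightarrow> F \<subseteq> \<Delta> \<Longrightarrow> A \<in> sets borel \<Longrightarrow> A \<subseteq> cball t0 \<rho> \<Longrightarrow>
      integrable lborel (\<lambda>t. (norm (indicator A t *\<^sub>R trig_poly F c t))\<^sup>2) \<and>
      (\<integral>t. (norm (indicator A t *\<^sub>R trig_poly F c t))\<^sup>2 \<partial>lborel) \<le> C * (\<Sum>\<beta>\<in>F. (norm (c \<beta>))\<^sup>2)"
    by (rule trig_poly_local_bound[OF \<Delta>, where \<rho> = \<rho>]) (rule that, assumption, blast)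
  show thesis
  proof (rule that[of C])
    show "0 \<le> C" by fact
    fix u :: "'a \<Rightarrow> complex" and t0
    assume u [measurable]: "u \<in> borel_measurable borel" and u2: "integrable lborel (\<lambda>t. (norm (u t))\<^sup>2)"
      and supp: "\<And>t. t \<notin> cball t0 \<rho> \<Longrightarrow> u t = 0"
    define A where "A = cball t0 \<rho>"
    have A [measurable]: "A \<in> sets borel" and A': "A \<subseteq> cball t0 \<rho>" by (simp_all add: A_def)
    have i1: "integrable lborel (\<lambda>t. (norm (indicator A t *\<^sub>R (1::complex)))\<^sup>2)"
    proof -
      have "integrable lborel (\<lambda>t. indicator A t :: real)"
        using emeasure_bounded_finite[of A] by (simp add: A_def integrable_indicator_iff)
      then show ?thesis by (rule Bochner_Integration.integrable_bound) (auto simp: indicator_def)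
    qed
    have uA: "u t * (indicator A t *\<^sub>R z) = u t * z" for t z using supp by (cases "t \<in> A") (auto simp: A_def)
    have ui: "integrable lborel u"
      using Cauchy_Schwarz_integrable[of u lborel "\<lambda>t. indicator A t *\<^sub>R (1::complex)"] u2 i1 unfolding uA by simp
    show "l2_bound \<Delta> (C * (\<integral>t. (norm (u t))\<^sup>2 \<partial>lborel)) (\<lambda>\<beta>. \<integral>t. u t * cis (2 * pi * (\<beta> \<bullet> t)) \<partial>lborel)"
    proof (rule l2_bound_by_duality[OF ui])
      show "0 \<le> C * (\<integral>t. (norm (u t))\<^sup>2 \<partial>lborel)" using C(1) by (simp add: integral_nonneg_AE)
      fix F c assume F: "finite F" "F \<subseteq> \<Delta>"
      have "(norm (\<integral>t. u t * trig_poly F c t \<partial>lborel))\<^sup>2 = (norm (\<integral>t. u t * (indicator A t *\<^sub>R trig_poly F c t) \<partial>lborel))\<^sup>2"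
        unfolding uA ..
      also have "\<dots> \<le> (\<integral>t. (norm (u t))\<^sup>2 \<partial>lborel) * (\<integral>t. (norm (indicator A t *\<^sub>R trig_poly F c t))\<^sup>2 \<partial>lborel)"
        by (rule Cauchy_Schwarz_integral[OF _ _ u2]) (use C(2)[OF F A A'] in simp_all)
      also have "\<dots> \<le> (\<integral>t. (norm (u t))\<^sup>2 \<partial>lborel) * (C * (\<Sum>\<beta>\<in>F. (norm (c \<beta>))\<^sup>2))"
        using C(2)[OF F A A'] by (intro mult_left_mono) (simp_all add: integral_nonneg_AE)
      finally show "(norm (\<integral>t. u t * trig_poly F c t \<partial>lborel))\<^sup>2 \<le> C * (\<integral>t. (norm (u t))\<^sup>2 \<partial>lborel) * (\<Sum>\<beta>\<in>F. (norm (c \<beta>))\<^sup>2)"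
        by (simp add: mult_ac)
    qed
  qed
qed

section \<open>Lattices and Fourier series on the torus\<close>

lemma dual_basis_exists:
  fixes B :: "'a::euclidean_space set"
  assumes "independent B" "span B = UNIV"
  obtains d where "\<And>b c. b \<in> B \<Longrightarrow> c \<in> B \<Longrightarrow> d b \<bullet> c = (if b = c then 1 else 0)"
    "\<And>z. z = (\<Sum>b\<in>B. (d b \<bullet> z) *\<^sub>R b)" "finite B"
proof -
  have "finite B" using assms(1) by (rule independent_bound_general[THEN conjunct1])
  have "\<forall>b. \<exists>g::'a \<Rightarrow> real. linear g \<and> (\<forall>c\<in>B. g c = (if b = c then 1 else 0))"
    by (rule allI, rule linear_independent_extend[OF assms(1)])
  then obtain g :: "'a \<Rightarrow> 'a \<Rightarrow> real" where g: "\<And>b. linear (g b)" "\<And>b c. c \<in> B \<Longrightarrow> g b c = (if b = c then 1 else 0)"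
    by metis
  define d where "d b = (\<Sum>i\<in>Basis. g b i *\<^sub>R i)" for b
  have dg: "d b \<bullet> z = g b z" for b z
  proof -
    have "g b z = g b (\<Sum>i\<in>Basis. (z \<bullet> i) *\<^sub>R i)" by (simp add: euclidean_representation)
    also have "\<dots> = (\<Sum>i\<in>Basis. (z \<bullet> i) * g b i)"
      using g(1)[of b] by (simp add: linear_sum linear_cmul)
    finally show ?thesis by (simp add: d_def inner_sum_left inner_commute[of z] mult.commute)
  qed
  show thesis
  proof
    show "d b \<bullet> c = (if b = c then 1 else 0)" if "b \<in> B" "c \<in> B" for b c
      using g(2) that by (simp add: dg)
    show "finite B" by fact
    have "(\<lambda>z. \<Sum>b\<in>B. (d b \<bullet> z) *\<^sub>R b) z = id z" for z
    proof (rule linear_eq_on_span[where B = B and g = id and f = "\<lambda>z. \<Sum>b\<in>B. (d b \<bullet> z) *\<^sub>R b"])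
      show "linear (\<lambda>z. \<Sum>b\<in>B. (d b \<bullet> z) *\<^sub>R b)"
        by (auto intro!: linearI simp: inner_add_right scaleR_add_left sum.distrib scaleR_sum_right)
      show "(\<Sum>b\<in>B. (d b \<bullet> z) *\<^sub>R b) = id z" if "z \<in> B" for z
      proof -
        have "(\<Sum>b\<in>B. (d b \<bullet> z) *\<^sub>R b) = (\<Sum>b\<in>B. if b = z then b else 0)"
          using that by (intro sum.cong) (auto simp: dg g(2))
        then show ?thesis using that \<open>finite B\<close> by simp
      qed
      show "linear (id :: 'a \<Rightarrow> 'a)" by (rule linearI) auto
    qed (auto simp: assms)
    then show "z = (\<Sum>b\<in>B. (d b \<bullet> z) *\<^sub>R b)" for z by simp
  qed
qed

text \<open>The dual vectors \<open>d b\<close> turn coordinates into inner products. Membership in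
  the lattice and in its fundamental cell become conditions on the numbers
  \<open>d b \<bullet> z\<close>, and the same vectors supply the elements of the dual lattice from
  which kernels are built.\<close>

locale lattice_basis =
  fixes \<Gamma> :: "'a::euclidean_space set" and B :: "'a set" and d :: "'a \<Rightarrow> 'a"
  assumes finB: "finite B"
    and dual: "\<And>b c. b \<in> B \<Longrightarrow> c \<in> B \<Longrightarrow> d b \<bullet> c = (if b = c then 1 else 0)"
    and expand: "\<And>z. z = (\<Sum>b\<in>B. (d b \<bullet> z) *\<^sub>R b)"
    and lattice: "\<Gamma> = range (\<lambda>c :: 'a \<Rightarrow> int. \<Sum>b\<in>B. of_int (c b) *\<^sub>R b)"
begin

lemma dual_sum: "b \<in> B \<Longrightarrow> d b \<bullet> (\<Sum>c\<in>B. f c *\<^sub>R c) = f b"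
proof -
  assume b: "b \<in> B"
  have "d b \<bullet> (\<Sum>c\<in>B. f c *\<^sub>R c) = (\<Sum>c\<in>B. if c = b then f c else 0)"
    unfolding inner_sum_right using b by (intro sum.cong) (auto simp: dual)
  then show ?thesis using b finB by simp
qed

lemma mem_lattice: "z \<in> \<Gamma> \<longleftrightarrow> (\<forall>b\<in>B. d b \<bullet> z \<in> \<int>)"
proof
  show "z \<in> \<Gamma> \<Longrightarrow> \<forall>b\<in>B. d b \<bullet> z \<in> \<int>" by (auto simp: lattice dual_sum)
  assume *: "\<forall>b\<in>B. d b \<bullet> z \<in> \<int>"
  have "z = (\<Sum>b\<in>B. of_int \<lfloor>d b \<bullet> z\<rfloor> *\<^sub>R b)"
    by (subst expand) (use * in \<open>auto intro!: sum.cong elim!: Ints_cases\<close>)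
  then show "z \<in> \<Gamma>" unfolding lattice by (intro range_eqI[where x = "\<lambda>b. \<lfloor>d b \<bullet> z\<rfloor>"])
qed

lemma lattice_zero [simp]: "0 \<in> \<Gamma>" and lattice_add: "x \<in> \<Gamma> \<Longrightarrow> y \<in> \<Gamma> \<Longrightarrow> x + y \<in> \<Gamma>"
  and lattice_diff: "x \<in> \<Gamma> \<Longrightarrow> y \<in> \<Gamma> \<Longrightarrow> x - y \<in> \<Gamma>" and lattice_neg: "x \<in> \<Gamma> \<Longrightarrow> - x \<in> \<Gamma>"
  by (auto simp: mem_lattice inner_simps)

lemma countable_lattice: "countable \<Gamma>"
proof -
  have "\<Gamma> \<subseteq> (\<lambda>c. \<Sum>b\<in>B. of_int (c b) *\<^sub>R b) ` (B \<rightarrow>\<^sub>E (UNIV :: int set))"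
  proof
    fix z assume "z \<in> \<Gamma>"
    then obtain c :: "'a \<Rightarrow> int" where "z = (\<Sum>b\<in>B. of_int (c b) *\<^sub>R b)" by (auto simp: lattice)
    then have "z = (\<Sum>b\<in>B. of_int (restrict c B b) *\<^sub>R b)" by simp
    then show "z \<in> (\<lambda>c. \<Sum>b\<in>B. of_int (c b) *\<^sub>R b) ` (B \<rightarrow>\<^sub>E (UNIV :: int set))"
      by (simp only:, intro image_eqI[where x = "restrict c B"] refl restrict_PiE_iff[THEN iffD2]) simp
  qed
  moreover have "countable (B \<rightarrow>\<^sub>E (UNIV :: int set))" by (rule countable_PiE[OF finB]) simp
  ultimately show ?thesis by (rule countable_subset[OF _ countable_image])
qed

lemma dual_mem: "b \<in> B \<Longrightarrow> d b \<in> dual_lattice \<Gamma>"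
  by (auto simp: dual_lattice_def mem_lattice inner_commute[of _ "d b"])

lemma cis_periodic:
  assumes "\<eta> \<in> dual_lattice \<Gamma>" "\<gamma> \<in> \<Gamma>"
  shows "cis (2 * pi * (\<eta> \<bullet> (z + \<gamma>))) = cis (2 * pi * (\<eta> \<bullet> z))"
proof -
  obtain k where "\<gamma> \<bullet> \<eta> = of_int k" using assms by (auto simp: dual_lattice_def elim!: Ints_cases)
  then have "2 * pi * (\<eta> \<bullet> (z + \<gamma>)) = 2 * pi * (\<eta> \<bullet> z) + 2 * pi * of_int k"
    by (simp add: inner_add_right inner_commute[of \<eta> \<gamma>] distrib_left)
  then show ?thesis by (simp add: cis_mult[symmetric] cis_multiple_2pi)
qed

text \<open>Half-open, so that the lattice translates tile the space exactly and the representative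
  of a point is unique, not only unique off a null set.\<close>

definition cell :: "'a set" where "cell = {z. \<forall>b\<in>B. 0 \<le> d b \<bullet> z \<and> d b \<bullet> z < 1}"

definition cell_base :: "'a \<Rightarrow> 'a" where "cell_base z = (\<Sum>b\<in>B. of_int \<lfloor>d b \<bullet> z\<rfloor> *\<^sub>R b)"

lemma cell_base_mem: "cell_base z \<in> \<Gamma>" unfolding lattice cell_base_def by (rule range_eqI[where x = "\<lambda>b. \<lfloor>d b \<bullet> z\<rfloor>"]) simp

lemma cell_base_unique: "\<gamma> \<in> \<Gamma> \<Longrightarrow> z - \<gamma> \<in> cell \<longleftrightarrow> \<gamma> = cell_base z"
proof
  assume g: "\<gamma> \<in> \<Gamma>" and z: "z - \<gamma> \<in> cell"
  have "d b \<bullet> \<gamma> = of_int \<lfloor>d b \<bullet> z\<rfloor>" if "b \<in> B" for b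
  proof -
    have "d b \<bullet> \<gamma> \<in> \<int>" using g that by (simp add: mem_lattice)
    then obtain k where k: "d b \<bullet> \<gamma> = of_int k" by (rule Ints_cases)
    have "0 \<le> d b \<bullet> z - of_int k" "d b \<bullet> z - of_int k < 1"
      using z that k by (auto simp: cell_def inner_diff_right)
    then have "\<lfloor>d b \<bullet> z\<rfloor> = k" by linarith
    then show ?thesis using k by simp
  qed
  then show "\<gamma> = cell_base z" unfolding cell_base_def using expand[of \<gamma>] by simp
next
  assume "\<gamma> = cell_base z"
  then show "z - \<gamma> \<in> cell"
    unfolding cell_def cell_base_def by (auto simp: inner_diff_right dual_sum) linarith
qed

lemma cell_measurable [measurable]: "cell \<in> sets borel"
proof -
  have "cell = (\<Inter>b\<in>B. {z. 0 \<le> d b \<bullet> z} \<inter> {z. d b \<bullet> z < 1})" if "B \<noteq> {}"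
    using that unfolding cell_def by auto
  moreover have "cell = UNIV" if "B = {}" unfolding cell_def using that by simp
  moreover have "(\<Inter>b\<in>B. {z. 0 \<le> d b \<bullet> z} \<inter> {z. d b \<bullet> z < 1}) \<in> sets borel" if "B \<noteq> {}"
    by (rule sets.finite_INT[OF finB that])
       (intro sets.Int borel_closed borel_open closed_halfspace_ge open_halfspace_lt)
  ultimately show ?thesis by (cases "B = {}") auto
qed

lemma norm_le_dual_sum: "(\<And>b. b \<in> B \<Longrightarrow> \<bar>d b \<bullet> z\<bar> \<le> r) \<Longrightarrow> norm z \<le> r * (\<Sum>b\<in>B. norm b)"
proof -
  assume r: "\<And>b. b \<in> B \<Longrightarrow> \<bar>d b \<bullet> z\<bar> \<le> r"
  have "norm z = norm (\<Sum>b\<in>B. (d b \<bullet> z) *\<^sub>R b)" by (subst expand) simp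
  also have "\<dots> \<le> (\<Sum>b\<in>B. r * norm b)"
    by (rule sum_norm_le) (use r in \<open>auto intro!: mult_right_mono\<close>)
  finally show ?thesis by (simp add: sum_distrib_left)
qed

lemma cell_bounded: "bounded cell"
  unfolding bounded_iff using norm_le_dual_sum[of _ 1]
  by (intro exI[of _ "1 * (\<Sum>b\<in>B. norm b)"]) (auto simp: cell_def less_imp_le)

lemma cell_finite: "emeasure lborel cell < \<infinity>"
  using emeasure_bounded_finite[OF cell_bounded] .

text \<open>Countably many lattice translates of the part inside the cell cover a periodic set, and
  translations preserve null sets.\<close>

lemma periodic_null:
  assumes V: "V \<in> sets borel" and per: "\<And>z \<gamma>. z \<in> V \<Longrightarrow> \<gamma> \<in> \<Gamma> \<Longrightarrow> z + \<gamma> \<in> V"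
    and 0: "emeasure lborel (cell \<inter> V) = 0"
  shows "emeasure lborel V = 0"
proof -
  have sub: "V \<subseteq> (\<Union>\<gamma>\<in>\<Gamma>. (+) \<gamma> ` (cell \<inter> V))"
  proof
    fix z assume "z \<in> V"
    have "z - cell_base z \<in> cell" using cell_base_unique[OF cell_base_mem] by blast
    moreover have "z - cell_base z \<in> V" using per[OF \<open>z \<in> V\<close> lattice_neg[OF cell_base_mem]] by simp
    ultimately show "z \<in> (\<Union>\<gamma>\<in>\<Gamma>. (+) \<gamma> ` (cell \<inter> V))"
      using cell_base_mem[of z] by (auto intro!: bexI[of _ "cell_base z"] image_eqI[of _ _ "z - cell_base z"])
  qed
  have m: "(+) \<gamma> ` (cell \<inter> V) \<in> null_sets lborel" for \<gamma>
  proof -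
    define S where "S = cell \<inter> V"
    have S: "S \<in> sets borel" using V by (simp add: S_def)
    have eq: "(+) \<gamma> ` S = (+) (- \<gamma>) -` S"
    proof (intro equalityI subsetI)
      fix x assume "x \<in> (+) (- \<gamma>) -` S"
      then show "x \<in> (+) \<gamma> ` S" by (intro image_eqI[of _ _ "- \<gamma> + x"]) auto
    qed auto
    have "emeasure (distr lborel borel ((+) (- \<gamma>))) S = emeasure lborel ((+) (- \<gamma>) -` S \<inter> space lborel)"
      by (rule emeasure_distr) (simp_all add: S)
    then have "emeasure lborel ((+) \<gamma> ` S) = 0"
      unfolding lborel_distr_plus eq using 0 by (simp add: S_def)
    moreover have "(+) \<gamma> ` S \<in> sets lborel"
      unfolding eq using measurable_sets_borel[of "(+) (- \<gamma>)" borel S] S by simp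
    ultimately show ?thesis unfolding S_def[symmetric] by (rule null_setsI)
  qed
  have "(\<Union>\<gamma>\<in>\<Gamma>. (+) \<gamma> ` (cell \<inter> V)) \<in> null_sets lborel"
    by (rule null_sets_UN'[OF countable_lattice m])
  then have "V \<in> null_sets lborel"
    using sub V null_sets_subset[of _ lborel V] by (metis sets_lborel)
  then show ?thesis by auto
qed

text \<open>A nonempty open set is not null, so by periodicity its part in the cell cannot be null
  either. With \<open>V = UNIV\<close> this yields the positive volume of the cell without any
  determinant; the uniqueness theorem uses it for the set where its kernel is large.\<close>

lemma periodic_open_positive:
  assumes V: "open V" "V \<noteq> {}" and per: "\<And>z \<gamma>. z \<in> V \<Longrightarrow> \<gamma> \<in> \<Gamma> \<Longrightarrow> z + \<gamma> \<in> V"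
  shows "0 < measure lborel (cell \<inter> V)"
proof -
  have "emeasure lborel V \<noteq> 0"
  proof
    assume "emeasure lborel V = 0"
    then have "V \<in> null_sets lborel" using V(1) by auto
    then have "negligible V" by (simp add: negligible_iff_null_sets null_sets_completionI)
    then show False using open_not_negligible V by blast
  qed
  have "emeasure lborel (cell \<inter> V) \<noteq> 0"
    using periodic_null[of V] per V(1) \<open>emeasure lborel V \<noteq> 0\<close> by (metis borel_open)
  moreover have "emeasure lborel (cell \<inter> V) < \<infinity>"
    using cell_finite emeasure_mono[of "cell \<inter> V" cell lborel] by (auto simp: le_less_trans)
  ultimately show ?thesis
    by (simp add: measure_def enn2real_positive_iff zero_less_iff_neq_zero)
qed

lemma cell_positive: "0 < measure lborel cell"
  using periodic_open_positive[of UNIV] by simp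

text \<open>The translates of the cell partition the space, and shifting each piece back to the cell
  turns the sum of the integrals over the pieces into the integral of the periodization. At most one
  cell indicator is nonzero at any point, so the norms of the pieces add up to at most the norm of
  \<phi>, which justifies exchanging sum and integral on both sides.\<close>

lemma unfolding_integral:
  fixes \<phi> :: "'a \<Rightarrow> complex"
  assumes \<phi>: "integrable lborel \<phi>"
    and s: "\<And>z. (\<lambda>\<gamma>. norm (\<phi> (z + \<gamma>))) summable_on \<Gamma>"
  shows "integrable lborel (\<lambda>z. indicator cell z *\<^sub>R (\<Sum>\<^sub>\<infinity>\<gamma>\<in>\<Gamma>. \<phi> (z + \<gamma>)))"
    and "(\<integral>z. indicator cell z *\<^sub>R (\<Sum>\<^sub>\<infinity>\<gamma>\<in>\<Gamma>. \<phi> (z + \<gamma>)) \<partial>lborel) = (\<integral>z. \<phi> z \<partial>lborel)"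
proof -
  have m [measurable]: "\<phi> \<in> borel_measurable borel" using borel_measurable_integrable[OF \<phi>] by simp
  have tr: "(\<integral>z. indicator cell z *\<^sub>R \<psi> (z + \<gamma>) \<partial>lborel) = (\<integral>z. indicator cell (z - \<gamma>) *\<^sub>R \<psi> z \<partial>lborel)"
    if [measurable]: "\<psi> \<in> borel_measurable borel" for \<psi> :: "'a \<Rightarrow> 'b::{banach, second_countable_topology}" and \<gamma>
    using lborel_integral_shift(1)[of "\<lambda>z. indicator cell (z - \<gamma>) *\<^sub>R \<psi> z" \<gamma>] by simp
  have if': "integrable lborel (\<lambda>z. indicator cell (z - \<gamma>) *\<^sub>R \<phi> z)" for \<gamma>
    by (rule Bochner_Integration.integrable_bound[OF \<phi>]) (auto simp: indicator_def)
  have if1: "integrable lborel (\<lambda>z. indicator cell z *\<^sub>R \<phi> (z + \<gamma>))" for \<gamma>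
    using lborel_integrable_shift(1)[of "\<lambda>z. indicator cell (z - \<gamma>) *\<^sub>R \<phi> z" \<gamma>] if' by simp
  have one: "indicator cell (z - \<gamma>) = (if \<gamma> = cell_base z then 1 else 0 :: real)" if "\<gamma> \<in> \<Gamma>" for z \<gamma>
    using cell_base_unique[OF that] by (auto simp: indicator_def)
  have bd: "(\<Sum>\<gamma>\<in>F. indicator cell (z - \<gamma>)) \<le> (1::real)" if "finite F" "F \<subseteq> \<Gamma>" for F z
  proof -
    have "(\<Sum>\<gamma>\<in>F. indicator cell (z - \<gamma>)) = (\<Sum>\<gamma>\<in>F. if \<gamma> = cell_base z then 1 else 0 :: real)"
      using that by (intro sum.cong one) auto
    also have "\<dots> \<le> 1" using that by simp
    finally show ?thesis .
  qed
  have N: "(\<lambda>\<gamma>. \<integral>z. norm (indicator cell (z - \<gamma>) *\<^sub>R \<phi> z) \<partial>lborel) summable_on \<Gamma>"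
  proof (rule bounded_sums_summable(1))
    fix F assume F: "finite F" "F \<subseteq> \<Gamma>"
    have "(\<Sum>\<gamma>\<in>F. \<integral>z. norm (indicator cell (z - \<gamma>) *\<^sub>R \<phi> z) \<partial>lborel) =
        (\<integral>z. (\<Sum>\<gamma>\<in>F. norm (indicator cell (z - \<gamma>) *\<^sub>R \<phi> z)) \<partial>lborel)"
      by (rule Bochner_Integration.integral_sum[symmetric]) (use if' in \<open>rule integrable_norm\<close>)
    also have "\<dots> = (\<integral>z. (\<Sum>\<gamma>\<in>F. indicator cell (z - \<gamma>)) * norm (\<phi> z) \<partial>lborel)"
      by (simp add: sum_distrib_right)
    also have "\<dots> \<le> (\<integral>z. norm (\<phi> z) \<partial>lborel)"
      by (rule integral_mono') (use \<phi> bd[OF F] in \<open>auto intro!: mult_left_le_one_le sum_nonneg\<close>)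
    finally show "(\<Sum>\<gamma>\<in>F. \<integral>z. norm (indicator cell (z - \<gamma>) *\<^sub>R \<phi> z) \<partial>lborel) \<le> (\<integral>z. norm (\<phi> z) \<partial>lborel)" .
  qed (rule integral_nonneg_AE, simp)
  have hs: "((\<lambda>\<gamma>. indicator cell (z - \<gamma>) *\<^sub>R \<phi> z) has_sum \<phi> z) \<Gamma>" for z
  proof -
    have "((\<lambda>\<gamma>. indicator cell (z - \<gamma>) *\<^sub>R \<phi> z) has_sum (\<Sum>\<gamma>\<in>{cell_base z}. indicator cell (z - \<gamma>) *\<^sub>R \<phi> z)) \<Gamma>"
      by (rule has_sum_finite_neutralI[where B = "{cell_base z}"]) (auto simp: cell_base_mem one)
    then show ?thesis using cell_base_mem[of z] by (simp add: one)
  qed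
  have hs': "(\<lambda>\<gamma>. norm (indicator cell (z - \<gamma>) *\<^sub>R \<phi> z)) summable_on \<Gamma>" for z
    by (rule finite_nonzero_values_imp_summable_on, rule finite_subset[of _ "{cell_base z}"]) (auto simp: one split: if_splits)
  have A: "((\<lambda>\<gamma>. \<integral>z. indicator cell (z - \<gamma>) *\<^sub>R \<phi> z \<partial>lborel) has_sum (\<integral>z. \<phi> z \<partial>lborel)) \<Gamma>"
    using integral_infsum(2)[OF countable_lattice if' hs' N] unfolding infsumI[OF hs] .
  have s': "(\<lambda>\<gamma>. norm (indicator cell z *\<^sub>R \<phi> (z + \<gamma>))) summable_on \<Gamma>" for z
    using s[of z] by (cases "z \<in> cell") auto
  have N': "(\<lambda>\<gamma>. \<integral>z. norm (indicator cell z *\<^sub>R \<phi> (z + \<gamma>)) \<partial>lborel) summable_on \<Gamma>"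
    using N tr[of "\<lambda>z. norm (\<phi> z)"] by simp
  have eq: "(\<Sum>\<^sub>\<infinity>\<gamma>\<in>\<Gamma>. indicator cell z *\<^sub>R \<phi> (z + \<gamma>)) = indicator cell z *\<^sub>R (\<Sum>\<^sub>\<infinity>\<gamma>\<in>\<Gamma>. \<phi> (z + \<gamma>))" for z
    by (cases "z \<in> cell") auto
  show "integrable lborel (\<lambda>z. indicator cell z *\<^sub>R (\<Sum>\<^sub>\<infinity>\<gamma>\<in>\<Gamma>. \<phi> (z + \<gamma>)))"
    using integral_infsum(1)[OF countable_lattice if1 s' N'] by (simp only: eq)
  have "((\<lambda>\<gamma>. \<integral>z. indicator cell z *\<^sub>R \<phi> (z + \<gamma>) \<partial>lborel) has_sum
      (\<integral>z. indicator cell z *\<^sub>R (\<Sum>\<^sub>\<infinity>\<gamma>\<in>\<Gamma>. \<phi> (z + \<gamma>)) \<partial>lborel)) \<Gamma>"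
    using integral_infsum(2)[OF countable_lattice if1 s' N'] by (simp only: eq)
  then show "(\<integral>z. indicator cell z *\<^sub>R (\<Sum>\<^sub>\<infinity>\<gamma>\<in>\<Gamma>. \<phi> (z + \<gamma>)) \<partial>lborel) = (\<integral>z. \<phi> z \<partial>lborel)"
    using A has_sum_unique by (simp only: tr[OF m]) blast
qed

text \<open>A periodic function is the periodization of its own restriction to the cell. With this,
  invariance of cell integrals under shifts follows from unfolding, and no shifted cell has to be
  cut into pieces and reassembled.\<close>

lemma periodic_fold:
  fixes f :: "'a \<Rightarrow> complex"
  assumes per: "\<And>z \<gamma>. \<gamma> \<in> \<Gamma> \<Longrightarrow> f (z + \<gamma>) = f z"
  shows "((\<lambda>\<gamma>. indicator cell (z + \<gamma>) *\<^sub>R f (z + \<gamma>)) has_sum f z) \<Gamma>"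
    and "(\<lambda>\<gamma>. norm (indicator cell (z + \<gamma>) *\<^sub>R f (z + \<gamma>))) summable_on \<Gamma>"
proof -
  have one: "indicator cell (z + \<gamma>) = (if \<gamma> = - cell_base z then 1 else 0 :: real)" if "\<gamma> \<in> \<Gamma>" for \<gamma>
    using cell_base_unique[OF lattice_neg[OF that], of z] minus_equation_iff[of \<gamma> "cell_base z"]
    by (auto simp: indicator_def)
  have "((\<lambda>\<gamma>. indicator cell (z + \<gamma>) *\<^sub>R f (z + \<gamma>)) has_sum
      (\<Sum>\<gamma>\<in>{- cell_base z}. indicator cell (z + \<gamma>) *\<^sub>R f (z + \<gamma>))) \<Gamma>"
    by (rule has_sum_finite_neutralI[where B = "{- cell_base z}"]) (auto simp: lattice_neg cell_base_mem one)
  then show "((\<lambda>\<gamma>. indicator cell (z + \<gamma>) *\<^sub>R f (z + \<gamma>)) has_sum f z) \<Gamma>"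
    using per[OF lattice_neg[OF cell_base_mem], of z z] one[OF lattice_neg[OF cell_base_mem], of z] by simp
  show "(\<lambda>\<gamma>. norm (indicator cell (z + \<gamma>) *\<^sub>R f (z + \<gamma>))) summable_on \<Gamma>"
    by (rule finite_nonzero_values_imp_summable_on, rule finite_subset[of _ "{- cell_base z}"])
       (auto simp: one split: if_splits)
qed

lemma cell_integrable:
  fixes f :: "'a \<Rightarrow> complex"
  assumes [measurable]: "f \<in> borel_measurable borel" and M: "\<And>z. norm (f z) \<le> M"
  shows "integrable lborel (\<lambda>z. indicator cell z *\<^sub>R f z)"
proof (rule Bochner_Integration.integrable_bound)
  show "integrable lborel (\<lambda>z. M * indicator cell z)"
    using cell_finite by (intro integrable_mult_right) (simp add: integrable_indicator_iff)
  show "AE z in lborel. norm (indicator cell z *\<^sub>R f z) \<le> norm (M * indicator cell z)"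
    using M by (intro AE_I2) (auto simp: indicator_def intro: order_trans[OF M abs_ge_self])
qed measurable

lemma cell_integral_shift:
  fixes f :: "'a \<Rightarrow> complex"
  assumes f [measurable]: "f \<in> borel_measurable borel" and M: "\<And>z. norm (f z) \<le> M"
    and per: "\<And>z \<gamma>. \<gamma> \<in> \<Gamma> \<Longrightarrow> f (z + \<gamma>) = f z"
  shows "(\<integral>z. indicator cell z *\<^sub>R f (z + w) \<partial>lborel) = (\<integral>z. indicator cell z *\<^sub>R f z \<partial>lborel)"
proof -
  define \<phi> where "\<phi> = (\<lambda>z. indicator cell z *\<^sub>R f z)"
  have [measurable]: "\<phi> \<in> borel_measurable borel" unfolding \<phi>_def by measurable
  have i: "integrable lborel (\<lambda>z. \<phi> (z + w))"
    using cell_integrable[OF f M] lborel_integrable_shift(1)[of \<phi> w] unfolding \<phi>_def by simp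
  have eq: "\<phi> (z + \<gamma> + w) = \<phi> (z + w + \<gamma>)" for z \<gamma> by (simp add: add_ac)
  have h: "(\<Sum>\<^sub>\<infinity>\<gamma>\<in>\<Gamma>. \<phi> (z + \<gamma> + w)) = f (z + w)" for z
    unfolding eq unfolding \<phi>_def by (rule infsumI[OF periodic_fold(1)[OF per]])
  have s: "(\<lambda>\<gamma>. norm (\<phi> (z + \<gamma> + w))) summable_on \<Gamma>" for z
    unfolding eq unfolding \<phi>_def by (rule periodic_fold(2)[OF per])
  have "(\<integral>z. indicator cell z *\<^sub>R f (z + w) \<partial>lborel) = (\<integral>z. \<phi> (z + w) \<partial>lborel)"
    using unfolding_integral(2)[OF i s] by (simp only: h)
  also have "\<dots> = (\<integral>z. \<phi> z \<partial>lborel)" by (rule lborel_integral_shift) simp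
  finally show ?thesis by (simp add: \<phi>_def)
qed

lemma character_integral:
  assumes \<eta>: "\<eta> \<in> dual_lattice \<Gamma>"
  shows "(\<integral>z. indicator cell z *\<^sub>R cis (2 * pi * (\<eta> \<bullet> z)) \<partial>lborel) = (if \<eta> = 0 then of_real (measure lborel cell) else 0)"
proof (cases "\<eta> = 0")
  case True
  have "(\<integral>z. indicator cell z *\<^sub>R (1::complex) \<partial>lborel) = of_real (\<integral>z. indicator cell z \<partial>lborel)"
    by (simp only: integral_complex_of_real[symmetric] scaleR_conv_of_real mult_1_right)
  then show ?thesis using True by simp
next
  case False
  have "\<exists>b\<in>B. \<eta> \<bullet> b \<noteq> 0"
  proof (rule ccontr)
    assume "\<not> (\<exists>b\<in>B. \<eta> \<bullet> b \<noteq> 0)"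
    then have "\<eta> \<bullet> (\<Sum>b\<in>B. (d b \<bullet> \<eta>) *\<^sub>R b) = 0" by (simp add: inner_sum_right)
    then show False using expand[of \<eta>] False by simp
  qed
  then obtain b where b: "b \<in> B" "\<eta> \<bullet> b \<noteq> 0" by blast
  \<comment> \<open>Scaled so that \<open>\<eta> \<bullet> w = 1/2\<close>: a shift by
    \<open>w\<close> reverses the sign of the character, while the cell integral of a periodic
    function does not change under shifts. The integral thus equals its negative.\<close>
  define w where "w = (1 / (2 * (\<eta> \<bullet> b))) *\<^sub>R b"
  let ?f = "\<lambda>z. cis (2 * pi * (\<eta> \<bullet> z))"
  have neg: "?f (z + w) = - ?f z" for z
  proof -
    have "2 * pi * (\<eta> \<bullet> (z + w)) = 2 * pi * (\<eta> \<bullet> z) + pi"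
      using b by (simp add: w_def inner_add_right distrib_left)
    then show ?thesis by (simp only: cis_mult[symmetric] cis_pi) simp
  qed
  have "(\<integral>z. indicator cell z *\<^sub>R ?f (z + w) \<partial>lborel) = (\<integral>z. indicator cell z *\<^sub>R ?f z \<partial>lborel)"
    by (rule cell_integral_shift[where M = 1]) (auto simp: cis_periodic[OF \<eta>])
  then show ?thesis using False unfolding neg by simp
qed

text \<open>All factors are at most 1, so a product exceeding \<open>q\<close> forces every factor
  above \<open>q\<close>, and then every coordinate of \<open>z\<close> is close to an
  integer.\<close>

lemma near_lattice:
  assumes "r > 0"
  obtains q where "0 < q" "q < 1"
    "\<And>z. (\<Prod>b\<in>B. (cos (pi * (d b \<bullet> z)))\<^sup>2) > q \<Longrightarrow> \<exists>\<gamma>\<in>\<Gamma>. norm (z - \<gamma>) < r"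
proof -
  define S where "S = 1 + (\<Sum>b\<in>B. norm b)"
  have S: "S \<ge> 1" by (simp add: S_def sum_nonneg)
  \<comment> \<open>The bound \<open>1/4\<close> makes \<open>cos (pi * \<rho>)\<close> positive, as
    needed for \<open>0 < q\<close>. The other bound turns coordinates within \<rho> of integers
    into a distance of at most \<open>r / 2\<close> from the lattice; the summand 1 in
    \<open>S\<close> excludes a division by zero.\<close>
  define \<rho> where "\<rho> = min (1/4) (r / (2 * S))"
  have \<rho>: "0 < \<rho>" "\<rho> \<le> 1/4" using assms S by (auto simp: \<rho>_def)
  define q where "q = (cos (pi * \<rho>))\<^sup>2"
  have c: "0 < cos (pi * \<rho>)" using \<rho> by (intro cos_gt_zero) (auto simp: field_simps)
  have c1: "cos (pi * \<rho>) < 1"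
    using \<rho> cos_monotone_0_pi[of 0 "pi * \<rho>"] by (simp add: field_simps)
  show thesis
  proof
    show "0 < q" using c by (simp add: q_def)
    show "q < 1" unfolding q_def using c c1 by (simp add: power_less_one_iff abs_square_less_1)
    fix z assume z: "(\<Prod>b\<in>B. (cos (pi * (d b \<bullet> z)))\<^sup>2) > q"
    have small: "\<bar>d b \<bullet> z - of_int (round (d b \<bullet> z))\<bar> \<le> \<rho>" if b: "b \<in> B" for b
    proof (rule ccontr)
      define y where "y = d b \<bullet> z - of_int (round (d b \<bullet> z))"
      assume "\<not> \<bar>d b \<bullet> z - of_int (round (d b \<bullet> z))\<bar> \<le> \<rho>"
      then have y: "\<rho> < \<bar>y\<bar>" "\<bar>y\<bar> \<le> 1/2"
        using of_int_round_abs_le[of "d b \<bullet> z"] by (auto simp: y_def abs_minus_commute)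
      have "pi * (d b \<bullet> z) = pi * y + pi * of_int (round (d b \<bullet> z))" by (simp add: y_def algebra_simps)
      then have "cos (pi * (d b \<bullet> z)) = cos (pi * y) * cos (pi * of_int (round (d b \<bullet> z)))"
        by (simp add: cos_add sin_integer_2pi sin_times_pi_eq_0 mult.commute)
      then have "(cos (pi * (d b \<bullet> z)))\<^sup>2 = (cos (pi * y))\<^sup>2 * (cos (pi * of_int (round (d b \<bullet> z))))\<^sup>2"
        by (simp only: power_mult_distrib)
      also have "\<dots> \<le> (cos (pi * y))\<^sup>2 * 1"
        by (intro mult_left_mono) (auto simp: abs_square_le_1)
      also have "(cos (pi * y))\<^sup>2 = (cos (pi * \<bar>y\<bar>))\<^sup>2" by (auto simp: abs_if)
      also have "(cos (pi * \<bar>y\<bar>))\<^sup>2 * 1 < q"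
      proof -
        have "cos (pi * \<bar>y\<bar>) < cos (pi * \<rho>)"
          using y \<rho> by (intro cos_monotone_0_pi) (auto simp: field_simps)
        moreover have "0 \<le> cos (pi * \<bar>y\<bar>)"
        proof (rule cos_ge_zero)
          have "0 \<le> pi * \<bar>y\<bar>" by simp
          then show "- (pi / 2) \<le> pi * \<bar>y\<bar>" using pi_gt_zero by linarith
          show "pi * \<bar>y\<bar> \<le> pi / 2" using y by (simp add: field_simps)
        qed
        ultimately show ?thesis unfolding q_def by (simp add: power_strict_mono)
      qed
      finally have *: "(cos (pi * (d b \<bullet> z)))\<^sup>2 < q" .
      have "(\<Prod>b\<in>B. (cos (pi * (d b \<bullet> z)))\<^sup>2) = (cos (pi * (d b \<bullet> z)))\<^sup>2 * (\<Prod>b\<in>B - {b}. (cos (pi * (d b \<bullet> z)))\<^sup>2)"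
        by (rule prod.remove[OF finB b])
      also have "\<dots> \<le> (cos (pi * (d b \<bullet> z)))\<^sup>2 * 1"
        by (intro mult_left_mono prod_le_1) (auto simp: abs_square_le_1)
      finally show False using * z by simp
    qed
    define \<gamma> where "\<gamma> = (\<Sum>b\<in>B. of_int (round (d b \<bullet> z)) *\<^sub>R b)"
    have "norm (z - \<gamma>) \<le> \<rho> * (\<Sum>b\<in>B. norm b)"
      by (rule norm_le_dual_sum) (use small in \<open>simp add: \<gamma>_def inner_diff_right dual_sum\<close>)
    also have "\<dots> \<le> \<rho> * S" using \<rho> by (simp add: S_def)
    also have "\<dots> \<le> r / (2 * S) * S" using S by (intro mult_right_mono) (auto simp: \<rho>_def)
    also have "\<dots> < r" using assms S by simp
    finally have "norm (z - \<gamma>) < r" .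
    moreover have "\<gamma> \<in> \<Gamma>" by (simp add: mem_lattice \<gamma>_def dual_sum)
    ultimately show "\<exists>\<gamma>\<in>\<Gamma>. norm (z - \<gamma>) < r" by blast
  qed
qed

lemma dual_lattice_add: "x \<in> dual_lattice \<Gamma> \<Longrightarrow> y \<in> dual_lattice \<Gamma> \<Longrightarrow> x + y \<in> dual_lattice \<Gamma>"
  and dual_lattice_neg: "x \<in> dual_lattice \<Gamma> \<Longrightarrow> - x \<in> dual_lattice \<Gamma>"
  and dual_lattice_zero: "0 \<in> dual_lattice \<Gamma>"
  by (auto simp: dual_lattice_def inner_simps)

text \<open>Each squared cosine is a combination of the constant 1 and the characters of
  \<open>d b\<close> and \<open>- d b\<close>. These vectors lie in the dual lattice, so multiplying
  by a factor only moves frequencies within that lattice and orthogonality is inherited. The factors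
  form a list because powers require repeated basis vectors.\<close>

lemma orthogonal_trig_product:
  fixes H :: "'a \<Rightarrow> complex"
  assumes [measurable]: "H \<in> borel_measurable borel" and M: "\<And>z. norm (H z) \<le> M"
    and o: "\<And>\<eta>. \<eta> \<in> dual_lattice \<Gamma> \<Longrightarrow> (\<integral>z. indicator cell z *\<^sub>R (H z * cis (2 * pi * (\<eta> \<bullet> z))) \<partial>lborel) = 0"
    and xs: "set xs \<subseteq> B" and \<eta>: "\<eta> \<in> dual_lattice \<Gamma>"
  shows "(\<integral>z. indicator cell z *\<^sub>R (H z * (\<Prod>b\<leftarrow>xs. of_real ((cos (pi * (d b \<bullet> (z - z0))))\<^sup>2)) * cis (2 * pi * (\<eta> \<bullet> z))) \<partial>lborel) = 0"
  using xs \<eta>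
proof (induction xs arbitrary: \<eta>)
  case Nil
  then show ?case using o by simp
next
  case (Cons b xs)
  define P where "P = (\<lambda>z. \<Prod>b\<leftarrow>xs. complex_of_real ((cos (pi * (d b \<bullet> (z - z0))))\<^sup>2))"
  let ?I = "\<lambda>\<eta> z. indicator cell z *\<^sub>R (H z * P z * cis (2 * pi * (\<eta> \<bullet> z)))"
  have [measurable]: "P \<in> borel_measurable borel" unfolding P_def
    by (induction xs) (auto intro!: borel_measurable_times)
  have P1: "norm (P z) \<le> 1" for z unfolding P_def
    by (induction xs) (auto simp: norm_mult norm_power abs_square_le_1 intro!: mult_le_one)
  have i: "integrable lborel (?I \<eta>)" for \<eta>
    by (rule cell_integrable[where M = M])
       (auto simp: norm_mult intro!: order_trans[OF mult_right_le_one_le M] P1)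
  \<comment> \<open>This phase absorbs the center \<open>z0\<close> into the coefficients, so that
    what remains are characters centered at the origin.\<close>
  define c where "c = cis (2 * pi * (d b \<bullet> z0))"
  have c0: "c \<noteq> 0" by (simp add: c_def)
  have cc: "complex_of_real ((cos (pi * (d b \<bullet> (z - z0))))\<^sup>2) =
      1/2 + (inverse c / 4) * cis (2 * pi * (d b \<bullet> z)) + (c / 4) * cis (2 * pi * (- d b \<bullet> z))" for z
  proof -
    define \<theta> where "\<theta> = pi * (d b \<bullet> (z - z0))"
    have e1: "inverse c * cis (2 * pi * (d b \<bullet> z)) = cis (2 * \<theta>)"
      by (simp add: c_def \<theta>_def cis_mult inner_diff_right algebra_simps)
    have e2: "c * cis (2 * pi * (- d b \<bullet> z)) = cis (- (2 * \<theta>))"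
      by (simp add: c_def \<theta>_def cis_mult inner_diff_right algebra_simps)
    have "1/2 + (inverse c / 4) * cis (2 * pi * (d b \<bullet> z)) + (c / 4) * cis (2 * pi * (- d b \<bullet> z)) =
        1/2 + (inverse c * cis (2 * pi * (d b \<bullet> z)) + c * cis (2 * pi * (- d b \<bullet> z))) / 4"
      by (simp only: add_divide_distrib times_divide_eq_left add.assoc)
    also have "\<dots> = 1/2 + (cis (2 * \<theta>) + cis (- (2 * \<theta>))) / 4" unfolding e1 e2 ..
    also have "\<dots> = of_real (1/2 + cos (2 * \<theta>) / 2)" by (simp add: complex_eq_iff)
    also have "1/2 + cos (2 * \<theta>) / 2 = (cos \<theta>)\<^sup>2" by (simp only: cos_double_cos) (simp add: field_simps)
    finally show ?thesis unfolding \<theta>_def by (rule sym)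
  qed
  have split: "indicator cell z *\<^sub>R (H z * (\<Prod>b\<leftarrow>b # xs. of_real ((cos (pi * (d b \<bullet> (z - z0))))\<^sup>2)) * cis (2 * pi * (\<eta> \<bullet> z))) =
     (1/2) * ?I \<eta> z + ((inverse c / 4) * ?I (\<eta> + d b) z + (c / 4) * ?I (\<eta> + - d b) z)" for z
  proof -
    have e: "cis (2 * pi * ((\<eta> + \<xi>) \<bullet> z)) = cis (2 * pi * (\<eta> \<bullet> z)) * cis (2 * pi * (\<xi> \<bullet> z))" for \<xi>
      by (simp add: cis_mult inner_add_left distrib_left)
    show ?thesis
      unfolding list.map prod_list.Cons cc e P_def[symmetric]
      by (simp only: scaleR_conv_of_real P_def[THEN fun_cong, symmetric]) (simp add: algebra_simps)
  qed
  have b: "b \<in> B" and xs: "set xs \<subseteq> B" using Cons.prems by auto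
  have d: "\<eta> + d b \<in> dual_lattice \<Gamma>" "\<eta> + - d b \<in> dual_lattice \<Gamma>"
    by (intro dual_lattice_add dual_lattice_neg dual_mem b Cons.prems(2))+
  have "(\<integral>z. ?I \<eta> z \<partial>lborel) = 0" "(\<integral>z. ?I (\<eta> + d b) z \<partial>lborel) = 0" "(\<integral>z. ?I (\<eta> + - d b) z \<partial>lborel) = 0"
    unfolding P_def by (rule Cons.IH[OF xs Cons.prems(2)], rule Cons.IH[OF xs d(1)], rule Cons.IH[OF xs d(2)])
  then show ?case unfolding split
    by (subst Bochner_Integration.integral_add integral_mult_right_zero | intro integrable_mult_right Bochner_Integration.integrable_add i | simp)+
qed

text \<open>The kernels \<open>\<Prod>b\<in>B. (cos (pi * (d b \<bullet> (z - z0))))\<^sup>2\<^sup>n\<close> are trigonometric polynomials that concentrate, modulo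
  the lattice, at the point \<open>z0\<close> of continuity.\<close>

theorem fourier_coefficients_unique:
  fixes H :: "'a \<Rightarrow> complex"
  assumes H [measurable]: "H \<in> borel_measurable borel" and M: "\<And>z. norm (H z) \<le> M"
    and per: "\<And>z \<gamma>. \<gamma> \<in> \<Gamma> \<Longrightarrow> H (z + \<gamma>) = H z"
    and o: "\<And>\<eta>. \<eta> \<in> dual_lattice \<Gamma> \<Longrightarrow> (\<integral>z. indicator cell z *\<^sub>R (H z * cis (2 * pi * (\<eta> \<bullet> z))) \<partial>lborel) = 0"
    and cont: "isCont H z0"
  shows "H z0 = 0"
proof (rule ccontr)
  assume h0: "H z0 \<noteq> 0"
  \<comment> \<open>After normalization \<open>G z0 = 1\<close>, so by continuity the real part of
    \<open>G\<close> is at least \<open>1/2\<close> near \<open>z0\<close>, and by periodicity near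
    every lattice translate of \<open>z0\<close>.\<close>
  define G where "G z = H z / H z0" for z
  have [measurable]: "G \<in> borel_measurable borel" unfolding G_def by measurable
  define K where "K = M / norm (H z0)"
  have GK: "norm (G z) \<le> K" for z using M by (simp add: G_def K_def norm_divide divide_right_mono)
  have K0: "0 \<le> K" using order_trans[OF norm_ge_zero GK] .
  have "isCont G z0" unfolding G_def using h0 by (intro continuous_intros cont)
  then obtain r where r: "r > 0" "\<And>z. norm (z - z0) < r \<Longrightarrow> norm (G z - G z0) < 1/2"
    unfolding continuous_at_eps_delta dist_norm by (metis half_gt_zero_iff zero_less_one)
  obtain q where q: "0 < q" "q < 1"
    "\<And>z. (\<Prod>b\<in>B. (cos (pi * (d b \<bullet> z)))\<^sup>2) > q \<Longrightarrow> \<exists>\<gamma>\<in>\<Gamma>. norm (z - \<gamma>) < r"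
    using near_lattice[OF r(1)] by metis
  define Q where "Q z = (\<Prod>b\<in>B. (cos (pi * (d b \<bullet> (z - z0))))\<^sup>2)" for z
  have Q0: "0 \<le> Q z" for z unfolding Q_def by (intro prod_nonneg) simp
  have Q1: "Q z \<le> 1" for z unfolding Q_def by (intro prod_le_1) (auto simp: abs_square_le_1)
  have Qm [measurable]: "Q \<in> borel_measurable borel" unfolding Q_def by measurable
  have Gq: "Re (G z) \<ge> 1/2" if "Q z > q" for z
  proof -
    obtain \<gamma> where \<gamma>: "\<gamma> \<in> \<Gamma>" "norm (z - z0 - \<gamma>) < r" using q(3)[of "z - z0"] \<open>Q z > q\<close> unfolding Q_def by blast
    have "norm (z - \<gamma> - z0) < r" using \<gamma>(2) by (simp add: algebra_simps)
    then have "norm (G (z - \<gamma>) - G z0) < 1/2" by (rule r(2))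
    moreover have "G (z - \<gamma>) = G z" using per[OF lattice_neg[OF \<gamma>(1)], of z] by (simp add: G_def)
    moreover have "G z0 = 1" using h0 by (simp add: G_def)
    ultimately have "norm (G z - 1) < 1/2" by simp
    then have "\<bar>Re (G z - 1)\<bar> < 1/2" using abs_Re_le_cmod[of "G z - 1"] by linarith
    then show ?thesis unfolding abs_less_iff by simp
  qed
  \<comment> \<open>Strictly between \<open>q\<close> and 1. Where \<open>Q\<close> is at most
    \<open>q\<close> the real part of \<open>G\<close> is only bounded and the kernel
    \<open>Q z ^ n\<close> is at most \<open>q ^ n\<close>, while on the open set \<open>V\<close>
    around \<open>z0\<close> the kernel exceeds \<open>p ^ n\<close>. The quotient
    \<open>(p / q) ^ n\<close> is unbounded, which produces the contradiction.\<close>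
  define p where "p = (1 + q) / 2"
  have p: "q < p" "p < 1" "0 < p" using q by (auto simp: p_def)
  define V where "V = {z. Q z > p}"
  have "open V" unfolding V_def Q_def by (intro open_Collect_less continuous_intros)
  moreover have "z0 \<in> V" using p by (simp add: V_def Q_def)
  moreover have "z + \<gamma> \<in> V" if zV: "z \<in> V" "\<gamma> \<in> \<Gamma>" for z \<gamma>
  proof -
    have "Q (z + \<gamma>) = Q z" unfolding Q_def
    proof (rule prod.cong[OF refl])
      fix b assume "b \<in> B"
      then obtain k where k: "d b \<bullet> \<gamma> = of_int k" using zV(2) by (auto simp: mem_lattice elim!: Ints_cases)
      have s: "sin (of_int k * pi) = 0" by (auto simp: sin_zero_iff_int2)
      have "pi * (d b \<bullet> (z + \<gamma> - z0)) = pi * (d b \<bullet> (z - z0)) + of_int k * pi"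
        by (simp add: inner_add_right inner_diff_right k algebra_simps)
      then have "cos (pi * (d b \<bullet> (z + \<gamma> - z0))) = cos (pi * (d b \<bullet> (z - z0))) * cos (of_int k * pi)"
        using s by (simp add: cos_add)
      moreover have "(cos (of_int k * pi))\<^sup>2 = 1" using s sin_cos_squared_add[of "of_int k * pi"] by simp
      ultimately show "(cos (pi * (d b \<bullet> (z + \<gamma> - z0))))\<^sup>2 = (cos (pi * (d b \<bullet> (z - z0))))\<^sup>2"
        by (simp add: power_mult_distrib)
    qed
    then show ?thesis using that by (simp add: V_def)
  qed
  ultimately have m: "0 < measure lborel (cell \<inter> V)" using periodic_open_positive[of V] by blast
  have Vb [measurable]: "V \<in> sets borel" unfolding V_def by measurable
  \<comment> \<open>The integral of \<open>G\<close> against the \<open>n\<close>th power of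
    \<open>Q\<close> vanishes. In its real part \<open>V\<close> contributes at least the left side,
    the points outside \<open>V\<close> with \<open>Q z > q\<close> contribute nothing negative, and
    the remaining points at most the right side in absolute value.\<close>
  have key: "(1/2) * p ^ n * measure lborel (cell \<inter> V) \<le> K * q ^ n * measure lborel cell" for n
  proof -
    obtain xs where xs: "set xs = B" "distinct xs" using finite_distinct_list[OF finB] by blast
    have "of_real (Q z) ^ n = (\<Prod>b\<leftarrow>concat (replicate n xs). complex_of_real ((cos (pi * (d b \<bullet> (z - z0))))\<^sup>2))" for z
    proof (induction n)
      case (Suc n)
      have "complex_of_real (Q z) = (\<Prod>b\<leftarrow>xs. of_real ((cos (pi * (d b \<bullet> (z - z0))))\<^sup>2))"
        unfolding Q_def of_real_prod using prod.distinct_set_conv_list[OF xs(2)] xs(1) by simp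
      then show ?case using Suc by simp
    qed simp
    then have "(\<integral>z. indicator cell z *\<^sub>R (H z * of_real (Q z) ^ n) \<partial>lborel) = 0"
      using orthogonal_trig_product[OF H M o _ dual_lattice_zero, of "concat (replicate n xs)" z0] xs(1) by simp
    then have "(\<integral>z. indicator cell z *\<^sub>R (H z * of_real (Q z) ^ n) \<partial>lborel) / H z0 = 0" by simp
    then have z: "(\<integral>z. indicator cell z *\<^sub>R (G z * of_real (Q z) ^ n) \<partial>lborel) = 0"
      unfolding integral_divide_zero[symmetric] by (simp add: G_def scaleR_conv_of_real)
    have iG: "integrable lborel (\<lambda>z. indicator cell z *\<^sub>R (G z * of_real (Q z) ^ n))"
      by (rule cell_integrable[where M = K])
        (auto simp: norm_mult norm_power Q0 Q1 power_le_one intro!: order_trans[OF mult_right_le_one_le GK])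
    have iFV: "integrable lborel (\<lambda>z. indicator (cell \<inter> V) z :: real)"
      using cell_finite emeasure_mono[of "cell \<inter> V" cell lborel] by (simp add: integrable_indicator_iff le_less_trans)
    have iF: "integrable lborel (\<lambda>z. indicator cell z :: real)"
      using cell_finite by (simp add: integrable_indicator_iff)
    have pw: "(1/2) * p ^ n * indicator (cell \<inter> V) z - K * q ^ n * indicator cell z \<le> Re (indicator cell z *\<^sub>R (G z * of_real (Q z) ^ n))" for z
    proof (cases "z \<in> cell")
      case True
      have R: "Re (G z * of_real (Q z) ^ n) = Re (G z) * Q z ^ n"
        by (simp flip: of_real_power)
      have Kq: "0 \<le> K * q ^ n" using K0 q by simp
      consider "z \<in> V" | "z \<notin> V" "Q z > q" | "z \<notin> V" "Q z \<le> q" by fastforce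
      then have "(1/2) * p ^ n * indicator V z - K * q ^ n \<le> Re (G z) * Q z ^ n"
      proof cases
        case 1
        then have "(1/2) * p ^ n \<le> Re (G z) * Q z ^ n"
          using p Gq[of z] by (intro mult_mono power_mono) (auto simp: V_def)
        then show ?thesis using 1 Kq by simp
      next
        case 2
        have "0 \<le> Re (G z) * Q z ^ n" using Gq[OF 2(2)] Q0[of z] by (intro mult_nonneg_nonneg) auto
        then show ?thesis using 2 Kq by simp
      next
        case 3
        have "\<bar>Re (G z) * Q z ^ n\<bar> \<le> K * q ^ n"
          unfolding abs_mult using 3 Q0[of z] K0 order_trans[OF abs_Re_le_cmod GK]
          by (intro mult_mono) (auto intro!: power_mono)
        then show ?thesis using 3 by (simp add: abs_le_iff)
      qed
      then show ?thesis using True R by (simp add: indicator_inter_arith)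
    qed simp
    have "(1/2) * p ^ n * measure lborel (cell \<inter> V) - K * q ^ n * measure lborel cell =
       (\<integral>z. (1/2) * p ^ n * indicator (cell \<inter> V) z - K * q ^ n * indicator cell z \<partial>lborel)"
      using iFV iF by (simp add: Bochner_Integration.integral_diff)
    also have "\<dots> \<le> (\<integral>z. Re (indicator cell z *\<^sub>R (G z * of_real (Q z) ^ n)) \<partial>lborel)"
      by (rule integral_mono[OF _ integrable_Re[OF iG] pw]) (use iFV iF in auto)
    also have "\<dots> = Re (\<integral>z. indicator cell z *\<^sub>R (G z * of_real (Q z) ^ n) \<partial>lborel)"
      using iG by (rule integral_Re)
    finally show ?thesis using z by simp
  qed
  have bound: "(p / q) ^ n * ((1/2) * measure lborel (cell \<inter> V)) \<le> K * measure lborel cell" for n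
  proof -
    have "(1/2) * p ^ n * measure lborel (cell \<inter> V) / q ^ n \<le> K * q ^ n * measure lborel cell / q ^ n"
      using key[of n] q by (intro divide_right_mono) auto
    then show ?thesis using q by (simp add: power_divide)
  qed
  have "1 < p / q" using p q by simp
  from real_arch_pow[OF this, of "K * measure lborel cell / ((1/2) * measure lborel (cell \<inter> V))"]
  obtain n where "K * measure lborel cell / ((1/2) * measure lborel (cell \<inter> V)) < (p / q) ^ n" ..
  then have "K * measure lborel cell < (p / q) ^ n * ((1/2) * measure lborel (cell \<inter> V))"
    using m by (simp add: pos_divide_less_eq)
  then show False using bound[of n] by linarith
qed

end

section \<open>Wiener amalgam spaces\<close>

lemma cube_eq_cbox: "R \<ge> 0 \<Longrightarrow> cube x R = cbox x (x + R *\<^sub>R One)"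
  using image_affinity_cbox[of R x "0::'a::euclidean_space" One] by (simp add: cube_def add.commute)

interpretation unit_lattice: lattice_basis "integer_points :: 'a::euclidean_space set" Basis "\<lambda>b. b"
proof
  show "z = (\<Sum>b\<in>Basis. (b \<bullet> z) *\<^sub>R b)" for z :: 'a
    by (simp add: euclidean_representation inner_commute[of _ z])
  have eq: "(\<Sum>b\<in>Basis. real_of_int (c b) *\<^sub>R b) \<bullet> k = of_int (c k)" if "k \<in> Basis" for c :: "'a \<Rightarrow> int" and k
    using that by simp
  show "(integer_points :: 'a set) = range (\<lambda>c :: 'a \<Rightarrow> int. \<Sum>b\<in>Basis. of_int (c b) *\<^sub>R b)"
  proof (intro equalityI subsetI)
    fix z :: 'a assume "z \<in> integer_points"
    then have "z \<bullet> b = of_int \<lfloor>z \<bullet> b\<rfloor>" if "b \<in> Basis" for b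
      using that by (auto simp: integer_points_def elim!: Ints_cases)
    then have "(\<Sum>b\<in>Basis. (z \<bullet> b) *\<^sub>R b) = (\<Sum>b\<in>Basis. of_int \<lfloor>z \<bullet> b\<rfloor> *\<^sub>R b)"
      by (intro sum.cong) auto
    then have "z = (\<Sum>b\<in>Basis. of_int \<lfloor>z \<bullet> b\<rfloor> *\<^sub>R b)" by (simp add: euclidean_representation)
    then show "z \<in> range (\<lambda>c :: 'a \<Rightarrow> int. \<Sum>b\<in>Basis. of_int (c b) *\<^sub>R b)"
      by (rule range_eqI[where x = "\<lambda>b. \<lfloor>z \<bullet> b\<rfloor>"])
  qed (auto simp: integer_points_def)
qed (auto simp: inner_Basis)

text \<open>The closed cubes of the amalgam norm overlap along their faces, whereas the half-open
  cells inside them partition the space. Decompositions use the cells and estimates use the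
  cubes.\<close>

lemma unit_cell_subset: "t - k \<in> unit_lattice.cell \<Longrightarrow> t \<in> cube k 1"
  by (auto simp: cube_eq_cbox unit_lattice.cell_def mem_box inner_diff_right inner_add_left inner_commute[of _ t] inner_commute[of _ k] less_imp_le)

lemma cube_subset_cball: "cube k 1 \<subseteq> cball (k::'a::euclidean_space) (real DIM('a))"
proof
  fix t assume t: "t \<in> cube k 1"
  have "norm (t - k) \<le> (\<Sum>b\<in>Basis. \<bar>(t - k) \<bullet> b\<bar>)" by (rule norm_le_l1)
  also have "\<dots> \<le> (\<Sum>b\<in>(Basis::'a set). 1)"
    using t by (intro sum_mono) (auto simp: cube_eq_cbox mem_box inner_diff_left inner_add_left abs_le_iff algebra_simps)
  finally show "t \<in> cball k (real DIM('a))" by (simp add: dist_norm norm_minus_commute)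
qed

lemma cube_borel [measurable]: "cube (k::'a::euclidean_space) 1 \<in> sets borel"
  by (simp add: cube_eq_cbox)

text \<open>The space of the theorem with local exponent 2 and global exponent 1, for Borel
  functions, together with a summable majorant \<open>w\<close> of the local norms. Because
  \<open>w\<close> need not equal these norms, it can simply be multiplied by bounds for a
  factor.\<close>

definition amalgam :: "('a::euclidean_space \<Rightarrow> complex) \<Rightarrow> ('a \<Rightarrow> real) \<Rightarrow> bool" where
  "amalgam g w \<longleftrightarrow> g \<in> borel_measurable borel \<and> w summable_on integer_points \<and>
     (\<forall>k\<in>integer_points. 0 \<le> w k \<and> integrable lborel (\<lambda>t. (norm (indicator (cube k 1) t *\<^sub>R g t))\<^sup>2) \<and>
       (\<integral>t. (norm (indicator (cube k 1) t *\<^sub>R g t))\<^sup>2 \<partial>lborel) \<le> (w k)\<^sup>2)"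

text \<open>Functions whose local norms are summable pair with functions whose local norms are
  merely bounded: Cauchy-Schwarz on each cube, then summation over the cubes.\<close>

lemma amalgam_pairing:
  fixes g p :: "'a::euclidean_space \<Rightarrow> complex"
  assumes g: "amalgam g w" and p: "p \<in> borel_measurable borel" and N: "N \<ge> 0"
    and pN: "\<And>k. k \<in> integer_points \<Longrightarrow> integrable lborel (\<lambda>t. (norm (indicator (cube k 1) t *\<^sub>R p t))\<^sup>2) \<and>
       (\<integral>t. (norm (indicator (cube k 1) t *\<^sub>R p t))\<^sup>2 \<partial>lborel) \<le> N\<^sup>2"
  shows "integrable lborel (\<lambda>t. g t * p t)"
    and "norm (\<integral>t. g t * p t \<partial>lborel) \<le> N * (\<Sum>\<^sub>\<infinity>k\<in>integer_points. w k)"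
proof -
  note [measurable] = p
  have [measurable]: "g \<in> borel_measurable borel" and ws: "w summable_on integer_points"
    and w0: "\<And>k. k \<in> integer_points \<Longrightarrow> 0 \<le> w k"
    and gi: "\<And>k. k \<in> integer_points \<Longrightarrow> integrable lborel (\<lambda>t. (norm (indicator (cube k 1) t *\<^sub>R g t))\<^sup>2)"
    and gw: "\<And>k. k \<in> integer_points \<Longrightarrow> (\<integral>t. (norm (indicator (cube k 1) t *\<^sub>R g t))\<^sup>2 \<partial>lborel) \<le> (w k)\<^sup>2"
    using g unfolding amalgam_def by auto
  define f where "f k t = indicator unit_lattice.cell (t - k) *\<^sub>R (g t * p t)" for k t
  let ?c = "\<lambda>k t. indicator (cube k 1) t *\<^sub>R g t" and ?d = "\<lambda>k t. indicator (cube k 1) t *\<^sub>R p t"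
  have le: "norm (f k t) \<le> norm (?c k t) * norm (?d k t)" for k t
    using unit_cell_subset[of t k] by (auto simp: f_def indicator_def norm_mult)
  have fi: "integrable lborel (f k) \<and> (\<integral>t. norm (f k t) \<partial>lborel) \<le> N * w k" if k: "k \<in> integer_points" for k
  proof -
    have i: "integrable lborel (\<lambda>t. ?c k t * ?d k t)"
      by (rule Cauchy_Schwarz_integrable) (use gi[OF k] pN[OF k] in auto)
    have i': "integrable lborel (\<lambda>t. norm (?c k t) * norm (?d k t))"
      using integrable_norm[OF i] by (simp only: norm_mult)
    have fk: "integrable lborel (f k)"
      by (rule Bochner_Integration.integrable_bound[OF i']) (use le in \<open>auto simp: f_def[abs_def]\<close>)
    have "(\<integral>t. norm (f k t) \<partial>lborel) \<le> (\<integral>t. norm (?c k t) * norm (?d k t) \<partial>lborel)"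
      by (rule integral_mono[OF integrable_norm[OF fk] i' le])
    also have "\<dots> \<le> N * w k"
    proof (rule power2_le_imp_le)
      have "(\<integral>t. norm (?c k t) * norm (?d k t) \<partial>lborel)\<^sup>2 \<le>
          (\<integral>t. (norm (?c k t))\<^sup>2 \<partial>lborel) * (\<integral>t. (norm (?d k t))\<^sup>2 \<partial>lborel)"
        by (rule Cauchy_Schwarz_integral_norm) (use gi[OF k] pN[OF k] in auto)
      also have "\<dots> \<le> (w k)\<^sup>2 * N\<^sup>2" using gw[OF k] pN[OF k] by (intro mult_mono) (auto intro: integral_nonneg_AE)
      finally show "(\<integral>t. norm (?c k t) * norm (?d k t) \<partial>lborel)\<^sup>2 \<le> (N * w k)\<^sup>2"
        by (simp only: power_mult_distrib mult.commute)
      show "0 \<le> N * w k" using N w0[OF k] by simp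
    qed
    finally show ?thesis using fk by simp
  qed
  have one: "indicator unit_lattice.cell (t - k) = (if k = unit_lattice.cell_base t then 1 else 0 :: real)" if "k \<in> integer_points" for t k :: 'a
    using unit_lattice.cell_base_unique[OF that] by (auto simp: indicator_def)
  have s: "(\<lambda>k. norm (f k t)) summable_on integer_points" for t
    by (rule finite_nonzero_values_imp_summable_on, rule finite_subset[of _ "{unit_lattice.cell_base t}"])
       (auto simp: f_def one split: if_splits)
  have h: "(\<Sum>\<^sub>\<infinity>k\<in>integer_points. f k t) = g t * p t" for t
  proof (rule infsumI)
    have "((\<lambda>k. f k t) has_sum (\<Sum>k\<in>{unit_lattice.cell_base t}. f k t)) integer_points"
      by (rule has_sum_finite_neutralI[where B = "{unit_lattice.cell_base t}"]) (auto simp: unit_lattice.cell_base_mem f_def one)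
    then show "((\<lambda>k. f k t) has_sum (g t * p t)) integer_points"
      using one[OF unit_lattice.cell_base_mem, of t t] by (simp add: f_def)
  qed
  have Ns: "(\<lambda>k. N * w k) summable_on integer_points" using ws by (rule summable_on_cmult_right)
  have ns: "(\<lambda>k. \<integral>t. norm (f k t) \<partial>lborel) summable_on integer_points"
    by (rule summable_on_comparison_test[OF Ns]) (use fi in \<open>auto intro: integral_nonneg_AE\<close>)
  note I = integral_infsum[OF unit_lattice.countable_lattice conjunct1[OF fi] s ns, unfolded h]
  show "integrable lborel (\<lambda>t. g t * p t)" by (rule I(1))
  show "norm (\<integral>t. g t * p t \<partial>lborel) \<le> N * (\<Sum>\<^sub>\<infinity>k\<in>integer_points. w k)"
  proof (rule norm_infsum_le[OF I(2) has_sum_cmult_right[OF has_sum_infsum[OF ws]]])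
    fix k :: 'a assume "k \<in> integer_points"
    then show "norm (\<integral>x. f k x \<partial>lborel) \<le> N * w k" using conjunct2[OF fi[of k]] integral_norm_bound[of lborel "f k"] by (meson order_trans)
  qed
qed

text \<open>Pairing with the constant 1, which is a trigonometric polynomial with the single
  frequency 0; the local bound for such polynomials supplies the uniform bound over cubes.\<close>

lemma amalgam_integrable:
  assumes "amalgam g w" shows "integrable lborel g"
proof -
  have ud: "uniform_discrete {0::'a}" unfolding uniform_discrete_def by (intro exI[of _ 1]) auto
  have one: "trig_poly {0} (\<lambda>_. 1) = (\<lambda>t::'a::euclidean_space. 1)" by (simp add: trig_poly_def[abs_def])
  obtain C where C: "C \<ge> 0" "\<And>t0 F c A. finite F \<Longrightarrow> F \<subseteq> {0::'a} \<Longrightarrow> A \<in> sets borel \<Longrightarrow> A \<subseteq> cball t0 (real DIM('a)) \<Longrightarrow>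
      integrable lborel (\<lambda>t. (norm (indicator A t *\<^sub>R trig_poly F c t))\<^sup>2) \<and>
      (\<integral>t. (norm (indicator A t *\<^sub>R trig_poly F c t))\<^sup>2 \<partial>lborel) \<le> C * (\<Sum>\<beta>\<in>F. (norm (c \<beta>))\<^sup>2)"
    by (rule trig_poly_local_bound[OF ud, where \<rho> = "real DIM('a)"]) (rule that, assumption, blast)
  have "integrable lborel (\<lambda>t. g t * 1)"
  proof (rule amalgam_pairing(1)[OF assms, where N = "sqrt C"])
    show "integrable lborel (\<lambda>t. (norm (indicator (cube k 1) t *\<^sub>R (1::complex)))\<^sup>2) \<and>
       (\<integral>t. (norm (indicator (cube k 1) t *\<^sub>R (1::complex)))\<^sup>2 \<partial>lborel) \<le> (sqrt C)\<^sup>2" for k :: 'a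
      using C(2)[OF _ _ cube_borel cube_subset_cball, of "{0}" k "\<lambda>_. 1"] C(1) unfolding one by simp
  qed (use C(1) in auto)
  then show ?thesis by simp
qed

text \<open>Duality once more. On unit cubes, trigonometric polynomials with frequencies in \<Delta>
  have local norms uniformly bounded by the \<open>l2\<close> norm of their coefficients, so they
  can be paired with an amalgam function.\<close>

lemma amalgam_sampling:
  fixes \<Delta> :: "'a::euclidean_space set"
  assumes \<Delta>: "uniform_discrete \<Delta>"
  obtains C where "C \<ge> 0"
    "\<And>u w. amalgam u w \<Longrightarrow> l2_bound \<Delta> (C * (\<Sum>\<^sub>\<infinity>k\<in>integer_points. w k)\<^sup>2) (\<lambda>\<beta>. \<integral>t. u t * cis (2 * pi * (\<beta> \<bullet> t)) \<partial>lborel)"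
proof -
  obtain C where C: "C \<ge> 0" "\<And>t0 F c A. finite F \<Longrightarrow> F \<subseteq> \<Delta> \<Longrightarrow> A \<in> sets borel \<Longrightarrow> A \<subseteq> cball t0 (real DIM('a)) \<Longrightarrow>
      integrable lborel (\<lambda>t. (norm (indicator A t *\<^sub>R trig_poly F c t))\<^sup>2) \<and>
      (\<integral>t. (norm (indicator A t *\<^sub>R trig_poly F c t))\<^sup>2 \<partial>lborel) \<le> C * (\<Sum>\<beta>\<in>F. (norm (c \<beta>))\<^sup>2)"
    by (rule trig_poly_local_bound[OF \<Delta>, where \<rho> = "real DIM('a)"]) (rule that, assumption, blast)
  show thesis
  proof (rule that[OF C(1)])
    fix u :: "'a \<Rightarrow> complex" and w assume u: "amalgam u w"
    show "l2_bound \<Delta> (C * (\<Sum>\<^sub>\<infinity>k\<in>integer_points. w k)\<^sup>2) (\<lambda>\<beta>. \<integral>t. u t * cis (2 * pi * (\<beta> \<bullet> t)) \<partial>lborel)"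
    proof (rule l2_bound_by_duality[OF amalgam_integrable[OF u]])
      show "0 \<le> C * (\<Sum>\<^sub>\<infinity>k\<in>integer_points. w k)\<^sup>2" using C(1) by simp
      fix F and c :: "'a \<Rightarrow> complex" assume F: "finite F" "F \<subseteq> \<Delta>"
      define N where "N = sqrt (C * (\<Sum>\<beta>\<in>F. (norm (c \<beta>))\<^sup>2))"
      have N2: "N\<^sup>2 = C * (\<Sum>\<beta>\<in>F. (norm (c \<beta>))\<^sup>2)" unfolding N_def using C(1) by (simp add: sum_nonneg)
      have "norm (\<integral>t. u t * trig_poly F c t \<partial>lborel) \<le> N * (\<Sum>\<^sub>\<infinity>k\<in>integer_points. w k)"
      proof (rule amalgam_pairing(2)[OF u])
        show "0 \<le> N" using C(1) by (simp add: N_def sum_nonneg)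
        show "integrable lborel (\<lambda>t. (norm (indicator (cube k 1) t *\<^sub>R trig_poly F c t))\<^sup>2) \<and>
           (\<integral>t. (norm (indicator (cube k 1) t *\<^sub>R trig_poly F c t))\<^sup>2 \<partial>lborel) \<le> N\<^sup>2" for k
          unfolding N2 by (rule C(2)[OF F cube_borel cube_subset_cball])
      qed measurable
      from power_mono[OF this norm_ge_zero, of 2]
      show "(norm (\<integral>t. u t * trig_poly F c t \<partial>lborel))\<^sup>2 \<le> C * (\<Sum>\<^sub>\<infinity>k\<in>integer_points. w k)\<^sup>2 * (\<Sum>\<beta>\<in>F. (norm (c \<beta>))\<^sup>2)"
        by (simp add: power_mult_distrib N2 mult_ac)
    qed
  qed
qed

text \<open>The bound \<open>c k\<close> may vary with the cube. This matters for differences of two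
  exponentials, which are small only on bounded regions and not uniformly on the space.\<close>

lemma amalgam_mult:
  assumes g: "amalgam g w" and v [measurable]: "v \<in> borel_measurable borel"
    and b: "\<And>k t. k \<in> integer_points \<Longrightarrow> t \<in> cube k 1 \<Longrightarrow> norm (v t) \<le> c k" and c: "\<And>k. k \<in> integer_points \<Longrightarrow> 0 \<le> c k"
    and s: "(\<lambda>k. c k * w k) summable_on integer_points"
  shows "amalgam (\<lambda>t. g t * v t) (\<lambda>k. c k * w k)"
proof -
  have [measurable]: "g \<in> borel_measurable borel" using g by (simp add: amalgam_def)
  have "0 \<le> c k * w k \<and> integrable lborel (\<lambda>t. (norm (indicator (cube k 1) t *\<^sub>R (g t * v t)))\<^sup>2) \<and>
       (\<integral>t. (norm (indicator (cube k 1) t *\<^sub>R (g t * v t)))\<^sup>2 \<partial>lborel) \<le> (c k * w k)\<^sup>2" if k: "k \<in> integer_points" for k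
  proof -
    have w0: "0 \<le> w k" and i: "integrable lborel (\<lambda>t. (norm (indicator (cube k 1) t *\<^sub>R g t))\<^sup>2)"
      and l: "(\<integral>t. (norm (indicator (cube k 1) t *\<^sub>R g t))\<^sup>2 \<partial>lborel) \<le> (w k)\<^sup>2"
      using g k by (auto simp: amalgam_def)
    have le: "(norm (indicator (cube k 1) t *\<^sub>R (g t * v t)))\<^sup>2 \<le> (c k)\<^sup>2 * (norm (indicator (cube k 1) t *\<^sub>R g t))\<^sup>2" for t
    proof (cases "t \<in> cube k 1")
      case True
      have "(norm (v t))\<^sup>2 \<le> (c k)\<^sup>2" using b[OF k True] by (intro power_mono) auto
      from mult_right_mono[OF this, of "(norm (g t))\<^sup>2"] show ?thesis using True
        by (simp add: norm_mult power_mult_distrib mult.commute)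
    qed simp
    have i2: "integrable lborel (\<lambda>t. (norm (indicator (cube k 1) t *\<^sub>R (g t * v t)))\<^sup>2)"
      by (rule Bochner_Integration.integrable_bound[OF integrable_mult_right[OF i, of "(c k)\<^sup>2"]]) (use le in auto)
    have "(\<integral>t. (norm (indicator (cube k 1) t *\<^sub>R (g t * v t)))\<^sup>2 \<partial>lborel) \<le> (c k)\<^sup>2 * (\<integral>t. (norm (indicator (cube k 1) t *\<^sub>R g t))\<^sup>2 \<partial>lborel)"
      using integral_mono[OF i2 integrable_mult_right[OF i, of "(c k)\<^sup>2"] le] by simp
    also have "\<dots> \<le> (c k)\<^sup>2 * (w k)\<^sup>2" using l by (intro mult_left_mono) auto
    finally show ?thesis using i2 w0 c[OF k] by (simp add: power_mult_distrib)
  qed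
  then show ?thesis using s unfolding amalgam_def by simp
qed

section \<open>Continuity of sampled Fourier transforms\<close>

lemma isCont_infsum:
  fixes f :: "'i \<Rightarrow> 'b::metric_space \<Rightarrow> 'c::banach"
  assumes r: "r > 0" and c: "\<And>i. i \<in> I \<Longrightarrow> isCont (f i) z0"
    and b: "\<And>i z. i \<in> I \<Longrightarrow> z \<in> ball z0 r \<Longrightarrow> norm (f i z) \<le> M i" and M: "M summable_on I"
  shows "isCont (\<lambda>z. \<Sum>\<^sub>\<infinity>i\<in>I. f i z) z0"
proof -
  have u: "uniform_limit (ball z0 r) (\<lambda>X z. \<Sum>i\<in>X. f i z) (\<lambda>z. \<Sum>\<^sub>\<infinity>i\<in>I. f i z) (finite_subsets_at_top I)"
    by (rule Weierstrass_m_test_general[OF b M])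
  have "((\<lambda>z. \<Sum>\<^sub>\<infinity>i\<in>I. f i z) \<longlongrightarrow> (\<Sum>\<^sub>\<infinity>i\<in>I. f i z0)) (at z0 within ball z0 r)"
  proof (rule swap_uniform_limit[OF _ _ u])
    show "\<forall>\<^sub>F X in finite_subsets_at_top I. ((\<lambda>z. \<Sum>i\<in>X. f i z) \<longlongrightarrow> (\<Sum>i\<in>X. f i z0)) (at z0 within ball z0 r)"
    proof (rule eventually_finite_subsets_at_top_weakI, rule tendsto_sum)
      fix X i assume "X \<subseteq> I" "i \<in> X"
      then have "isCont (f i) z0" using c by auto
      then show "(f i \<longlongrightarrow> f i z0) (at z0 within ball z0 r)"
        unfolding isCont_def using tendsto_within_subset by blast
    qed
    show "((\<lambda>X. \<Sum>i\<in>X. f i z0) \<longlongrightarrow> (\<Sum>\<^sub>\<infinity>i\<in>I. f i z0)) (finite_subsets_at_top I)"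
      by (rule tendsto_uniform_limitI[OF u]) (use r in simp)
    show "finite_subsets_at_top I \<noteq> bot" by simp
  qed
  moreover have "at z0 within ball z0 r = at z0" using r by (intro at_within_open) auto
  ultimately show ?thesis by (simp add: isCont_def)
qed

lemma norm_cis_diff_le: "norm (cis x - cis y) \<le> \<bar>x - y\<bar>"
proof -
  have "cis x - cis y = cis y * (cis (x - y) - 1)" by (simp add: algebra_simps cis_mult)
  then have "norm (cis x - cis y) = norm (exp (\<i> * of_real (x - y)) - 1)"
    by (simp add: norm_mult cis_conv_exp)
  also have "\<dots> \<le> \<bar>x - y\<bar>" using iexp_approx1[of "x - y" 0] by simp
  finally show ?thesis .
qed

text \<open>The sample at \<open>\<omega> - \<beta>\<close> is the coefficient at \<beta> of
  \<open>g\<close> multiplied by the character of \<omega>. That factor is unimodular, so the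
  sampling bound does not depend on \<omega>; for continuity the same bound is applied to
  \<open>g\<close> times a difference of characters.\<close>

lemma amalgam_fourier_samples:
  fixes \<Delta> :: "'a::euclidean_space set"
  assumes \<Delta>: "uniform_discrete \<Delta>" and g: "amalgam g w"
  obtains K where "\<And>\<omega>. l2_bound \<Delta> K (\<lambda>\<beta>. fourier g (\<omega> - \<beta>))"
    "\<And>\<omega>0. \<exists>V. (\<forall>\<omega>. l2_bound \<Delta> (V \<omega>) (\<lambda>\<beta>. fourier g (\<omega> - \<beta>) - fourier g (\<omega>0 - \<beta>))) \<and> (V \<longlongrightarrow> 0) (at \<omega>0)"
proof -
  obtain C where C: "C \<ge> 0"
    "\<And>u w. amalgam u w \<Longrightarrow> l2_bound \<Delta> (C * (\<Sum>\<^sub>\<infinity>k\<in>integer_points. w k)\<^sup>2) (\<lambda>\<beta>. \<integral>t. u t * cis (2 * pi * (\<beta> \<bullet> t)) \<partial>lborel)"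
    by (rule amalgam_sampling[OF \<Delta>]) (rule that, assumption, blast)
  have gm [measurable]: "g \<in> borel_measurable borel" and ws: "w summable_on integer_points"
    and w0: "\<And>k. k \<in> integer_points \<Longrightarrow> 0 \<le> w k" using g by (auto simp: amalgam_def)
  have gi: "integrable lborel g" by (rule amalgam_integrable[OF g])
  define E where "E \<omega> t = cis (- 2 * pi * (t \<bullet> \<omega>))" for \<omega> t :: 'a
  have [measurable]: "E \<omega> \<in> borel_measurable borel" for \<omega> unfolding E_def by measurable
  have fe: "fourier g (\<omega> - \<beta>) = (\<integral>t. (g t * E \<omega> t) * cis (2 * pi * (\<beta> \<bullet> t)) \<partial>lborel)" for \<omega> \<beta>
  proof -
    have "cis (- 2 * pi * (t \<bullet> (\<omega> - \<beta>))) = E \<omega> t * cis (2 * pi * (\<beta> \<bullet> t))" for t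
      unfolding E_def cis_mult by (simp add: inner_diff_right inner_commute[of t] algebra_simps)
    then show ?thesis unfolding fourier_lborel[OF gm] by (simp only: mult.assoc)
  qed
  have ei: "integrable lborel (\<lambda>t. (g t * E \<omega> t) * cis (2 * pi * (\<beta> \<bullet> t)))" for \<omega> \<beta>
    by (rule Bochner_Integration.integrable_bound[OF gi]) (auto simp: norm_mult E_def)
  have 1: "l2_bound \<Delta> (C * (\<Sum>\<^sub>\<infinity>k\<in>integer_points. w k)\<^sup>2) (\<lambda>\<beta>. fourier g (\<omega> - \<beta>))" for \<omega>
  proof -
    have "amalgam (\<lambda>t. g t * E \<omega> t) (\<lambda>k. 1 * w k)"
      by (rule amalgam_mult[OF g]) (use ws in \<open>auto simp: E_def\<close>)
    from C(2)[OF this] show ?thesis by (simp add: fe)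
  qed
  have 2: "\<exists>V. (\<forall>\<omega>. l2_bound \<Delta> (V \<omega>) (\<lambda>\<beta>. fourier g (\<omega> - \<beta>) - fourier g (\<omega>0 - \<beta>))) \<and> (V \<longlongrightarrow> 0) (at \<omega>0)" for \<omega>0
  proof -
    \<comment> \<open>Two bounds for a difference of characters on the cube at \<open>k\<close>. The
      constant 2 gives the summable majorant \<open>2 * w k\<close>, uniform in \<omega>; the other
      grows with \<open>k\<close> but makes every single term tend to 0 as \<omega> approaches
      \<open>\<omega>0\<close>. The summand \<open>real DIM('a)\<close> bounds the distance from
      \<open>k\<close> within its cube.\<close>
    define c where "c \<omega> k = min 2 (2 * pi * (norm (\<omega> - \<omega>0) * (norm k + real DIM('a))))" for \<omega> and k :: 'a
    have c0: "0 \<le> c \<omega> k" and c2: "c \<omega> k \<le> 2" for \<omega> k by (auto simp: c_def)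
    have ce: "norm (E \<omega> t - E \<omega>0 t) \<le> c \<omega> k" if "t \<in> cube k 1" for \<omega> k t
    proof -
      have "norm (E \<omega> t - E \<omega>0 t) \<le> norm (E \<omega> t) + norm (E \<omega>0 t)" by (rule norm_triangle_ineq4)
      then have a: "norm (E \<omega> t - E \<omega>0 t) \<le> 2" by (simp add: E_def)
      have "norm t \<le> norm k + real DIM('a)"
        using cube_subset_cball that norm_triangle_ineq2[of t k] by (force simp: dist_norm norm_minus_commute)
      then have nt: "norm t * norm (\<omega> - \<omega>0) \<le> (norm k + real DIM('a)) * norm (\<omega> - \<omega>0)" by (rule mult_right_mono) simp
      have "norm (E \<omega> t - E \<omega>0 t) \<le> \<bar>- 2 * pi * (t \<bullet> \<omega>) - - 2 * pi * (t \<bullet> \<omega>0)\<bar>" unfolding E_def by (rule norm_cis_diff_le)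
      also have "- 2 * pi * (t \<bullet> \<omega>) - - 2 * pi * (t \<bullet> \<omega>0) = - (2 * pi * (t \<bullet> (\<omega> - \<omega>0)))"
        by (simp add: inner_diff_right algebra_simps)
      also have "\<bar>- (2 * pi * (t \<bullet> (\<omega> - \<omega>0)))\<bar> = 2 * pi * \<bar>t \<bullet> (\<omega> - \<omega>0)\<bar>" by (simp add: abs_mult)
      also have "\<dots> \<le> 2 * pi * (norm (\<omega> - \<omega>0) * (norm k + real DIM('a)))"
        using Cauchy_Schwarz_ineq2[of t "\<omega> - \<omega>0"] nt by (intro mult_left_mono) (auto simp: mult.commute)
      finally show ?thesis using a by (simp add: c_def)
    qed
    have s: "(\<lambda>k. c \<omega> k * w k) summable_on integer_points" for \<omega>
      by (rule summable_on_comparison_test[OF summable_on_cmult_right[OF ws, of 2]])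
         (use c0 c2 w0 in \<open>auto intro!: mult_right_mono\<close>)
    define V where "V \<omega> = C * (\<Sum>\<^sub>\<infinity>k\<in>integer_points. c \<omega> k * w k)\<^sup>2" for \<omega>
    have "l2_bound \<Delta> (V \<omega>) (\<lambda>\<beta>. fourier g (\<omega> - \<beta>) - fourier g (\<omega>0 - \<beta>))" for \<omega>
    proof -
      have a: "amalgam (\<lambda>t. g t * (E \<omega> t - E \<omega>0 t)) (\<lambda>k. c \<omega> k * w k)"
        by (rule amalgam_mult[OF g]) (use ce c0 s in auto)
      have "(\<integral>t. g t * (E \<omega> t - E \<omega>0 t) * cis (2 * pi * (\<beta> \<bullet> t)) \<partial>lborel) = fourier g (\<omega> - \<beta>) - fourier g (\<omega>0 - \<beta>)" for \<beta>
        unfolding fe right_diff_distrib left_diff_distrib by (rule Bochner_Integration.integral_diff[OF ei ei])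
      with C(2)[OF a] show ?thesis by (simp add: V_def)
    qed
    moreover have "(V \<longlongrightarrow> 0) (at \<omega>0)"
    proof -
      have "isCont (\<lambda>\<omega>. \<Sum>\<^sub>\<infinity>k\<in>integer_points. c \<omega> k * w k) \<omega>0"
      proof (rule isCont_infsum[where r = 1 and M = "\<lambda>k. 2 * w k"])
        show "isCont (\<lambda>\<omega>. c \<omega> k * w k) \<omega>0" for k unfolding c_def by (intro continuous_intros)
        show "norm (c \<omega> k * w k) \<le> 2 * w k" if "k \<in> integer_points" for \<omega> k
          using c0 c2 w0[OF that] by (auto simp: abs_mult intro!: mult_right_mono)
      qed (use ws in \<open>auto intro: summable_on_cmult_right\<close>)
      then have "isCont V \<omega>0" unfolding V_def by (intro continuous_intros)
      moreover have "V \<omega>0 = 0" by (simp add: V_def c_def)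
      ultimately show ?thesis by (simp add: isCont_def)
    qed
    ultimately show ?thesis by blast
  qed
  show thesis by (rule that[OF 1 2])
qed

definition cross_series :: "'a::euclidean_space set \<Rightarrow> ('a \<Rightarrow> complex) \<Rightarrow> ('a \<Rightarrow> complex) \<Rightarrow> 'a \<Rightarrow> 'a \<Rightarrow> complex" where
  "cross_series \<Delta> g h \<xi> \<omega> = (\<Sum>\<^sub>\<infinity>\<beta>\<in>\<Delta>. cnj (fourier g (\<omega> - \<beta>)) * fourier h (\<omega> - \<beta> - \<xi>))"

text \<open>For each \<omega> the series pairs two \<open>l2\<close> families that are uniformly
  bounded and continuous in \<omega>, so boundedness and continuity are those of the pairing. The
  shift by \<xi> only moves the point at which the second family is evaluated.\<close>

lemma cross_series_bounds:
  assumes \<Delta>: "uniform_discrete \<Delta>" and g: "amalgam g w" and h: "amalgam h w'"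
  obtains K where "\<And>\<omega> \<xi>. norm (cross_series \<Delta> g h \<xi> \<omega>) \<le> K" "\<And>\<omega> \<xi>. isCont (cross_series \<Delta> g h \<xi>) \<omega>"
    "\<And>\<omega> \<xi>. (\<lambda>\<beta>. norm (cnj (fourier g (\<omega> - \<beta>)) * fourier h (\<omega> - \<beta> - \<xi>))) summable_on \<Delta>"
    "\<And>\<omega> \<xi>. (\<Sum>\<^sub>\<infinity>\<beta>\<in>\<Delta>. norm (cnj (fourier g (\<omega> - \<beta>)) * fourier h (\<omega> - \<beta> - \<xi>))) \<le> K"
proof -
  obtain K where K: "\<And>\<omega>. l2_bound \<Delta> K (\<lambda>\<beta>. fourier g (\<omega> - \<beta>))"
    "\<And>\<omega>0. \<exists>V. (\<forall>\<omega>. l2_bound \<Delta> (V \<omega>) (\<lambda>\<beta>. fourier g (\<omega> - \<beta>) - fourier g (\<omega>0 - \<beta>))) \<and> (V \<longlongrightarrow> 0) (at \<omega>0)"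
    by (rule amalgam_fourier_samples[OF \<Delta> g]) (rule that, assumption+)
  obtain M where M: "\<And>\<omega>. l2_bound \<Delta> M (\<lambda>\<beta>. fourier h (\<omega> - \<beta>))"
    "\<And>\<omega>0. \<exists>V. (\<forall>\<omega>. l2_bound \<Delta> (V \<omega>) (\<lambda>\<beta>. fourier h (\<omega> - \<beta>) - fourier h (\<omega>0 - \<beta>))) \<and> (V \<longlongrightarrow> 0) (at \<omega>0)"
    by (rule amalgam_fourier_samples[OF \<Delta> h]) (rule that, assumption+)
  have a: "l2_bound \<Delta> K (\<lambda>\<beta>. cnj (fourier g (\<omega> - \<beta>)))" for \<omega>
    by (rule l2_bound_norm_cong[OF K(1)]) simp
  have sh: "\<omega> - \<beta> - \<xi> = (\<omega> - \<xi>) - \<beta>" for \<omega> \<beta> \<xi> :: 'a by simp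
  have b: "l2_bound \<Delta> M (\<lambda>\<beta>. fourier h (\<omega> - \<beta> - \<xi>))" for \<omega> \<xi>
    unfolding sh[of \<omega> _ \<xi>] by (rule M(1))
  have cont: "isCont (cross_series \<Delta> g h \<xi>) \<omega>0" for \<omega>0 \<xi>
  proof -
    obtain V where V: "\<And>\<omega>. l2_bound \<Delta> (V \<omega>) (\<lambda>\<beta>. fourier g (\<omega> - \<beta>) - fourier g (\<omega>0 - \<beta>))" "(V \<longlongrightarrow> 0) (at \<omega>0)"
      using K(2)[of \<omega>0] by auto
    obtain U where U: "\<And>\<omega>. l2_bound \<Delta> (U \<omega>) (\<lambda>\<beta>. fourier h (\<omega> - \<beta>) - fourier h (\<omega>0 - \<xi> - \<beta>))" "(U \<longlongrightarrow> 0) (at (\<omega>0 - \<xi>))"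
      using M(2)[of "\<omega>0 - \<xi>"] by auto
    have U': "((\<lambda>\<omega>. U (\<omega> - \<xi>)) \<longlongrightarrow> 0) (at \<omega>0)"
      using LIM_offset[OF U(2), of "- \<xi>"] by simp
    show ?thesis unfolding isCont_def cross_series_def
    proof (rule tendsto_infsum_l2[OF a b])
      have "l2_bound \<Delta> (V \<omega>) (\<lambda>\<beta>. cnj (fourier g (\<omega> - \<beta>)) - cnj (fourier g (\<omega>0 - \<beta>)))" for \<omega>
        by (rule l2_bound_norm_cong[OF V(1)]) (simp only: complex_cnj_diff[symmetric] complex_mod_cnj)
      then show "\<forall>\<^sub>F \<omega> in at \<omega>0. l2_bound \<Delta> e (\<lambda>\<beta>. cnj (fourier g (\<omega> - \<beta>)) - cnj (fourier g (\<omega>0 - \<beta>)))" if "e > 0" for e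
        using V(2) that by (rule l2_bound_eventually)
      have "l2_bound \<Delta> (U (\<omega> - \<xi>)) (\<lambda>\<beta>. fourier h (\<omega> - \<beta> - \<xi>) - fourier h (\<omega>0 - \<beta> - \<xi>))" for \<omega>
        unfolding sh[of \<omega> _ \<xi>] sh[of \<omega>0 _ \<xi>] by (rule U(1))
      then show "\<forall>\<^sub>F \<omega> in at \<omega>0. l2_bound \<Delta> e (\<lambda>\<beta>. fourier h (\<omega> - \<beta> - \<xi>) - fourier h (\<omega>0 - \<beta> - \<xi>))" if "e > 0" for e
        using U' that by (rule l2_bound_eventually)
    qed
  qed
  have n: "norm (cross_series \<Delta> g h \<xi> \<omega>) \<le> sqrt (K * M)" for \<omega> \<xi>
    unfolding cross_series_def by (rule l2_bound_product(4)[OF a b])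
  show thesis
    by (rule that[OF n cont l2_bound_product(1)[OF a b] l2_bound_product(3)[OF a b]])
qed

section \<open>The density of a model set\<close>

context lattice_basis
begin

lemma sum_indicator_cell_le:
  assumes "finite F" "F \<subseteq> \<Gamma>"
  shows "(\<Sum>\<gamma>\<in>F. indicator cell (z - \<gamma>)) \<le> (1::real)"
proof -
  have "(\<Sum>\<gamma>\<in>F. indicator cell (z - \<gamma>)) = (\<Sum>\<gamma>\<in>F. if \<gamma> = cell_base z then 1 else 0 :: real)"
    using assms cell_base_unique by (intro sum.cong) (auto simp: indicator_def)
  also have "\<dots> \<le> 1" using assms by simp
  finally show ?thesis .
qed

lemma cell_translate_integral:
  "integrable lborel (\<lambda>z. indicator cell (z - \<gamma>) :: real)" "(\<integral>z. indicator cell (z - \<gamma>) \<partial>lborel) = measure lborel cell"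
proof -
  have m: "(indicator cell :: 'a \<Rightarrow> real) \<in> borel_measurable borel" by measurable
  have "integrable lborel (indicator cell :: 'a \<Rightarrow> real)" using cell_finite by (simp add: integrable_indicator_iff)
  then show "integrable lborel (\<lambda>z. indicator cell (z - \<gamma>) :: real)"
    using lborel_integrable_shift(2)[OF m] by simp
  show "(\<integral>z. indicator cell (z - \<gamma>) \<partial>lborel) = measure lborel cell"
    using lborel_integral_shift(2)[OF m] by simp
qed

text \<open>The cells attached to the points of \<open>F\<close> are disjoint and lie in
  \<open>S\<close>. In the companion estimate the cells cover \<open>S\<close> instead; together
  they count lattice points up to a boundary layer as thick as a cell.\<close>

lemma card_times_volume_le:
  assumes F: "finite F" "F \<subseteq> \<Gamma>" and S: "S \<in> sets borel" "bounded S"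
    and sub: "\<And>\<gamma> z. \<gamma> \<in> F \<Longrightarrow> z - \<gamma> \<in> cell \<Longrightarrow> z \<in> S"
  shows "real (card F) * measure lborel cell \<le> measure lborel S"
proof -
  have iS: "integrable lborel (indicator S :: 'a \<Rightarrow> real)"
    using S emeasure_bounded_finite[OF S(2)] by (simp add: integrable_indicator_iff)
  have "real (card F) * measure lborel cell = (\<integral>z. (\<Sum>\<gamma>\<in>F. indicator cell (z - \<gamma>)) \<partial>lborel)"
    by (subst Bochner_Integration.integral_sum) (simp_all add: cell_translate_integral)
  also have "\<dots> \<le> (\<integral>z. indicator S z \<partial>lborel)"
  proof (rule integral_mono[OF _ iS])
    show "integrable lborel (\<lambda>z. \<Sum>\<gamma>\<in>F. indicator cell (z - \<gamma>) :: real)"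
      by (intro Bochner_Integration.integrable_sum cell_translate_integral)
    show "(\<Sum>\<gamma>\<in>F. indicator cell (z - \<gamma>)) \<le> (indicator S z :: real)" for z
      using sum_indicator_cell_le[OF F, of z] sub[of _ z]
      by (cases "z \<in> S") (auto intro!: sum_nonpos simp: indicator_def)
  qed
  also have "\<dots> = measure lborel S" using S by simp
  finally show ?thesis .
qed

lemma volume_le_card_times:
  assumes F: "finite F" "F \<subseteq> \<Gamma>" and S: "S \<in> sets borel" "bounded S"
    and sub: "\<And>\<gamma> z. z \<in> S \<Longrightarrow> \<gamma> \<in> \<Gamma> \<Longrightarrow> z - \<gamma> \<in> cell \<Longrightarrow> \<gamma> \<in> F"
  shows "measure lborel S \<le> real (card F) * measure lborel cell"
proof -
  have iS: "integrable lborel (indicator S :: 'a \<Rightarrow> real)"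
    using S emeasure_bounded_finite[OF S(2)] by (simp add: integrable_indicator_iff)
  have "measure lborel S = (\<integral>z. indicator S z \<partial>lborel)" using S by simp
  also have "\<dots> \<le> (\<integral>z. (\<Sum>\<gamma>\<in>F. indicator cell (z - \<gamma>)) \<partial>lborel)"
  proof (rule integral_mono[OF iS])
    show "integrable lborel (\<lambda>z. \<Sum>\<gamma>\<in>F. indicator cell (z - \<gamma>) :: real)"
      by (intro Bochner_Integration.integrable_sum cell_translate_integral)
    fix z
    show "(indicator S z :: real) \<le> (\<Sum>\<gamma>\<in>F. indicator cell (z - \<gamma>))"
    proof (cases "z \<in> S")
      case True
      have FDz: "z - cell_base z \<in> cell" using cell_base_unique[OF cell_base_mem] by blast
      then have "cell_base z \<in> F" using sub[OF True cell_base_mem] by blast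
      then have "indicator cell (z - cell_base z) \<le> (\<Sum>\<gamma>\<in>F. indicator cell (z - \<gamma>) :: real)"
        by (rule member_le_sum) (use F in auto)
      then show ?thesis using True FDz by simp
    qed (simp add: sum_nonneg)
  qed
  also have "\<dots> = real (card F) * measure lborel cell"
    by (subst Bochner_Integration.integral_sum) (simp_all add: cell_translate_integral)
  finally show ?thesis .
qed

text \<open>Discreteness follows from volume: one quotient of volumes bounds the cardinality of
  every finite subset of \<open>\<Gamma> \<inter> S\<close>.\<close>

lemma finite_lattice_bounded:
  assumes "bounded S" shows "finite (\<Gamma> \<inter> S)"
proof -
  obtain r where r: "\<And>z. z \<in> S \<Longrightarrow> norm z \<le> r" using assms by (auto simp: bounded_iff)
  obtain \<rho> where \<rho>: "\<And>z. z \<in> cell \<Longrightarrow> norm z \<le> \<rho>" using cell_bounded by (auto simp: bounded_iff)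
  define M where "M = measure lborel (cball (0::'a) (r + \<rho>))"
  have "finite (\<Gamma> \<inter> S) \<and> card (\<Gamma> \<inter> S) \<le> nat \<lceil>M / measure lborel cell\<rceil>"
  proof (rule finite_if_finite_subsets_card_bdd)
    fix F assume F: "F \<subseteq> \<Gamma> \<inter> S" "finite F"
    have "real (card F) * measure lborel cell \<le> M"
      unfolding M_def
    proof (rule card_times_volume_le)
      fix \<gamma> z assume "\<gamma> \<in> F" "z - \<gamma> \<in> cell"
      then have "norm \<gamma> \<le> r" "norm (z - \<gamma>) \<le> \<rho>" using F r \<rho> by auto
      then show "z \<in> cball 0 (r + \<rho>)" using norm_triangle_ineq[of \<gamma> "z - \<gamma>"] by simp
    qed (use F in auto)
    then have "real (card F) \<le> M / measure lborel cell" using cell_positive by (simp add: pos_le_divide_eq)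
    then show "card F \<le> nat \<lceil>M / measure lborel cell\<rceil>" by linarith
  qed
  then show ?thesis by blast
qed

end

lemma mem_cube_shift:
  fixes x y v :: "'a::euclidean_space"
  assumes "y \<in> cube x R" "R \<ge> 0" "norm v \<le> r"
  shows "y + v \<in> cube (x - r *\<^sub>R One) (R + 2 * r)"
proof -
  have r: "0 \<le> r" using assms(3) norm_ge_zero order_trans by blast
  have "\<bar>v \<bullet> b\<bar> \<le> r" if "b \<in> Basis" for b using Basis_le_norm[OF that, of v] assms(3) by linarith
  then have "x \<bullet> b - r \<le> y \<bullet> b + v \<bullet> b \<and> y \<bullet> b + v \<bullet> b \<le> x \<bullet> b - r + (R + 2 * r)" if "b \<in> Basis" for b
    using that assms(1,2) by (fastforce simp: cube_eq_cbox mem_box inner_add_left abs_le_iff)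
  then show ?thesis using assms(2) r
    by (simp add: cube_eq_cbox mem_box inner_add_left inner_diff_left)
qed

lemma measure_cube_times_interval:
  assumes "R \<ge> 0" "c \<le> e"
  shows "measure lborel (cube (x::'b::euclidean_space) R \<times> {c..e::real}) = R ^ DIM('b) * (e - c)"
proof -
  have "cube x R \<times> {c..e} = cbox (x, c) (x + R *\<^sub>R One, e)" using assms by (simp add: cube_eq_cbox cbox_Pair_eq)
  moreover have "measure lborel (cbox (x, c) (x + R *\<^sub>R One, e)) = measure lborel (cbox x (x + R *\<^sub>R One)) * measure lborel (cbox c e)"
    by (rule content_Pair)
  moreover have "measure lborel (cbox x (x + R *\<^sub>R One)) = R ^ DIM('b)"
    using assms by (subst content_cbox) (auto simp: inner_add_left)
  ultimately show ?thesis using assms by simp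
qed

lemma bounded_cube: "R \<ge> 0 \<Longrightarrow> bounded (cube x R)" by (simp add: cube_eq_cbox)

section \<open>Counting lattice points in strips\<close>

locale cut_and_project = lattice_basis \<Gamma> B d
  for \<Gamma> :: "('b::euclidean_space \<times> real) set" and B d +
  assumes inj_fst: "inj_on fst \<Gamma>" and dense_snd: "closure (snd ` \<Gamma>) = UNIV"
begin

definition strip_points :: "'b \<Rightarrow> real \<Rightarrow> real set \<Rightarrow> ('b \<times> real) set" where
  "strip_points x R A = {\<gamma> \<in> \<Gamma>. fst \<gamma> \<in> cube x R \<and> snd \<gamma> \<in> A}"

lemma strip_points_eq: "strip_points x R A = \<Gamma> \<inter> (cube x R \<times> A)"
  unfolding strip_points_def by (auto simp: mem_Times_iff)

lemma finite_strip_points: "R \<ge> 0 \<Longrightarrow> bounded A \<Longrightarrow> finite (strip_points x R A)"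
  unfolding strip_points_eq by (intro finite_lattice_bounded bounded_Times bounded_cube)

lemma dense_point: "u < v \<Longrightarrow> \<exists>\<gamma>\<in>\<Gamma>. u < snd \<gamma> \<and> snd \<gamma> < v"
proof -
  assume "u < v"
  then have "{u<..<v} \<inter> closure (snd ` \<Gamma>) \<noteq> {}" using dense_snd by simp
  then have "{u<..<v} \<inter> snd ` \<Gamma> \<noteq> {}" by (simp only: open_Int_closure_eq_empty[OF open_greaterThanLessThan]) simp
  then obtain \<gamma> where "\<gamma> \<in> \<Gamma>" "snd \<gamma> \<in> {u<..<v}" by blast
  then show ?thesis by (intro bexI[of _ \<gamma>]) auto
qed

lemma cell_radius: obtains \<rho> where "\<rho> > 0" "\<And>z. z \<in> cell \<Longrightarrow> norm (fst z) \<le> \<rho> \<and> \<bar>snd z\<bar> \<le> \<rho>"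
proof -
  obtain \<rho> where \<rho>: "\<rho> > 0" "\<And>z. z \<in> cell \<Longrightarrow> norm z \<le> \<rho>" using cell_bounded by (auto simp: bounded_pos)
  show thesis
  proof (rule that[OF \<rho>(1)])
    fix z assume "z \<in> cell"
    then show "norm (fst z) \<le> \<rho> \<and> \<bar>snd z\<bar> \<le> \<rho>"
      using \<rho>(2)[of z] norm_fst_le[of "fst z" "snd z"] norm_snd_le[of "snd z" "fst z"] by simp
  qed
qed

text \<open>Cells attached to points of the strip stay in a box enlarged by \<rho> on every side.
  For growing \<open>R\<close> the enlargement of the cube is negligible, but the error
  \<open>2 * \<rho>\<close> in the direction of the window is not small against
  \<open>e - c\<close>; it becomes so only after many windows are joined.\<close>

lemma strip_points_upper:
  assumes \<rho>: "\<rho> > 0" "\<And>z. z \<in> cell \<Longrightarrow> norm (fst z) \<le> \<rho> \<and> \<bar>snd z\<bar> \<le> \<rho>" and "R \<ge> 0" "c \<le> e"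
  shows "real (card (strip_points x R {c..e})) * measure lborel cell \<le> (R + 2 * \<rho>) ^ DIM('b) * (e - c + 2 * \<rho>)"
proof -
  let ?S = "cube (x - \<rho> *\<^sub>R One) (R + 2 * \<rho>) \<times> {c - \<rho>..e + \<rho>}"
  have "real (card (strip_points x R {c..e})) * measure lborel cell \<le> measure lborel ?S"
  proof (rule card_times_volume_le)
    show "finite (strip_points x R {c..e})" by (rule finite_strip_points) (use assms in auto)
    show "?S \<in> sets borel" using assms by (intro borel_closed closed_Times) (simp_all add: cube_eq_cbox closed_cbox)
    show "bounded ?S" using assms by (intro bounded_Times bounded_cube) auto
    fix \<gamma> z assume g: "\<gamma> \<in> strip_points x R {c..e}" "z - \<gamma> \<in> cell"
    then have "norm (fst z - fst \<gamma>) \<le> \<rho>" "\<bar>snd z - snd \<gamma>\<bar> \<le> \<rho>" using \<rho>(2)[of "z - \<gamma>"] by auto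
    moreover have "fst \<gamma> + (fst z - fst \<gamma>) \<in> cube (x - \<rho> *\<^sub>R One) (R + 2 * \<rho>)"
      using g assms calculation by (intro mem_cube_shift) (auto simp: strip_points_def)
    ultimately show "z \<in> ?S" using g by (auto simp: strip_points_def mem_Times_iff)
  qed (auto simp: strip_points_def)
  also have "\<dots> = (R + 2 * \<rho>) ^ DIM('b) * (e - c + 2 * \<rho>)"
    using assms by (subst measure_cube_times_interval) auto
  finally show ?thesis .
qed

lemma strip_points_lower:
  assumes \<rho>: "\<rho> > 0" "\<And>z. z \<in> cell \<Longrightarrow> norm (fst z) \<le> \<rho> \<and> \<bar>snd z\<bar> \<le> \<rho>" and R: "R \<ge> 2 * \<rho>" and ce: "e - c \<ge> 2 * \<rho>"
  shows "(R - 2 * \<rho>) ^ DIM('b) * (e - c - 2 * \<rho>) \<le> real (card (strip_points x R {c..e})) * measure lborel cell"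
proof -
  let ?S = "cube (x + \<rho> *\<^sub>R One) (R - 2 * \<rho>) \<times> {c + \<rho>..e - \<rho>}"
  have "(R - 2 * \<rho>) ^ DIM('b) * (e - c - 2 * \<rho>) = measure lborel ?S"
    using R ce \<rho>(1) by (subst measure_cube_times_interval) auto
  also have "measure lborel ?S \<le> real (card (strip_points x R {c..e})) * measure lborel cell"
  proof (rule volume_le_card_times)
    show "finite (strip_points x R {c..e})" by (rule finite_strip_points) (use assms in auto)
    show "?S \<in> sets borel" using assms by (intro borel_closed closed_Times) (simp_all add: cube_eq_cbox closed_cbox)
    show "bounded ?S" using assms by (intro bounded_Times bounded_cube) auto
    fix \<gamma> z assume g: "z \<in> ?S" "\<gamma> \<in> \<Gamma>" "z - \<gamma> \<in> cell"
    then have n: "norm (fst z - fst \<gamma>) \<le> \<rho>" "\<bar>snd z - snd \<gamma>\<bar> \<le> \<rho>" using \<rho>(2)[of "z - \<gamma>"] by auto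
    have "fst z + (fst \<gamma> - fst z) \<in> cube (x + \<rho> *\<^sub>R One - \<rho> *\<^sub>R One) (R - 2 * \<rho> + 2 * \<rho>)"
      by (rule mem_cube_shift) (use g n R in \<open>auto simp: norm_minus_commute mem_Times_iff\<close>)
    then show "\<gamma> \<in> strip_points x R {c..e}" using g n by (auto simp: strip_points_def mem_Times_iff)
  qed (auto simp: strip_points_def)
  finally show ?thesis .
qed

text \<open>Adding a lattice vector maps the lattice to itself and moves the window by exactly
  \<open>snd \<gamma>0\<close>. The accompanying displacement of the cube has length at most
  \<open>r\<close> and is absorbed by enlarging the cube.\<close>

lemma card_strip_points_translate_le:
  assumes g: "\<gamma>0 \<in> \<Gamma>" "norm (fst \<gamma>0) \<le> r" and R: "R \<ge> 0" and A: "bounded A"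
  shows "card (strip_points x R A) \<le> card (strip_points (x - r *\<^sub>R One) (R + 2 * r) ((+) (snd \<gamma>0) ` A))"
proof (rule card_inj_on_le)
  have r: "0 \<le> r" using g(2) norm_ge_zero order_trans by blast
  show "inj_on ((+) \<gamma>0) (strip_points x R A)" by simp
  show "finite (strip_points (x - r *\<^sub>R One) (R + 2 * r) ((+) (snd \<gamma>0) ` A))"
    by (rule finite_strip_points) (use R r A in \<open>auto intro: bounded_translation\<close>)
  show "(+) \<gamma>0 ` strip_points x R A \<subseteq> strip_points (x - r *\<^sub>R One) (R + 2 * r) ((+) (snd \<gamma>0) ` A)"
  proof
    fix z assume "z \<in> (+) \<gamma>0 ` strip_points x R A"
    then obtain \<gamma> where \<gamma>: "z = \<gamma>0 + \<gamma>" "\<gamma> \<in> \<Gamma>" "fst \<gamma> \<in> cube x R" "snd \<gamma> \<in> A" by (auto simp: strip_points_def)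
    have "fst \<gamma> + fst \<gamma>0 \<in> cube (x - r *\<^sub>R One) (R + 2 * r)" by (rule mem_cube_shift[OF \<gamma>(3) R g(2)])
    then show "z \<in> strip_points (x - r *\<^sub>R One) (R + 2 * r) ((+) (snd \<gamma>0) ` A)"
      using \<gamma> lattice_add[OF g(1) \<gamma>(2)] by (auto simp: strip_points_def add.commute)
  qed
qed

text \<open>Lattice vectors move \<open>N\<close> copies of the window into consecutive slots of
  length \<open>l + \<delta>\<close>. The copies are disjoint and lie in one long window, for which
  the boundary error \<open>2 * \<rho>\<close> is small relative to \<open>N\<close>. The radius
  \<open>r\<close> depends on \<open>N\<close> and \<delta> but not on \<open>R\<close> or
  \<open>x\<close>, so it disappears in the limit.\<close>

lemma card_strip_points_upper:
  assumes \<rho>: "\<rho> > 0" "\<And>z. z \<in> cell \<Longrightarrow> norm (fst z) \<le> \<rho> \<and> \<bar>snd z\<bar> \<le> \<rho>"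
    and l: "l > 0" and \<delta>: "\<delta> > 0" and N: "N > 0"
  obtains r where "r \<ge> 0" "\<And>R x. R \<ge> 0 \<Longrightarrow>
    real N * real (card (strip_points x R {c..c + l})) * measure lborel cell \<le> (R + 2 * r) ^ DIM('b) * (real N * (l + \<delta>) + 2 * \<rho>)"
proof -
  \<comment> \<open>Density provides a lattice vector that puts the left end of the window within
    \<delta> of the left end of slot \<open>i\<close>; the extra length \<delta> of the slot leaves
    room for this inaccuracy.\<close>
  have "\<forall>i. \<exists>\<gamma>\<in>\<Gamma>. real i * (l + \<delta>) - c < snd \<gamma> \<and> snd \<gamma> < real i * (l + \<delta>) - c + \<delta>"
    using dense_point \<delta> by simp
  then obtain G where G: "\<And>i. G i \<in> \<Gamma>" "\<And>i. real i * (l + \<delta>) - c < snd (G i)" "\<And>i. snd (G i) < real i * (l + \<delta>) - c + \<delta>"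
    by metis
  define r where "r = (\<Sum>i<N. norm (fst (G i)))"
  have r0: "r \<ge> 0" by (simp add: r_def sum_nonneg)
  have Gr: "norm (fst (G i)) \<le> r" if "i < N" for i
    unfolding r_def by (rule member_le_sum) (use that in auto)
  define A where "A i = (+) (snd (G i)) ` {c..c + l}" for i
  have Asub: "A i \<subseteq> {real i * (l + \<delta>)<..<real (Suc i) * (l + \<delta>)}" for i
    using G(2,3)[of i] by (auto simp: A_def algebra_simps)
  show thesis
  proof (rule that[of "r + \<rho>"])
    show "0 \<le> r + \<rho>" using r0 \<rho> by simp
    fix R :: real and x :: 'b assume R: "R \<ge> 0"
    let ?y = "x - r *\<^sub>R One"
    let ?Q = "strip_points ?y (R + 2 * r) {0..real N * (l + \<delta>)}"
    have fQ: "finite ?Q" by (rule finite_strip_points) (use R r0 in auto)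
    have fA: "finite (strip_points ?y (R + 2 * r) (A i))" for i
      by (rule finite_strip_points) (use R r0 in \<open>auto simp: A_def\<close>)
    have "N * card (strip_points x R {c..c + l}) = (\<Sum>i<N. card (strip_points x R {c..c + l}))" by simp
    also have "\<dots> \<le> (\<Sum>i<N. card (strip_points ?y (R + 2 * r) (A i)))"
      unfolding A_def by (intro sum_mono card_strip_points_translate_le G R Gr) auto
    also have "\<dots> = card (\<Union>i<N. strip_points ?y (R + 2 * r) (A i))"
    proof (rule card_UN_disjoint[symmetric])
      show "\<forall>i\<in>{..<N}. \<forall>j\<in>{..<N}. i \<noteq> j \<longrightarrow> strip_points ?y (R + 2 * r) (A i) \<inter> strip_points ?y (R + 2 * r) (A j) = {}"
      proof (intro ballI impI)
        have lt: "A i \<inter> A j = {}" if "i < j" for i j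
        proof -
          have "real (Suc i) * (l + \<delta>) \<le> real j * (l + \<delta>)" using that l \<delta> by (intro mult_right_mono) auto
          then show ?thesis using Asub[of i] Asub[of j] by fastforce
        qed
        fix i j :: nat assume "i \<noteq> j"
        then have "A i \<inter> A j = {}" using lt[of i j] lt[of j i] by (cases i j rule: linorder_cases) auto
        then show "strip_points ?y (R + 2 * r) (A i) \<inter> strip_points ?y (R + 2 * r) (A j) = {}" by (auto simp: strip_points_def)
      qed
    qed (use fA in auto)
    also have "\<dots> \<le> card ?Q"
    proof (rule card_mono[OF fQ], rule UN_least)
      fix i assume "i \<in> {..<N}"
      then have "real (Suc i) * (l + \<delta>) \<le> real N * (l + \<delta>)" using l \<delta> by (intro mult_right_mono) auto
      moreover have "0 \<le> real i * (l + \<delta>)" using l \<delta> by simp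
      ultimately have "A i \<subseteq> {0..real N * (l + \<delta>)}" using Asub[of i] by fastforce
      then show "strip_points ?y (R + 2 * r) (A i) \<subseteq> ?Q" by (auto simp: strip_points_def)
    qed
    finally have "real N * real (card (strip_points x R {c..c + l})) \<le> real (card ?Q)" by (simp flip: of_nat_mult)
    then have "real N * real (card (strip_points x R {c..c + l})) * measure lborel cell \<le> real (card ?Q) * measure lborel cell"
      by (rule mult_right_mono) simp
    also have "\<dots> \<le> (R + 2 * r + 2 * \<rho>) ^ DIM('b) * (real N * (l + \<delta>) - 0 + 2 * \<rho>)"
      by (rule strip_points_upper[OF \<rho>]) (use R r0 l \<delta> in auto)
    finally show "real N * real (card (strip_points x R {c..c + l})) * measure lborel cell \<le> (R + 2 * (r + \<rho>)) ^ DIM('b) * (real N * (l + \<delta>) + 2 * \<rho>)"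
      by (simp add: algebra_simps)
  qed
qed

text \<open>The reverse arrangement: a long window is cut into \<open>N\<close> slots of length
  \<open>l - \<delta>\<close>, and a lattice vector moves each of them into the original window. The
  slots only have to cover, so a union bound suffices and shared endpoints do no harm.\<close>

lemma card_strip_points_lower:
  assumes \<rho>: "\<rho> > 0" "\<And>z. z \<in> cell \<Longrightarrow> norm (fst z) \<le> \<rho> \<and> \<bar>snd z\<bar> \<le> \<rho>"
    and l: "l > 0" and \<delta>: "\<delta> > 0" "\<delta> < l" and N: "N > 0" "real N * (l - \<delta>) \<ge> 2 * \<rho>"
  obtains r where "r \<ge> 0" "\<And>R x. R \<ge> 2 * r \<Longrightarrow>
    (R - 2 * r) ^ DIM('b) * (real N * (l - \<delta>) - 2 * \<rho>) \<le> real N * real (card (strip_points x R {c..c + l})) * measure lborel cell"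
proof -
  have "\<forall>i. \<exists>\<gamma>\<in>\<Gamma>. - (real i * (l - \<delta>) - c) < snd \<gamma> \<and> snd \<gamma> < - (real i * (l - \<delta>) - c) + \<delta>"
    using dense_point \<delta> by simp
  then obtain G where G: "\<And>i. G i \<in> \<Gamma>" "\<And>i. - (real i * (l - \<delta>) - c) < snd (G i)" "\<And>i. snd (G i) < - (real i * (l - \<delta>) - c) + \<delta>"
    by metis
  define r where "r = (\<Sum>i<N. norm (fst (G i)))"
  have r0: "r \<ge> 0" by (simp add: r_def sum_nonneg)
  have Gr: "norm (fst (G i)) \<le> r" if "i < N" for i
    unfolding r_def by (rule member_le_sum) (use that in auto)
  define A where "A i = {real i * (l - \<delta>)..real (Suc i) * (l - \<delta>)}" for i
  have Asub: "(+) (snd (G i)) ` A i \<subseteq> {c..c + l}" for i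
    using G(2,3)[of i] by (auto simp: A_def algebra_simps)
  show thesis
  proof (rule that[of "r + \<rho>"])
    show "0 \<le> r + \<rho>" using r0 \<rho> by simp
    fix R :: real and x :: 'b assume R: "R \<ge> 2 * (r + \<rho>)"
    let ?y = "x + r *\<^sub>R One"
    let ?Q = "strip_points ?y (R - 2 * r) {0..real N * (l - \<delta>)}"
    have R2: "R - 2 * r \<ge> 0" using R \<rho> by simp
    have fA: "finite (strip_points ?y (R - 2 * r) (A i))" for i
      by (rule finite_strip_points) (use R2 in \<open>auto simp: A_def\<close>)
    have fP: "finite (strip_points x R {c..c + l})" by (rule finite_strip_points) (use R r0 \<rho> in auto)
    have cov: "{0..real N * (l - \<delta>)} \<subseteq> (\<Union>i<N. A i)"
    proof
      fix t assume t: "t \<in> {0..real N * (l - \<delta>)}"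
      have p: "0 < l - \<delta>" using \<delta> by simp
      show "t \<in> (\<Union>i<N. A i)"
      \<comment> \<open>At the right end the floor used below would return the index
        \<open>N\<close>, which is out of range; that point belongs to the closed last slot.\<close>
      proof (cases "t = real N * (l - \<delta>)")
        case True
        then have "t \<in> A (N - 1)" using N(1) p by (simp add: A_def of_nat_diff mult_right_mono)
        then show ?thesis using N(1) by force
      next
        case False
        define i where "i = nat \<lfloor>t / (l - \<delta>)\<rfloor>"
        have q0: "0 \<le> t / (l - \<delta>)" using t p by simp
        then have i: "real i \<le> t / (l - \<delta>)" "t / (l - \<delta>) < real (Suc i)" unfolding i_def by linarith+
        have "t < real N * (l - \<delta>)" using t False by simp
        then have "t / (l - \<delta>) < real N" using p by (simp add: pos_divide_less_eq)
        then have "i < N" using i(1) by linarith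
        moreover have "t \<in> A i" using i p by (simp add: A_def pos_le_divide_eq pos_divide_less_eq)
        ultimately show ?thesis by blast
      qed
    qed
    have "card ?Q \<le> card (\<Union>i<N. strip_points ?y (R - 2 * r) (A i))"
    proof (rule card_mono)
      show "?Q \<subseteq> (\<Union>i<N. strip_points ?y (R - 2 * r) (A i))" using cov unfolding strip_points_def by blast
    qed (use fA in simp)
    also have "\<dots> \<le> (\<Sum>i<N. card (strip_points ?y (R - 2 * r) (A i)))" by (rule card_UN_le) simp
    also have "\<dots> \<le> (\<Sum>i<N. card (strip_points x R {c..c + l}))"
    proof (rule sum_mono)
      fix i assume "i \<in> {..<N}"
      then have "card (strip_points ?y (R - 2 * r) (A i)) \<le> card (strip_points (?y - r *\<^sub>R One) (R - 2 * r + 2 * r) ((+) (snd (G i)) ` A i))"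
        by (intro card_strip_points_translate_le G Gr R2) (auto simp: A_def)
      also have "\<dots> \<le> card (strip_points x R {c..c + l})"
        by (rule card_mono[OF fP]) (use Asub[of i] in \<open>auto simp: strip_points_def\<close>)
      finally show "card (strip_points ?y (R - 2 * r) (A i)) \<le> card (strip_points x R {c..c + l})" .
    qed
    finally have "real (card ?Q) \<le> real N * real (card (strip_points x R {c..c + l}))" by (simp flip: of_nat_mult)
    then have "real (card ?Q) * measure lborel cell \<le> real N * real (card (strip_points x R {c..c + l})) * measure lborel cell"
      by (rule mult_right_mono) simp
    moreover have "(R - 2 * r - 2 * \<rho>) ^ DIM('b) * (real N * (l - \<delta>) - 0 - 2 * \<rho>) \<le> real (card ?Q) * measure lborel cell"
      by (rule strip_points_lower[OF \<rho>]) (use R N in auto)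
    ultimately show "(R - 2 * (r + \<rho>)) ^ DIM('b) * (real N * (l - \<delta>) - 2 * \<rho>) \<le> real N * real (card (strip_points x R {c..c + l})) * measure lborel cell"
      by (simp add: algebra_simps)
  qed
qed

lemma power_ratio_tendsto: "((\<lambda>R. ((R + k) / R) ^ n) \<longlongrightarrow> (1::real)) at_top"
proof -
  have "((\<lambda>R. (1 + k / R) ^ n) \<longlongrightarrow> (1 + 0) ^ n) at_top"
    by (intro tendsto_intros tendsto_divide_0[OF tendsto_const] filterlim_at_top_imp_at_infinity filterlim_ident)
  moreover have "\<forall>\<^sub>F R in at_top. (1 + k / R) ^ n = ((R + k) / R) ^ n"
    using eventually_gt_at_top[of 0] by eventually_elim (simp add: add_divide_distrib)
  ultimately show ?thesis by (simp add: tendsto_cong)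
qed

text \<open>Since \<open>p\<^sub>2(\<Gamma>)\<close> is dense, translates of the window by lattice points can be laid side by side with small
  gaps. Each contributes the same count up to boundary effects, and together they count the lattice points in a thick box.\<close>

theorem density_limit:
  assumes l: "l > 0"
  shows "((\<lambda>R. real (card (strip_points x R {c..c + l})) / R ^ DIM('b)) \<longlongrightarrow> l / measure lborel cell) at_top"
proof (rule order_tendstoI)
  obtain \<rho> where \<rho>: "\<rho> > 0" "\<And>z. z \<in> cell \<Longrightarrow> norm (fst z) \<le> \<rho> \<and> \<bar>snd z\<bar> \<le> \<rho>" by (rule cell_radius) (rule that, assumption, blast)
  define V where "V = measure lborel cell"
  have V: "V > 0" using cell_positive by (simp add: V_def)
  let ?n = "\<lambda>R. real (card (strip_points x R {c..c + l}))"
  {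
    fix T assume T: "l / measure lborel cell < T"
    \<comment> \<open>A quarter of the gap. One \<delta> pays for the spaces between the windows and
      another for the boundary term \<open>2 * \<rho>\<close>, which is at most
      \<open>real N * \<delta>\<close>. Still \<open>l + 2 * \<delta> < T * V\<close>, leaving room
      for a ratio that only tends to 1.\<close>
    define \<delta> where "\<delta> = (T * V - l) / 4"
    have \<delta>: "\<delta> > 0" using T V by (simp add: \<delta>_def V_def pos_divide_less_eq)
    obtain N :: nat where N0: "2 * \<rho> / \<delta> < real N" using reals_Archimedean2 by blast
    have N: "N > 0" using N0 \<rho> \<delta> by (metis divide_pos_pos less_trans mult_pos_pos of_nat_0_less_iff zero_less_numeral)
    have N2: "2 * \<rho> \<le> real N * \<delta>" using N0 \<delta> by (simp add: pos_divide_less_eq)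
    obtain r where r: "r \<ge> 0" "\<And>R x. R \<ge> 0 \<Longrightarrow>
        real N * real (card (strip_points x R {c..c + l})) * measure lborel cell \<le> (R + 2 * r) ^ DIM('b) * (real N * (l + \<delta>) + 2 * \<rho>)"
      by (rule card_strip_points_upper[OF \<rho> l \<delta> N, of c]) (assumption, rule that, assumption, blast)
    define K where "K = (l + 2 * \<delta>) / V"
    have K0: "0 < K" using l \<delta> V by (simp add: K_def)
    have KT: "K < T" using V \<delta> by (simp add: K_def pos_divide_less_eq \<delta>_def field_simps)
    have "((\<lambda>R. ((R + 2 * r) / R) ^ DIM('b) * K) \<longlongrightarrow> 1 * K) at_top" by (intro tendsto_mult_right power_ratio_tendsto)
    then have "\<forall>\<^sub>F R in at_top. ((R + 2 * r) / R) ^ DIM('b) * K < T" using KT by (intro order_tendstoD) auto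
    then show "\<forall>\<^sub>F R in at_top. ?n R / R ^ DIM('b) < T"
      using eventually_gt_at_top[of 0]
    proof eventually_elim
      case (elim R)
      have p: "0 \<le> (R + 2 * r) ^ DIM('b)" using elim r by simp
      have "real N * ?n R * V \<le> (R + 2 * r) ^ DIM('b) * (real N * (l + \<delta>) + 2 * \<rho>)"
        using r(2)[of R x] elim by (simp add: V_def)
      also have "\<dots> \<le> (R + 2 * r) ^ DIM('b) * (real N * (l + 2 * \<delta>))"
        using N2 p by (intro mult_left_mono) (auto simp: algebra_simps)
      finally have "real N * (?n R * V) \<le> real N * ((R + 2 * r) ^ DIM('b) * (l + 2 * \<delta>))" by (simp add: mult_ac)
      then have "?n R * V \<le> (R + 2 * r) ^ DIM('b) * (l + 2 * \<delta>)" using N by simp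
      then have "?n R \<le> (R + 2 * r) ^ DIM('b) * K" using V by (simp add: K_def pos_le_divide_eq)
      then have "?n R / R ^ DIM('b) \<le> (R + 2 * r) ^ DIM('b) * K / R ^ DIM('b)" using elim by (intro divide_right_mono) auto
      also have "\<dots> = ((R + 2 * r) / R) ^ DIM('b) * K" by (simp add: power_divide)
      finally show ?case using elim by simp
    qed
  }
  {
    fix T assume T: "T < l / measure lborel cell"
    \<comment> \<open>As in the upper estimate, with the additional bound \<open>l / 4\<close>: it
      keeps the slots longer than \<delta>, so that the choice of \<open>N\<close> also yields
      \<open>2 * \<rho> \<le> real N * (l - \<delta>)\<close>.\<close>
    define \<delta> where "\<delta> = min (l / 4) ((l - T * V) / 4)"
    have TV: "T * V < l" using T V by (simp add: V_def pos_less_divide_eq)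
    have \<delta>: "\<delta> > 0" "\<delta> < l" "\<delta> \<le> l / 4" "\<delta> \<le> (l - T * V) / 4" using TV l unfolding \<delta>_def by (auto simp: min_def)
    obtain N :: nat where N0: "2 * \<rho> / \<delta> < real N" using reals_Archimedean2 by blast
    have N: "N > 0" using N0 \<rho> \<delta>(1) by (metis divide_pos_pos less_trans mult_pos_pos of_nat_0_less_iff zero_less_numeral)
    have N2: "2 * \<rho> \<le> real N * \<delta>" using N0 \<delta> by (simp add: pos_divide_less_eq)
    have "real N * \<delta> \<le> real N * (l - \<delta>)" using \<delta> by (intro mult_left_mono) auto
    then have N3: "real N * (l - \<delta>) \<ge> 2 * \<rho>" using N2 by linarith
    obtain r where r: "r \<ge> 0" "\<And>R x. R \<ge> 2 * r \<Longrightarrow>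
        (R - 2 * r) ^ DIM('b) * (real N * (l - \<delta>) - 2 * \<rho>) \<le> real N * real (card (strip_points x R {c..c + l})) * measure lborel cell"
      by (rule card_strip_points_lower[OF \<rho> l \<delta>(1,2) N N3, of c]) (assumption, rule that, assumption, blast)
    define K where "K = (l - 2 * \<delta>) / V"
    have KT: "T < K" using V TV \<delta> by (simp add: K_def pos_less_divide_eq)
    have "((\<lambda>R. ((R + - (2 * r)) / R) ^ DIM('b) * K) \<longlongrightarrow> 1 * K) at_top" by (intro tendsto_mult_right power_ratio_tendsto)
    then have "\<forall>\<^sub>F R in at_top. T < ((R + - (2 * r)) / R) ^ DIM('b) * K" using KT by (intro order_tendstoD) auto
    then show "\<forall>\<^sub>F R in at_top. T < ?n R / R ^ DIM('b)"
      using eventually_gt_at_top[of 0] eventually_ge_at_top[of "2 * r"]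
    proof eventually_elim
      case (elim R)
      have p: "0 \<le> (R - 2 * r) ^ DIM('b)" using elim by simp
      have "(R - 2 * r) ^ DIM('b) * (real N * (l - 2 * \<delta>)) \<le> (R - 2 * r) ^ DIM('b) * (real N * (l - \<delta>) - 2 * \<rho>)"
        using N2 p by (intro mult_left_mono) (auto simp: algebra_simps)
      also have "\<dots> \<le> real N * ?n R * V" using r(2)[of R x] elim by (simp add: V_def)
      finally have "real N * ((R - 2 * r) ^ DIM('b) * (l - 2 * \<delta>)) \<le> real N * (?n R * V)" by (simp add: mult_ac)
      then have "(R - 2 * r) ^ DIM('b) * (l - 2 * \<delta>) \<le> ?n R * V" using N by simp
      then have "(R - 2 * r) ^ DIM('b) * K \<le> ?n R" using V by (simp add: K_def pos_divide_le_eq)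
      then have "(R - 2 * r) ^ DIM('b) * K / R ^ DIM('b) \<le> ?n R / R ^ DIM('b)" using elim by (intro divide_right_mono) auto
      moreover have "(R - 2 * r) ^ DIM('b) * K / R ^ DIM('b) = ((R + - (2 * r)) / R) ^ DIM('b) * K" by (simp add: power_divide)
      ultimately show ?case using elim by simp
    qed
  }
qed

text \<open>By injectivity of \<open>fst\<close>, counting points of the model set in a cube is
  counting lattice points in a strip. Uniqueness of limits then identifies the definite description
  in \<open>point_density\<close>.\<close>

lemma point_density_model_set:
  assumes a: "a > 0"
  shows "point_density (model_set \<Gamma> {- a..a}) = 2 * a / measure lborel cell"
proof -
  have eq: "card (model_set \<Gamma> {- a..a} \<inter> cube x R) = card (strip_points x R {- a..- a + 2 * a})" for x R
  proof -
    have "model_set \<Gamma> {- a..a} \<inter> cube x R = fst ` strip_points x R {- a..- a + 2 * a}"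
      by (auto simp: model_set_def strip_points_def)
    moreover have "inj_on fst (strip_points x R {- a..- a + 2 * a})"
      by (rule inj_on_subset[OF inj_fst]) (auto simp: strip_points_def)
    ultimately show ?thesis by (simp add: card_image)
  qed
  have lim: "((\<lambda>R. real (card (model_set \<Gamma> {- a..a} \<inter> cube x R)) / R ^ DIM('b)) \<longlongrightarrow> 2 * a / measure lborel cell) at_top" for x
    unfolding eq using density_limit[of "2 * a" x "- a"] a by simp
  show ?thesis unfolding point_density_def
  proof (rule the_equality)
    show "\<forall>x. ((\<lambda>R. real (card (model_set \<Gamma> {- a..a} \<inter> cube x R)) / R ^ DIM('b)) \<longlongrightarrow> 2 * a / measure lborel cell) at_top"
      using lim by blast
    fix D assume D: "\<forall>x. ((\<lambda>R. real (card (model_set \<Gamma> {- a..a} \<inter> cube x R)) / R ^ DIM('b)) \<longlongrightarrow> D) at_top"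
    show "D = 2 * a / measure lborel cell"
      by (rule tendsto_unique[OF _ spec[OF D] lim]) simp
  qed
qed

end

section \<open>Evaluation of \<open>\<Phi>\<close>\<close>

abbreviation uniform_density :: "real \<Rightarrow> real \<Rightarrow> complex" where
  "uniform_density r \<equiv> normalized_indicator {- r..r}"

lemma uniform_density_eq: "r > 0 \<Longrightarrow> uniform_density r x = of_real (indicator {- r..r} x / (2 * r))"
  by (simp add: normalized_indicator_def)

lemma norm_uniform_density: "r > 0 \<Longrightarrow> norm (uniform_density r x) = indicator {- r..r} x / (2 * r)"
  by (simp only: uniform_density_eq norm_of_real) simp

lemma uniform_density_borel [measurable]: "uniform_density r \<in> borel_measurable borel"
  unfolding normalized_indicator_def by measurable

lemma uniform_density_integrable: "integrable lborel (uniform_density r)"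
  unfolding normalized_indicator_def by (intro integrable_of_real integrable_divide_zero)
    (simp add: integrable_indicator_iff emeasure_lborel_Icc_eq)

lemma uniform_density_nn_integral:
  assumes "r > 0"
  shows "(\<integral>\<^sup>+x. ennreal (norm (uniform_density r x)) \<partial>lborel) = 1"
proof -
  have "(\<integral>\<^sup>+x. ennreal (norm (uniform_density r x)) \<partial>lborel) = (\<integral>\<^sup>+x. ennreal (1 / (2 * r)) * indicator {- r..r} x \<partial>lborel)"
    using assms by (intro nn_integral_cong) (auto simp: norm_uniform_density indicator_def)
  also have "\<dots> = ennreal (1 / (2 * r)) * ennreal (2 * r)"
    using assms by (subst nn_integral_cmult_indicator) auto
  also have "\<dots> = 1" using assms by (simp add: ennreal_mult'[symmetric])
  finally show ?thesis .
qed

lemma uniform_density_integral: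
  assumes "r > 0" shows "(\<integral>x. uniform_density r x \<partial>lborel) = 1"
proof -
  have "(\<integral>x. uniform_density r x \<partial>lborel) = of_real (\<integral>x. indicator {- r..r} x / (2 * r) \<partial>lborel)"
    by (simp only: integral_complex_of_real[symmetric] uniform_density_eq[OF assms])
  also have "(\<integral>x. indicator {- r..r} x / (2 * r) \<partial>lborel) = 1" using assms by simp
  finally show ?thesis by simp
qed

text \<open>Minkowski's integral inequality for averages against a probability density supported on
  \<open>{- r..r}\<close>. Nonnegative integrals are used so that the bound yields integrability of
  the average and does not presuppose it.\<close>

lemma nn_integral_smear:
  fixes K :: "real \<Rightarrow> real \<Rightarrow> complex"
  assumes [measurable]: "(\<lambda>(x, v). K x v) \<in> borel_measurable (lborel \<Otimes>\<^sub>M lborel)" and r: "r > 0"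
    and b: "\<And>v. \<bar>v\<bar> \<le> r \<Longrightarrow> (\<integral>\<^sup>+x. ennreal (norm (K x v)) \<partial>lborel) \<le> c"
  shows "(\<integral>\<^sup>+x. ennreal (norm (\<integral>v. K x v * uniform_density r v \<partial>lborel)) \<partial>lborel) \<le> c"
proof -
  have "(\<integral>\<^sup>+x. ennreal (norm (\<integral>v. K x v * uniform_density r v \<partial>lborel)) \<partial>lborel) \<le>
     (\<integral>\<^sup>+x. (\<integral>\<^sup>+v. ennreal (norm (K x v)) * ennreal (norm (uniform_density r v)) \<partial>lborel) \<partial>lborel)"
  proof (rule nn_integral_mono)
    fix x
    have [measurable]: "K x \<in> borel_measurable lborel"
      using measurable_compose[OF measurable_Pair1'[of x lborel lborel] assms(1)] by simp
    \<comment> \<open>If the slice is not integrable, its Bochner integral is 0 by convention and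
      the bound is trivial.\<close>
    show "ennreal (norm (\<integral>v. K x v * uniform_density r v \<partial>lborel)) \<le>
        (\<integral>\<^sup>+v. ennreal (norm (K x v)) * ennreal (norm (uniform_density r v)) \<partial>lborel)"
      using integral_norm_bound_ennreal[of lborel "\<lambda>v. K x v * uniform_density r v"]
      by (cases "integrable lborel (\<lambda>v. K x v * uniform_density r v)")
         (simp_all add: ennreal_mult' norm_mult not_integrable_integral_eq)
  qed
  also have "\<dots> = (\<integral>\<^sup>+v. (\<integral>\<^sup>+x. ennreal (norm (K x v)) * ennreal (norm (uniform_density r v)) \<partial>lborel) \<partial>lborel)"
    by (rule lborel_pair.Fubini'[symmetric]) measurable
  also have "\<dots> \<le> (\<integral>\<^sup>+v. c * ennreal (norm (uniform_density r v)) \<partial>lborel)"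
  proof (rule nn_integral_mono)
    fix v
    have [measurable]: "(\<lambda>x. K x v) \<in> borel_measurable lborel"
      using measurable_compose[OF measurable_Pair2'[of v lborel lborel] assms(1)] by simp
    have "(\<integral>\<^sup>+x. ennreal (norm (K x v)) * ennreal (norm (uniform_density r v)) \<partial>lborel) =
        (\<integral>\<^sup>+x. ennreal (norm (K x v)) \<partial>lborel) * ennreal (norm (uniform_density r v))"
      by (rule nn_integral_multc) measurable
    also have "\<dots> \<le> c * ennreal (norm (uniform_density r v))"
      using b[of v] r by (cases "\<bar>v\<bar> \<le> r") (auto intro!: mult_right_mono simp: norm_uniform_density indicator_def)
    finally show "(\<integral>\<^sup>+x. ennreal (norm (K x v)) * ennreal (norm (uniform_density r v)) \<partial>lborel) \<le> c * ennreal (norm (uniform_density r v))" .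
  qed
  also have "\<dots> = c * (\<integral>\<^sup>+v. ennreal (norm (uniform_density r v)) \<partial>lborel)" by (rule nn_integral_cmult) measurable
  also have "\<dots> = c" using uniform_density_nn_integral[OF r] by simp
  finally show ?thesis .
qed

section \<open>Convolution with uniform densities\<close>

lemma fconv_lborel:
  assumes [measurable]: "f \<in> borel_measurable borel" "g \<in> borel_measurable borel"
  shows "fconv f g x = (\<integral>v. f (x - v) * g v \<partial>lborel)"
proof -
  have "fconv f g x = (\<integral>y. f y * g (x - y) \<partial>lborel)"
    unfolding fconv_def by (rule integral_completion) simp
  also have "\<dots> = (\<integral>v. f (x - v) * g (x - (x - v)) \<partial>lborel)"
    by (rule lborel_integral_shift(3)[symmetric]) measurable
  finally show ?thesis by simp
qed

lemma fconv_borel [measurable]: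
  assumes [measurable]: "f \<in> borel_measurable borel" "g \<in> borel_measurable borel"
  shows "fconv f g \<in> borel_measurable borel"
  unfolding fconv_lborel[OF assms, abs_def] by measurable

text \<open>A Lipschitz bound for translation in the \<open>L1\<close> norm. Convolution with a
  uniform density preserves it with the same constant, so one constant controls all stages of the
  infinite convolution.\<close>

definition L1_modulus :: "(real \<Rightarrow> complex) \<Rightarrow> real \<Rightarrow> bool" where
  "L1_modulus f c \<longleftrightarrow> (\<forall>y. (\<integral>\<^sup>+x. ennreal (norm (f (x - y) - f x)) \<partial>lborel) \<le> ennreal (c * \<bar>y\<bar>))"

text \<open>The difference between \<open>f\<close> and its convolution is an average of the
  differences \<open>f (x - v) - f x\<close> over \<open>\<bar>v\<bar> \<le> r\<close>, each of norm
  at most \<open>c * r\<close>. The translation modulus of the convolution is an average of that of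
  \<open>f\<close> in the same way.\<close>

lemma fconv_uniform:
  assumes f: "integrable lborel f" and m: "L1_modulus f c" and c: "c \<ge> 0" and r: "r > 0"
  shows "integrable lborel (fconv f (uniform_density r))"
    and "L1_modulus (fconv f (uniform_density r)) c"
    and "(\<integral>x. norm (fconv f (uniform_density r) x - f x) \<partial>lborel) \<le> c * r"
proof -
  have [measurable]: "f \<in> borel_measurable borel" using borel_measurable_integrable[OF f] by simp
  let ?u = "uniform_density r"
  have i: "integrable lborel (\<lambda>v. f (x - v) * ?u v)" for x
  proof (rule Bochner_Integration.integrable_bound)
    show "integrable lborel (\<lambda>v. (1 / (2 * r)) *\<^sub>R f (x - v))"
      using f lborel_integrable_shift(3)[of f x] by simp
    show "AE v in lborel. norm (f (x - v) * ?u v) \<le> norm ((1 / (2 * r)) *\<^sub>R f (x - v))"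
      using r by (auto simp: norm_uniform_density indicator_def norm_mult)
  qed measurable
  have d1: "fconv f ?u x - f x = (\<integral>v. (f (x - v) - f x) * ?u v \<partial>lborel)" for x
    using i[of x] uniform_density_integrable[of r] uniform_density_integral[OF r]
    by (simp add: fconv_lborel left_diff_distrib Bochner_Integration.integral_diff)
  have D: "(\<integral>\<^sup>+x. ennreal (norm (fconv f ?u x - f x)) \<partial>lborel) \<le> ennreal (c * r)"
    unfolding d1
  proof (rule nn_integral_smear[OF _ r])
    fix v :: real assume "\<bar>v\<bar> \<le> r"
    then have "ennreal (c * \<bar>v\<bar>) \<le> ennreal (c * r)" using c by (intro ennreal_leI mult_left_mono)
    then show "(\<integral>\<^sup>+x. ennreal (norm (f (x - v) - f x)) \<partial>lborel) \<le> ennreal (c * r)"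
      using m unfolding L1_modulus_def by (meson order_trans)
  qed measurable
  have iD: "integrable lborel (\<lambda>x. fconv f ?u x - f x)"
    using D by (intro integrableI_bounded) (auto simp: le_less_trans)
  have "integrable lborel (\<lambda>x. (fconv f ?u x - f x) + f x)" using iD f by (rule Bochner_Integration.integrable_add)
  then show "integrable lborel (fconv f ?u)" by simp
  have "ennreal (\<integral>x. norm (fconv f ?u x - f x) \<partial>lborel) \<le> ennreal (c * r)"
    using D nn_integral_eq_integral[OF integrable_norm[OF iD]] by simp
  then show "(\<integral>x. norm (fconv f ?u x - f x) \<partial>lborel) \<le> c * r" using c r by simp
  show "L1_modulus (fconv f ?u) c" unfolding L1_modulus_def
  proof
    fix y
    have d2: "fconv f ?u (x - y) - fconv f ?u x = (\<integral>v. (f (x - y - v) - f (x - v)) * ?u v \<partial>lborel)" for x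
      using i[of x] i[of "x - y"] by (simp add: fconv_lborel left_diff_distrib Bochner_Integration.integral_diff)
    show "(\<integral>\<^sup>+x. ennreal (norm (fconv f ?u (x - y) - fconv f ?u x)) \<partial>lborel) \<le> ennreal (c * \<bar>y\<bar>)"
      unfolding d2
    proof (rule nn_integral_smear[OF _ r])
      fix v :: real
      have "(\<integral>\<^sup>+x. ennreal (norm (f (x - y - v) - f (x - v))) \<partial>lborel) = (\<integral>\<^sup>+x. ennreal (norm (f (x - y) - f x)) \<partial>lborel)"
      proof -
        have "(\<integral>\<^sup>+x. ennreal (norm (f (x - y) - f x)) \<partial>lborel) =
            (\<integral>\<^sup>+x. ennreal (norm (f (x - y) - f x)) \<partial>(distr lborel borel ((+) (- v))))" by (simp only: lborel_distr_plus)
        also have "\<dots> = (\<integral>\<^sup>+x. ennreal (norm (f (- v + x - y) - f (- v + x))) \<partial>lborel)"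
          by (subst nn_integral_distr) auto
        also have "(\<lambda>x. ennreal (norm (f (- v + x - y) - f (- v + x)))) = (\<lambda>x. ennreal (norm (f (x - y - v) - f (x - v))))"
          by (simp add: algebra_simps)
        finally show ?thesis ..
      qed
      then show "(\<integral>\<^sup>+x. ennreal (norm (f (x - y - v) - f (x - v))) \<partial>lborel) \<le> ennreal (c * \<bar>y\<bar>)"
        using m unfolding L1_modulus_def by simp
    qed measurable
  qed
qed

lemma uniform_density_modulus:
  assumes r: "r > 0" shows "L1_modulus (uniform_density r) (2 / r)"
  unfolding L1_modulus_def
proof
  fix y :: real
  \<comment> \<open>A shift by \<open>y\<close> changes the indicator only at points within distance
    \<open>\<bar>y\<bar>\<close> of one of the two endpoints. These have total length at most
    \<open>4 * \<bar>y\<bar>\<close>, and the density has height \<open>1 / (2 * r)\<close>.\<close>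
  let ?A = "{r - \<bar>y\<bar>..r + \<bar>y\<bar>} \<union> {- r - \<bar>y\<bar>..- r + \<bar>y\<bar>}"
  have "(\<integral>\<^sup>+x. ennreal (norm (uniform_density r (x - y) - uniform_density r x)) \<partial>lborel) \<le>
      (\<integral>\<^sup>+x. ennreal (1 / (2 * r)) * indicator ?A x \<partial>lborel)"
  proof (rule nn_integral_mono)
    fix x :: real
    have "norm (uniform_density r (x - y) - uniform_density r x) \<le> 1 / (2 * r) * indicator ?A x"
      unfolding uniform_density_eq[OF r] of_real_diff[symmetric] norm_of_real
    proof (cases "x \<in> ?A")
      case True
      then show "\<bar>indicator {- r..r} (x - y) / (2 * r) - indicator {- r..r} x / (2 * r)\<bar> \<le> 1 / (2 * r) * indicator ?A x"
        using r by (auto simp: indicator_def)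
    next
      case False
      then have "x - y \<in> {- r..r} \<longleftrightarrow> x \<in> {- r..r}" by auto
      then show "\<bar>indicator {- r..r} (x - y) / (2 * r) - indicator {- r..r} x / (2 * r)\<bar> \<le> 1 / (2 * r) * indicator ?A x"
        using r by (auto simp: indicator_def)
    qed
    then show "ennreal (norm (uniform_density r (x - y) - uniform_density r x)) \<le> ennreal (1 / (2 * r)) * indicator ?A x"
      using r by (auto simp: indicator_def ennreal_leI split: if_splits)
  qed
  also have "\<dots> = ennreal (1 / (2 * r)) * emeasure lborel ?A" by (rule nn_integral_cmult_indicator) simp
  also have "\<dots> \<le> ennreal (1 / (2 * r)) * (ennreal (2 * \<bar>y\<bar>) + ennreal (2 * \<bar>y\<bar>))"
    by (intro mult_left_mono order_trans[OF emeasure_subadditive]) auto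
  also have "\<dots> = ennreal (2 / r * \<bar>y\<bar>)"
    using r by (subst ennreal_plus[symmetric]) (auto simp: ennreal_mult'[symmetric])
  finally show "(\<integral>\<^sup>+x. ennreal (norm (uniform_density r (x - y) - uniform_density r x)) \<partial>lborel) \<le> ennreal (2 / r * \<bar>y\<bar>)" .
qed

text \<open>Completeness of \<open>L1\<close> for sequences with summable increments: the
  telescoping series converges absolutely almost everywhere, and the sum of the norms of its terms
  dominates every remainder.\<close>

lemma L1_series_limit:
  fixes P :: "nat \<Rightarrow> 'a \<Rightarrow> 'b::{banach, second_countable_topology}"
  assumes P: "\<And>k. integrable M (P k)" and d: "\<And>k. (\<integral>x. norm (P (Suc k) x - P k x) \<partial>M) \<le> \<delta> k" and s: "summable \<delta>"
  obtains f where "integrable M f" "(\<lambda>k. \<integral>x. norm (P k x - f x) \<partial>M) \<longlonglongrightarrow> 0"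
proof -
  define D where "D k x = P (Suc k) x - P k x" for k x
  have D: "integrable M (D k)" for k unfolding D_def using P by simp
  note [measurable] = borel_measurable_integrable[OF P] borel_measurable_integrable[OF D]
  have sD: "summable (\<lambda>k. \<integral>x. norm (D k x) \<partial>M)"
    using d by (intro summable_comparison_test'[OF s, of 0]) (simp add: D_def integral_nonneg_AE)
  have "(\<integral>\<^sup>+x. (\<Sum>k. ennreal (norm (D k x))) \<partial>M) = (\<Sum>k. ennreal (\<integral>x. norm (D k x) \<partial>M))"
    by (subst nn_integral_suminf) (auto intro!: suminf_cong nn_integral_eq_integral integrable_norm D)
  also have "\<dots> \<noteq> \<infinity>" using sD by (simp add: ennreal_suminf_neq_top integral_nonneg_AE)
  finally have "AE x in M. (\<Sum>k. ennreal (norm (D k x))) \<noteq> \<infinity>" by (intro nn_integral_PInf_AE) auto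
  then have ae: "AE x in M. summable (\<lambda>k. norm (D k x))"
    by eventually_elim (auto intro: summable_suminf_not_top)
  define f where "f x = P 0 x + (\<Sum>k. D k x)" for x
  have f: "integrable M f" unfolding f_def using P integrable_suminf[OF D ae sD] by simp
  have iw: "integrable M (\<lambda>x. \<Sum>k. norm (D k x))"
    by (rule integrable_suminf) (use D ae sD in auto)
  note [measurable] = borel_measurable_integrable[OF f]
  have "(\<lambda>k. \<integral>x. norm (P k x - f x) \<partial>M) \<longlonglongrightarrow> (\<integral>x. 0 \<partial>M)"
  proof (rule integral_dominated_convergence[OF _ _ iw])
    have tel: "P k x = P 0 x + (\<Sum>i<k. D i x)" for k x
      by (induction k) (simp_all add: D_def)
    show "AE x in M. (\<lambda>k. norm (P k x - f x)) \<longlonglongrightarrow> 0" using ae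
    proof eventually_elim
      case (elim x)
      have "(\<lambda>k. P 0 x + (\<Sum>i<k. D i x)) \<longlonglongrightarrow> f x"
        unfolding f_def by (intro tendsto_intros summable_LIMSEQ summable_norm_cancel[OF elim])
      then have "(\<lambda>k. norm (P k x - f x)) \<longlonglongrightarrow> norm (f x - f x)"
        unfolding tel[symmetric] by (intro tendsto_intros)
      then show ?case by simp
    qed
    show "AE x in M. norm (norm (P k x - f x)) \<le> (\<Sum>i. norm (D i x))" for k using ae
    proof eventually_elim
      case (elim x)
      have "f x - P k x = (\<Sum>i. D (i + k) x)"
        unfolding f_def tel[of k x] using suminf_split_initial_segment[OF summable_norm_cancel[OF elim], of k] by simp
      then have "norm (P k x - f x) = norm (\<Sum>i. D (i + k) x)" by (metis norm_minus_commute)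
      also have "\<dots> \<le> (\<Sum>i. norm (D (i + k) x))"
        using elim by (intro summable_norm) (simp add: summable_iff_shift[of "\<lambda>i. norm (D i x)"])
      also have "\<dots> \<le> (\<Sum>i. norm (D i x))"
        using suminf_split_initial_segment[OF elim, of k] by (simp add: sum_nonneg)
      finally show ?case by simp
    qed
  qed auto
  then show thesis using that f by simp
qed

text \<open>The modulus \<open>2 / r\<close> of the first factor persists, so convolving with the
  factor of half-width \<open>q ^ Suc k * r\<close> moves the product by at most
  \<open>2 * q ^ Suc k\<close>. The geometric series gives both existence of the limit and its
  distance from the first factor.\<close>

lemma infinite_fconv_uniform:
  assumes q: "0 < q" "q < 1" and r: "0 < r"
  defines "u \<equiv> \<lambda>s. uniform_density (q ^ s * r)"
  shows "integrable lebesgue (infinite_fconv u)"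
    and "(\<integral>x. norm (infinite_fconv u x - uniform_density r x) \<partial>lebesgue) \<le> 2 * q / (1 - q)"
proof -
  define P where "P = partial_fconv u"
  have rs: "0 < q ^ s * r" for s using q r by simp
  have P: "integrable lborel (P k) \<and> L1_modulus (P k) (2 / r)" for k
  proof (induction k)
    case 0
    show ?case using uniform_density_modulus[OF r] uniform_density_integrable by (simp add: P_def u_def)
  next
    case (Suc k)
    have "P (Suc k) = fconv (P k) (uniform_density (q ^ Suc k * r))" by (simp add: P_def u_def)
    then show ?case using fconv_uniform(1,2)[of "P k" "2 / r", OF _ _ _ rs[of "Suc k"]] Suc r by simp
  qed
  have d: "(\<integral>x. norm (P (Suc k) x - P k x) \<partial>lborel) \<le> 2 * q ^ Suc k" for k
  proof -
    have "P (Suc k) = fconv (P k) (uniform_density (q ^ Suc k * r))" by (simp add: P_def u_def)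
    then have "(\<integral>x. norm (P (Suc k) x - P k x) \<partial>lborel) \<le> 2 / r * (q ^ Suc k * r)"
      using fconv_uniform(3)[of "P k" "2 / r", OF _ _ _ rs[of "Suc k"]] P[of k] r by simp
    also have "\<dots> = 2 * q ^ Suc k" using r by simp
    finally show ?thesis .
  qed
  have s: "summable (\<lambda>k. 2 * q ^ Suc k)" using q by (intro summable_mult summable_Suc_iff[THEN iffD2] summable_geometric) simp
  have Pm: "P k \<in> borel_measurable lborel" for k using P[of k] borel_measurable_integrable by blast
  have Pl: "integrable lebesgue (P k)" for k using P Pm by (simp add: integrable_completion)
  have dl: "(\<integral>x. norm (P (Suc k) x - P k x) \<partial>lebesgue) \<le> 2 * q ^ Suc k" for k
    using d[of k] Pm[of k] Pm[of "Suc k"] by (subst integral_completion) auto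
  obtain f where f: "integrable lebesgue f" "(\<lambda>k. \<integral>x. norm (P k x - f x) \<partial>lebesgue) \<longlonglongrightarrow> 0"
    by (rule L1_series_limit[OF Pl dl s]) (rule that)
  define F where "F = infinite_fconv u"
  \<comment> \<open>\<open>infinite_fconv\<close> is an arbitrary choice among the limits; after
    existence only the properties common to all of them are used.\<close>
  have F: "integrable lebesgue F" "(\<lambda>k. \<integral>x. norm (P k x - F x) \<partial>lebesgue) \<longlonglongrightarrow> 0"
  proof -
    have "integrable lebesgue F \<and> (\<forall>k. integrable lebesgue (partial_fconv u k)) \<and>
      (\<lambda>k. \<integral>x. norm (partial_fconv u k x - F x) \<partial>lebesgue) \<longlonglongrightarrow> 0"
      unfolding F_def infinite_fconv_def
      by (rule someI[where x = f]) (use f Pl in \<open>auto simp: P_def\<close>)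
    then show "integrable lebesgue F" "(\<lambda>k. \<integral>x. norm (P k x - F x) \<partial>lebesgue) \<longlonglongrightarrow> 0" by (auto simp: P_def)
  qed
  have acc: "(\<integral>x. norm (P k x - P 0 x) \<partial>lebesgue) \<le> (\<Sum>i<k. 2 * q ^ Suc i)" for k
  proof (induction k)
    case (Suc k)
    have "(\<integral>x. norm (P (Suc k) x - P 0 x) \<partial>lebesgue) \<le> (\<integral>x. norm (P (Suc k) x - P k x) + norm (P k x - P 0 x) \<partial>lebesgue)"
      by (rule integral_mono) (use Pl norm_triangle_ineq[of "P (Suc k) x - P k x" "P k x - P 0 x" for x] in auto)
    also have "\<dots> = (\<integral>x. norm (P (Suc k) x - P k x) \<partial>lebesgue) + (\<integral>x. norm (P k x - P 0 x) \<partial>lebesgue)"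
      by (rule Bochner_Integration.integral_add) (use Pl in auto)
    finally show ?case using Suc dl[of k] by simp
  qed simp
  have geo: "(\<Sum>i<k. 2 * q ^ Suc i) \<le> 2 * q / (1 - q)" for k
  proof -
    have "(\<Sum>i<k. 2 * q ^ Suc i) \<le> (\<Sum>i. 2 * q ^ Suc i)" using s q by (intro sum_le_suminf) auto
    also have "\<dots> = 2 * q * (\<Sum>i. q ^ i)" using q by (subst suminf_mult[symmetric]) (auto intro: summable_geometric simp: mult.assoc)
    also have "\<dots> = 2 * q / (1 - q)" using q by (simp add: suminf_geometric)
    finally show ?thesis .
  qed
  have le: "(\<integral>x. norm (F x - P 0 x) \<partial>lebesgue) \<le> (\<integral>x. norm (P k x - F x) \<partial>lebesgue) + 2 * q / (1 - q)" for k
  proof -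
    have "(\<integral>x. norm (F x - P 0 x) \<partial>lebesgue) \<le> (\<integral>x. norm (P k x - F x) + norm (P k x - P 0 x) \<partial>lebesgue)"
    proof (rule integral_mono)
      show "norm (F x - P 0 x) \<le> norm (P k x - F x) + norm (P k x - P 0 x)" for x
        using norm_triangle_ineq[of "F x - P k x" "P k x - P 0 x"] by (simp add: norm_minus_commute)
    qed (use Pl F in auto)
    also have "\<dots> = (\<integral>x. norm (P k x - F x) \<partial>lebesgue) + (\<integral>x. norm (P k x - P 0 x) \<partial>lebesgue)"
      by (rule Bochner_Integration.integral_add) (use Pl F in auto)
    finally show ?thesis using acc[of k] geo[of k] by linarith
  qed
  have "(\<lambda>k. (\<integral>x. norm (P k x - F x) \<partial>lebesgue) + 2 * q / (1 - q)) \<longlonglongrightarrow> 0 + 2 * q / (1 - q)"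
    by (intro tendsto_intros F)
  then have "(\<integral>x. norm (F x - P 0 x) \<partial>lebesgue) \<le> 0 + 2 * q / (1 - q)"
    using le by (intro LIMSEQ_le_const) auto
  then show "integrable lebesgue (infinite_fconv u)"
    "(\<integral>x. norm (infinite_fconv u x - uniform_density r x) \<partial>lebesgue) \<le> 2 * q / (1 - q)"
    using F(1) by (auto simp: F_def P_def u_def)
qed

lemma fourier_diff_le:
  assumes f: "integrable lebesgue f" and g: "integrable lebesgue g"
  shows "norm (fourier f t - fourier g t) \<le> (\<integral>x. norm (f x - g x) \<partial>lebesgue)"
proof -
  have [measurable]: "f \<in> borel_measurable lebesgue" "g \<in> borel_measurable lebesgue"
    "(\<lambda>x. cis (- (2 * pi * (x \<bullet> t)))) \<in> borel_measurable lebesgue"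
    using borel_measurable_integrable[OF f] borel_measurable_integrable[OF g]
    by (auto intro!: measurable_completion)
  have i: "integrable lebesgue (\<lambda>x. h x * cis (- 2 * pi * (x \<bullet> t)))"
    if h: "integrable lebesgue h" and [measurable]: "h \<in> borel_measurable lebesgue" for h :: "'a \<Rightarrow> complex"
    by (rule Bochner_Integration.integrable_bound[OF h]) (auto simp: norm_mult)
  have "fourier f t - fourier g t = (\<integral>x. (f x - g x) * cis (- 2 * pi * (x \<bullet> t)) \<partial>lebesgue)"
    unfolding fourier_def left_diff_distrib
    by (rule Bochner_Integration.integral_diff[symmetric]) (use i[OF f] i[OF g] in auto)
  also have "norm \<dots> \<le> (\<integral>x. norm ((f x - g x) * cis (- 2 * pi * (x \<bullet> t))) \<partial>lebesgue)" by (rule integral_norm_bound)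
  finally show ?thesis by (simp add: norm_mult)
qed

lemma uniform_density_dist:
  assumes r: "0 < r" "r \<le> a"
  shows "(\<integral>x. norm (uniform_density r x - uniform_density a x) \<partial>lebesgue) = 2 - 2 * r / a"
proof -
  have i: "integrable lborel (\<lambda>x. indicator {- c..c} x :: real)" for c :: real
    by (simp add: integrable_indicator_iff emeasure_lborel_Icc_eq)
  have "norm (uniform_density r x - uniform_density a x) =
      (1 / (2 * r) - 1 / a) * indicator {- r..r} x + 1 / (2 * a) * indicator {- a..a} x" for x
  proof -
    have "norm (uniform_density r x - uniform_density a x) = \<bar>indicator {- r..r} x / (2 * r) - indicator {- a..a} x / (2 * a)\<bar>"
      using r uniform_density_eq[of r x] uniform_density_eq[of a x] by (simp only: of_real_diff[symmetric] norm_of_real)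
    moreover have "1 / (2 * a) \<le> 1 / (2 * r)" using r by (simp add: frac_le)
    ultimately show ?thesis using r by (auto simp: indicator_def)
  qed
  then have "(\<integral>x. norm (uniform_density r x - uniform_density a x) \<partial>lborel) =
     (\<integral>x. (1 / (2 * r) - 1 / a) * indicator {- r..r} x + 1 / (2 * a) * indicator {- a..a} x \<partial>lborel)" by simp
  also have "\<dots> = (1 / (2 * r) - 1 / a) * (2 * r) + 1 / (2 * a) * (2 * a)"
    using i r by (subst Bochner_Integration.integral_add) auto
  also have "\<dots> = 2 - 2 * r / a" using r by (simp add: field_simps)
  finally show ?thesis by (subst integral_completion) auto
qed

section \<open>The limit Psi and the function Phi\<close>

lemma psi_eq:
  assumes a: "a > 0" and e: "0 < \<epsilon>" "\<epsilon> < 1" and n: "n > 0"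
  shows "psi \<epsilon> {- a..a} n = infinite_fconv (\<lambda>s. uniform_density ((\<epsilon> ^ n) ^ s * ((1 - \<epsilon> ^ n) * a)))"
proof -
  have q: "0 < \<epsilon> ^ n" "\<epsilon> ^ n < 1" using e n by (auto simp: power_less_one_iff)
  have "(\<lambda>x. c * x) ` {- b..b} = {- (c * b)..c * b}" if "c > 0" "b > 0" for b c :: real
    using that by (simp add: image_mult_atLeastAtMost)
  then have "(\<lambda>x. \<epsilon> ^ (n * s) * x) ` shrunk_window \<epsilon> {- a..a} n =
      {- ((\<epsilon> ^ n) ^ s * ((1 - \<epsilon> ^ n) * a))..(\<epsilon> ^ n) ^ s * ((1 - \<epsilon> ^ n) * a)}" for s
    using a e q by (simp add: shrunk_window_def power_mult)
  then show ?thesis unfolding psi_def by simp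
qed

text \<open>With \<open>q = \<epsilon> ^ n\<close>, the function \<open>psi\<close> is within
  \<open>2 * q / (1 - q)\<close> of the uniform density on the shrunk window, and that density is
  within \<open>2 * q\<close> of the one on the full window. The Fourier transform does not increase
  distances from \<open>L1\<close> to the supremum norm, so the convergence is uniform. The
  degenerate index \<open>n = 0\<close> is irrelevant for the limit.\<close>

lemma Psi_eq:
  assumes a: "a > 0" and e: "0 < \<epsilon>" "\<epsilon> < 1"
  shows "Psi \<epsilon> {- a..a} = fourier (uniform_density a)"
proof -
  have bound: "dist (fourier (psi \<epsilon> {- a..a} n) t) (fourier (uniform_density a) t) \<le> 2 * \<epsilon> ^ n / (1 - \<epsilon> ^ n) + 2 * \<epsilon> ^ n"
    if n: "n > 0" for n t
  proof -
    have q: "0 < \<epsilon> ^ n" "\<epsilon> ^ n < 1" using e n by (auto simp: power_less_one_iff)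
    define r where "r = (1 - \<epsilon> ^ n) * a"
    have r: "0 < r" "r \<le> a" using q a by (auto simp: r_def mult_le_cancel_right1)
    note p = infinite_fconv_uniform[OF q r(1), folded psi_eq[OF a e n, folded r_def]]
    have u: "integrable lebesgue (uniform_density c)" for c
      using uniform_density_integrable by (subst integrable_completion) auto
    have "2 - 2 * r / a = 2 * \<epsilon> ^ n" using a by (simp add: r_def field_simps)
    then show ?thesis
      using fourier_diff_le[OF p(1) u[of r], of t] p(2) fourier_diff_le[OF u[of r] u[of a], of t]
        uniform_density_dist[OF r] dist_triangle[of "fourier (psi \<epsilon> {- a..a} n) t" "fourier (uniform_density a) t" "fourier (uniform_density r) t"]
      by (simp add: dist_norm)
  qed
  have lim: "(\<lambda>n. 2 * \<epsilon> ^ n / (1 - \<epsilon> ^ n) + 2 * \<epsilon> ^ n) \<longlonglongrightarrow> 0"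
  proof -
    have "(\<lambda>n. 2 * \<epsilon> ^ n / (1 - \<epsilon> ^ n) + 2 * \<epsilon> ^ n) \<longlonglongrightarrow> 2 * 0 / (1 - 0) + 2 * 0"
      by (intro tendsto_intros LIMSEQ_power_zero) (use e in auto)
    then show ?thesis by simp
  qed
  have ul: "uniform_limit UNIV (\<lambda>n. fourier (psi \<epsilon> {- a..a} n)) (fourier (uniform_density a)) sequentially"
  proof (rule uniform_limitI)
    fix d :: real assume "d > 0"
    then have "\<forall>\<^sub>F n in sequentially. 2 * \<epsilon> ^ n / (1 - \<epsilon> ^ n) + 2 * \<epsilon> ^ n < d"
      using lim by (intro order_tendstoD)
    then show "\<forall>\<^sub>F n in sequentially. \<forall>t\<in>UNIV. dist (fourier (psi \<epsilon> {- a..a} n) t) (fourier (uniform_density a) t) < d"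
      using eventually_gt_at_top[of 0]
    proof eventually_elim
      case (elim n)
      then show ?case using bound[of n] by (meson le_less_trans)
    qed
  qed
  show ?thesis unfolding Psi_def
  proof (rule the_equality)
    show "uniform_limit UNIV (\<lambda>n. fourier (psi \<epsilon> {- a..a} n)) (fourier (uniform_density a)) sequentially" by (rule ul)
  next
    fix P assume P: "uniform_limit UNIV (\<lambda>n. fourier (psi \<epsilon> {- a..a} n)) P sequentially"
    show "P = fourier (uniform_density a)"
    proof
      fix t show "P t = fourier (uniform_density a) t"
        by (rule LIMSEQ_unique[OF tendsto_uniform_limitI[OF P UNIV_I] tendsto_uniform_limitI[OF ul UNIV_I]])
    qed
  qed
qed

text \<open>The factor \<open>fourier ?U (t - y)\<close> is the conjugate transform of a modulated
  density, so Parseval turns the convolution at \<open>t\<close> into an integral of the squared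
  density against a character. The square of the density is \<open>1 / (2 * a)\<close> times the
  density, and the length of the window in \<open>Phi\<close> cancels this factor.\<close>

lemma Phi_eq:
  assumes a: "a > 0" and e: "0 < \<epsilon>" "\<epsilon> < 1"
  shows "Phi \<epsilon> {- a..a} t = fourier (uniform_density a) t"
proof -
  let ?U = "uniform_density a"
  define V where "V x = ?U x * cis (2 * pi * (x * t))" for x
  have [measurable]: "V \<in> borel_measurable borel" unfolding V_def by measurable
  have Vi: "integrable lborel V"
    by (rule Bochner_Integration.integrable_bound[OF uniform_density_integrable[of a]]) (auto simp: V_def norm_mult)
  have cont: "isCont ?U x" if "x \<noteq> a" "x \<noteq> - a" for x
  proof -
    have "frontier {- a..a} = {- a, a}" using a by (simp add: frontier_def)
    then have "isCont (indicator {- a..a} :: real \<Rightarrow> real) x" using that by (simp add: isCont_indicator)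
    then show ?thesis unfolding uniform_density_eq[OF a, abs_def] using a by (intro continuous_intros) auto
  qed
  have N: "{- a, a} \<in> null_sets lborel" by (rule countable_imp_null_set_lborel) simp
  have c1: "AE x in lborel. isCont ?U x" by (rule AE_I'[OF N]) (use cont in blast)
  have c2: "AE x in lborel. isCont V x"
    using c1 by eventually_elim (auto simp: V_def[abs_def] intro!: continuous_intros isCont_o2[of _ _ cis] simp: cis_conv_exp)
  have bd: "norm (?U x) \<le> 1 / (2 * a)" for x
    unfolding norm_uniform_density[OF a] using a by (simp add: indicator_def)
  have bd': "norm (V x) \<le> 1 / (2 * a)" for x using bd by (simp add: V_def norm_mult)
  have reflect: "fourier ?U (t - y) = cnj (fourier V y)" for y
  proof -
    have "cnj (fourier V y) = (\<integral>x. cnj (V x * cis (- 2 * pi * (x \<bullet> y))) \<partial>lborel)"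
      unfolding fourier_lborel[OF \<open>V \<in> borel_measurable borel\<close>] by (rule Bochner_Integration.integral_cnj[symmetric])
    also have "\<dots> = (\<integral>x. ?U x * cis (- 2 * pi * (x \<bullet> (t - y))) \<partial>lborel)"
    proof (rule Bochner_Integration.integral_cong[OF refl])
      fix x
      have "cnj (?U x) = ?U x" unfolding uniform_density_eq[OF a] by simp
      then have "cnj (V x * cis (- 2 * pi * (x \<bullet> y))) = ?U x * (cis (- (2 * pi * (x * t))) * cis (2 * pi * (x * y)))"
        by (simp add: V_def cis_cnj mult.assoc)
      also have "\<dots> = ?U x * cis (- 2 * pi * (x \<bullet> (t - y)))"
        by (simp add: cis_mult algebra_simps)
      finally show "cnj (V x * cis (- 2 * pi * (x \<bullet> y))) = ?U x * cis (- 2 * pi * (x \<bullet> (t - y)))" .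
    qed
    finally show ?thesis unfolding fourier_lborel[OF uniform_density_borel] ..
  qed
  have "fconv (fourier ?U) (fourier ?U) t = (\<integral>y. fourier ?U y * cnj (fourier V y) \<partial>lebesgue)"
    unfolding fconv_def reflect ..
  also have "\<dots> = (\<integral>y. fourier ?U y * cnj (fourier V y) \<partial>lborel)"
    by (rule integral_completion) measurable
  also have "\<dots> = (\<integral>x. ?U x * cnj (V x) \<partial>lborel)"
    by (rule parseval(2)[OF uniform_density_integrable bd c1 Vi bd' c2])
  also have "\<dots> = (\<integral>x. of_real (1 / (2 * a)) * (?U x * cis (- 2 * pi * (x \<bullet> t))) \<partial>lborel)"
  proof (rule Bochner_Integration.integral_cong[OF refl])
    fix x
    have "?U x * cnj (?U x) = of_real (1 / (2 * a)) * ?U x" unfolding uniform_density_eq[OF a] by (simp add: indicator_def)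
    then show "?U x * cnj (V x) = of_real (1 / (2 * a)) * (?U x * cis (- 2 * pi * (x \<bullet> t)))"
      by (simp add: V_def cis_cnj mult.assoc[symmetric])
  qed
  also have "\<dots> = of_real (1 / (2 * a)) * fourier ?U t"
    unfolding fourier_lborel[OF uniform_density_borel] by (rule integral_mult_right_zero)
  finally have "fconv (fourier ?U) (fourier ?U) t = of_real (1 / (2 * a)) * fourier ?U t" .
  moreover have "measure lebesgue {- a..a} = 2 * a" using a by simp
  ultimately show ?thesis unfolding Phi_def Psi_eq[OF a e] using a by simp
qed

section \<open>Weak characterization of dual systems\<close>

definition sqnorm :: "('a::euclidean_space \<Rightarrow> complex) \<Rightarrow> real" where
  "sqnorm f = (\<integral>x. (norm (f x))\<^sup>2 \<partial>lebesgue)"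

lemma sqnorm_nonneg [simp]: "0 \<le> sqnorm f"
  unfolding sqnorm_def by (rule integral_nonneg_AE) simp

lemma Lp_norm_2: "Lp_norm 2 f = sqrt (sqnorm f)"
proof -
  have "norm (f x) powr 2 = (norm (f x))\<^sup>2" for x by simp
  then show ?thesis
    unfolding Lp_norm_def sqnorm_def using sqnorm_nonneg[of f, unfolded sqnorm_def] by (simp add: powr_half_sqrt)
qed

lemma L2D: "f \<in> L2 \<Longrightarrow> f \<in> borel_measurable lebesgue" "f \<in> L2 \<Longrightarrow> integrable lebesgue (\<lambda>x. (norm (f x))\<^sup>2)"
  by (auto simp: L2_def)

lemma L2_scale: "f \<in> L2 \<Longrightarrow> (\<lambda>x. c * f x) \<in> L2"
  by (auto simp: L2_def norm_mult power_mult_distrib)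

lemma norm_add_square_le: "(norm (a + b))\<^sup>2 \<le> 2 * (norm a)\<^sup>2 + 2 * (norm (b::'a::real_normed_vector))\<^sup>2"
proof -
  have "(norm (a + b))\<^sup>2 \<le> (norm a + norm b)\<^sup>2" by (intro power_mono norm_triangle_ineq) simp
  then show ?thesis using zero_le_power2[of "norm a - norm b"] by (simp add: power2_sum power2_diff)
qed

lemma L2_add: assumes "f \<in> L2" "g \<in> L2" shows "(\<lambda>x. f x + g x) \<in> L2"
proof -
  note [measurable] = L2D(1)[OF assms(1)] L2D(1)[OF assms(2)]
  have "integrable lebesgue (\<lambda>x. (norm (f x + g x))\<^sup>2)"
  proof (rule Bochner_Integration.integrable_bound)
    show "integrable lebesgue (\<lambda>x. 2 * (norm (f x))\<^sup>2 + 2 * (norm (g x))\<^sup>2)"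
      using L2D(2)[OF assms(1)] L2D(2)[OF assms(2)] by simp
    show "AE x in lebesgue. norm ((norm (f x + g x))\<^sup>2) \<le> norm (2 * (norm (f x))\<^sup>2 + 2 * (norm (g x))\<^sup>2)"
      by (intro AE_I2) (simp add: norm_add_square_le)
  qed measurable
  then show ?thesis by (simp add: L2_def)
qed

lemma L2_diff: assumes "f \<in> L2" "g \<in> L2" shows "(\<lambda>x. f x - g x) \<in> L2"
  using L2_add[OF assms(1) L2_scale[OF assms(2), of "-1"]] by simp

lemma L2_sum: "finite F \<Longrightarrow> (\<And>j. j \<in> F \<Longrightarrow> f j \<in> L2) \<Longrightarrow> (\<lambda>x. \<Sum>j\<in>F. f j x) \<in> L2"
proof (induction F rule: finite_induct)
  case empty
  show ?case by (simp add: L2_def)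
next
  case (insert j F)
  then show ?case by (simp add: L2_add)
qed

lemma L2_inner_integrable: "f \<in> L2 \<Longrightarrow> g \<in> L2 \<Longrightarrow> integrable lebesgue (\<lambda>x. f x * cnj (g x))"
  by (rule Cauchy_Schwarz_integrable) (auto dest: L2D)

lemma L2_inner_bound: "f \<in> L2 \<Longrightarrow> g \<in> L2 \<Longrightarrow> (norm (L2_inner f g))\<^sup>2 \<le> sqnorm f * sqnorm g"
  unfolding L2_inner_def sqnorm_def
  using Cauchy_Schwarz_integral[of f lebesgue "\<lambda>x. cnj (g x)"] L2D[of f] L2D[of g] by auto

lemma L2_inner_bound': "f \<in> L2 \<Longrightarrow> g \<in> L2 \<Longrightarrow> norm (L2_inner f g) \<le> sqrt (sqnorm f * sqnorm g)"
  using L2_inner_bound by (intro real_le_rsqrt) auto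

lemma L2_inner_self: "L2_inner f f = of_real (sqnorm f)"
  unfolding L2_inner_def sqnorm_def integral_complex_of_real[symmetric] by (simp only: complex_norm_square)

lemma L2_inner_diff_left: "f \<in> L2 \<Longrightarrow> g \<in> L2 \<Longrightarrow> k \<in> L2 \<Longrightarrow>
    L2_inner (\<lambda>x. f x - g x) k = L2_inner f k - L2_inner g k"
  unfolding L2_inner_def left_diff_distrib
  by (intro Bochner_Integration.integral_diff L2_inner_integrable)

lemma L2_inner_diff_right: "f \<in> L2 \<Longrightarrow> g \<in> L2 \<Longrightarrow> k \<in> L2 \<Longrightarrow>
    L2_inner k (\<lambda>x. f x - g x) = L2_inner k f - L2_inner k g"
  unfolding L2_inner_def complex_cnj_diff right_diff_distrib
  by (intro Bochner_Integration.integral_diff L2_inner_integrable)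

lemma L2_inner_commute: "L2_inner f g = cnj (L2_inner g f)"
  unfolding L2_inner_def by (subst Bochner_Integration.integral_cnj[symmetric]) (simp add: mult.commute)

lemma L2_inner_sum_left:
  assumes "finite F" "\<And>j. j \<in> F \<Longrightarrow> d j \<in> L2" "k \<in> L2"
  shows "L2_inner (\<lambda>x. \<Sum>j\<in>F. c j * d j x) k = (\<Sum>j\<in>F. c j * L2_inner (d j) k)"
proof -
  have "L2_inner (\<lambda>x. \<Sum>j\<in>F. c j * d j x) k = (\<integral>x. (\<Sum>j\<in>F. c j * (d j x * cnj (k x))) \<partial>lebesgue)"
    unfolding L2_inner_def sum_distrib_right by (simp add: mult.assoc)
  also have "\<dots> = (\<Sum>j\<in>F. \<integral>x. c j * (d j x * cnj (k x)) \<partial>lebesgue)"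
    by (rule Bochner_Integration.integral_sum) (intro integrable_mult_right L2_inner_integrable assms)
  also have "\<dots> = (\<Sum>j\<in>F. c j * L2_inner (d j) k)" by (simp add: L2_inner_def)
  finally show ?thesis .
qed

section \<open>Continuous functions of compact support and their density\<close>

definition test_functions :: "('a::euclidean_space \<Rightarrow> complex) set" where
  "test_functions = {f. continuous_on UNIV f \<and> (\<exists>R. \<forall>x. norm x > R \<longrightarrow> f x = 0)}"

lemma test_functionD:
  assumes "f \<in> test_functions"
  obtains R B where "R > 0" "B > 0" "\<And>x. norm x > R \<Longrightarrow> f x = 0" "\<And>x. norm (f x) \<le> B" "continuous_on UNIV f"
proof -
  obtain R where R: "\<And>x. norm x > R \<Longrightarrow> f x = 0" and c: "continuous_on UNIV f"
    using assms by (auto simp: test_functions_def)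
  have "compact (f ` cball 0 (max R 1))"
    by (intro compact_continuous_image continuous_on_subset[OF c]) auto
  then obtain B where B: "B > 0" "\<And>y. y \<in> f ` cball 0 (max R 1) \<Longrightarrow> norm y \<le> B"
    using compact_imp_bounded bounded_pos by metis
  have "norm (f x) \<le> B" for x
    using B R[of x] by (cases "norm x \<le> max R 1") auto
  moreover have "f x = 0" if "norm x > max R 1" for x using R that by auto
  ultimately show thesis using that[of "max R 1" B] B c by auto
qed

lemma test_function_borel: "f \<in> test_functions \<Longrightarrow> f \<in> borel_measurable borel"
  by (auto simp: test_functions_def intro: borel_measurable_continuous_onI)

lemma cball_integrable: "integrable lborel (\<lambda>x. c * indicator (cball (a::'a::euclidean_space) R) x :: real)"
  using emeasure_bounded_finite[of "cball a R"] by (intro integrable_mult_right) (simp add: integrable_indicator_iff)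

lemma test_function_L2:
  assumes "f \<in> test_functions" shows "f \<in> L2"
proof -
  obtain R B where RB: "\<And>x. norm x > R \<Longrightarrow> f x = 0" "\<And>x. norm (f x) \<le> B" by (rule test_functionD[OF assms]) blast
  note [measurable] = test_function_borel[OF assms]
  have "integrable lborel (\<lambda>x. (norm (f x))\<^sup>2)"
  proof (rule Bochner_Integration.integrable_bound[OF cball_integrable])
    have "norm ((norm (f x))\<^sup>2) \<le> norm (B\<^sup>2 * indicator (cball 0 R) x)" for x
      using RB(1)[of x] power_mono[OF RB(2)[of x], of 2] by (cases "norm x \<le> R") auto
    then show "AE x in lborel. norm ((norm (f x))\<^sup>2) \<le> norm (B\<^sup>2 * indicator (cball 0 R) x)" by simp
  qed measurable
  then have "integrable lebesgue (\<lambda>x. (norm (f x))\<^sup>2)" by (subst integrable_completion) auto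
  then show ?thesis using test_function_borel[OF assms] by (simp add: L2_def measurable_completion)
qed

lemma test_function_translate:
  assumes "f \<in> test_functions" shows "(\<lambda>x. f (x - a)) \<in> test_functions"
proof -
  obtain R where R: "\<And>x. norm x > R \<Longrightarrow> f x = 0" and c: "continuous_on UNIV f"
    using assms by (auto simp: test_functions_def)
  have "f (x - a) = 0" if "norm x > R + norm a" for x
    using R[of "x - a"] norm_triangle_ineq2[of x a] that by simp
  moreover have "continuous_on UNIV (\<lambda>x. f (x - a))"
    by (rule continuous_on_compose2[OF c]) (auto intro: continuous_intros)
  ultimately show ?thesis unfolding test_functions_def by blast
qed

lemma sqnorm_tendsto_zero:
  fixes s :: "nat \<Rightarrow> 'a::euclidean_space \<Rightarrow> complex"
  assumes "\<And>n. s n \<in> borel_measurable lebesgue" "f \<in> borel_measurable lebesgue"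
    and w: "integrable lebesgue w" and b: "\<And>n x. (norm (f x - s n x))\<^sup>2 \<le> w x"
    and lim: "AE x in lebesgue. (\<lambda>n. s n x) \<longlonglongrightarrow> f x"
  shows "(\<lambda>n. sqnorm (\<lambda>x. f x - s n x)) \<longlonglongrightarrow> 0"
proof -
  note [measurable] = assms(1,2)
  have "(\<lambda>n. \<integral>x. (norm (f x - s n x))\<^sup>2 \<partial>lebesgue) \<longlonglongrightarrow> (\<integral>x. 0 \<partial>(lebesgue :: 'a measure))"
  proof (rule integral_dominated_convergence[OF _ _ w])
    show "AE x in lebesgue. (\<lambda>n. (norm (f x - s n x))\<^sup>2) \<longlonglongrightarrow> 0"
      using lim
    proof eventually_elim
      case (elim x)
      have "(\<lambda>n. (norm (f x - s n x))\<^sup>2) \<longlonglongrightarrow> (norm (f x - f x))\<^sup>2" by (intro tendsto_intros elim)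
      then show ?case by simp
    qed
  qed (use b in auto)
  then show ?thesis by (simp add: sqnorm_def)
qed

text \<open>The function is first truncated in space and in height. The truncation is an almost
  everywhere limit of continuous functions; clipping their values and cutting off their supports
  provides a common dominating function, so the pointwise limit becomes a limit in norm.\<close>

lemma test_functions_dense:
  fixes f :: "'a::euclidean_space \<Rightarrow> complex"
  assumes f: "f \<in> L2" and e: "e > 0"
  obtains k where "k \<in> test_functions" "sqnorm (\<lambda>x. f x - k x) < e"
proof -
  note fm [measurable] = L2D(1)[OF f]
  define s where "s n x = (if norm x \<le> real n \<and> norm (f x) \<le> real n then f x else 0)" for n x
  have sm [measurable]: "s n \<in> borel_measurable lebesgue" for n
  proof -
    have [measurable]: "(\<lambda>x::'a. norm x) \<in> borel_measurable lebesgue" by (rule measurable_completion) simp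
    show ?thesis unfolding s_def by measurable
  qed
  have "(\<lambda>n. sqnorm (\<lambda>x. f x - s n x)) \<longlonglongrightarrow> 0"
  proof (rule sqnorm_tendsto_zero[OF sm fm L2D(2)[OF f]])
    show "(norm (f x - s n x))\<^sup>2 \<le> (norm (f x))\<^sup>2" for n x by (simp add: s_def)
    have "(\<lambda>n. s n x) \<longlonglongrightarrow> f x" for x
    proof (rule tendsto_eventually)
      obtain N where "max (norm x) (norm (f x)) \<le> real N" using real_arch_simple by blast
      then have "s n x = f x" if "n \<ge> N" for n using that by (auto simp: s_def)
      then show "\<forall>\<^sub>F n in sequentially. s n x = f x" using eventually_sequentially by blast
    qed
    then show "AE x in lebesgue. (\<lambda>n. s n x) \<longlonglongrightarrow> f x" by simp
  qed
  then have "\<forall>\<^sub>F n in sequentially. sqnorm (\<lambda>x. f x - s n x) < e / 4"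
    using e by (intro order_tendstoD) auto
  then obtain n where n: "sqnorm (\<lambda>x. f x - s n x) < e / 4" using eventually_happens by fastforce
  define M where "M = real n + 1"
  have M: "M > 0" by (simp add: M_def)
  define v where "v = s n"
  have vb: "norm (v x) \<le> M" and v0: "norm x > M \<Longrightarrow> v x = 0" for x by (auto simp: v_def s_def M_def)
  have vm: "v \<in> borel_measurable lebesgue" unfolding v_def by (rule sm)
  \<comment> \<open>This notion of measurability is by definition an approximation by continuous
    functions off a negligible set, and thus supplies the sequence \<open>g\<close>.\<close>
  have "v measurable_on UNIV"
    using vm by (simp add: measurable_on_iff_borel_measurable lebesgue_on_UNIV_eq)
  then obtain N g where N: "negligible N" and g: "\<And>i. continuous_on UNIV (g i)"
    and lim: "\<And>x. x \<notin> N \<Longrightarrow> (\<lambda>i. g i x) \<longlonglongrightarrow> v x"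
    unfolding measurable_on_def by auto
  \<comment> \<open>Radial projection onto the disk of radius \<open>M\<close>: continuous, bounded
    by \<open>M\<close>, and the identity on the values taken by \<open>v\<close>.\<close>
  define c where "c z = z / of_real (max 1 (norm z / M))" for z :: complex
  have cc: "continuous_on UNIV c" unfolding c_def using M by (intro continuous_intros) (auto simp: max_def)
  have cM: "norm (c z) \<le> M" for z
  proof -
    have "\<bar>max 1 (norm z / M)\<bar> = max 1 (norm z / M)" by simp
    then have "norm (c z) = norm z / max 1 (norm z / M)"
      unfolding c_def norm_divide norm_of_real by (simp only:)
    then show ?thesis using M by (auto simp: max_def field_simps)
  qed
  have c00: "c 0 = 0" by (simp add: c_def)
  have cid: "c z = z" if "norm z \<le> M" for z using that M by (simp add: c_def max_def field_simps)
  \<comment> \<open>A continuous cutoff equal to 1 on the ball of radius \<open>M\<close>, outside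
    of which \<open>v\<close> vanishes, and to 0 beyond radius \<open>M + 1\<close>.\<close>
  define \<theta> where "\<theta> x = max 0 (min 1 (M + 1 - norm x))" for x :: 'a
  have \<theta>c: "continuous_on UNIV \<theta>" unfolding \<theta>_def by (intro continuous_intros)
  have \<theta>1: "0 \<le> \<theta> x" "\<theta> x \<le> 1" for x by (auto simp: \<theta>_def)
  have \<theta>0: "\<theta> x = 0" if "norm x > M + 1" for x using that by (simp add: \<theta>_def)
  define k where "k i x = of_real (\<theta> x) * c (g i x)" for i x
  have kc: "continuous_on UNIV (k i)" for i unfolding k_def
    by (intro continuous_intros \<theta>c continuous_on_compose2[OF cc g]) auto
  have kt: "k i \<in> test_functions" for i
    unfolding test_functions_def using kc \<theta>0 by (auto simp: k_def intro!: exI[of _ "M + 1"])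
  have kb: "norm (k i x) \<le> M" for i x
    using mult_mono[OF \<theta>1(2) cM] M \<theta>1 by (auto simp: k_def norm_mult)
  have "(\<lambda>i. sqnorm (\<lambda>x. v x - k i x)) \<longlonglongrightarrow> 0"
  proof (rule sqnorm_tendsto_zero[OF L2D(1)[OF test_function_L2[OF kt]] vm])
    show "integrable lebesgue (\<lambda>x. (2 * M)\<^sup>2 * indicator (cball 0 (M + 1)) x)"
      by (rule integrable_completion[THEN iffD2, OF _ cball_integrable]) (intro borel_measurable_times borel_measurable_indicator borel_measurable_const, simp)
    show "(norm (v x - k i x))\<^sup>2 \<le> (2 * M)\<^sup>2 * indicator (cball 0 (M + 1)) x" for i x
    proof (cases "norm x \<le> M + 1")
      case True
      have "norm (v x - k i x) \<le> 2 * M" using norm_triangle_ineq4[of "v x" "k i x"] vb[of x] kb[of i x] by linarith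
      then show ?thesis using True power_mono[of "norm (v x - k i x)" "2 * M" 2] by simp
    qed (use v0[of x] \<theta>0[of x] in \<open>auto simp: k_def\<close>)
    have "(\<lambda>i. k i x) \<longlonglongrightarrow> v x" if "x \<notin> N" for x
    proof -
      have "(\<lambda>i. of_real (\<theta> x) * c (g i x)) \<longlonglongrightarrow> of_real (\<theta> x) * c (v x)"
        using continuous_on_tendsto_compose[OF cc lim[OF that]] by (intro tendsto_intros) auto
      moreover have "of_real (\<theta> x) * c (v x) = v x"
        using v0[of x] cid[OF vb] by (cases "norm x > M") (auto simp: \<theta>_def cid c00)
      ultimately show ?thesis by (simp add: k_def)
    qed
    then show "AE x in lebesgue. (\<lambda>i. k i x) \<longlonglongrightarrow> v x"
      using N by (auto simp: negligible_iff_null_sets intro!: AE_I'[of N])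
  qed
  then have "\<forall>\<^sub>F i in sequentially. sqnorm (\<lambda>x. v x - k i x) < e / 4"
    using e by (intro order_tendstoD) auto
  then obtain i where i: "sqnorm (\<lambda>x. v x - k i x) < e / 4" using eventually_happens by fastforce
  have vL: "v \<in> L2"
  proof -
    have "integrable lebesgue (\<lambda>x. (norm (v x))\<^sup>2)"
    proof (rule Bochner_Integration.integrable_bound[OF L2D(2)[OF f]])
      show "(\<lambda>x. (norm (v x))\<^sup>2) \<in> borel_measurable lebesgue" using vm by measurable
      show "AE x in lebesgue. norm ((norm (v x))\<^sup>2) \<le> norm ((norm (f x))\<^sup>2)" by (simp add: v_def s_def)
    qed
    then show ?thesis using vm by (simp add: L2_def)
  qed
  note a1 = L2D(2)[OF L2_diff[OF f vL]] and a2 = L2D(2)[OF L2_diff[OF vL test_function_L2[OF kt]]]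
  have "sqnorm (\<lambda>x. f x - k i x) \<le> 2 * sqnorm (\<lambda>x. f x - v x) + 2 * sqnorm (\<lambda>x. v x - k i x)"
  proof -
    have "sqnorm (\<lambda>x. f x - k i x) \<le> (\<integral>x. 2 * (norm (f x - v x))\<^sup>2 + 2 * (norm (v x - k i x))\<^sup>2 \<partial>lebesgue)"
      unfolding sqnorm_def
    proof (rule integral_mono)
      show "integrable lebesgue (\<lambda>x. (norm (f x - k i x))\<^sup>2)"
        by (rule L2D(2)[OF L2_diff[OF f test_function_L2[OF kt]]])
      show "(norm (f x - k i x))\<^sup>2 \<le> 2 * (norm (f x - v x))\<^sup>2 + 2 * (norm (v x - k i x))\<^sup>2" for x
        using norm_add_square_le[of "f x - v x" "v x - k i x"] by simp
    qed (use a1 a2 in simp)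
    then show ?thesis using a1 a2 by (simp add: sqnorm_def)
  qed
  then have "sqnorm (\<lambda>x. f x - k i x) < e" using n i by (simp add: v_def)
  then show thesis using that kt by blast
qed

lemma zero_by_density:
  assumes lip: "\<And>f k. f \<in> L2 \<Longrightarrow> k \<in> test_functions \<Longrightarrow> norm (\<Psi> f - \<Psi> k) \<le> C * sqrt (sqnorm (\<lambda>x. f x - k x))"
    and zero: "\<And>k. k \<in> test_functions \<Longrightarrow> \<Psi> k = (0::complex)" and C: "C \<ge> 0" and f: "f \<in> L2"
  shows "\<Psi> f = 0"
proof -
  have "norm (\<Psi> f) \<le> 0 + e" if e: "e > 0" for e
  proof -
    have "(e / (C + 1))\<^sup>2 > 0" using e C by simp
    then obtain k where k: "k \<in> test_functions" "sqnorm (\<lambda>x. f x - k x) < (e / (C + 1))\<^sup>2"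
      by (rule test_functions_dense[OF f])
    have "sqrt (sqnorm (\<lambda>x. f x - k x)) \<le> e / (C + 1)"
      using k(2) e C by (intro real_le_lsqrt) auto
    then have "C * sqrt (sqnorm (\<lambda>x. f x - k x)) \<le> C * (e / (C + 1))" using C by (rule mult_left_mono)
    also have "\<dots> \<le> e" using C e by (simp add: field_simps)
    finally show ?thesis using lip[OF f k(1)] zero[OF k(1)] by simp
  qed
  then have "norm (\<Psi> f) \<le> 0" by (rule field_le_epsilon)
  then show ?thesis by simp
qed

section \<open>Bessel sequences and weak duality\<close>

lemma Bessel_l2_bound:
  assumes "Bessel_sequence I e"
  obtains B where "B \<ge> 0" "\<And>f. f \<in> L2 \<Longrightarrow> l2_bound I (B * sqnorm f) (\<lambda>j. L2_inner f (e j))"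
proof -
  obtain B where B: "\<And>f. f \<in> L2 \<Longrightarrow> (\<lambda>j. (norm (L2_inner f (e j)))\<^sup>2) summable_on I \<and>
        (\<Sum>\<^sub>\<infinity>j\<in>I. (norm (L2_inner f (e j)))\<^sup>2) \<le> B * (Lp_norm 2 f)\<^sup>2"
    using assms unfolding Bessel_sequence_def by blast
  show thesis
  proof (rule that[of "\<bar>B\<bar>"])
    fix f :: "'b \<Rightarrow> complex" assume f: "f \<in> L2"
    have "(\<Sum>\<^sub>\<infinity>j\<in>I. (norm (L2_inner f (e j)))\<^sup>2) \<le> B * sqnorm f" using B[OF f] by (simp add: Lp_norm_2)
    also have "\<dots> \<le> \<bar>B\<bar> * sqnorm f" by (intro mult_right_mono) auto
    finally show "l2_bound I (\<bar>B\<bar> * sqnorm f) (\<lambda>j. L2_inner f (e j))"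
      using l2_bound_infsum[OF B[OF f, THEN conjunct1]] unfolding l2_bound_def by (meson order_trans)
  qed simp
qed

text \<open>The weak identity extends from test functions to all of \<open>L2\<close>, one argument
  at a time, because the Bessel bounds make both sides continuous. Norm convergence then follows by
  testing the remainder of a partial sum against itself: its squared norm is a tail of the series,
  which is at most the norm of the remainder times a vanishing tail of coefficients.\<close>

theorem dual_system_iff_weak:
  assumes d: "Bessel_sequence I d" and e: "Bessel_sequence I e"
  shows "dual_system I d e \<longleftrightarrow>
    (\<forall>f\<in>test_functions. \<forall>k\<in>test_functions. (\<Sum>\<^sub>\<infinity>j\<in>I. L2_inner f (e j) * L2_inner (d j) k) = L2_inner f k)"
proof -
  obtain B where B: "B \<ge> 0" "\<And>f. f \<in> L2 \<Longrightarrow> l2_bound I (B * sqnorm f) (\<lambda>j. L2_inner f (e j))"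
    by (rule Bessel_l2_bound[OF e]) (rule that, assumption, blast)
  obtain B' where B': "B' \<ge> 0" "\<And>f. f \<in> L2 \<Longrightarrow> l2_bound I (B' * sqnorm f) (\<lambda>j. L2_inner f (d j))"
    by (rule Bessel_l2_bound[OF d]) (rule that, assumption, blast)
  have dL: "d j \<in> L2" if "j \<in> I" for j using d that by (auto simp: Bessel_sequence_def)
  have eL: "e j \<in> L2" if "j \<in> I" for j using e that by (auto simp: Bessel_sequence_def)
  have b: "l2_bound I (B' * sqnorm k) (\<lambda>j. L2_inner (d j) k)" if "k \<in> L2" for k
    using B'(2)[OF that] by (rule l2_bound_norm_cong) (subst L2_inner_commute, simp)
  define S where "S f k = (\<Sum>\<^sub>\<infinity>j\<in>I. L2_inner f (e j) * L2_inner (d j) k)" for f k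
  have sm: "(\<lambda>j. L2_inner f (e j) * L2_inner (d j) k) summable_on I" if "f \<in> L2" "k \<in> L2" for f k
    by (rule l2_bound_product(2)[OF B(2) b]) fact+
  have Sb: "norm (S f k) \<le> sqrt (B * B') * sqrt (sqnorm f) * sqrt (sqnorm k)" if "f \<in> L2" "k \<in> L2" for f k
    using l2_bound_product(4)[OF B(2)[OF that(1)] b[OF that(2)]] B B'
    unfolding S_def by (simp add: real_sqrt_mult mult_ac)
  have ib: "norm (L2_inner f k) \<le> sqrt (sqnorm f) * sqrt (sqnorm k)" if "f \<in> L2" "k \<in> L2" for f k :: "'b \<Rightarrow> complex"
    using L2_inner_bound'[OF that] by (simp add: real_sqrt_mult)
  have Sl: "S (\<lambda>x. f x - f' x) k = S f k - S f' k" if "f \<in> L2" "f' \<in> L2" "k \<in> L2" for f f' k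
  proof -
    have "S (\<lambda>x. f x - f' x) k = (\<Sum>\<^sub>\<infinity>j\<in>I. L2_inner f (e j) * L2_inner (d j) k - L2_inner f' (e j) * L2_inner (d j) k)"
      unfolding S_def using that eL by (intro infsum_cong) (simp add: L2_inner_diff_left left_diff_distrib)
    also have "\<dots> = S f k - S f' k" unfolding S_def using sm that by (intro infsum_diff) auto
    finally show ?thesis .
  qed
  have Sr: "S f (\<lambda>x. k x - k' x) = S f k - S f k'" if "f \<in> L2" "k \<in> L2" "k' \<in> L2" for f k k'
  proof -
    have "S f (\<lambda>x. k x - k' x) = (\<Sum>\<^sub>\<infinity>j\<in>I. L2_inner f (e j) * L2_inner (d j) k - L2_inner f (e j) * L2_inner (d j) k')"
      unfolding S_def using that dL by (intro infsum_cong) (simp add: L2_inner_diff_right right_diff_distrib)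
    also have "\<dots> = S f k - S f k'" unfolding S_def using sm that by (intro infsum_diff) auto
    finally show ?thesis .
  qed
  define K where "K = sqrt (B * B') + 1"
  have K: "K \<ge> 0" using B B' by (simp add: K_def)
  define E where "E f k = S f k - L2_inner f k" for f k
  have Eb: "norm (E f k) \<le> K * sqrt (sqnorm f) * sqrt (sqnorm k)" if "f \<in> L2" "k \<in> L2" for f k
    using Sb[OF that] ib[OF that] norm_triangle_ineq4[of "S f k" "L2_inner f k"]
    by (simp add: E_def K_def algebra_simps)
  have r_sum: "(\<lambda>t. \<Sum>j\<in>F. L2_inner f (e j) * d j t) \<in> L2" if "finite F" "F \<subseteq> I" for F f
    using that dL by (intro L2_sum L2_scale) auto
  have r_inner: "L2_inner (\<lambda>t. f t - (\<Sum>j\<in>F. L2_inner f (e j) * d j t)) k =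
      L2_inner f k - (\<Sum>j\<in>F. L2_inner f (e j) * L2_inner (d j) k)"
    if "finite F" "F \<subseteq> I" "f \<in> L2" "k \<in> L2" for F f k
    using that dL by (subst L2_inner_diff_left[OF _ r_sum]) (auto intro!: L2_inner_sum_left)
  show ?thesis
  proof
    assume dual: "dual_system I d e"
    show "\<forall>f\<in>test_functions. \<forall>k\<in>test_functions. (\<Sum>\<^sub>\<infinity>j\<in>I. L2_inner f (e j) * L2_inner (d j) k) = L2_inner f k"
    proof (intro ballI)
      fix f k :: "'b \<Rightarrow> complex" assume "f \<in> test_functions" "k \<in> test_functions"
      then have fk: "f \<in> L2" "k \<in> L2" by (auto intro: test_function_L2)
      let ?r = "\<lambda>F t. f t - (\<Sum>j\<in>F. L2_inner f (e j) * d j t)"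
      have lim: "((\<lambda>F. Lp_norm 2 (?r F)) \<longlongrightarrow> 0) (finite_subsets_at_top I)"
        using dual fk by (simp add: dual_system_def)
      have "((\<lambda>F. \<Sum>j\<in>F. L2_inner f (e j) * L2_inner (d j) k) \<longlongrightarrow> L2_inner f k) (finite_subsets_at_top I)"
      proof (rule Lim_null[THEN iffD2], rule Lim_null_comparison)
        show "((\<lambda>F. Lp_norm 2 (?r F) * sqrt (sqnorm k)) \<longlongrightarrow> 0) (finite_subsets_at_top I)"
          using tendsto_mult_right[OF lim, of "sqrt (sqnorm k)"] by simp
        show "\<forall>\<^sub>F F in finite_subsets_at_top I. norm ((\<Sum>j\<in>F. L2_inner f (e j) * L2_inner (d j) k) - L2_inner f k) \<le> Lp_norm 2 (?r F) * sqrt (sqnorm k)"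
        proof (rule eventually_finite_subsets_at_top_weakI)
          fix F assume F: "finite F" "F \<subseteq> I"
          have "norm (L2_inner f k - (\<Sum>j\<in>F. L2_inner f (e j) * L2_inner (d j) k)) \<le> Lp_norm 2 (?r F) * sqrt (sqnorm k)"
            unfolding r_inner[OF F fk, symmetric] Lp_norm_2 by (intro ib L2_diff fk r_sum F)
          then show "norm ((\<Sum>j\<in>F. L2_inner f (e j) * L2_inner (d j) k) - L2_inner f k) \<le> Lp_norm 2 (?r F) * sqrt (sqnorm k)"
            by (simp only: norm_minus_commute)
        qed
      qed
      then show "(\<Sum>\<^sub>\<infinity>j\<in>I. L2_inner f (e j) * L2_inner (d j) k) = L2_inner f k"
        by (intro infsumI) (simp add: has_sum_def)
    qed
  next
    assume *: "\<forall>f\<in>test_functions. \<forall>k\<in>test_functions. (\<Sum>\<^sub>\<infinity>j\<in>I. L2_inner f (e j) * L2_inner (d j) k) = L2_inner f k"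
    have E1: "E f k = 0" if f: "f \<in> test_functions" and k: "k \<in> L2" for f k
    proof (rule zero_by_density[where C = "K * sqrt (sqnorm f)", OF _ _ _ k])
      note fL = test_function_L2[OF f]
      show "norm (E f k - E f k') \<le> K * sqrt (sqnorm f) * sqrt (sqnorm (\<lambda>x. k x - k' x))"
        if "k \<in> L2" "k' \<in> test_functions" for k k'
      proof -
        note k'L = test_function_L2[OF that(2)]
        have "E f k - E f k' = E f (\<lambda>x. k x - k' x)"
          unfolding E_def Sr[OF fL that(1) k'L] L2_inner_diff_right[OF that(1) k'L fL] by simp
        then show ?thesis using Eb[OF fL L2_diff[OF that(1) k'L]] by simp
      qed
      show "E f k = 0" if "k \<in> test_functions" for k using * f that by (simp add: E_def S_def)
      show "0 \<le> K * sqrt (sqnorm f)" using K by simp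
    qed
    have E2: "E f k = 0" if f: "f \<in> L2" and k: "k \<in> L2" for f k
    proof (rule zero_by_density[where C = "K * sqrt (sqnorm k)" and \<Psi> = "\<lambda>f. E f k", OF _ _ _ f])
      show "norm (E f k - E f' k) \<le> K * sqrt (sqnorm k) * sqrt (sqnorm (\<lambda>x. f x - f' x))"
        if "f \<in> L2" "f' \<in> test_functions" for f f'
      proof -
        note f'L = test_function_L2[OF that(2)]
        have "E f k - E f' k = E (\<lambda>x. f x - f' x) k"
          unfolding E_def Sl[OF that(1) f'L k] L2_inner_diff_left[OF that(1) f'L k] by simp
        then show ?thesis using Eb[OF L2_diff[OF that(1) f'L] k] by (simp add: mult_ac)
      qed
      show "E f k = 0" if "f \<in> test_functions" for f using E1[OF that k] .
      show "0 \<le> K * sqrt (sqnorm k)" using K by simp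
    qed
    show "dual_system I d e"
      unfolding dual_system_def
    proof
      fix f :: "'b \<Rightarrow> complex" assume f: "f \<in> L2"
      let ?r = "\<lambda>F t. f t - (\<Sum>j\<in>F. L2_inner f (e j) * d j t)"
      let ?a = "\<lambda>j. (norm (L2_inner f (e j)))\<^sup>2"
      have sa: "?a summable_on I" by (rule l2_bound_summable(1)[OF B(2)[OF f]])
      have bound: "Lp_norm 2 (?r F) \<le> sqrt ((infsum ?a I - sum ?a F) * B')" if F: "finite F" "F \<subseteq> I" for F
      proof -
        have rL: "?r F \<in> L2" by (intro L2_diff f r_sum F)
        define b where "b j = L2_inner (d j) (?r F)" for j
        have sF: "(\<lambda>j. L2_inner f (e j) * b j) summable_on I" unfolding b_def by (rule sm[OF f rL])
        \<comment> \<open>The weak identity with the remainder itself as second argument.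
          Cauchy-Schwarz on the tail leaves one factor equal to the norm of the remainder, which is
          then cancelled.\<close>
        have "L2_inner (?r F) (?r F) = S f (?r F) - (\<Sum>j\<in>F. L2_inner f (e j) * b j)"
          using E2[OF f rL] unfolding b_def r_inner[OF F f rL] by (simp add: E_def)
        also have "\<dots> = (\<Sum>\<^sub>\<infinity>j\<in>I - F. L2_inner f (e j) * b j)"
          using infsum_Diff[OF sF, of F] F by (simp add: S_def b_def summable_on_finite)
        finally have eq: "complex_of_real (sqnorm (?r F)) = (\<Sum>\<^sub>\<infinity>j\<in>I - F. L2_inner f (e j) * b j)"
          by (simp only: L2_inner_self)
        have s': "?a summable_on (I - F)" using sa by (rule summable_on_subset_banach) auto
        have la: "l2_bound (I - F) (infsum ?a I - sum ?a F) (\<lambda>j. L2_inner f (e j))"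
          using l2_bound_infsum[OF s'] infsum_Diff[OF sa, of F] F by (simp add: summable_on_finite)
        have lb: "l2_bound (I - F) (B' * sqnorm (?r F)) b"
          using b[OF rL] unfolding l2_bound_def b_def by blast
        have "sqnorm (?r F) \<le> sqrt ((infsum ?a I - sum ?a F) * (B' * sqnorm (?r F)))"
          using l2_bound_product(4)[OF la lb] unfolding eq[symmetric] by simp
        also have "\<dots> = sqrt ((infsum ?a I - sum ?a F) * B') * sqrt (sqnorm (?r F))"
          by (simp add: real_sqrt_mult[symmetric] mult.assoc)
        finally have "sqrt (sqnorm (?r F)) * sqrt (sqnorm (?r F)) \<le> sqrt ((infsum ?a I - sum ?a F) * B') * sqrt (sqnorm (?r F))"
          by simp
        moreover have "0 \<le> sqrt ((infsum ?a I - sum ?a F) * B')" using l2_bound_nonneg[OF la] B' by simp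
        moreover have "y \<le> x" if "y * y \<le> x * y" "0 \<le> x" "0 \<le> y" for x y :: real
          using that by (cases "y = 0") (auto simp: mult_le_cancel_right)
        ultimately have "sqrt (sqnorm (?r F)) \<le> sqrt ((infsum ?a I - sum ?a F) * B')"
          by (meson real_sqrt_ge_zero sqnorm_nonneg)
        then show ?thesis by (simp add: Lp_norm_2)
      qed
      have "((\<lambda>F. sum ?a F) \<longlongrightarrow> infsum ?a I) (finite_subsets_at_top I)"
        using has_sum_infsum[OF sa] by (simp add: has_sum_def)
      then have "((\<lambda>F. sqrt ((infsum ?a I - sum ?a F) * B')) \<longlongrightarrow> sqrt ((infsum ?a I - infsum ?a I) * B')) (finite_subsets_at_top I)"
        by (intro tendsto_intros)
      then have lim: "((\<lambda>F. sqrt ((infsum ?a I - sum ?a F) * B')) \<longlongrightarrow> 0) (finite_subsets_at_top I)" by simp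
      show "((\<lambda>F. Lp_norm 2 (?r F)) \<longlongrightarrow> 0) (finite_subsets_at_top I)"
      proof (rule Lim_null_comparison[OF _ lim], rule eventually_finite_subsets_at_top_weakI)
        fix F assume F: "finite F" "F \<subseteq> I"
        have "norm (Lp_norm 2 (?r F)) = Lp_norm 2 (?r F)" by (simp add: Lp_norm_2)
        then show "norm (Lp_norm 2 (?r F)) \<le> sqrt ((infsum ?a I - sum ?a F) * B')" using bound[OF F] by simp
      qed
    qed
  qed
qed

section \<open>Correlations with Gabor elements\<close>

lemma correlation_fourier:
  fixes f u :: "'a::euclidean_space \<Rightarrow> complex"
  assumes f: "integrable lborel f" and u: "integrable lborel u"
  defines "P \<equiv> \<lambda>y. \<integral>t. f t * cnj (u (t - y)) \<partial>lborel"
  shows "integrable lborel P" and "fourier P \<omega> = fourier f \<omega> * cnj (fourier u \<omega>)"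
proof -
  have mf [measurable]: "f \<in> borel_measurable borel" and mu [measurable]: "u \<in> borel_measurable borel"
    using borel_measurable_integrable[OF f] borel_measurable_integrable[OF u] by auto
  have iu: "integrable lborel (\<lambda>y. u (t - y))" for t using lborel_integrable_shift(3)[OF mu] u by simp
  have iu': "integrable lborel (\<lambda>y. f t * cnj (u (t - y)))" for t
    using integrable_mult_right[OF integrable_cnj[OF iu]] .
  have n0: "(\<integral>y. norm (u (t - y)) \<partial>lborel) = (\<integral>y. norm (u y) \<partial>lborel)" for t
    by (rule lborel_integral_shift(3)) measurable
  have nu: "(\<integral>y. norm (f t * cnj (u (t - y))) \<partial>lborel) = norm (f t) * (\<integral>y. norm (u y) \<partial>lborel)" for t
    by (simp add: norm_mult n0)
  \<comment> \<open>The unimodular factor \<open>v\<close> covers two uses: \<open>v = 1\<close> for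
    the integrability of \<open>P\<close>, and the character at \<omega> for exchanging the
    integrals in its transform.\<close>
  have prod: "integrable (lborel \<Otimes>\<^sub>M lborel) (\<lambda>(t, y). f t * cnj (u (t - y)) * v y)"
    if v [measurable]: "v \<in> borel_measurable borel" and v1: "\<And>y. norm (v y) = 1" for v :: "'a \<Rightarrow> complex"
  proof (rule lborel_pair.Fubini_integrable)
    show "(\<lambda>(t, y). f t * cnj (u (t - y)) * v y) \<in> borel_measurable (lborel \<Otimes>\<^sub>M lborel)" by measurable
    show "integrable lborel (\<lambda>t. \<integral>y. norm (case (t, y) of (t, y) \<Rightarrow> f t * cnj (u (t - y)) * v y) \<partial>lborel)"
      using f by (simp add: norm_mult n0 v1)
    show "AE t in lborel. integrable lborel (\<lambda>y. case (t, y) of (t, y) \<Rightarrow> f t * cnj (u (t - y)) * v y)"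
    proof (rule AE_I2, simp only: prod.case)
      fix t show "integrable lborel (\<lambda>y. f t * cnj (u (t - y)) * v y)"
        by (rule Bochner_Integration.integrable_bound[OF iu'[of t]]) (auto simp: norm_mult v1)
    qed
  qed
  show "integrable lborel P"
    unfolding P_def using lborel_pair.integrable_snd[OF prod[of "\<lambda>_. 1"]] by simp
  then have mP: "P \<in> borel_measurable borel" using borel_measurable_integrable by fastforce
  let ?v = "\<lambda>y. cis (- 2 * pi * (y \<bullet> \<omega>))"
  have "fourier P \<omega> = (\<integral>y. (\<integral>t. f t * cnj (u (t - y)) * ?v y \<partial>lborel) \<partial>lborel)"
    unfolding fourier_lborel[OF mP] unfolding P_def by simp
  also have "\<dots> = (\<integral>t. (\<integral>y. f t * cnj (u (t - y)) * ?v y \<partial>lborel) \<partial>lborel)"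
    by (rule lborel_pair.Fubini_integral) (rule prod, auto)
  also have "\<dots> = (\<integral>t. f t * cis (- 2 * pi * (t \<bullet> \<omega>)) * cnj (fourier u \<omega>) \<partial>lborel)"
  proof (rule Bochner_Integration.integral_cong[OF refl])
    fix t
    have "(\<integral>y. cnj (u (t - y)) * ?v y \<partial>lborel) = (\<integral>s. cnj (u (t - (t - s))) * ?v (t - s) \<partial>lborel)"
      by (rule lborel_integral_shift(3)[symmetric]) measurable
    also have "\<dots> = (\<integral>s. cis (- 2 * pi * (t \<bullet> \<omega>)) * cnj (u s * cis (- 2 * pi * (s \<bullet> \<omega>))) \<partial>lborel)"
    proof (rule Bochner_Integration.integral_cong[OF refl])
      fix s
      have "?v (t - s) = cis (- 2 * pi * (t \<bullet> \<omega>)) * cis (2 * pi * (s \<bullet> \<omega>))"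
        by (simp add: cis_mult inner_diff_left algebra_simps)
      then show "cnj (u (t - (t - s))) * ?v (t - s) = cis (- 2 * pi * (t \<bullet> \<omega>)) * cnj (u s * cis (- 2 * pi * (s \<bullet> \<omega>)))"
        by (simp add: cis_cnj)
    qed
    also have "\<dots> = cis (- 2 * pi * (t \<bullet> \<omega>)) * cnj (fourier u \<omega>)"
      unfolding fourier_lborel[OF mu] by (simp only: integral_mult_right_zero Bochner_Integration.integral_cnj)
    finally have e: "(\<integral>y. cnj (u (t - y)) * ?v y \<partial>lborel) = cis (- 2 * pi * (t \<bullet> \<omega>)) * cnj (fourier u \<omega>)" .
    have "(\<integral>y. f t * cnj (u (t - y)) * ?v y \<partial>lborel) = (\<integral>y. f t * (cnj (u (t - y)) * ?v y) \<partial>lborel)"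
      by (rule Bochner_Integration.integral_cong[OF refl]) (rule mult.assoc)
    also have "\<dots> = f t * (\<integral>y. cnj (u (t - y)) * ?v y \<partial>lborel)" by (rule integral_mult_right_zero)
    also have "\<dots> = f t * (cis (- 2 * pi * (t \<bullet> \<omega>)) * cnj (fourier u \<omega>))" unfolding e ..
    also have "\<dots> = f t * cis (- 2 * pi * (t \<bullet> \<omega>)) * cnj (fourier u \<omega>)" by (rule mult.assoc[symmetric])
    finally show "(\<integral>y. f t * cnj (u (t - y)) * ?v y \<partial>lborel) = f t * cis (- 2 * pi * (t \<bullet> \<omega>)) * cnj (fourier u \<omega>)" .
  qed
  also have "\<dots> = fourier f \<omega> * cnj (fourier u \<omega>)"
    unfolding fourier_lborel[OF mf] by (rule integral_mult_left_zero)
  finally show "fourier P \<omega> = fourier f \<omega> * cnj (fourier u \<omega>)" .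
qed

lemma fourier_modulate:
  assumes [measurable]: "u \<in> borel_measurable borel"
  shows "fourier (\<lambda>t. u t * cis (2 * pi * (\<beta> \<bullet> t))) \<omega> = fourier u (\<omega> - \<beta>)"
proof -
  have m: "(\<lambda>t. u t * cis (2 * pi * (\<beta> \<bullet> t))) \<in> borel_measurable borel" by measurable
  have eq: "u t * cis (2 * pi * (\<beta> \<bullet> t)) * cis (- 2 * pi * (t \<bullet> \<omega>)) = u t * cis (- 2 * pi * (t \<bullet> (\<omega> - \<beta>)))" for t
    by (simp add: mult.assoc cis_mult inner_diff_right inner_commute[of \<beta>] algebra_simps)
  show ?thesis unfolding fourier_lborel[OF m] fourier_lborel[OF assms] eq ..
qed

lemma test_function_bounds:
  assumes "f \<in> test_functions"
  shows "\<exists>R B. R > 0 \<and> B > 0 \<and> (\<forall>x. norm x > R \<longrightarrow> f x = 0) \<and> (\<forall>x. norm (f x) \<le> B) \<and> continuous_on UNIV f"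
proof (rule test_functionD[OF assms])
  fix R B :: real
  assume "R > 0" "B > 0" "\<And>x. norm x > R \<Longrightarrow> f x = 0" "\<And>x. norm (f x) \<le> B" "continuous_on UNIV f"
  then show ?thesis by blast
qed

lemma test_function_props:
  assumes "f \<in> test_functions"
  shows "f \<in> borel_measurable borel" and "integrable lborel f" and "\<And>x. isCont f x"
    and "integrable lborel (\<lambda>w. (norm (fourier f w))\<^sup>2)"
proof -
  obtain R B where RB: "R > 0" "B > 0" "\<And>x. norm x > R \<Longrightarrow> f x = 0" "\<And>x. norm (f x) \<le> B" "continuous_on UNIV f"
    using test_function_bounds[OF assms] by auto
  show [measurable]: "f \<in> borel_measurable borel" by (rule test_function_borel[OF assms])
  show i: "integrable lborel f"
  proof (rule Bochner_Integration.integrable_bound[OF cball_integrable])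
    have "norm (f x) \<le> norm (B * indicator (cball 0 R) x)" for x
      using RB(2) RB(3)[of x] RB(4)[of x] by (cases "norm x \<le> R") auto
    then show "AE x in lborel. norm (f x) \<le> norm (B * indicator (cball 0 R) x)" by simp
  qed measurable
  show c: "isCont f x" for x using RB(5) by (simp add: continuous_on_eq_continuous_at)
  show "integrable lborel (\<lambda>w. (norm (fourier f w))\<^sup>2)"
    by (rule plancherel_integrable[OF i RB(4)]) (simp add: c)
qed

lemma test_function_modulate_scale:
  assumes "f \<in> test_functions" and e: "\<epsilon> > 0"
  shows "(\<lambda>t. f (\<epsilon> *\<^sub>R t) * cis (2 * pi * (\<beta> \<bullet> t))) \<in> test_functions"
proof -
  obtain R where R: "\<And>x. norm x > R \<Longrightarrow> f x = 0" and c: "continuous_on UNIV f"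
    using assms by (auto simp: test_functions_def)
  have "f (\<epsilon> *\<^sub>R t) = 0" if "norm t > R / \<epsilon>" for t
    using R[of "\<epsilon> *\<^sub>R t"] that e by (simp add: pos_divide_less_eq mult.commute)
  moreover have "continuous_on UNIV (\<lambda>t. f (\<epsilon> *\<^sub>R t) * cis (2 * pi * (\<beta> \<bullet> t)))"
    unfolding cis_conv_exp
    by (intro continuous_intros continuous_on_compose2[OF c]) auto
  ultimately show ?thesis unfolding test_functions_def by auto
qed

lemma fourier_scale:
  fixes f :: "'a::euclidean_space \<Rightarrow> complex"
  assumes [measurable]: "f \<in> borel_measurable borel" and e: "\<epsilon> > 0"
  shows "fourier (\<lambda>t. f (\<epsilon> *\<^sub>R t)) \<omega> = of_real (inverse (\<epsilon> ^ DIM('a))) * fourier f (\<omega> /\<^sub>R \<epsilon>)"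
proof -
  have "fourier f (\<omega> /\<^sub>R \<epsilon>) = \<bar>\<epsilon>\<bar> ^ DIM('a) *\<^sub>R (\<integral>x. f (0 + \<epsilon> *\<^sub>R x) * cis (- 2 * pi * ((0 + \<epsilon> *\<^sub>R x) \<bullet> (\<omega> /\<^sub>R \<epsilon>))) \<partial>lborel)"
    unfolding fourier_lborel[OF assms(1)] by (rule lborel_integral_affine) (use e in auto)
  also have "(\<integral>x. f (0 + \<epsilon> *\<^sub>R x) * cis (- 2 * pi * ((0 + \<epsilon> *\<^sub>R x) \<bullet> (\<omega> /\<^sub>R \<epsilon>))) \<partial>lborel) = fourier (\<lambda>t. f (\<epsilon> *\<^sub>R t)) \<omega>"
    using e by (subst fourier_lborel) (auto simp flip: mult.assoc)
  finally show ?thesis using e by (simp add: scaleR_conv_of_real mult.assoc[symmetric])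
qed

text \<open>Testing against dilated and modulated bumps concentrates the weight at a prescribed frequency.\<close>

lemma continuous_zero_by_testing:
  fixes W :: "'a::euclidean_space \<Rightarrow> complex"
  assumes cont: "\<And>\<omega>. isCont W \<omega>" and bd: "\<And>\<omega>. norm (W \<omega>) \<le> K"
    and test: "\<And>f k. f \<in> test_functions \<Longrightarrow> k \<in> test_functions \<Longrightarrow>
      (\<integral>\<omega>. fourier f \<omega> * cnj (fourier k (\<omega> - \<xi>)) * W \<omega> \<partial>lborel) = 0"
  shows "W \<omega>0 = 0"
proof -
  have Wm [measurable]: "W \<in> borel_measurable borel"
    using cont by (intro borel_measurable_continuous_onI) (simp add: continuous_on_eq_continuous_at)
  \<comment> \<open>A tent function. Only its continuity, compact support, the bound 1 and a nonzero
    norm enter.\<close>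
  define \<phi> :: "'a \<Rightarrow> complex" where "\<phi> x = of_real (max 0 (1 - norm x))" for x
  have \<phi>: "\<phi> \<in> test_functions"
    unfolding test_functions_def \<phi>_def by (auto intro!: continuous_intros exI[of _ 1])
  note p = test_function_props[OF \<phi>]
  note [measurable] = p(1)
  have n\<phi>: "norm (\<phi> x) = max 0 (1 - norm x)" for x unfolding \<phi>_def norm_of_real by simp
  have b1: "norm (\<phi> x) \<le> 1" for x by (simp add: n\<phi>)
  define w where "w v = fourier \<phi> v * cnj (fourier \<phi> v)" for v
  have wi: "integrable lborel w" unfolding w_def
    by (rule parseval(1)[OF p(2) b1 _ p(2) b1]) (simp_all add: p(3))
  have wint: "(\<integral>v. w v \<partial>lborel) = (\<integral>x. \<phi> x * cnj (\<phi> x) \<partial>lborel)" unfolding w_def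
    by (rule parseval(2)[OF p(2) b1 _ p(2) b1]) (simp_all add: p(3))
  have [measurable]: "w \<in> borel_measurable borel" using borel_measurable_integrable[OF wi] by simp
  have pos: "(\<integral>x. \<phi> x * cnj (\<phi> x) \<partial>lborel) \<noteq> 0"
  proof -
    have e: "\<phi> x * cnj (\<phi> x) = of_real ((norm (\<phi> x))\<^sup>2)" for x by (simp only: complex_norm_square)
    have i2: "integrable lborel (\<lambda>x. (norm (\<phi> x))\<^sup>2)"
      by (rule Bochner_Integration.integrable_bound[OF p(2)]) (use b1 in \<open>auto simp: power2_eq_square mult_left_le\<close>)
    have ib: "integrable lborel (\<lambda>x. (1/4) * indicator (cball (0::'a) (1/2)) x :: real)" by (rule cball_integrable)
    have le: "(1/4) * indicator (cball (0::'a) (1/2)) x \<le> (norm (\<phi> x))\<^sup>2" for x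
    proof (cases "norm x \<le> 1/2")
      case True
      then have "(1/2)\<^sup>2 \<le> (norm (\<phi> x))\<^sup>2" by (intro power_mono) (auto simp: n\<phi>)
      then show ?thesis using True by (simp add: power2_eq_square)
    qed simp
    have "0 < (1/4) * measure lborel (cball (0::'a) (1/2))" by (simp add: content_cball_pos)
    also have "\<dots> = (\<integral>x. (1/4) * indicator (cball (0::'a) (1/2)) x \<partial>lborel)" by simp
    also have "\<dots> \<le> (\<integral>x. (norm (\<phi> x))\<^sup>2 \<partial>lborel)" by (rule integral_mono[OF ib i2 le])
    finally show ?thesis unfolding e integral_complex_of_real by simp
  qed
  have zero: "(\<integral>v. w v * W (\<omega>0 + \<epsilon> *\<^sub>R v) \<partial>lborel) = 0" if e: "\<epsilon> > 0" for \<epsilon>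
  proof -
    \<comment> \<open>The bump for \<open>f\<close> is modulated to \<open>\<omega>0\<close> and the
      one for \<open>k\<close> to \<open>\<omega>0 - \<xi>\<close>. The shift by \<xi> in the test
      integral aligns them, so the product of their transforms is a positive multiple of
      \<open>w\<close> rescaled around \<open>\<omega>0\<close>, and the mass of \<open>w\<close> is
      the squared norm of \<phi>.\<close>
    define f where "f = (\<lambda>t. \<phi> (\<epsilon> *\<^sub>R t) * cis (2 * pi * (\<omega>0 \<bullet> t)))"
    define k where "k = (\<lambda>t. \<phi> (\<epsilon> *\<^sub>R t) * cis (2 * pi * ((\<omega>0 - \<xi>) \<bullet> t)))"
    define c where "c = complex_of_real (inverse (\<epsilon> ^ DIM('a)))"
    have c0: "c \<noteq> 0" using e by (simp add: c_def)
    have fk: "f \<in> test_functions" "k \<in> test_functions" unfolding f_def k_def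
      by (intro test_function_modulate_scale[OF \<phi> e])+
    have ff: "fourier f \<omega> = c * fourier \<phi> ((\<omega> - \<omega>0) /\<^sub>R \<epsilon>)" for \<omega>
      unfolding f_def c_def using e by (subst fourier_modulate) (auto simp: fourier_scale)
    have kk: "fourier k (\<omega> - \<xi>) = c * fourier \<phi> ((\<omega> - \<omega>0) /\<^sub>R \<epsilon>)" for \<omega>
      unfolding k_def c_def using e by (subst fourier_modulate) (auto simp: fourier_scale algebra_simps)
    have "fourier f \<omega> * cnj (fourier k (\<omega> - \<xi>)) * W \<omega> = (c * cnj c) * (w ((\<omega> - \<omega>0) /\<^sub>R \<epsilon>) * W \<omega>)" for \<omega>
      unfolding ff kk w_def by simp
    then have "(c * cnj c) * (\<integral>\<omega>. w ((\<omega> - \<omega>0) /\<^sub>R \<epsilon>) * W \<omega> \<partial>lborel) = 0"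
      using test[OF fk] by (simp only: integral_mult_right_zero)
    then have "(\<integral>\<omega>. w ((\<omega> - \<omega>0) /\<^sub>R \<epsilon>) * W \<omega> \<partial>lborel) = 0" using c0 by simp
    moreover have "(\<integral>\<omega>. w ((\<omega> - \<omega>0) /\<^sub>R \<epsilon>) * W \<omega> \<partial>lborel) = \<bar>\<epsilon>\<bar> ^ DIM('a) *\<^sub>R
        (\<integral>v. w ((\<omega>0 + \<epsilon> *\<^sub>R v - \<omega>0) /\<^sub>R \<epsilon>) * W (\<omega>0 + \<epsilon> *\<^sub>R v) \<partial>lborel)"
      by (rule lborel_integral_affine) (use e in auto)
    ultimately show ?thesis using e by simp
  qed
  have "(\<lambda>n. \<integral>v. w v * W (\<omega>0 + (1 / real (Suc n)) *\<^sub>R v) \<partial>lborel) \<longlonglongrightarrow> (\<integral>v. w v * W \<omega>0 \<partial>lborel)"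
  proof (rule integral_dominated_convergence)
    show "integrable lborel (\<lambda>v. norm (w v) * K)" using wi by auto
    show "AE v in lborel. (\<lambda>n. w v * W (\<omega>0 + (1 / real (Suc n)) *\<^sub>R v)) \<longlonglongrightarrow> w v * W \<omega>0"
    proof (rule AE_I2)
      fix v
      have "(\<lambda>n. \<omega>0 + (1 / real (Suc n)) *\<^sub>R v) \<longlonglongrightarrow> \<omega>0 + 0 *\<^sub>R v"
        by (intro tendsto_intros lim_1_over_n[THEN LIMSEQ_Suc])
      then have "(\<lambda>n. W (\<omega>0 + (1 / real (Suc n)) *\<^sub>R v)) \<longlonglongrightarrow> W \<omega>0"
        using isCont_tendsto_compose[OF cont] by simp
      then show "(\<lambda>n. w v * W (\<omega>0 + (1 / real (Suc n)) *\<^sub>R v)) \<longlonglongrightarrow> w v * W \<omega>0" by (intro tendsto_intros)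
    qed
    show "AE v in lborel. norm (w v * W (\<omega>0 + (1 / real (Suc n)) *\<^sub>R v)) \<le> norm (w v) * K" for n
      using bd by (auto simp: norm_mult intro!: mult_left_mono)
  qed measurable
  then have "(\<integral>v. w v * W \<omega>0 \<partial>lborel) = 0" using zero by (simp add: LIMSEQ_const_iff)
  then have "(\<integral>v. w v \<partial>lborel) * W \<omega>0 = 0" by (simp only: integral_mult_left_zero)
  then show ?thesis using pos unfolding wint by simp
qed

section \<open>Correlations and their square sums\<close>

definition correlation :: "('a::euclidean_space \<Rightarrow> complex) \<Rightarrow> ('a \<Rightarrow> complex) \<Rightarrow> 'a \<Rightarrow> 'a \<Rightarrow> complex" where
  "correlation f g y \<beta> = L2_inner f (transl y (modul \<beta> g))"

text \<open>Two readings of one integral. As a function of \<open>y\<close> it is a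
  cross-correlation, whose transform is a product; as a function of \<beta> it is, up to
  conjugation, a trigonometric coefficient of a compactly supported function, to which local
  sampling applies when \<open>f\<close> is a test function.\<close>

lemma correlation_eq:
  assumes [measurable]: "f \<in> borel_measurable borel" "g \<in> borel_measurable borel"
  shows "correlation f g y \<beta> = (\<integral>t. f t * cnj (g (t - y) * cis (2 * pi * (\<beta> \<bullet> (t - y)))) \<partial>lborel)"
    and "correlation f g y \<beta> = cnj (\<integral>t. (cnj (f (t + y)) * g t) * cis (2 * pi * (\<beta> \<bullet> t)) \<partial>lborel)"
proof -
  show 1: "correlation f g y \<beta> = (\<integral>t. f t * cnj (g (t - y) * cis (2 * pi * (\<beta> \<bullet> (t - y)))) \<partial>lborel)"
    unfolding correlation_def L2_inner_def transl_def modul_def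
    by (subst integral_completion) (auto simp: mult.commute)
  also have "\<dots> = (\<integral>t. f (t + y) * cnj (g (t + y - y) * cis (2 * pi * (\<beta> \<bullet> (t + y - y)))) \<partial>lborel)"
    by (rule lborel_integral_shift(1)[symmetric]) measurable
  also have "\<dots> = cnj (\<integral>t. (cnj (f (t + y)) * g t) * cis (2 * pi * (\<beta> \<bullet> t)) \<partial>lborel)"
    by (subst Bochner_Integration.integral_cnj[symmetric]) (simp add: mult.assoc)
  finally show "correlation f g y \<beta> = cnj (\<integral>t. (cnj (f (t + y)) * g t) * cis (2 * pi * (\<beta> \<bullet> t)) \<partial>lborel)" .
qed

text \<open>In \<open>transl y (modul \<beta> g)\<close> the translation acts last, so translating
  \<open>f\<close> just changes \<open>y\<close> and no phase factor appears. The pairings of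
  translated functions are therefore exact translates of the original ones.\<close>

lemma correlation_translate:
  assumes [measurable]: "f \<in> borel_measurable borel" "g \<in> borel_measurable borel"
  shows "correlation (\<lambda>t. f (t - x)) g y \<beta> = correlation f g (y - x) \<beta>"
proof -
  have [measurable]: "(\<lambda>t. f (t - x)) \<in> borel_measurable borel" by measurable
  show ?thesis
    by (subst (1 2) correlation_eq(2)) (simp_all add: algebra_simps)
qed

text \<open>A function supported in the ball of radius \<rho> about the origin, when correlated with
  \<open>g\<close> at position \<open>y\<close>, sees \<open>g\<close> only on the ball about
  \<open>- y\<close>. The mass of \<open>g\<close> there bounds the correlations and can be both
  integrated over \<open>y\<close> and summed over lattice points.\<close>

definition local_energy :: "('a::euclidean_space \<Rightarrow> complex) \<Rightarrow> real \<Rightarrow> 'a \<Rightarrow> real" where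
  "local_energy g \<rho> y = (\<integral>t. indicator (cball y \<rho>) t * (norm (g t))\<^sup>2 \<partial>lborel)"

definition square_integrable :: "('a::euclidean_space \<Rightarrow> complex) \<Rightarrow> bool" where
  "square_integrable g \<longleftrightarrow> g \<in> borel_measurable borel \<and> integrable lborel g \<and> integrable lborel (\<lambda>t. (norm (g t))\<^sup>2)"

lemma local_energy_integrable:
  "square_integrable g \<Longrightarrow> integrable lborel (\<lambda>t. indicator (cball y \<rho>) t * (norm (g t))\<^sup>2)"
  by (rule Bochner_Integration.integrable_bound[of _ "\<lambda>t. (norm (g t))\<^sup>2"])
     (auto simp: square_integrable_def indicator_def)

lemma local_energy_nonneg: "0 \<le> local_energy g \<rho> y"
  unfolding local_energy_def by (intro integral_nonneg_AE) simp

lemma local_energy_le: "square_integrable g \<Longrightarrow> local_energy g \<rho> y \<le> (\<integral>t. (norm (g t))\<^sup>2 \<partial>lborel)"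
  unfolding local_energy_def
  by (rule integral_mono[OF local_energy_integrable]) (auto simp: square_integrable_def indicator_def)

lemma local_energy_mono:
  assumes "square_integrable g" "cball y \<rho> \<subseteq> cball y' \<rho>'"
  shows "local_energy g \<rho> y \<le> local_energy g \<rho>' y'"
  unfolding local_energy_def
  by (rule integral_mono[OF local_energy_integrable local_energy_integrable])
     (use assms in \<open>auto simp: indicator_def\<close>)

text \<open>These are conjugated trigonometric coefficients of \<open>cnj (f (t + y)) * g t\<close>,
  a function supported in a ball of fixed radius. Local sampling applies with a constant that does
  not depend on where the ball lies.\<close>

lemma correlation_l2_bound:
  fixes \<Delta> :: "'a::euclidean_space set"
  assumes \<Delta>: "uniform_discrete \<Delta>"
  obtains C where "C \<ge> 0"
    "\<And>f g B y y0. f \<in> borel_measurable borel \<Longrightarrow> (\<And>t. norm (f t) \<le> B) \<Longrightarrow> (\<And>t. norm (t + y0) > \<rho> \<Longrightarrow> f (t + y) = 0) \<Longrightarrow>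
      square_integrable g \<Longrightarrow> l2_bound \<Delta> (C * B\<^sup>2 * local_energy g \<rho> (- y0)) (correlation f g y)"
proof -
  obtain C where C: "C \<ge> 0" "\<And>u t0. u \<in> borel_measurable borel \<Longrightarrow> integrable lborel (\<lambda>t. (norm (u t))\<^sup>2) \<Longrightarrow> (\<And>t. t \<notin> cball t0 \<rho> \<Longrightarrow> u t = 0) \<Longrightarrow>
      l2_bound \<Delta> (C * (\<integral>t. (norm (u t))\<^sup>2 \<partial>lborel)) (\<lambda>\<beta>. \<integral>t. u t * cis (2 * pi * (\<beta> \<bullet> t)) \<partial>lborel)"
    by (rule local_sampling[OF \<Delta>, where \<rho> = \<rho>]) (rule that, assumption, blast)
  show thesis
  proof (rule that[OF C(1)])
    fix f g :: "'a \<Rightarrow> complex" and B y y0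
    assume f [measurable]: "f \<in> borel_measurable borel" and B: "\<And>t. norm (f t) \<le> B"
      and supp: "\<And>t. norm (t + y0) > \<rho> \<Longrightarrow> f (t + y) = 0" and g: "square_integrable g"
    have gm [measurable]: "g \<in> borel_measurable borel" using g by (simp add: square_integrable_def)
    define u where "u = (\<lambda>t. cnj (f (t + y)) * g t)"
    have um [measurable]: "u \<in> borel_measurable borel" unfolding u_def by measurable
    have d: "dist (- y0) t = norm (t + y0)" for t
      by (metis add.commute diff_minus_eq_add dist_commute dist_norm)
    have le: "(norm (u t))\<^sup>2 \<le> B\<^sup>2 * (indicator (cball (- y0) \<rho>) t * (norm (g t))\<^sup>2)" for t
    proof (cases "norm (t + y0) \<le> \<rho>")
      case True
      have "(norm (f (t + y)))\<^sup>2 \<le> B\<^sup>2" using B by (intro power_mono) auto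
      then show ?thesis using True by (auto simp: u_def norm_mult power_mult_distrib d intro!: mult_right_mono)
    next
      case False
      then show ?thesis using supp[of t] by (simp add: u_def)
    qed
    note iE = integrable_mult_right[OF local_energy_integrable[OF g, of "- y0" \<rho>], of "B\<^sup>2"]
    have iu: "integrable lborel (\<lambda>t. (norm (u t))\<^sup>2)"
      by (rule Bochner_Integration.integrable_bound[OF iE]) (use le in auto)
    have "u t = 0" if "t \<notin> cball (- y0) \<rho>" for t using supp[of t] that by (simp add: u_def d)
    note b = C(2)[OF um iu this]
    have "(\<integral>t. (norm (u t))\<^sup>2 \<partial>lborel) \<le> B\<^sup>2 * local_energy g \<rho> (- y0)"
      using integral_mono[OF iu iE le] by (simp add: local_energy_def)
    then have "C * (\<integral>t. (norm (u t))\<^sup>2 \<partial>lborel) \<le> C * B\<^sup>2 * local_energy g \<rho> (- y0)"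
      using C(1) by (simp add: mult.assoc mult_left_mono)
    then have "l2_bound \<Delta> (C * B\<^sup>2 * local_energy g \<rho> (- y0)) (\<lambda>\<beta>. \<integral>t. u t * cis (2 * pi * (\<beta> \<bullet> t)) \<partial>lborel)"
      using b unfolding l2_bound_def by (meson order_trans)
    then show "l2_bound \<Delta> (C * B\<^sup>2 * local_energy g \<rho> (- y0)) (correlation f g y)"
      by (rule l2_bound_norm_cong) (simp add: correlation_eq(2) u_def)
  qed
qed

lemma test_function_uniformly_continuous:
  assumes "f \<in> test_functions" shows "uniformly_continuous_on UNIV f"
  unfolding uniformly_continuous_on_def
proof (intro allI impI)
  fix e :: real assume e: "e > 0"
  obtain R B where RB: "R > 0" "B > 0" "\<And>x. norm x > R \<Longrightarrow> f x = 0" "\<And>x. norm (f x) \<le> B" "continuous_on UNIV f"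
    using test_function_bounds[OF assms] by auto
  have "uniformly_continuous_on (cball 0 (R + 1)) f"
    by (intro compact_uniformly_continuous continuous_on_subset[OF RB(5)]) auto
  then obtain d where d: "d > 0" "\<And>x x'. x \<in> cball 0 (R + 1) \<Longrightarrow> x' \<in> cball 0 (R + 1) \<Longrightarrow> dist x' x < d \<Longrightarrow> dist (f x') (f x) < e"
    using e unfolding uniformly_continuous_on_def by blast
  show "\<exists>d>0. \<forall>x\<in>UNIV. \<forall>x'\<in>UNIV. dist x' x < d \<longrightarrow> dist (f x') (f x) < e"
  proof (intro exI[of _ "min d 1"] conjI ballI impI)
    fix x x' :: 'a assume dd: "dist x' x < min d 1"
    show "dist (f x') (f x) < e"
    proof (cases "norm x \<le> R + 1 \<and> norm x' \<le> R + 1")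
      case True
      then show ?thesis using d(2)[of x x'] dd by simp
    next
      case False
      have "\<bar>norm x' - norm x\<bar> < 1" using dd norm_triangle_ineq3[of x' x] by (simp add: dist_norm)
      then have "norm x > R" "norm x' > R" using False by auto
      then show ?thesis using RB(3) e by simp
    qed
  qed (use d in auto)
qed

lemma countable_uniform_discrete:
  fixes S :: "'a::euclidean_space set"
  assumes "uniform_discrete S" shows "countable S"
proof -
  have "finite (S \<inter> cball 0 (real n))" for n
  proof -
    have "uniform_discrete (S \<inter> cball 0 (real n))" using assms by (rule uniform_discrete_subset) auto
    then show ?thesis using uniform_discrete_finite_iff bounded_subset[OF bounded_cball] by blast
  qed
  then have "countable (\<Union>n. S \<inter> cball 0 (real n))" by (intro countable_UN[OF countableI_type] countable_finite)
  moreover have "(\<Union>n. S \<inter> cball 0 (real n)) = S"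
  proof (intro equalityI subsetI)
    fix x assume "x \<in> S"
    moreover obtain n where "norm x \<le> real n" using real_arch_simple by blast
    ultimately show "x \<in> (\<Union>n. S \<inter> cball 0 (real n))" by auto
  qed auto
  ultimately show ?thesis by simp
qed

lemma borel_measurable_infsum:
  fixes f :: "'i \<Rightarrow> 'a \<Rightarrow> 'b::{banach, second_countable_topology}"
  assumes I: "countable I" and m [measurable]: "\<And>i. i \<in> I \<Longrightarrow> f i \<in> borel_measurable M"
    and s: "\<And>x. x \<in> space M \<Longrightarrow> (\<lambda>i. f i x) summable_on I"
  shows "(\<lambda>x. \<Sum>\<^sub>\<infinity>i\<in>I. f i x) \<in> borel_measurable M"
proof (cases "finite I")
  case True
  then show ?thesis by simp
next
  case False
  define e where "e = from_nat_into I"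
  have e: "bij_betw e UNIV I" unfolding e_def using I False by (rule bij_betw_from_nat_into)
  have eI: "e n \<in> I" for n using e by (auto simp: bij_betw_def)
  have lim: "(\<lambda>n. \<Sum>i<n. f (e i) x) \<longlonglongrightarrow> (\<Sum>\<^sub>\<infinity>i\<in>I. f i x)" if x: "x \<in> space M" for x
  proof -
    have "((\<lambda>i. f (e i) x) has_sum (\<Sum>\<^sub>\<infinity>i\<in>I. f i x)) UNIV"
      using has_sum_infsum[OF s[OF x]] has_sum_reindex_bij_betw[OF e, of "\<lambda>i. f i x"] by simp
    then show ?thesis using has_sum_imp_sums by (simp add: sums_def)
  qed
  show ?thesis
    by (rule borel_measurable_LIMSEQ_metric[OF _ lim]) (use eI in auto)
qed

text \<open>Summable local norms are in particular bounded, so \<open>g\<close> may be paired with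
  its own conjugate.\<close>

lemma amalgam_square_integrable:
  assumes g: "amalgam g w" shows "square_integrable g"
proof -
  have gm [measurable]: "g \<in> borel_measurable borel" and ws: "w summable_on integer_points"
    and w0: "\<And>k. k \<in> integer_points \<Longrightarrow> 0 \<le> w k" using g by (auto simp: amalgam_def)
  define N where "N = (\<Sum>\<^sub>\<infinity>k\<in>integer_points. w k)"
  have wN: "w k \<le> N" if "k \<in> integer_points" for k
    unfolding N_def using finite_sum_le_infsum[OF ws, of "{k}"] that w0 by auto
  have N: "0 \<le> N" unfolding N_def by (rule infsum_nonneg) (rule w0)
  have "integrable lborel (\<lambda>t. g t * cnj (g t))"
  proof (rule amalgam_pairing(1)[OF g _ N])
    fix k :: 'a assume k: "k \<in> integer_points"
    have "(w k)\<^sup>2 \<le> N\<^sup>2" using wN[OF k] w0[OF k] by (intro power_mono)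
    then show "integrable lborel (\<lambda>t. (norm (indicator (cube k 1) t *\<^sub>R cnj (g t)))\<^sup>2) \<and>
       (\<integral>t. (norm (indicator (cube k 1) t *\<^sub>R cnj (g t)))\<^sup>2 \<partial>lborel) \<le> N\<^sup>2"
      using g k unfolding amalgam_def by (auto simp: norm_scaleR)
  qed measurable
  from integrable_norm[OF this] have "integrable lborel (\<lambda>t. (norm (g t))\<^sup>2)"
    by (simp add: norm_mult power2_eq_square)
  then show ?thesis using gm amalgam_integrable[OF g] by (simp add: square_integrable_def)
qed

lemma gabor_element_L2:
  assumes g: "square_integrable g" shows "transl y (modul \<beta> g) \<in> L2"
proof -
  have [measurable]: "g \<in> borel_measurable borel" using g by (simp add: square_integrable_def)
  have m: "(\<lambda>t. cis (2 * pi * (\<beta> \<bullet> (t - y))) * g (t - y)) \<in> borel_measurable borel" by measurable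
  have sq: "(\<lambda>t. (norm (g t))\<^sup>2) \<in> borel_measurable borel" by measurable
  have "integrable lborel (\<lambda>t. (norm (cis (2 * pi * (\<beta> \<bullet> (t - y))) * g (t - y)))\<^sup>2)"
    using lborel_integrable_shift(2)[OF sq, of y] g by (simp add: norm_mult square_integrable_def)
  moreover have "(\<lambda>t. (norm (cis (2 * pi * (\<beta> \<bullet> (t - y))) * g (t - y)))\<^sup>2) \<in> borel_measurable lborel" by measurable
  ultimately have "integrable lebesgue (\<lambda>t. (norm (cis (2 * pi * (\<beta> \<bullet> (t - y))) * g (t - y)))\<^sup>2)"
    by (simp only: integrable_completion)
  moreover have "transl y (modul \<beta> g) = (\<lambda>t. cis (2 * pi * (\<beta> \<bullet> (t - y))) * g (t - y))"
    by (simp add: transl_def[abs_def] modul_def)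
  ultimately show ?thesis using m by (simp add: L2_def measurable_completion)
qed

text \<open>Moving \<open>y\<close> amounts to translating \<open>f\<close>. The difference between
  \<open>f\<close> and a small translate is uniformly small and supported in a slightly larger ball,
  so the square-sum bound applies to it; this accounts for the radius \<open>R + 1\<close> and for
  shifts shorter than 1.\<close>

lemma correlation_continuous:
  fixes \<Delta> :: "'a::euclidean_space set"
  assumes \<Delta>: "uniform_discrete \<Delta>" and f: "f \<in> test_functions" and g: "square_integrable g"
  obtains K \<rho> where "K \<ge> 0" "\<rho> > 0" "\<forall>y. l2_bound \<Delta> (K * local_energy g \<rho> (- y)) (correlation f g y)"
    "\<forall>y0. \<forall>e>0. \<forall>\<^sub>F y in at y0. l2_bound \<Delta> e (\<lambda>\<beta>. correlation f g y \<beta> - correlation f g y0 \<beta>)"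
proof -
  obtain R B where RB: "R > 0" "B > 0" "\<And>x. norm x > R \<Longrightarrow> f x = 0" "\<And>x. norm (f x) \<le> B" "continuous_on UNIV f"
    using test_function_bounds[OF f] by auto
  note [measurable] = test_function_borel[OF f]
  have gm [measurable]: "g \<in> borel_measurable borel" using g by (simp add: square_integrable_def)
  obtain C where C: "C \<ge> 0"
    "\<And>f g B y y0. f \<in> borel_measurable borel \<Longrightarrow> (\<And>t. norm (f t) \<le> B) \<Longrightarrow> (\<And>t. norm (t + y0) > R + 1 \<Longrightarrow> f (t + y) = 0) \<Longrightarrow>
      square_integrable g \<Longrightarrow> l2_bound \<Delta> (C * B\<^sup>2 * local_energy g (R + 1) (- y0)) (correlation f g y)"
    by (rule correlation_l2_bound[OF \<Delta>, where \<rho> = "R + 1"]) (rule that, assumption, blast)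
  define E where "E = (\<integral>t. (norm (g t))\<^sup>2 \<partial>lborel)"
  have E: "0 \<le> E" unfolding E_def by (rule integral_nonneg_AE) simp
  have 1: "l2_bound \<Delta> (C * B\<^sup>2 * local_energy g (R + 1) (- y)) (correlation f g y)" for y
    by (rule C(2)[OF test_function_borel[OF f] RB(4) _ g]) (simp add: RB(3))
  have 2: "\<forall>\<^sub>F y in at y0. l2_bound \<Delta> e (\<lambda>\<beta>. correlation f g y \<beta> - correlation f g y0 \<beta>)" if e: "e > 0" for y0 e
  proof -
    \<comment> \<open>Solves \<open>C * s\<^sup>2 * E \<le> e\<close>; the summand 1 covers the case
      \<open>C * E = 0\<close>.\<close>
    define s where "s = sqrt (e / (C * E + 1))"
    have CE: "0 \<le> C * E" using C(1) E by simp
    have s: "s > 0" using e CE by (simp add: s_def)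
    have s2: "C * s\<^sup>2 * E \<le> e" using e CE by (simp add: s_def field_simps)
    obtain \<delta> where \<delta>: "\<delta> > 0" "\<And>x x'. dist x' x < \<delta> \<Longrightarrow> dist (f x') (f x) < s"
      using test_function_uniformly_continuous[OF f] s unfolding uniformly_continuous_on_def by blast
    have "\<forall>\<^sub>F y in at y0. dist y y0 < min \<delta> 1" unfolding eventually_at using \<delta>(1) by (intro exI[of _ "min \<delta> 1"]) auto
    then show ?thesis
    proof eventually_elim
      case (elim y)
      define x where "x = y0 - y"
      have nx: "norm x < \<delta>" "norm x < 1" using elim by (simp_all add: x_def dist_norm norm_minus_commute)
      define f' where "f' = (\<lambda>t. f (t - x) - f t)"
      have fx: "(\<lambda>t. f (t - x)) \<in> test_functions" by (rule test_function_translate[OF f])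
      have "correlation f g y \<beta> - correlation f g y0 \<beta> = correlation f' g y0 \<beta>" for \<beta>
      proof -
        have "correlation f g y \<beta> = correlation (\<lambda>t. f (t - x)) g y0 \<beta>"
          by (subst correlation_translate) (auto simp: x_def)
        then show ?thesis unfolding f'_def correlation_def
          by (simp add: L2_inner_diff_left[OF test_function_L2[OF fx] test_function_L2[OF f] gabor_element_L2[OF g]])
      qed
      moreover have "l2_bound \<Delta> (C * s\<^sup>2 * local_energy g (R + 1) (- y0)) (correlation f' g y0)"
      proof (rule C(2)[OF _ _ _ g])
        show "f' \<in> borel_measurable borel" unfolding f'_def by measurable
        show "norm (f' t) \<le> s" for t using \<delta>(2)[of "t - x" t] nx by (simp add: f'_def dist_norm less_imp_le)
        show "f' (t + y0) = 0" if "norm (t + y0) > R + 1" for t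
        proof -
          have "norm (t + y0 - x) > R" using that nx(2) norm_triangle_ineq2[of "t + y0" x] by linarith
          then show ?thesis using that RB(3) by (simp add: f'_def)
        qed
      qed
      moreover have "C * s\<^sup>2 * local_energy g (R + 1) (- y0) \<le> e"
      proof -
        have "C * s\<^sup>2 * local_energy g (R + 1) (- y0) \<le> C * s\<^sup>2 * E"
          using local_energy_le[OF g] C(1) unfolding E_def by (intro mult_left_mono) auto
        then show ?thesis using s2 by linarith
      qed
      ultimately show ?case using l2_bound_mono by simp
    qed
  qed
  show thesis
  proof (rule that[of "C * B\<^sup>2" "R + 1"])
    show "\<forall>y. l2_bound \<Delta> (C * B\<^sup>2 * local_energy g (R + 1) (- y)) (correlation f g y)" using 1 by blast
    show "\<forall>y0. \<forall>e>0. \<forall>\<^sub>F y in at y0. l2_bound \<Delta> e (\<lambda>\<beta>. correlation f g y \<beta> - correlation f g y0 \<beta>)"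
      using 2 by blast
  qed (use C(1) RB(1) in simp_all)
qed

text \<open>The conjugate of the second correlation is
  \<open>L2_inner (transl y (modul \<beta> h)) k\<close>, so this is the part of the weak expansion
  that belongs to one generator and one translation.\<close>

definition corr_series :: "'a::euclidean_space set \<Rightarrow> ('a \<Rightarrow> complex) \<Rightarrow> ('a \<Rightarrow> complex) \<Rightarrow> ('a \<Rightarrow> complex) \<Rightarrow> ('a \<Rightarrow> complex) \<Rightarrow> 'a \<Rightarrow> complex" where
  "corr_series \<Delta> f k g h y = (\<Sum>\<^sub>\<infinity>\<beta>\<in>\<Delta>. correlation f g y \<beta> * cnj (correlation k h y \<beta>))"

text \<open>Cauchy-Schwarz bounds the series by a geometric mean of the two local energies.
  Replacing it by their sum costs only precision and gives a bound in which \<open>g\<close> and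
  \<open>h\<close> can be integrated or summed separately.\<close>

lemma corr_series_props:
  fixes \<Delta> :: "'a::euclidean_space set"
  assumes \<Delta>: "uniform_discrete \<Delta>" and f: "f \<in> test_functions" and k: "k \<in> test_functions"
    and g: "square_integrable g" and h: "square_integrable h"
  obtains K \<rho> where "K \<ge> 0" "\<rho> > 0"
    "\<forall>y. (\<lambda>\<beta>. norm (correlation f g y \<beta> * cnj (correlation k h y \<beta>))) summable_on \<Delta>"
    "\<forall>y. (\<Sum>\<^sub>\<infinity>\<beta>\<in>\<Delta>. norm (correlation f g y \<beta> * cnj (correlation k h y \<beta>))) \<le> K * (local_energy g \<rho> (- y) + local_energy h \<rho> (- y))"
    "\<forall>y. norm (corr_series \<Delta> f k g h y) \<le> K * (local_energy g \<rho> (- y) + local_energy h \<rho> (- y))"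
    "\<forall>y. isCont (corr_series \<Delta> f k g h) y"
proof -
  obtain K1 \<rho>1 where 1: "K1 \<ge> 0" "\<rho>1 > 0" "\<forall>y. l2_bound \<Delta> (K1 * local_energy g \<rho>1 (- y)) (correlation f g y)"
    "\<forall>y0. \<forall>e>0. \<forall>\<^sub>F y in at y0. l2_bound \<Delta> e (\<lambda>\<beta>. correlation f g y \<beta> - correlation f g y0 \<beta>)"
    by (rule correlation_continuous[OF \<Delta> f g])
  obtain K2 \<rho>2 where 2: "K2 \<ge> 0" "\<rho>2 > 0" "\<forall>y. l2_bound \<Delta> (K2 * local_energy h \<rho>2 (- y)) (correlation k h y)"
    "\<forall>y0. \<forall>e>0. \<forall>\<^sub>F y in at y0. l2_bound \<Delta> e (\<lambda>\<beta>. correlation k h y \<beta> - correlation k h y0 \<beta>)"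
    by (rule correlation_continuous[OF \<Delta> k h])
  define \<rho> where "\<rho> = max \<rho>1 \<rho>2"
  define K where "K = K1 + K2"
  have le1: "K1 * local_energy g \<rho>1 (- y) \<le> K * local_energy g \<rho> (- y)" for y
    using 1(1) 2(1) local_energy_mono[OF g subset_cball, of \<rho>1 \<rho> "- y"]
    by (intro mult_mono local_energy_nonneg) (auto simp: K_def \<rho>_def)
  have le2: "K2 * local_energy h \<rho>2 (- y) \<le> K * local_energy h \<rho> (- y)" for y
    using 1(1) 2(1) local_energy_mono[OF h subset_cball, of \<rho>2 \<rho> "- y"]
    by (intro mult_mono local_energy_nonneg) (auto simp: K_def \<rho>_def)
  have b1: "l2_bound \<Delta> (K * local_energy g \<rho> (- y)) (correlation f g y)" for y
    using l2_bound_mono[OF _ le1] 1(3) by blast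
  have b2: "l2_bound \<Delta> (K * local_energy h \<rho> (- y)) (\<lambda>\<beta>. cnj (correlation k h y \<beta>))" for y
    using l2_bound_norm_cong[OF l2_bound_mono[OF spec[OF 2(3)] le2]] by simp
  have K0: "0 \<le> K" using 1 2 by (simp add: K_def)
  have amgm: "sqrt (K * u * (K * v)) \<le> K * (u + v)" if "0 \<le> u" "0 \<le> v" for u v
  proof -
    have "K * u * (K * v) = K\<^sup>2 * (u * v)" by (simp add: power2_eq_square mult_ac)
    also have "\<dots> \<le> K\<^sup>2 * (u + v)\<^sup>2" using that by (intro mult_left_mono) (auto simp: power2_sum)
    also have "\<dots> = (K * (u + v))\<^sup>2" by (simp add: power_mult_distrib)
    finally show ?thesis using K0 that by (intro real_le_lsqrt) auto
  qed
  note am = amgm[OF local_energy_nonneg local_energy_nonneg]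
  have s: "(\<lambda>\<beta>. norm (correlation f g y \<beta> * cnj (correlation k h y \<beta>))) summable_on \<Delta>" for y
    by (rule l2_bound_product(1)[OF b1 b2])
  have n: "(\<Sum>\<^sub>\<infinity>\<beta>\<in>\<Delta>. norm (correlation f g y \<beta> * cnj (correlation k h y \<beta>))) \<le> K * (local_energy g \<rho> (- y) + local_energy h \<rho> (- y))" for y
    by (rule order_trans[OF l2_bound_product(3)[OF b1 b2] am])
  have n': "norm (corr_series \<Delta> f k g h y) \<le> K * (local_energy g \<rho> (- y) + local_energy h \<rho> (- y))" for y
    unfolding corr_series_def by (rule order_trans[OF l2_bound_product(4)[OF b1 b2] am])
  have c: "isCont (corr_series \<Delta> f k g h) y0" for y0
    unfolding isCont_def corr_series_def
  proof (rule tendsto_infsum_l2)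
    show "l2_bound \<Delta> (K * (\<integral>t. (norm (g t))\<^sup>2 \<partial>lborel)) (correlation f g y)" for y
      by (rule l2_bound_mono[OF b1]) (intro mult_left_mono local_energy_le g K0)
    show "l2_bound \<Delta> (K * (\<integral>t. (norm (h t))\<^sup>2 \<partial>lborel)) (\<lambda>\<beta>. cnj (correlation k h y \<beta>))" for y
      by (rule l2_bound_mono[OF b2]) (intro mult_left_mono local_energy_le h K0)
    show "\<forall>\<^sub>F y in at y0. l2_bound \<Delta> e (\<lambda>\<beta>. correlation f g y \<beta> - correlation f g y0 \<beta>)" if "e > 0" for e
      using 1(4) that by blast
    show "\<forall>\<^sub>F y in at y0. l2_bound \<Delta> e (\<lambda>\<beta>. cnj (correlation k h y \<beta>) - cnj (correlation k h y0 \<beta>))" if "e > 0" for e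
    proof -
      have "\<forall>\<^sub>F y in at y0. l2_bound \<Delta> e (\<lambda>\<beta>. correlation k h y \<beta> - correlation k h y0 \<beta>)" using 2(4) that by blast
      then show ?thesis
        by eventually_elim (erule l2_bound_norm_cong, simp only: complex_cnj_diff[symmetric] complex_mod_cnj)
    qed
  qed
  have r: "\<rho> > 0" using 1(2) by (simp add: \<rho>_def)
  show thesis
    by (rule that[OF K0 r]) (intro allI s n n' c)+
qed

text \<open>By Fubini, a point \<open>t\<close> contributes \<open>(norm (g t))\<^sup>2\<close>
  times the volume of a ball of radius \<rho>.\<close>

lemma local_energy_integral:
  assumes g: "square_integrable g"
  shows "integrable lborel (\<lambda>y. local_energy g \<rho> (- y))"
proof -
  have [measurable]: "g \<in> borel_measurable borel" using g by (simp add: square_integrable_def)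
  let ?f = "\<lambda>t y. indicator (cball (0::'a) \<rho>) (t + y) * (norm (g t))\<^sup>2 :: real"
  have mi [measurable]: "(indicator (cball (0::'a) \<rho>) :: 'a \<Rightarrow> real) \<in> borel_measurable borel" by (intro borel_measurable_indicator) simp
  have i0: "integrable lborel (indicator (cball (0::'a) \<rho>) :: 'a \<Rightarrow> real)" using cball_integrable[of 1 "0::'a" \<rho>] by simp
  have i1: "integrable lborel (\<lambda>y. indicator (cball (0::'a) \<rho>) (t + y) :: real)" for t
    using lborel_integrable_shift(1)[OF mi, of t] i0 by (simp add: add.commute)
  have e1: "(\<integral>y. indicator (cball (0::'a) \<rho>) (t + y) \<partial>lborel) = measure lborel (cball (0::'a) \<rho>)" for t
    using lborel_integral_shift(1)[OF mi, of t] by (simp add: add.commute)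
  have "integrable (lborel \<Otimes>\<^sub>M lborel) (\<lambda>(t, y). ?f t y)"
  proof (rule lborel_pair.Fubini_integrable)
    show "(\<lambda>(t, y). ?f t y) \<in> borel_measurable (lborel \<Otimes>\<^sub>M lborel)" by measurable
    show "integrable lborel (\<lambda>t. \<integral>y. norm (case (t, y) of (t, y) \<Rightarrow> ?f t y) \<partial>lborel)"
      using g by (simp add: e1 square_integrable_def)
    show "AE t in lborel. integrable lborel (\<lambda>y. case (t, y) of (t, y) \<Rightarrow> ?f t y)"
      using i1 by simp
  qed
  from lborel_pair.integrable_snd[OF this]
  have "integrable lborel (\<lambda>y. \<integral>t. ?f t y \<partial>lborel)" .
  moreover have "(\<integral>t. ?f t y \<partial>lborel) = local_energy g \<rho> (- y)" for y
  proof -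
    have "indicator (cball (0::'a) \<rho>) (t + y) = (indicator (cball (- y) \<rho>) t :: real)" for t
      by (simp add: indicator_def dist_norm norm_minus_commute) (metis add.commute diff_minus_eq_add minus_diff_eq norm_minus_cancel add_uminus_conv_diff)
    then show ?thesis by (simp add: local_energy_def)
  qed
  ultimately show ?thesis by simp
qed

text \<open>Parseval is applied for each \<beta> separately, and the sum over \<Delta> is exchanged
  with the integral on both sides. The dominating functions are the local energies on the space
  side, and on the frequency side the uniform bound of \<open>cross_series_bounds\<close> times an
  integrable product of transforms.\<close>

lemma corr_series_fourier:
  fixes \<Delta> :: "'a::euclidean_space set"
  assumes \<Delta>: "uniform_discrete \<Delta>" and f: "f \<in> test_functions" and k: "k \<in> test_functions"
    and g: "amalgam g w" and h: "amalgam h w'"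
  shows "integrable lborel (corr_series \<Delta> f k g h)"
    and "(\<integral>y. corr_series \<Delta> f k g h y * cis (- 2 * pi * (\<xi> \<bullet> y)) \<partial>lborel) =
      (\<integral>\<omega>. fourier f \<omega> * cnj (fourier k (\<omega> - \<xi>)) * cross_series \<Delta> g h \<xi> \<omega> \<partial>lborel)"
proof -
  note gs = amalgam_square_integrable[OF g] and hs = amalgam_square_integrable[OF h]
  have gm [measurable]: "g \<in> borel_measurable borel" and hm [measurable]: "h \<in> borel_measurable borel"
    and gi: "integrable lborel g" and hi: "integrable lborel h"
    using gs hs by (auto simp: square_integrable_def)
  note fp = test_function_props[OF f] and kp = test_function_props[OF k]
  note [measurable] = fp(1) kp(1)
  have cD: "countable \<Delta>" by (rule countable_uniform_discrete[OF \<Delta>])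
  obtain K \<rho> where K: "K \<ge> 0" "\<rho> > 0"
    "\<forall>y. (\<lambda>\<beta>. norm (correlation f g y \<beta> * cnj (correlation k h y \<beta>))) summable_on \<Delta>"
    "\<forall>y. (\<Sum>\<^sub>\<infinity>\<beta>\<in>\<Delta>. norm (correlation f g y \<beta> * cnj (correlation k h y \<beta>))) \<le> K * (local_energy g \<rho> (- y) + local_energy h \<rho> (- y))"
    "\<forall>y. norm (corr_series \<Delta> f k g h y) \<le> K * (local_energy g \<rho> (- y) + local_energy h \<rho> (- y))"
    "\<forall>y. isCont (corr_series \<Delta> f k g h) y"
    by (rule corr_series_props[OF \<Delta> f k gs hs])
  have iE: "integrable lborel (\<lambda>y. K * (local_energy g \<rho> (- y) + local_energy h \<rho> (- y)))"
    by (intro integrable_mult_right Bochner_Integration.integrable_add local_energy_integral gs hs)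
  have E0: "0 \<le> K * (local_energy g \<rho> (- y) + local_energy h \<rho> (- y))" for y
    by (intro mult_nonneg_nonneg add_nonneg_nonneg K(1) local_energy_nonneg)
  have Cm [measurable]: "corr_series \<Delta> f k g h \<in> borel_measurable borel"
    using K(6) by (intro borel_measurable_continuous_onI) (simp add: continuous_on_eq_continuous_at)
  show "integrable lborel (corr_series \<Delta> f k g h)"
    by (rule Bochner_Integration.integrable_bound[OF iE]) (use K(5) E0 in auto)
  \<comment> \<open>For a single \<beta>, boundedness and continuity are the \<open>l2\<close>
    estimates evaluated on the finite subset \<open>{\<beta>}\<close>.\<close>
  have one: "\<exists>M. (\<forall>y. norm (correlation f g y \<beta>) \<le> M) \<and> (\<forall>y. isCont (\<lambda>y. correlation f g y \<beta>) y)
      \<and> integrable lborel (\<lambda>y. correlation f g y \<beta>) \<and> (\<forall>\<omega>. fourier (\<lambda>y. correlation f g y \<beta>) \<omega> = fourier f \<omega> * cnj (fourier g (\<omega> - \<beta>)))"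
    if f: "f \<in> test_functions" and g: "square_integrable g" and \<beta>: "\<beta> \<in> \<Delta>" for f g \<beta>
  proof -
    have [measurable]: "g \<in> borel_measurable borel" and gi: "integrable lborel g" using g by (auto simp: square_integrable_def)
    note [measurable] = test_function_borel[OF f]
    obtain K \<rho> where K: "K \<ge> 0" "\<rho> > 0" "\<forall>y. l2_bound \<Delta> (K * local_energy g \<rho> (- y)) (correlation f g y)"
      "\<forall>y0. \<forall>e>0. \<forall>\<^sub>F y in at y0. l2_bound \<Delta> e (\<lambda>\<beta>. correlation f g y \<beta> - correlation f g y0 \<beta>)"
      by (rule correlation_continuous[OF \<Delta> f g])
    define M where "M = sqrt (K * (\<integral>t. (norm (g t))\<^sup>2 \<partial>lborel))"
    have "norm (correlation f g y \<beta>) \<le> M" for y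
    proof -
      have "(norm (correlation f g y \<beta>))\<^sup>2 \<le> K * local_energy g \<rho> (- y)"
        using l2_boundD[OF spec[OF K(3)], of "{\<beta>}" y] \<beta> by simp
      also have "\<dots> \<le> K * (\<integral>t. (norm (g t))\<^sup>2 \<partial>lborel)" by (intro mult_left_mono local_energy_le g K)
      finally show ?thesis unfolding M_def by (rule real_le_rsqrt)
    qed
    moreover have "isCont (\<lambda>y. correlation f g y \<beta>) y0" for y0
      unfolding isCont_def
    proof (rule tendstoI)
      fix e :: real assume e: "e > 0"
      then have "\<forall>\<^sub>F y in at y0. l2_bound \<Delta> ((e / 2)\<^sup>2) (\<lambda>\<beta>. correlation f g y \<beta> - correlation f g y0 \<beta>)" using K(4) by simp
      then show "\<forall>\<^sub>F y in at y0. dist (correlation f g y \<beta>) (correlation f g y0 \<beta>) < e"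
      proof eventually_elim
        case (elim y)
        have "(norm (correlation f g y \<beta> - correlation f g y0 \<beta>))\<^sup>2 \<le> (e / 2)\<^sup>2"
          using l2_boundD[OF elim, of "{\<beta>}"] \<beta> by simp
        then have "norm (correlation f g y \<beta> - correlation f g y0 \<beta>) \<le> e / 2" by (rule power2_le_imp_le) (use e in simp)
        then show ?case using e by (simp add: dist_norm)
      qed
    qed
    moreover have u: "integrable lborel (\<lambda>t. g t * cis (2 * pi * (\<beta> \<bullet> t)))"
      by (rule Bochner_Integration.integrable_bound[OF gi]) (auto simp: norm_mult)
    note cf = correlation_fourier[OF test_function_props(2)[OF f] u]
    have eq: "(\<lambda>y. correlation f g y \<beta>) = (\<lambda>y. \<integral>t. f t * cnj (g (t - y) * cis (2 * pi * (\<beta> \<bullet> (t - y)))) \<partial>lborel)"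
      by (rule ext, rule correlation_eq(1)) measurable
    have "integrable lborel (\<lambda>y. correlation f g y \<beta>)" unfolding eq by (rule cf(1))
    moreover have "fourier (\<lambda>y. correlation f g y \<beta>) \<omega> = fourier f \<omega> * cnj (fourier g (\<omega> - \<beta>))" for \<omega>
      unfolding eq cf(2) by (subst fourier_modulate) auto
    ultimately show ?thesis by blast
  qed
  define P where "P \<beta> y = correlation f g y \<beta>" for \<beta> y
  \<comment> \<open>Modulating the second correlation by \<xi> does two things after conjugation: on
    the space side it produces the character in the claim, on the frequency side it shifts the
    transforms of \<open>k\<close> and \<open>h\<close> by \<xi>.\<close>
  define Q where "Q \<beta> y = correlation k h y \<beta> * cis (2 * pi * (\<xi> \<bullet> y))" for \<beta> y
  have pars: "integrable lborel (\<lambda>y. P \<beta> y * cnj (Q \<beta> y)) \<and> integrable lborel (\<lambda>\<omega>. fourier f \<omega> * cnj (fourier k (\<omega> - \<xi>)) * (cnj (fourier g (\<omega> - \<beta>)) * fourier h (\<omega> - \<beta> - \<xi>)))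
     \<and> (\<integral>y. P \<beta> y * cnj (Q \<beta> y) \<partial>lborel) = (\<integral>\<omega>. fourier f \<omega> * cnj (fourier k (\<omega> - \<xi>)) * (cnj (fourier g (\<omega> - \<beta>)) * fourier h (\<omega> - \<beta> - \<xi>)) \<partial>lborel)"
    if \<beta>: "\<beta> \<in> \<Delta>" for \<beta>
  proof -
    obtain M where P: "\<And>y. norm (P \<beta> y) \<le> M" "\<And>y. isCont (P \<beta>) y" "integrable lborel (P \<beta>)"
      "\<And>\<omega>. fourier (P \<beta>) \<omega> = fourier f \<omega> * cnj (fourier g (\<omega> - \<beta>))"
      using one[OF f gs \<beta>] unfolding P_def[abs_def] by blast
    obtain N where N: "\<And>y. norm (correlation k h y \<beta>) \<le> N" "\<And>y. isCont (\<lambda>y. correlation k h y \<beta>) y" "integrable lborel (\<lambda>y. correlation k h y \<beta>)"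
      "\<And>\<omega>. fourier (\<lambda>y. correlation k h y \<beta>) \<omega> = fourier k \<omega> * cnj (fourier h (\<omega> - \<beta>))"
      using one[OF k hs \<beta>] by blast
    have mk [measurable]: "(\<lambda>y. correlation k h y \<beta>) \<in> borel_measurable borel" using borel_measurable_integrable[OF N(3)] by simp
    have [measurable]: "P \<beta> \<in> borel_measurable borel" using borel_measurable_integrable[OF P(3)] by simp
    have Qm [measurable]: "Q \<beta> \<in> borel_measurable borel" unfolding Q_def[abs_def] by measurable
    have Q1: "norm (Q \<beta> y) \<le> N" for y using N(1) by (simp add: Q_def norm_mult)
    have Q2: "isCont (Q \<beta>) y" for y unfolding Q_def[abs_def] cis_conv_exp by (intro continuous_intros N(2))
    have Q3: "integrable lborel (Q \<beta>)"
      by (rule Bochner_Integration.integrable_bound[OF N(3)]) (auto simp: Q_def norm_mult)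
    have Q4: "fourier (Q \<beta>) \<omega> = fourier k (\<omega> - \<xi>) * cnj (fourier h (\<omega> - \<beta> - \<xi>))" for \<omega>
    proof -
      have "\<omega> - \<xi> - \<beta> = \<omega> - \<beta> - \<xi>" by simp
      then show ?thesis unfolding Q_def[abs_def] by (subst fourier_modulate[OF mk]) (simp only: N(4))
    qed
    have eq: "fourier (P \<beta>) \<omega> * cnj (fourier (Q \<beta>) \<omega>) =
        fourier f \<omega> * cnj (fourier k (\<omega> - \<xi>)) * (cnj (fourier g (\<omega> - \<beta>)) * fourier h (\<omega> - \<beta> - \<xi>))" for \<omega>
      unfolding P(4) Q4 by (simp add: mult_ac)
    have iPQ: "integrable lborel (\<lambda>y. P \<beta> y * cnj (Q \<beta> y))"
    proof (rule Bochner_Integration.integrable_bound)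
      show "integrable lborel (\<lambda>y. N *\<^sub>R P \<beta> y)" using P(3) by simp
      have "norm (P \<beta> y * cnj (Q \<beta> y)) \<le> norm (N *\<^sub>R P \<beta> y)" for y
        using mult_right_mono[OF order_trans[OF Q1[of y] abs_ge_self], of "norm (P \<beta> y)"] by (simp add: norm_mult mult.commute)
      then show "AE y in lborel. norm (P \<beta> y * cnj (Q \<beta> y)) \<le> norm (N *\<^sub>R P \<beta> y)" by simp
    qed measurable
    show ?thesis
      using parseval[OF P(3,1) _ Q3 Q1] P(2) Q2 iPQ unfolding eq by simp
  qed
  have PQ: "P \<beta> y * cnj (Q \<beta> y) = correlation f g y \<beta> * cnj (correlation k h y \<beta>) * cis (- 2 * pi * (\<xi> \<bullet> y))" for \<beta> y
    by (simp add: P_def Q_def cis_cnj)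
  have nPQ: "norm (P \<beta> y * cnj (Q \<beta> y)) = norm (correlation f g y \<beta> * cnj (correlation k h y \<beta>))" for \<beta> y
    unfolding PQ by (simp add: norm_mult)
  have sPQ: "(\<lambda>\<beta>. norm (P \<beta> y * cnj (Q \<beta> y))) summable_on \<Delta>" for y unfolding nPQ using K(3) by blast
  have nsPQ: "(\<lambda>\<beta>. \<integral>y. norm (P \<beta> y * cnj (Q \<beta> y)) \<partial>lborel) summable_on \<Delta>"
  proof (rule bounded_sums_summable(1))
    fix F assume F: "finite F" "F \<subseteq> \<Delta>"
    have ip: "integrable lborel (\<lambda>y. norm (P \<beta> y * cnj (Q \<beta> y)))" if "\<beta> \<in> F" for \<beta> using pars that F by (intro integrable_norm) auto
    have "(\<Sum>\<beta>\<in>F. \<integral>y. norm (P \<beta> y * cnj (Q \<beta> y)) \<partial>lborel) = (\<integral>y. (\<Sum>\<beta>\<in>F. norm (P \<beta> y * cnj (Q \<beta> y))) \<partial>lborel)"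
      by (rule Bochner_Integration.integral_sum[symmetric]) (rule ip)
    also have "\<dots> \<le> (\<integral>y. K * (local_energy g \<rho> (- y) + local_energy h \<rho> (- y)) \<partial>lborel)"
    proof (rule integral_mono[OF _ iE])
      show "integrable lborel (\<lambda>y. \<Sum>\<beta>\<in>F. norm (P \<beta> y * cnj (Q \<beta> y)))" by (rule Bochner_Integration.integrable_sum) (rule ip)
      show "(\<Sum>\<beta>\<in>F. norm (P \<beta> y * cnj (Q \<beta> y))) \<le> K * (local_energy g \<rho> (- y) + local_energy h \<rho> (- y))" for y
        using finite_sum_le_infsum[OF spec[OF K(3), of y] F] K(4) unfolding nPQ by (meson norm_ge_zero order_trans)
    qed
    finally show "(\<Sum>\<beta>\<in>F. \<integral>y. norm (P \<beta> y * cnj (Q \<beta> y)) \<partial>lborel) \<le> (\<integral>y. K * (local_energy g \<rho> (- y) + local_energy h \<rho> (- y)) \<partial>lborel)" .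
  qed (rule integral_nonneg_AE, simp)
  have hs1: "((\<lambda>\<beta>. \<integral>y. P \<beta> y * cnj (Q \<beta> y) \<partial>lborel) has_sum (\<integral>y. (\<Sum>\<^sub>\<infinity>\<beta>\<in>\<Delta>. P \<beta> y * cnj (Q \<beta> y)) \<partial>lborel)) \<Delta>"
    by (rule integral_infsum(2)[OF cD _ sPQ nsPQ]) (use pars in blast)
  have e1: "(\<Sum>\<^sub>\<infinity>\<beta>\<in>\<Delta>. P \<beta> y * cnj (Q \<beta> y)) = corr_series \<Delta> f k g h y * cis (- 2 * pi * (\<xi> \<bullet> y))" for y
    unfolding PQ corr_series_def by (rule infsum_cmult_left')
  obtain N where N: "\<And>\<omega> \<xi>. norm (cross_series \<Delta> g h \<xi> \<omega>) \<le> N" "\<And>\<omega> \<xi>. isCont (cross_series \<Delta> g h \<xi>) \<omega>"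
    "\<And>\<omega> \<xi>. (\<lambda>\<beta>. norm (cnj (fourier g (\<omega> - \<beta>)) * fourier h (\<omega> - \<beta> - \<xi>))) summable_on \<Delta>"
    "\<And>\<omega> \<xi>. (\<Sum>\<^sub>\<infinity>\<beta>\<in>\<Delta>. norm (cnj (fourier g (\<omega> - \<beta>)) * fourier h (\<omega> - \<beta> - \<xi>))) \<le> N"
    by (rule cross_series_bounds[OF \<Delta> g h]) (rule that, assumption+)
  define v where "v \<omega> = fourier f \<omega> * cnj (fourier k (\<omega> - \<xi>))" for \<omega>
  have sqk: "(\<lambda>\<omega>. (norm (fourier k \<omega>))\<^sup>2) \<in> borel_measurable borel" by measurable
  have vi: "integrable lborel v" unfolding v_def
    by (rule Cauchy_Schwarz_integrable) (use fp(4) kp(4) lborel_integrable_shift(2)[OF sqk, of \<xi>] in auto)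
  have [measurable]: "v \<in> borel_measurable borel" using borel_measurable_integrable[OF vi] by simp
  define c where "c \<beta> \<omega> = cnj (fourier g (\<omega> - \<beta>)) * fourier h (\<omega> - \<beta> - \<xi>)" for \<beta> \<omega>
  have sc: "(\<lambda>\<beta>. norm (v \<omega> * c \<beta> \<omega>)) summable_on \<Delta>" for \<omega>
    unfolding norm_mult[of "v _"] by (rule summable_on_cmult_right) (use N(3) in \<open>simp add: c_def\<close>)
  have ic: "integrable lborel (\<lambda>\<omega>. v \<omega> * c \<beta> \<omega>)" if "\<beta> \<in> \<Delta>" for \<beta> using pars[OF that] by (simp add: v_def c_def)
  have nsc: "(\<lambda>\<beta>. \<integral>\<omega>. norm (v \<omega> * c \<beta> \<omega>) \<partial>lborel) summable_on \<Delta>"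
  proof (rule bounded_sums_summable(1))
    fix F assume F: "finite F" "F \<subseteq> \<Delta>"
    have ip: "integrable lborel (\<lambda>\<omega>. norm (v \<omega> * c \<beta> \<omega>))" if "\<beta> \<in> F" for \<beta> using ic that F by (intro integrable_norm) auto
    have "(\<Sum>\<beta>\<in>F. \<integral>\<omega>. norm (v \<omega> * c \<beta> \<omega>) \<partial>lborel) = (\<integral>\<omega>. (\<Sum>\<beta>\<in>F. norm (v \<omega> * c \<beta> \<omega>)) \<partial>lborel)"
      by (rule Bochner_Integration.integral_sum[symmetric]) (rule ip)
    also have "\<dots> \<le> (\<integral>\<omega>. norm (v \<omega>) * N \<partial>lborel)"
    proof (rule integral_mono)
      show "integrable lborel (\<lambda>\<omega>. \<Sum>\<beta>\<in>F. norm (v \<omega> * c \<beta> \<omega>))" by (rule Bochner_Integration.integrable_sum) (rule ip)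
      show "integrable lborel (\<lambda>\<omega>. norm (v \<omega>) * N)" using vi by auto
      fix \<omega>
      have "(\<Sum>\<beta>\<in>F. norm (c \<beta> \<omega>)) \<le> N"
        using finite_sum_le_infsum[OF N(3)[of \<omega> \<xi>] F] N(4)[of \<omega> \<xi>] unfolding c_def by (meson norm_ge_zero order_trans)
      then show "(\<Sum>\<beta>\<in>F. norm (v \<omega> * c \<beta> \<omega>)) \<le> norm (v \<omega>) * N"
        unfolding norm_mult[of "v _"] sum_distrib_left[symmetric] by (intro mult_left_mono) auto
    qed
    finally show "(\<Sum>\<beta>\<in>F. \<integral>\<omega>. norm (v \<omega> * c \<beta> \<omega>) \<partial>lborel) \<le> (\<integral>\<omega>. norm (v \<omega>) * N \<partial>lborel)" .
  qed (rule integral_nonneg_AE, simp)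
  have hs2: "((\<lambda>\<beta>. \<integral>\<omega>. v \<omega> * c \<beta> \<omega> \<partial>lborel) has_sum (\<integral>\<omega>. (\<Sum>\<^sub>\<infinity>\<beta>\<in>\<Delta>. v \<omega> * c \<beta> \<omega>) \<partial>lborel)) \<Delta>"
    by (rule integral_infsum(2)[OF cD ic sc nsc])
  have e2: "(\<Sum>\<^sub>\<infinity>\<beta>\<in>\<Delta>. v \<omega> * c \<beta> \<omega>) = v \<omega> * cross_series \<Delta> g h \<xi> \<omega>" for \<omega>
    unfolding c_def cross_series_def by (rule infsum_cmult_right')
  have eq: "(\<integral>y. P \<beta> y * cnj (Q \<beta> y) \<partial>lborel) = (\<integral>\<omega>. v \<omega> * c \<beta> \<omega> \<partial>lborel)" if "\<beta> \<in> \<Delta>" for \<beta>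
    using pars[OF that] unfolding v_def c_def by (elim conjE)
  have "(\<integral>y. (\<Sum>\<^sub>\<infinity>\<beta>\<in>\<Delta>. P \<beta> y * cnj (Q \<beta> y)) \<partial>lborel) = (\<integral>\<omega>. (\<Sum>\<^sub>\<infinity>\<beta>\<in>\<Delta>. v \<omega> * c \<beta> \<omega>) \<partial>lborel)"
    by (rule has_sum_unique[OF hs1 has_sum_cong[OF eq, THEN iffD2, OF _ hs2]])
  then show "(\<integral>y. corr_series \<Delta> f k g h y * cis (- 2 * pi * (\<xi> \<bullet> y)) \<partial>lborel) =
      (\<integral>\<omega>. fourier f \<omega> * cnj (fourier k (\<omega> - \<xi>)) * cross_series \<Delta> g h \<xi> \<omega> \<partial>lborel)"
    unfolding e1 e2 unfolding v_def .
qed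

section \<open>The torus series of a model set\<close>

lemma local_energy_shift_subset:
  fixes x x' :: "'a::euclidean_space"
  assumes "norm (x - x') \<le> r"
  shows "cball (- x) \<rho> \<subseteq> cball (- x') (\<rho> + r)"
proof
  fix t assume "t \<in> cball (- x) \<rho>"
  moreover have "dist (- x') (- x) \<le> r" using assms by (simp add: dist_norm norm_minus_commute)
  ultimately show "t \<in> cball (- x') (\<rho> + r)" using dist_triangle[of "- x'" t "- x"] by simp
qed

context cut_and_project
begin

lemma energy_sum_bound:
  assumes uv: "u \<le> v" and \<rho>: "\<rho> > 0"
  obtains M where "M \<ge> 0" "\<forall>g x y F. square_integrable g \<longrightarrow> finite F \<longrightarrow> F \<subseteq> \<Gamma> \<longrightarrow>
    (\<Sum>\<gamma>\<in>F. indicator {u..v} (y + snd \<gamma>) * local_energy g \<rho> (- (x + fst \<gamma>))) \<le> M * (\<integral>t. (norm (g t))\<^sup>2 \<partial>lborel)"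
proof -
  obtain \<sigma> where \<sigma>: "\<sigma> > 0" "\<And>z. z \<in> cell \<Longrightarrow> norm (fst z) \<le> \<sigma> \<and> \<bar>snd z\<bar> \<le> \<sigma>"
    by (rule cell_radius) (rule that, assumption, blast)
  define M where "M = (2 * \<rho> + 2 * \<sigma>) ^ DIM('b) * (v - u + 2 * \<sigma>) / measure lborel cell"
  have M0: "M \<ge> 0" using uv \<rho> \<sigma>(1) by (simp add: M_def)
  have cnt: "real (card (strip_points p (2 * \<rho>) {u - y..v - y})) \<le> M" for p y
  proof -
    have "real (card (strip_points p (2 * \<rho>) {u - y..v - y})) * measure lborel cell \<le> (2 * \<rho> + 2 * \<sigma>) ^ DIM('b) * (v - y - (u - y) + 2 * \<sigma>)"
      by (rule strip_points_upper[OF \<sigma>]) (use \<rho> uv in auto)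
    then show ?thesis using cell_positive by (simp add: M_def pos_le_divide_eq)
  qed
  show thesis
  proof (rule that[OF M0], intro allI impI)
    fix g :: "'b \<Rightarrow> complex" and x :: 'b and y :: real and F :: "('b \<times> real) set" assume g: "square_integrable g" and F: "finite F" "F \<subseteq> \<Gamma>"
    have gi: "integrable lborel (\<lambda>t. (norm (g t))\<^sup>2)" using g by (simp add: square_integrable_def)
    let ?i = "\<lambda>(\<gamma>::'b \<times> real) t. indicator {u..v} (y + snd \<gamma>) * indicator (cball (- (x + fst \<gamma>)) \<rho>) t :: real"
    have pt: "(\<Sum>\<gamma>\<in>F. ?i \<gamma> t) \<le> M" for t
    proof -
      let ?p = "- x - t - \<rho> *\<^sub>R One"
      have sub: "{\<gamma> \<in> F. ?i \<gamma> t \<noteq> 0} \<subseteq> strip_points ?p (2 * \<rho>) {u - y..v - y}"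
      proof
        fix \<gamma> assume "\<gamma> \<in> {\<gamma> \<in> F. ?i \<gamma> t \<noteq> 0}"
        then have \<gamma>: "\<gamma> \<in> \<Gamma>" "u \<le> y + snd \<gamma>" "y + snd \<gamma> \<le> v" "dist (- (x + fst \<gamma>)) t \<le> \<rho>"
          using F by (auto simp: indicator_def split: if_splits)
        have "dist (- (x + fst \<gamma>)) t = norm (x + t + fst \<gamma>)"
        proof -
          have "- (x + fst \<gamma>) - t = - (x + t + fst \<gamma>)" by (simp add: algebra_simps)
          then show ?thesis unfolding dist_norm by (simp only: norm_minus_cancel)
        qed
        then have n: "norm (x + t + fst \<gamma>) \<le> \<rho>" using \<gamma>(4) by simp
        have "(- x - t) + (x + t + fst \<gamma>) \<in> cube (- x - t - \<rho> *\<^sub>R One) (0 + 2 * \<rho>)"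
          by (rule mem_cube_shift[OF _ _ n]) (simp_all add: cube_eq_cbox)
        then show "\<gamma> \<in> strip_points ?p (2 * \<rho>) {u - y..v - y}" using \<gamma> by (auto simp: strip_points_def)
      qed
      have "(\<Sum>\<gamma>\<in>F. ?i \<gamma> t) = (\<Sum>\<gamma>\<in>{\<gamma> \<in> F. ?i \<gamma> t \<noteq> 0}. ?i \<gamma> t)"
        by (rule sum.mono_neutral_right) (use F in auto)
      also have "\<dots> \<le> (\<Sum>\<gamma>\<in>{\<gamma> \<in> F. ?i \<gamma> t \<noteq> 0}. 1)" by (rule sum_mono) (simp add: indicator_def)
      also have "\<dots> = real (card {\<gamma> \<in> F. ?i \<gamma> t \<noteq> 0})" by simp
      also have "\<dots> \<le> real (card (strip_points ?p (2 * \<rho>) {u - y..v - y}))"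
        using card_mono[OF finite_strip_points sub] \<rho> by simp
      also have "\<dots> \<le> M" by (rule cnt)
      finally show ?thesis .
    qed
    have ie: "integrable lborel (\<lambda>t. ?i \<gamma> t * (norm (g t))\<^sup>2)" for \<gamma>
      using integrable_mult_right[OF local_energy_integrable[OF g, of "- (x + fst \<gamma>)" \<rho>], of "indicator {u..v} (y + snd \<gamma>)"]
      by (simp add: mult.assoc)
    have "(\<Sum>\<gamma>\<in>F. indicator {u..v} (y + snd \<gamma>) * local_energy g \<rho> (- (x + fst \<gamma>))) =
        (\<Sum>\<gamma>\<in>F. \<integral>t. ?i \<gamma> t * (norm (g t))\<^sup>2 \<partial>lborel)"
      unfolding local_energy_def mult.assoc by simp
    also have "\<dots> = (\<integral>t. (\<Sum>\<gamma>\<in>F. ?i \<gamma> t * (norm (g t))\<^sup>2) \<partial>lborel)"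
      by (rule Bochner_Integration.integral_sum[symmetric]) (rule ie)
    also have "\<dots> \<le> (\<integral>t. M * (norm (g t))\<^sup>2 \<partial>lborel)"
    proof (rule integral_mono[OF _ integrable_mult_right[OF gi]])
      show "integrable lborel (\<lambda>t. \<Sum>\<gamma>\<in>F. ?i \<gamma> t * (norm (g t))\<^sup>2)" by (rule Bochner_Integration.integrable_sum) (rule ie)
      show "(\<Sum>\<gamma>\<in>F. ?i \<gamma> t * (norm (g t))\<^sup>2) \<le> M * (norm (g t))\<^sup>2" for t
        unfolding sum_distrib_right[symmetric] by (rule mult_right_mono[OF pt]) simp
    qed
    finally show "(\<Sum>\<gamma>\<in>F. indicator {u..v} (y + snd \<gamma>) * local_energy g \<rho> (- (x + fst \<gamma>))) \<le> M * (\<integral>t. (norm (g t))\<^sup>2 \<partial>lborel)"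
      by simp
  qed
qed

section \<open>Periodization along the lattice\<close>

definition windowed :: "real \<Rightarrow> ('b \<Rightarrow> complex) \<Rightarrow> 'b \<times> real \<Rightarrow> complex" where
  "windowed a F z = F (fst z) * of_real (indicator {- a..a} (snd z))"

definition torus_series :: "'b set \<Rightarrow> real \<Rightarrow> ('b \<Rightarrow> complex) \<Rightarrow> ('b \<Rightarrow> complex) \<Rightarrow> ('b \<Rightarrow> complex) \<Rightarrow> ('b \<Rightarrow> complex) \<Rightarrow> 'b \<times> real \<Rightarrow> complex" where
  "torus_series \<Delta> a f k g h z = (\<Sum>\<^sub>\<infinity>\<gamma>\<in>\<Gamma>. windowed a (corr_series \<Delta> f k g h) (z + \<gamma>))"

lemma torus_series_periodic:
  assumes "\<gamma>0 \<in> \<Gamma>"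
  shows "torus_series \<Delta> a f k g h (z + \<gamma>0) = torus_series \<Delta> a f k g h z"
proof -
  have "bij_betw ((+) \<gamma>0) \<Gamma> \<Gamma>"
    unfolding bij_betw_def
  proof (intro conjI equalityI subsetI)
    show "inj_on ((+) \<gamma>0) \<Gamma>" by simp
    show "x \<in> \<Gamma>" if "x \<in> (+) \<gamma>0 ` \<Gamma>" for x using that lattice_add[OF assms] by (elim imageE) simp
    show "x \<in> (+) \<gamma>0 ` \<Gamma>" if "x \<in> \<Gamma>" for x using lattice_diff[OF that assms] by (intro image_eqI[of _ _ "x - \<gamma>0"]) simp_all
  qed
  from infsum_reindex_bij_betw[OF this, of "\<lambda>\<gamma>. windowed a (corr_series \<Delta> f k g h) (z + \<gamma>)"]
  show ?thesis by (simp add: torus_series_def add.assoc)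
qed

context
  fixes \<Delta> :: "'b set" and a :: real and f k g h :: "'b \<Rightarrow> complex"
  assumes \<Delta>: "uniform_discrete \<Delta>" and a: "a > 0" and f: "f \<in> test_functions" and k: "k \<in> test_functions"
    and gs: "square_integrable g" and hs: "square_integrable h"
begin

text \<open>The terms are dominated by local energies at the lattice points of a strip. For
  continuity, enlarging radius and window by 1 gives a majorant valid on the whole unit ball around
  \<open>(x0, y0)\<close>, and every single term is continuous there because no lattice translate of
  \<open>y0\<close> hits an endpoint of the window.\<close>

lemma torus_series_summable:
  "\<exists>K. \<forall>z. (\<lambda>\<gamma>. norm (windowed a (corr_series \<Delta> f k g h) (z + \<gamma>))) summable_on \<Gamma> \<and> norm (torus_series \<Delta> a f k g h z) \<le> K"
  and torus_series_isCont: "(\<And>\<gamma>. \<gamma> \<in> \<Gamma> \<Longrightarrow> \<bar>y0 + snd \<gamma>\<bar> \<noteq> a) \<Longrightarrow> isCont (torus_series \<Delta> a f k g h) (x0, y0)"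
proof -
  let ?F = "corr_series \<Delta> f k g h"
  obtain K \<rho> where K: "K \<ge> 0" "\<rho> > 0"
    "\<forall>y. (\<lambda>\<beta>. norm (correlation f g y \<beta> * cnj (correlation k h y \<beta>))) summable_on \<Delta>"
    "\<forall>y. (\<Sum>\<^sub>\<infinity>\<beta>\<in>\<Delta>. norm (correlation f g y \<beta> * cnj (correlation k h y \<beta>))) \<le> K * (local_energy g \<rho> (- y) + local_energy h \<rho> (- y))"
    "\<forall>y. norm (?F y) \<le> K * (local_energy g \<rho> (- y) + local_energy h \<rho> (- y))"
    "\<forall>y. isCont ?F y"
    by (rule corr_series_props[OF \<Delta> f k gs hs])
  define E where "E = (\<integral>t. (norm (g t))\<^sup>2 \<partial>lborel) + (\<integral>t. (norm (h t))\<^sup>2 \<partial>lborel)"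
  define env where "env b r x y \<gamma> = indicator {- b..b} (y + snd \<gamma>) * (K * (local_energy g r (- (x + fst \<gamma>)) + local_energy h r (- (x + fst \<gamma>))))" for b r y :: real and x :: 'b and \<gamma> :: "'b \<times> real"
  have env0: "0 \<le> env b r x y \<gamma>" for b r x y \<gamma>
    unfolding env_def using K(1) by (intro mult_nonneg_nonneg add_nonneg_nonneg local_energy_nonneg) auto
  have env_sum: "\<exists>M. \<forall>x y F. finite F \<longrightarrow> F \<subseteq> \<Gamma> \<longrightarrow> (\<Sum>\<gamma>\<in>F. env b r x y \<gamma>) \<le> M" if br: "b > 0" "r > 0" for b r
  proof -
    have bb: "- b \<le> b" using br by simp
    obtain M where M: "M \<ge> 0" "\<forall>g x y F. square_integrable g \<longrightarrow> finite F \<longrightarrow> F \<subseteq> \<Gamma> \<longrightarrow>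
       (\<Sum>\<gamma>\<in>F. indicator {- b..b} (y + snd \<gamma>) * local_energy g r (- (x + fst \<gamma>))) \<le> M * (\<integral>t. (norm (g t))\<^sup>2 \<partial>lborel)"
      by (rule energy_sum_bound[OF bb br(2)])
    have "(\<Sum>\<gamma>\<in>F. env b r x y \<gamma>) \<le> K * (M * E)" if F: "finite F" "F \<subseteq> \<Gamma>" for x y F
    proof -
      have "(\<Sum>\<gamma>\<in>F. env b r x y \<gamma>) = K * ((\<Sum>\<gamma>\<in>F. indicator {- b..b} (y + snd \<gamma>) * local_energy g r (- (x + fst \<gamma>))) +
          (\<Sum>\<gamma>\<in>F. indicator {- b..b} (y + snd \<gamma>) * local_energy h r (- (x + fst \<gamma>))))"
        unfolding env_def sum.distrib[symmetric] sum_distrib_left by (intro sum.cong refl) (simp add: algebra_simps)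
      also have "\<dots> \<le> K * (M * E)"
        using M(2) gs hs F unfolding E_def distrib_left[of M] by (intro mult_left_mono add_mono K(1)) blast+
      finally show ?thesis .
    qed
    then show ?thesis by blast
  qed
  have le: "norm (windowed a ?F (z + \<gamma>)) \<le> env a \<rho> (fst z) (snd z) \<gamma>" for z \<gamma>
    using spec[OF K(5), of "fst z + fst \<gamma>"] by (simp add: windowed_def env_def norm_mult indicator_def)
  obtain M where M: "\<forall>x y F. finite F \<longrightarrow> F \<subseteq> \<Gamma> \<longrightarrow> (\<Sum>\<gamma>\<in>F. env a \<rho> x y \<gamma>) \<le> M"
    using env_sum[OF a K(2)] by blast
  have fin: "(\<Sum>\<gamma>\<in>F. norm (windowed a ?F (z + \<gamma>))) \<le> M" if "finite F" "F \<subseteq> \<Gamma>" for F z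
    using sum_mono[of F "\<lambda>\<gamma>. norm (windowed a ?F (z + \<gamma>))" "env a \<rho> (fst z) (snd z)"] le M that by (meson order_trans)
  have s: "(\<lambda>\<gamma>. norm (windowed a ?F (z + \<gamma>))) summable_on \<Gamma>" "(\<Sum>\<^sub>\<infinity>\<gamma>\<in>\<Gamma>. norm (windowed a ?F (z + \<gamma>))) \<le> M" for z
    by (rule bounded_sums_summable[OF _ fin]; simp)+
  have "norm (torus_series \<Delta> a f k g h z) \<le> M" for z
    unfolding torus_series_def using norm_infsum_bound[OF s(1)] s(2) by (rule order_trans)
  then show "\<exists>K. \<forall>z. (\<lambda>\<gamma>. norm (windowed a ?F (z + \<gamma>))) summable_on \<Gamma> \<and> norm (torus_series \<Delta> a f k g h z) \<le> K"
    using s(1) by blast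
  assume reg: "\<And>\<gamma>. \<gamma> \<in> \<Gamma> \<Longrightarrow> \<bar>y0 + snd \<gamma>\<bar> \<noteq> a"
  obtain M' where M': "\<forall>x y F. finite F \<longrightarrow> F \<subseteq> \<Gamma> \<longrightarrow> (\<Sum>\<gamma>\<in>F. env (a + 1) (\<rho> + 1) x y \<gamma>) \<le> M'"
    using env_sum[of "a + 1" "\<rho> + 1"] a K(2) by auto
  show "isCont (torus_series \<Delta> a f k g h) (x0, y0)"
    unfolding torus_series_def
  proof (rule isCont_infsum[where r = 1 and M = "env (a + 1) (\<rho> + 1) x0 y0"])
    show "env (a + 1) (\<rho> + 1) x0 y0 summable_on \<Gamma>"
      by (rule bounded_sums_summable(1)[OF env0]) (use M' in blast)
    fix \<gamma> assume \<gamma>: "\<gamma> \<in> \<Gamma>"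
    show "isCont (\<lambda>z. windowed a ?F (z + \<gamma>)) (x0, y0)"
    proof -
      have "y0 + snd \<gamma> \<notin> frontier {- a..a}" using reg[OF \<gamma>] a by (auto simp: frontier_def)
      then have "isCont (indicator {- a..a} :: real \<Rightarrow> real) (y0 + snd \<gamma>)" by (simp add: isCont_indicator)
      then have 1: "isCont (\<lambda>z::'b \<times> real. indicator {- a..a} (snd z + snd \<gamma>) :: real) (x0, y0)"
        by (intro isCont_o2[where f = "\<lambda>z. snd z + snd \<gamma>" and g = "indicator {- a..a}"] continuous_add continuous_snd continuous_ident continuous_const) simp
      have 2: "isCont (\<lambda>z::'b \<times> real. ?F (fst z + fst \<gamma>)) (x0, y0)"
        by (intro isCont_o2[where f = "\<lambda>z. fst z + fst \<gamma>" and g = ?F] continuous_add continuous_fst continuous_ident continuous_const)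
          (rule spec[OF K(6)])
      show ?thesis unfolding windowed_def fst_add snd_add by (intro continuous_mult continuous_of_real 1 2)
    qed
    fix z assume z: "z \<in> ball (x0, y0) 1"
    have d: "norm (fst z - x0) \<le> 1" "\<bar>snd z - y0\<bar> \<le> 1"
    proof -
      have "dist z (x0, y0) < 1" using z by (simp only: mem_ball dist_commute)
      then show "norm (fst z - x0) \<le> 1" "\<bar>snd z - y0\<bar> \<le> 1"
        using dist_fst_le[of z "(x0, y0)"] dist_snd_le[of z "(x0, y0)"] by (simp_all only: dist_norm fst_conv snd_conv real_norm_def)
    qed
    have sub: "cball (- (fst z + fst \<gamma>)) \<rho> \<subseteq> cball (- (x0 + fst \<gamma>)) (\<rho> + 1)"
      by (rule local_energy_shift_subset) (use d in simp)
    have "indicator {- a..a} (snd z + snd \<gamma>) \<le> (indicator {- (a + 1)..a + 1} (y0 + snd \<gamma>) :: real)"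
      using d(2) by (auto simp: indicator_def abs_le_iff)
    then have "env a \<rho> (fst z) (snd z) \<gamma> \<le> env (a + 1) (\<rho> + 1) x0 y0 \<gamma>"
      unfolding env_def using K(1) local_energy_mono[OF gs sub] local_energy_mono[OF hs sub]
      by (intro mult_mono mult_left_mono add_mono mult_nonneg_nonneg add_nonneg_nonneg local_energy_nonneg) auto
    then show "norm (windowed a ?F (z + \<gamma>)) \<le> env (a + 1) (\<rho> + 1) x0 y0 \<gamma>" using le order_trans by blast
  qed simp
qed

end

lemma integral_product_function:
  fixes u :: "'b \<Rightarrow> complex" and v :: "real \<Rightarrow> complex"
  assumes u: "integrable lborel u" and v: "integrable lborel v"
  shows "integrable lborel (\<lambda>z. u (fst z) * v (snd z))"
    and "(\<integral>z. u (fst z) * v (snd z) \<partial>lborel) = (\<integral>x. u x \<partial>lborel) * (\<integral>y. v y \<partial>lborel)"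
proof -
  have [measurable]: "u \<in> borel_measurable borel" "v \<in> borel_measurable borel"
    using borel_measurable_integrable[OF u] borel_measurable_integrable[OF v] by auto
  have i: "integrable (lborel \<Otimes>\<^sub>M lborel) (\<lambda>z. u (fst z) * v (snd z))"
  proof (rule lborel_pair.Fubini_integrable)
    show "(\<lambda>z. u (fst z) * v (snd z)) \<in> borel_measurable (lborel \<Otimes>\<^sub>M lborel)" by measurable
    show "integrable lborel (\<lambda>x. \<integral>y. norm (u (fst (x, y)) * v (snd (x, y))) \<partial>lborel)"
      using u by (simp add: norm_mult)
  qed (use v in simp)
  then show "integrable lborel (\<lambda>z. u (fst z) * v (snd z))" by (simp only: lborel_prod)
  have "(\<integral>z. u (fst z) * v (snd z) \<partial>lborel) = (\<integral>z. u (fst z) * v (snd z) \<partial>(lborel \<Otimes>\<^sub>M lborel))"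
    by (simp only: lborel_prod)
  also have "\<dots> = (\<integral>x. (\<integral>y. u (fst (x, y)) * v (snd (x, y)) \<partial>lborel) \<partial>lborel)"
    by (rule lborel_pair.integral_fst'[symmetric, OF i])
  also have "\<dots> = (\<integral>x. u x \<partial>lborel) * (\<integral>y. v y \<partial>lborel)" by simp
  finally show "(\<integral>z. u (fst z) * v (snd z) \<partial>lborel) = (\<integral>x. u x \<partial>lborel) * (\<integral>y. v y \<partial>lborel)" .
qed

text \<open>Symmetry of the window allows the coefficient at \<eta> to be written with the argument
  \<open>- snd \<eta>\<close> that occurs in the theorem.\<close>

lemma fourier_uniform_density_even: "fourier (uniform_density a) (- t) = fourier (uniform_density a) t"
proof -
  let ?u = "\<lambda>x. uniform_density a x * cis (- 2 * pi * (x \<bullet> t))"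
  have "fourier (uniform_density a) t = (\<integral>x. ?u (0 - x) \<partial>lborel)"
    unfolding fourier_lborel[OF uniform_density_borel] by (rule lborel_integral_shift(3)[symmetric]) measurable
  also have "\<dots> = fourier (uniform_density a) (- t)"
    unfolding fourier_lborel[OF uniform_density_borel]
    by (intro Bochner_Integration.integral_cong refl) (auto simp: normalized_indicator_def indicator_def)
  finally show ?thesis ..
qed

lemma torus_series_measurable:
  assumes \<Delta>: "uniform_discrete \<Delta>" and a: "a > 0" and f: "f \<in> test_functions" and k: "k \<in> test_functions"
    and g: "amalgam g w" and h: "amalgam h w'"
  shows "torus_series \<Delta> a f k g h \<in> borel_measurable borel"
proof -
  note gs = amalgam_square_integrable[OF g] and hs = amalgam_square_integrable[OF h]
  have Fm [measurable]: "corr_series \<Delta> f k g h \<in> borel_measurable borel"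
    using borel_measurable_integrable[OF corr_series_fourier(1)[OF \<Delta> f k g h]] by simp
  obtain K where K: "\<forall>z. (\<lambda>\<gamma>. norm (windowed a (corr_series \<Delta> f k g h) (z + \<gamma>))) summable_on \<Gamma> \<and> norm (torus_series \<Delta> a f k g h z) \<le> K"
    using torus_series_summable[OF \<Delta> a f k gs hs] by blast
  have fsm [measurable]: "(\<lambda>z::'b \<times> real. fst z) \<in> borel_measurable borel" "(\<lambda>z::'b \<times> real. snd z) \<in> borel_measurable borel"
    by (intro borel_measurable_continuous_onI continuous_intros)+
  show ?thesis unfolding torus_series_def[abs_def]
  proof (rule borel_measurable_infsum[OF countable_lattice])
    show "(\<lambda>z. windowed a (corr_series \<Delta> f k g h) (z + \<gamma>)) \<in> borel_measurable borel" for \<gamma>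
      unfolding windowed_def fst_add snd_add by measurable
    show "(\<lambda>\<gamma>. windowed a (corr_series \<Delta> f k g h) (z + \<gamma>)) summable_on \<Gamma>" for z
      by (rule abs_summable_summable[OF conjunct1[OF spec[OF K]]])
  qed
qed

text \<open>The character is periodic and can be taken inside the periodization, so unfolding gives
  an integral over the whole space. There the integrand is a function of \<open>fst z\<close> times
  a function of \<open>snd z\<close>: the first factor is handled by Parseval, the second is the
  transform of the window.\<close>

lemma torus_series_coefficient:
  assumes \<Delta>: "uniform_discrete \<Delta>" and a: "a > 0" and f: "f \<in> test_functions" and k: "k \<in> test_functions"
    and g: "amalgam g w" and h: "amalgam h w'" and \<eta>: "\<eta> \<in> dual_lattice \<Gamma>"
  shows "(\<integral>z. indicator cell z *\<^sub>R (torus_series \<Delta> a f k g h z * cis (- (2 * pi * (\<eta> \<bullet> z)))) \<partial>lborel) =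
    of_real (2 * a) * fourier (uniform_density a) (- snd \<eta>) *
      (\<integral>\<omega>. fourier f \<omega> * cnj (fourier k (\<omega> - fst \<eta>)) * cross_series \<Delta> g h (fst \<eta>) \<omega> \<partial>lborel)"
proof -
  note gs = amalgam_square_integrable[OF g] and hs = amalgam_square_integrable[OF h]
  let ?F = "corr_series \<Delta> f k g h"
  have Fi: "integrable lborel ?F" by (rule corr_series_fourier(1)[OF \<Delta> f k g h])
  have [measurable]: "?F \<in> borel_measurable borel" using borel_measurable_integrable[OF Fi] by simp
  define u where "u x = ?F x * cis (- 2 * pi * (fst \<eta> \<bullet> x))" for x
  define v where "v y = complex_of_real (indicator {- a..a} y) * cis (- 2 * pi * (snd \<eta> * y))" for y
  have ui: "integrable lborel u"
    by (rule Bochner_Integration.integrable_bound[OF Fi]) (auto simp: u_def[abs_def] norm_mult)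
  have vU: "v y = of_real (2 * a) * (uniform_density a y * cis (- 2 * pi * (y \<bullet> snd \<eta>)))" for y
    using a by (simp add: v_def uniform_density_eq mult.commute)
  have ci: "integrable lborel (\<lambda>y. uniform_density a y * cis (- 2 * pi * (y \<bullet> snd \<eta>)))"
    by (rule Bochner_Integration.integrable_bound[OF uniform_density_integrable[of a]]) (auto simp: norm_mult)
  have vi: "integrable lborel v" unfolding vU[abs_def] using ci by (rule integrable_mult_right)
  have vint: "(\<integral>y. v y \<partial>lborel) = of_real (2 * a) * fourier (uniform_density a) (- snd \<eta>)"
    unfolding vU fourier_uniform_density_even unfolding fourier_lborel[OF uniform_density_borel] by (rule integral_mult_right_zero)
  have uint: "(\<integral>x. u x \<partial>lborel) = (\<integral>\<omega>. fourier f \<omega> * cnj (fourier k (\<omega> - fst \<eta>)) * cross_series \<Delta> g h (fst \<eta>) \<omega> \<partial>lborel)"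
    unfolding u_def by (rule corr_series_fourier(2)[OF \<Delta> f k g h])
  define \<phi> where "\<phi> z = u (fst z) * v (snd z)" for z
  have \<phi>i: "integrable lborel \<phi>" unfolding \<phi>_def by (rule integral_product_function(1)[OF ui vi])
  have per: "cis (- (2 * pi * (\<eta> \<bullet> (z + \<gamma>)))) = cis (- (2 * pi * (\<eta> \<bullet> z)))" if "\<gamma> \<in> \<Gamma>" for z \<gamma>
    using arg_cong[OF cis_periodic[OF \<eta> that, of z], of cnj] by (simp add: cis_cnj)
  have \<phi>w: "\<phi> z = windowed a ?F z * cis (- (2 * pi * (\<eta> \<bullet> z)))" for z
  proof -
    have "\<eta> \<bullet> z = fst \<eta> \<bullet> fst z + snd \<eta> * snd z" by (cases \<eta>; cases z) simp
    then have "cis (- (2 * pi * (\<eta> \<bullet> z))) = cis (- 2 * pi * (fst \<eta> \<bullet> fst z)) * cis (- 2 * pi * (snd \<eta> * snd z))"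
      by (simp add: cis_mult algebra_simps)
    then show ?thesis by (simp add: \<phi>_def u_def v_def windowed_def)
  qed
  have \<phi>\<gamma>: "\<phi> (z + \<gamma>) = windowed a ?F (z + \<gamma>) * cis (- (2 * pi * (\<eta> \<bullet> z)))" if "\<gamma> \<in> \<Gamma>" for z \<gamma>
    unfolding \<phi>w per[OF that] ..
  obtain K where K: "\<forall>z. (\<lambda>\<gamma>. norm (windowed a ?F (z + \<gamma>))) summable_on \<Gamma> \<and> norm (torus_series \<Delta> a f k g h z) \<le> K"
    using torus_series_summable[OF \<Delta> a f k gs hs] by blast
  have s: "(\<lambda>\<gamma>. norm (\<phi> (z + \<gamma>))) summable_on \<Gamma>" for z
  proof -
    have "norm (\<phi> (z + \<gamma>)) = norm (windowed a ?F (z + \<gamma>))" if "\<gamma> \<in> \<Gamma>" for \<gamma>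
      unfolding \<phi>\<gamma>[OF that] by (simp add: norm_mult)
    then have "(\<lambda>\<gamma>. norm (\<phi> (z + \<gamma>))) summable_on \<Gamma> \<longleftrightarrow> (\<lambda>\<gamma>. norm (windowed a ?F (z + \<gamma>))) summable_on \<Gamma>"
      by (rule summable_on_cong)
    then show ?thesis using conjunct1[OF spec[OF K, of z]] by (rule iffD2)
  qed
  have h: "(\<Sum>\<^sub>\<infinity>\<gamma>\<in>\<Gamma>. \<phi> (z + \<gamma>)) = torus_series \<Delta> a f k g h z * cis (- (2 * pi * (\<eta> \<bullet> z)))" for z
  proof -
    have "(\<Sum>\<^sub>\<infinity>\<gamma>\<in>\<Gamma>. \<phi> (z + \<gamma>)) = (\<Sum>\<^sub>\<infinity>\<gamma>\<in>\<Gamma>. windowed a ?F (z + \<gamma>) * cis (- (2 * pi * (\<eta> \<bullet> z))))"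
      by (rule infsum_cong) (rule \<phi>\<gamma>)
    also have "\<dots> = torus_series \<Delta> a f k g h z * cis (- (2 * pi * (\<eta> \<bullet> z)))"
      unfolding torus_series_def by (rule infsum_cmult_left')
    finally show ?thesis .
  qed
  have "(\<integral>z. indicator cell z *\<^sub>R (torus_series \<Delta> a f k g h z * cis (- (2 * pi * (\<eta> \<bullet> z)))) \<partial>lborel) = (\<integral>z. \<phi> z \<partial>lborel)"
    using unfolding_integral(2)[OF \<phi>i s] unfolding h .
  also have "\<dots> = (\<integral>x. u x \<partial>lborel) * (\<integral>y. v y \<partial>lborel)"
    unfolding \<phi>_def by (rule integral_product_function(2)[OF ui vi])
  finally show ?thesis unfolding uint vint by (simp only: mult.commute)
qed

lemma torus_series_translate:
  assumes f: "f \<in> test_functions" and k: "k \<in> test_functions" and g: "g \<in> borel_measurable borel" and h: "h \<in> borel_measurable borel"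
  shows "torus_series \<Delta> a (\<lambda>t. f (t - x)) (\<lambda>t. k (t - x)) g h 0 = torus_series \<Delta> a f k g h (- x, 0)"
proof -
  have "corr_series \<Delta> (\<lambda>t. f (t - x)) (\<lambda>t. k (t - x)) g h y = corr_series \<Delta> f k g h (y - x)" for y
    unfolding corr_series_def correlation_translate[OF test_function_borel[OF f] g] correlation_translate[OF test_function_borel[OF k] h] ..
  then show ?thesis by (simp add: torus_series_def windowed_def)
qed

lemma torus_series_zero:
  "torus_series \<Delta> a f k g h 0 = (\<Sum>\<^sub>\<infinity>x\<in>model_set \<Gamma> {- a..a}. corr_series \<Delta> f k g h x)"
proof -
  let ?A = "{\<gamma> \<in> \<Gamma>. snd \<gamma> \<in> {- a..a}}"
  have "torus_series \<Delta> a f k g h 0 = (\<Sum>\<^sub>\<infinity>\<gamma>\<in>?A. corr_series \<Delta> f k g h (fst \<gamma>))"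
    unfolding torus_series_def by (rule infsum_cong_neutral) (auto simp: windowed_def)
  also have "\<dots> = (\<Sum>\<^sub>\<infinity>x\<in>fst ` ?A. corr_series \<Delta> f k g h x)"
  proof -
    have "bij_betw fst ?A (fst ` ?A)" using inj_on_subset[OF inj_fst, of ?A] by (auto simp: bij_betw_def)
    from infsum_reindex_bij_betw[OF this, of "corr_series \<Delta> f k g h"] show ?thesis .
  qed
  finally show ?thesis by (simp add: model_set_def)
qed

end

lemma L2_inner_lborel:
  assumes [measurable]: "f \<in> borel_measurable borel" "k \<in> borel_measurable borel"
  shows "L2_inner f k = (\<integral>t. f t * cnj (k t) \<partial>lborel)"
  unfolding L2_inner_def by (rule integral_completion) measurable

lemma L2_inner_shift:
  assumes [measurable]: "f \<in> borel_measurable borel" "k \<in> borel_measurable borel"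
  shows "L2_inner (\<lambda>t. f (t - x)) (\<lambda>t. k (t - x)) = L2_inner f k"
proof -
  have m: "(\<lambda>t. f t * cnj (k t)) \<in> borel_measurable borel" by measurable
  have "L2_inner (\<lambda>t. f (t - x)) (\<lambda>t. k (t - x)) = (\<integral>t. f (t - x) * cnj (k (t - x)) \<partial>lborel)"
    by (rule L2_inner_lborel) measurable
  also have "\<dots> = L2_inner f k" unfolding L2_inner_lborel[OF assms] by (rule lborel_integral_shift(2)[OF m])
  finally show ?thesis .
qed

lemma snd_level_null:
  "{z. snd z = c} \<in> null_sets (lborel :: ('a::euclidean_space \<times> real) measure)"
proof -
  have eq: "{z. snd z = c} = {z. (0::'a, 1::real) \<bullet> z = c}" by auto
  have "{z :: 'a \<times> real. snd z = c} \<in> null_sets lebesgue"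
    unfolding eq negligible_iff_null_sets[symmetric] by (rule negligible_hyperplane) (simp add: zero_prod_def)
  moreover have "closed {z :: 'a \<times> real. snd z = c}" by (intro closed_Collect_eq continuous_intros)
  ultimately show ?thesis by (subst (asm) null_sets_completion_iff) auto
qed

lemma fourier_product:
  fixes f k :: "'a::euclidean_space \<Rightarrow> complex"
  assumes f: "f \<in> test_functions" and k: "k \<in> test_functions"
  shows "integrable lborel (\<lambda>\<omega>. fourier f \<omega> * cnj (fourier k (\<omega> - \<xi>)))"
    and "(\<integral>\<omega>. fourier f \<omega> * cnj (fourier k \<omega>) \<partial>lborel) = L2_inner f k"
proof -
  have P: "integrable lborel u" "AE x in lborel. isCont u x" "\<exists>A. \<forall>x. norm (u x) \<le> A"
    if "u \<in> test_functions" for u :: "'a \<Rightarrow> complex"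
  proof -
    show "integrable lborel u" "AE x in lborel. isCont u x" by (simp_all add: test_function_props[OF that])
    show "\<exists>A. \<forall>x. norm (u x) \<le> A" using test_function_bounds[OF that] by blast
  qed
  let ?k = "\<lambda>t. k (1 *\<^sub>R t) * cis (2 * pi * (\<xi> \<bullet> t))"
  have k': "?k \<in> test_functions" by (rule test_function_modulate_scale[OF k]) simp
  obtain A where A: "\<And>x. norm (f x) \<le> A" using P(3)[OF f] by blast
  obtain B where B: "\<And>x. norm (k x) \<le> B" using P(3)[OF k] by blast
  obtain B' where B': "\<And>x. norm (?k x) \<le> B'" using P(3)[OF k'] by blast
  have "integrable lborel (\<lambda>\<omega>. fourier f \<omega> * cnj (fourier ?k \<omega>))"
    by (rule parseval(1)[OF P(1)[OF f] A P(2)[OF f] P(1)[OF k'] B' P(2)[OF k']])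
  then show "integrable lborel (\<lambda>\<omega>. fourier f \<omega> * cnj (fourier k (\<omega> - \<xi>)))"
    by (simp add: fourier_modulate test_function_borel[OF k])
  show "(\<integral>\<omega>. fourier f \<omega> * cnj (fourier k \<omega>) \<partial>lborel) = L2_inner f k"
    unfolding parseval(2)[OF P(1)[OF f] A P(2)[OF f] P(1)[OF k] B P(2)[OF k]]
    by (rule L2_inner_lborel[symmetric]) (use f k test_function_borel in auto)
qed

lemma integrable_mult_bounded:
  fixes v G :: "'a::euclidean_space \<Rightarrow> complex"
  assumes v: "integrable lborel v" and [measurable]: "G \<in> borel_measurable borel" and C: "\<And>\<omega>. norm (G \<omega>) \<le> C"
  shows "integrable lborel (\<lambda>\<omega>. v \<omega> * G \<omega>)"
proof (rule Bochner_Integration.integrable_bound[OF integrable_mult_right[OF integrable_norm[OF v], of C]])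
  show "(\<lambda>\<omega>. v \<omega> * G \<omega>) \<in> borel_measurable lborel" using borel_measurable_integrable[OF v] by measurable
  have "norm (v \<omega> * G \<omega>) \<le> norm (C * norm (v \<omega>))" for \<omega>
  proof -
    have "norm (v \<omega> * G \<omega>) \<le> norm (v \<omega>) * C"
      unfolding norm_mult by (rule mult_left_mono[OF C]) simp
    also have "\<dots> \<le> norm (C * norm (v \<omega>))" by (simp only: real_norm_def mult.commute abs_ge_self)
    finally show ?thesis .
  qed
  then show "AE \<omega> in lborel. norm (v \<omega> * G \<omega>) \<le> norm (C * norm (v \<omega>))" by simp
qed

definition cross_sum :: "'a::euclidean_space set \<Rightarrow> nat \<Rightarrow> (nat \<Rightarrow> 'a \<Rightarrow> complex) \<Rightarrow> (nat \<Rightarrow> 'a \<Rightarrow> complex) \<Rightarrow> 'a \<Rightarrow> 'a \<Rightarrow> complex" where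
  "cross_sum \<Delta> L g h \<xi> \<omega> = (\<Sum>l=1..L. cross_series \<Delta> (g l) (h l) \<xi> \<omega>)"

lemma cross_sum_regular:
  assumes \<Delta>: "uniform_discrete \<Delta>" and g: "\<And>l. l \<in> {1..L} \<Longrightarrow> amalgam (g l) (w l)" and h: "\<And>l. l \<in> {1..L} \<Longrightarrow> amalgam (h l) (w' l)"
  shows "isCont (cross_sum \<Delta> L g h \<xi>) \<omega>" and "\<exists>K. \<forall>\<omega>. norm (cross_sum \<Delta> L g h \<xi> \<omega>) \<le> K"
proof -
  have one: "(\<exists>K. \<forall>\<omega>. norm (cross_series \<Delta> (g l) (h l) \<xi> \<omega>) \<le> K) \<and> (\<forall>\<omega>. isCont (cross_series \<Delta> (g l) (h l) \<xi>) \<omega>)"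
    if l: "l \<in> {1..L}" for l
    by (rule cross_series_bounds[OF \<Delta> g[OF l] h[OF l]]) blast
  show "isCont (cross_sum \<Delta> L g h \<xi>) \<omega>"
    unfolding cross_sum_def[abs_def] using one by (intro continuous_sum) blast
  from one have "\<forall>l\<in>{1..L}. \<exists>K. \<forall>\<omega>. norm (cross_series \<Delta> (g l) (h l) \<xi> \<omega>) \<le> K" by blast
  from bchoice[OF this] obtain K where K: "\<forall>l\<in>{1..L}. \<forall>\<omega>. norm (cross_series \<Delta> (g l) (h l) \<xi> \<omega>) \<le> K l" by blast
  have "norm (cross_sum \<Delta> L g h \<xi> \<omega>) \<le> (\<Sum>l=1..L. K l)" for \<omega>
    unfolding cross_sum_def by (rule sum_norm_le) (use K in blast)
  then show "\<exists>K. \<forall>\<omega>. norm (cross_sum \<Delta> L g h \<xi> \<omega>) \<le> K" by blast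
qed

section \<open>The sum over generators and the defect of the duality condition\<close>

context cut_and_project
begin

lemma torus_series_bounded:
  assumes "uniform_discrete \<Delta>" "a > 0" "f \<in> test_functions" "k \<in> test_functions" "square_integrable g" "square_integrable h"
  shows "\<exists>K. \<forall>z. norm (torus_series \<Delta> a f k g h z) \<le> K"
proof -
  obtain K where K: "\<forall>z. (\<lambda>\<gamma>. norm (windowed a (corr_series \<Delta> f k g h) (z + \<gamma>))) summable_on \<Gamma> \<and> norm (torus_series \<Delta> a f k g h z) \<le> K"
    using torus_series_summable[OF assms] by (elim exE)
  show ?thesis by (intro exI allI) (rule conjunct2[OF spec[OF K]])
qed

definition torus_sum :: "'b set \<Rightarrow> real \<Rightarrow> nat \<Rightarrow> (nat \<Rightarrow> 'b \<Rightarrow> complex) \<Rightarrow> (nat \<Rightarrow> 'b \<Rightarrow> complex) \<Rightarrow> ('b \<Rightarrow> complex) \<Rightarrow> ('b \<Rightarrow> complex) \<Rightarrow> 'b \<times> real \<Rightarrow> complex" where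
  "torus_sum \<Delta> a L g h f k z = (\<Sum>l=1..L. torus_series \<Delta> a f k (g l) (h l) z)"

text \<open>The exceptional points lie on countably many hyperplanes on which \<open>snd z\<close>
  is constant, two for each lattice point.\<close>

lemma AE_regular: "AE z in (lborel :: ('b \<times> real) measure). \<forall>\<gamma>\<in>\<Gamma>. \<bar>snd z + snd \<gamma>\<bar> \<noteq> a"
  unfolding AE_ball_countable[OF countable_lattice]
proof
  fix \<gamma> :: "'b \<times> real"
  show "AE z in (lborel :: ('b \<times> real) measure). \<bar>snd z + snd \<gamma>\<bar> \<noteq> a"
  proof (rule AE_I')
    show "{z :: 'b \<times> real. snd z = a - snd \<gamma>} \<union> {z. snd z = - a - snd \<gamma>} \<in> null_sets lborel"
      by (intro null_sets.Un snd_level_null)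
    show "{z \<in> space lborel. \<not> \<bar>snd z + snd \<gamma>\<bar> \<noteq> a} \<subseteq> {z :: 'b \<times> real. snd z = a - snd \<gamma>} \<union> {z. snd z = - a - snd \<gamma>}"
      by auto
  qed
qed

context
  fixes \<Delta> :: "'b set" and a :: real and L :: nat and g h :: "nat \<Rightarrow> 'b \<Rightarrow> complex" and w w' :: "nat \<Rightarrow> 'b \<Rightarrow> real"
  assumes \<Delta>: "uniform_discrete \<Delta>" and a: "a > 0"
    and g: "\<And>l. l \<in> {1..L} \<Longrightarrow> amalgam (g l) (w l)" and h: "\<And>l. l \<in> {1..L} \<Longrightarrow> amalgam (h l) (w' l)"
begin

lemma cross_regular:
  "isCont (cross_sum \<Delta> L g h \<xi>) \<omega>" "\<exists>K. \<forall>\<omega>. norm (cross_sum \<Delta> L g h \<xi> \<omega>) \<le> K"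
  by (rule cross_sum_regular[OF \<Delta> g h]; assumption)+

lemma torus_sum_regular:
  assumes f: "f \<in> test_functions" and k: "k \<in> test_functions"
  shows "\<exists>K. \<forall>z. norm (torus_sum \<Delta> a L g h f k z) \<le> K"
    and "torus_sum \<Delta> a L g h f k \<in> borel_measurable borel"
    and "\<forall>\<gamma>\<in>\<Gamma>. \<bar>y + snd \<gamma>\<bar> \<noteq> a \<Longrightarrow> isCont (torus_sum \<Delta> a L g h f k) (x, y)"
    and "\<gamma> \<in> \<Gamma> \<Longrightarrow> torus_sum \<Delta> a L g h f k (z + \<gamma>) = torus_sum \<Delta> a L g h f k z"
proof -
  note sq = amalgam_square_integrable[OF g] amalgam_square_integrable[OF h]
  have "\<exists>K. \<forall>z. norm (torus_series \<Delta> a f k (g l) (h l) z) \<le> K" if "l \<in> {1..L}" for l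
    by (rule torus_series_bounded[OF \<Delta> a f k sq(1)[OF that] sq(2)[OF that]])
  then have "\<forall>l\<in>{1..L}. \<exists>K. \<forall>z. norm (torus_series \<Delta> a f k (g l) (h l) z) \<le> K" by (rule ballI)
  from bchoice[OF this] obtain K where K: "\<forall>l\<in>{1..L}. \<forall>z. norm (torus_series \<Delta> a f k (g l) (h l) z) \<le> K l" by (elim exE)
  have "norm (torus_sum \<Delta> a L g h f k z) \<le> (\<Sum>l=1..L. K l)" for z
    unfolding torus_sum_def by (rule sum_norm_le) (rule K[rule_format])
  then show "\<exists>K. \<forall>z. norm (torus_sum \<Delta> a L g h f k z) \<le> K" by (intro exI allI)
  show "torus_sum \<Delta> a L g h f k \<in> borel_measurable borel"
    unfolding torus_sum_def[abs_def] by (intro borel_measurable_sum torus_series_measurable[OF \<Delta> a f k g h])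
  show "isCont (torus_sum \<Delta> a L g h f k) (x, y)" if reg: "\<forall>\<gamma>\<in>\<Gamma>. \<bar>y + snd \<gamma>\<bar> \<noteq> a"
    unfolding torus_sum_def[abs_def]
    by (intro continuous_sum torus_series_isCont[OF \<Delta> a f k sq(1) sq(2)] reg[rule_format])
  show "torus_sum \<Delta> a L g h f k (z + \<gamma>) = torus_sum \<Delta> a L g h f k z" if "\<gamma> \<in> \<Gamma>"
    unfolding torus_sum_def by (intro sum.cong refl torus_series_periodic that)
qed

lemma torus_sum_coefficient:
  assumes f: "f \<in> test_functions" and k: "k \<in> test_functions" and \<eta>: "\<eta> \<in> dual_lattice \<Gamma>"
  shows "(\<integral>z. indicator cell z *\<^sub>R (torus_sum \<Delta> a L g h f k z * cis (- (2 * pi * (\<eta> \<bullet> z)))) \<partial>lborel) =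
    of_real (2 * a) * fourier (uniform_density a) (- snd \<eta>) *
      (\<integral>\<omega>. fourier f \<omega> * cnj (fourier k (\<omega> - fst \<eta>)) * cross_sum \<Delta> L g h (fst \<eta>) \<omega> \<partial>lborel)"
proof -
  note sq = amalgam_square_integrable[OF g] amalgam_square_integrable[OF h]
  let ?e = "\<lambda>z. cis (- (2 * pi * (\<eta> \<bullet> z)))" and ?v = "\<lambda>\<omega>. fourier f \<omega> * cnj (fourier k (\<omega> - fst \<eta>))"
  have i1: "integrable lborel (\<lambda>z. indicator cell z *\<^sub>R (torus_series \<Delta> a f k (g l) (h l) z * ?e z))" if l: "l \<in> {1..L}" for l
  proof -
    obtain K where K: "\<forall>z. norm (torus_series \<Delta> a f k (g l) (h l) z) \<le> K"
      using torus_series_bounded[OF \<Delta> a f k sq(1)[OF l] sq(2)[OF l]] by (elim exE)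
    show ?thesis
    proof (rule cell_integrable)
      have [measurable]: "torus_series \<Delta> a f k (g l) (h l) \<in> borel_measurable borel"
        by (rule torus_series_measurable[OF \<Delta> a f k g[OF l] h[OF l]])
      show "(\<lambda>z. torus_series \<Delta> a f k (g l) (h l) z * ?e z) \<in> borel_measurable borel" by measurable
      show "norm (torus_series \<Delta> a f k (g l) (h l) z * ?e z) \<le> K" for z using K[rule_format, of z] by (simp add: norm_mult)
    qed
  qed
  have i2: "integrable lborel (\<lambda>\<omega>. ?v \<omega> * cross_series \<Delta> (g l) (h l) (fst \<eta>) \<omega>)" if l: "l \<in> {1..L}" for l
  proof -
    have one: "(\<exists>K. \<forall>\<omega>. norm (cross_series \<Delta> (g l) (h l) (fst \<eta>) \<omega>) \<le> K) \<and> (\<forall>\<omega>. isCont (cross_series \<Delta> (g l) (h l) (fst \<eta>)) \<omega>)"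
      by (rule cross_series_bounds[OF \<Delta> g[OF l] h[OF l]]) blast
    then obtain K where K: "\<And>\<omega>. norm (cross_series \<Delta> (g l) (h l) (fst \<eta>) \<omega>) \<le> K" by blast
    have [measurable]: "cross_series \<Delta> (g l) (h l) (fst \<eta>) \<in> borel_measurable borel"
      by (rule borel_measurable_continuous_onI) (use one in \<open>simp add: continuous_on_eq_continuous_at\<close>)
    show ?thesis by (rule integrable_mult_bounded[OF fourier_product(1)[OF f k] _ K]) measurable
  qed
  have "(\<integral>z. indicator cell z *\<^sub>R (torus_sum \<Delta> a L g h f k z * ?e z) \<partial>lborel) =
      (\<Sum>l=1..L. \<integral>z. indicator cell z *\<^sub>R (torus_series \<Delta> a f k (g l) (h l) z * ?e z) \<partial>lborel)"
    unfolding torus_sum_def sum_distrib_right scaleR_sum_right by (rule Bochner_Integration.integral_sum) (rule i1)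
  also have "\<dots> = (\<Sum>l=1..L. of_real (2 * a) * fourier (uniform_density a) (- snd \<eta>) * (\<integral>\<omega>. ?v \<omega> * cross_series \<Delta> (g l) (h l) (fst \<eta>) \<omega> \<partial>lborel))"
    by (rule sum.cong[OF refl]) (rule torus_series_coefficient[OF \<Delta> a f k g h \<eta>])
  also have "\<dots> = of_real (2 * a) * fourier (uniform_density a) (- snd \<eta>) * (\<integral>\<omega>. (\<Sum>l=1..L. ?v \<omega> * cross_series \<Delta> (g l) (h l) (fst \<eta>) \<omega>) \<partial>lborel)"
  proof -
    have "(\<integral>\<omega>. (\<Sum>l=1..L. ?v \<omega> * cross_series \<Delta> (g l) (h l) (fst \<eta>) \<omega>) \<partial>lborel) =
        (\<Sum>l=1..L. \<integral>\<omega>. ?v \<omega> * cross_series \<Delta> (g l) (h l) (fst \<eta>) \<omega> \<partial>lborel)"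
      by (rule Bochner_Integration.integral_sum) (rule i2)
    then show ?thesis by (simp only: sum_distrib_left)
  qed
  finally show ?thesis unfolding cross_sum_def sum_distrib_left .
qed

text \<open>The difference of the two sides of the duality condition at \<eta>, after the density
  and \<Phi> have been evaluated. It is continuous, so vanishing almost everywhere and vanishing
  everywhere are the same.\<close>

definition defect :: "'b \<times> real \<Rightarrow> 'b \<Rightarrow> complex" where
  "defect \<eta> \<omega> = of_real (2 * a / measure lborel cell) * fourier (uniform_density a) (- snd \<eta>) * cross_sum \<Delta> L g h (fst \<eta>) \<omega> -
    (if \<eta> = 0 then 1 else 0)"

lemma defect_regular: "isCont (defect \<eta>) \<omega>" "\<exists>K. \<forall>\<omega>. norm (defect \<eta> \<omega>) \<le> K"
proof -
  show "isCont (defect \<eta>) \<omega>" unfolding defect_def[abs_def]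
    by (intro continuous_diff continuous_mult continuous_const cross_regular(1))
  obtain K where K: "\<forall>\<omega>. norm (cross_sum \<Delta> L g h (fst \<eta>) \<omega>) \<le> K" using cross_regular(2)[of "fst \<eta>"] by (elim exE)
  let ?c = "of_real (2 * a / measure lborel cell) * fourier (uniform_density a) (- snd \<eta>)"
  have "norm (defect \<eta> \<omega>) \<le> norm ?c * K + 1" for \<omega>
  proof -
    have "norm (defect \<eta> \<omega>) \<le> norm (?c * cross_sum \<Delta> L g h (fst \<eta>) \<omega>) + norm (if \<eta> = 0 then 1 else 0 :: complex)"
      unfolding defect_def by (rule norm_triangle_ineq4)
    also have "\<dots> \<le> norm ?c * K + 1"
      unfolding norm_mult[of ?c] by (intro add_mono mult_left_mono K[rule_format]) auto
    finally show ?thesis .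
  qed
  then show "\<exists>K. \<forall>\<omega>. norm (defect \<eta> \<omega>) \<le> K" by (intro exI allI)
qed

text \<open>A constant has its only nonzero coefficient at \<open>\<eta> = 0\<close>, and there
  Parseval writes \<open>L2_inner f k\<close> as the integral of the product of the transforms.
  Subtracting the constant thus becomes subtracting the Kronecker delta under the frequency
  integral, and the factor \<open>measure lborel cell\<close> turns \<open>2 * a\<close> into the
  density.\<close>

lemma defect_coefficient:
  assumes f: "f \<in> test_functions" and k: "k \<in> test_functions" and \<eta>: "\<eta> \<in> dual_lattice \<Gamma>"
  shows "(\<integral>z. indicator cell z *\<^sub>R ((torus_sum \<Delta> a L g h f k z - L2_inner f k) * cis (- (2 * pi * (\<eta> \<bullet> z)))) \<partial>lborel) =
    of_real (measure lborel cell) * (\<integral>\<omega>. fourier f \<omega> * cnj (fourier k (\<omega> - fst \<eta>)) * defect \<eta> \<omega> \<partial>lborel)"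
proof -
  let ?e = "\<lambda>z. cis (- (2 * pi * (\<eta> \<bullet> z)))" and ?v = "\<lambda>\<omega>. fourier f \<omega> * cnj (fourier k (\<omega> - fst \<eta>))"
  let ?G = "cross_sum \<Delta> L g h (fst \<eta>)" and ?T = "torus_sum \<Delta> a L g h f k" and ?c = "L2_inner f k"
  let ?m = "measure lborel cell" and ?p = "fourier (uniform_density a) (- snd \<eta>)" and ?\<delta> = "if \<eta> = 0 then 1 else 0 :: complex"
  have e_neg: "?e z = cis (2 * pi * ((- \<eta>) \<bullet> z))" for z by simp
  have em: "(\<lambda>z. cis (- (2 * pi * (\<eta> \<bullet> z)))) \<in> borel_measurable borel" by measurable
  have Tm: "?T \<in> borel_measurable borel" by (rule torus_sum_regular(2)[OF f k])
  obtain K where K: "\<forall>z. norm (?T z) \<le> K" using torus_sum_regular(1)[OF f k] by (elim exE)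
  have i1: "integrable lborel (\<lambda>z. indicator cell z *\<^sub>R (?T z * ?e z))"
    by (rule cell_integrable[of _ K]) (use Tm em K in \<open>auto simp: norm_mult\<close>)
  have i2: "integrable lborel (\<lambda>z. indicator cell z *\<^sub>R (?e z))" by (rule cell_integrable[of _ 1]) (use em in auto)
  have ce: "(\<integral>z. indicator cell z *\<^sub>R ?e z \<partial>lborel) = ?\<delta> * of_real ?m"
    unfolding e_neg character_integral[OF dual_lattice_neg[OF \<eta>]] by simp
  have "(\<integral>z. indicator cell z *\<^sub>R ((?T z - ?c) * ?e z) \<partial>lborel) =
      (\<integral>z. indicator cell z *\<^sub>R (?T z * ?e z) - ?c * (indicator cell z *\<^sub>R ?e z) \<partial>lborel)"
    by (intro Bochner_Integration.integral_cong refl) (simp add: indicator_def algebra_simps)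
  also have "\<dots> = (\<integral>z. indicator cell z *\<^sub>R (?T z * ?e z) \<partial>lborel) - ?c * (\<integral>z. indicator cell z *\<^sub>R ?e z \<partial>lborel)"
    by (simp only: Bochner_Integration.integral_diff[OF i1 integrable_mult_right[OF i2]] integral_mult_right_zero)
  finally have lhs: "(\<integral>z. indicator cell z *\<^sub>R ((?T z - ?c) * ?e z) \<partial>lborel) =
      of_real (2 * a) * ?p * (\<integral>\<omega>. ?v \<omega> * ?G \<omega> \<partial>lborel) - ?c * (?\<delta> * of_real ?m)"
    unfolding ce torus_sum_coefficient[OF f k \<eta>] .
  have vi: "integrable lborel ?v" by (rule fourier_product(1)[OF f k])
  obtain C where C: "\<forall>\<omega>. norm (?G \<omega>) \<le> C" using cross_regular(2)[of "fst \<eta>"] by (elim exE)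
  have Gm [measurable]: "?G \<in> borel_measurable borel"
    by (rule borel_measurable_continuous_onI) (simp add: continuous_on_eq_continuous_at cross_regular(1))
  have vGi: "integrable lborel (\<lambda>\<omega>. ?v \<omega> * ?G \<omega>)"
    by (rule integrable_mult_bounded[OF vi Gm C[rule_format]])
  let ?D = "of_real (2 * a / ?m) * ?p"
  have "(\<integral>\<omega>. ?v \<omega> * defect \<eta> \<omega> \<partial>lborel) = (\<integral>\<omega>. ?D * (?v \<omega> * ?G \<omega>) - ?\<delta> * ?v \<omega> \<partial>lborel)"
    by (intro Bochner_Integration.integral_cong refl) (simp only: defect_def right_diff_distrib mult_ac)
  also have "\<dots> = ?D * (\<integral>\<omega>. ?v \<omega> * ?G \<omega> \<partial>lborel) - ?\<delta> * (\<integral>\<omega>. ?v \<omega> \<partial>lborel)"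
    unfolding Bochner_Integration.integral_diff[OF integrable_mult_right[OF vGi] integrable_mult_right[OF vi]]
    by (simp only: integral_mult_right_zero)
  also have "?\<delta> * (\<integral>\<omega>. ?v \<omega> \<partial>lborel) = ?\<delta> * ?c"
  proof (cases "\<eta> = 0")
    case True
    then show ?thesis using fourier_product(2)[OF f k] by (simp only: fst_zero diff_zero)
  qed simp
  finally have "of_real ?m * (\<integral>\<omega>. ?v \<omega> * defect \<eta> \<omega> \<partial>lborel) =
      of_real ?m * of_real (2 * a / ?m) * ?p * (\<integral>\<omega>. ?v \<omega> * ?G \<omega> \<partial>lborel) - ?c * (?\<delta> * of_real ?m)"
    by (simp only: right_diff_distrib mult_ac)
  also have "of_real ?m * of_real (2 * a / ?m) = complex_of_real (2 * a)"
  proof -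
    have "?m * (2 * a / ?m) = 2 * a" using cell_positive by simp
    then show ?thesis unfolding of_real_mult[symmetric] by (simp only:)
  qed
  finally show ?thesis unfolding lhs ..
qed

lemma defect_zero:
  assumes *: "\<And>f k. f \<in> test_functions \<Longrightarrow> k \<in> test_functions \<Longrightarrow> torus_sum \<Delta> a L g h f k 0 = L2_inner f k"
    and \<eta>: "\<eta> \<in> dual_lattice \<Gamma>"
  shows "defect \<eta> \<omega> = 0"
proof -
  have "(\<integral>\<omega>. fourier f \<omega> * cnj (fourier k (\<omega> - fst \<eta>)) * defect \<eta> \<omega> \<partial>lborel) = 0"
    if f: "f \<in> test_functions" and k: "k \<in> test_functions" for f k
  proof -
    let ?T = "torus_sum \<Delta> a L g h f k" and ?c = "L2_inner f k"
    have T0: "?T (- x, 0) = ?c" for x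
    proof -
      have "?T (- x, 0) = torus_sum \<Delta> a L g h (\<lambda>t. f (t - x)) (\<lambda>t. k (t - x)) 0"
        unfolding torus_sum_def using g h
        by (intro sum.cong refl torus_series_translate[symmetric] f k) (auto simp: amalgam_def)
      also have "\<dots> = L2_inner (\<lambda>t. f (t - x)) (\<lambda>t. k (t - x))"
        by (intro * test_function_translate f k)
      also have "\<dots> = ?c" by (intro L2_inner_shift test_function_borel f k)
      finally show ?thesis .
    qed
    have T\<gamma>: "?T (x, snd \<gamma>) = ?c" if "\<gamma> \<in> \<Gamma>" for x \<gamma>
    proof -
      have "(x, snd \<gamma>) = (- (fst \<gamma> - x), 0) + \<gamma>" by (simp add: prod_eq_iff)
      then show ?thesis using torus_sum_regular(4)[OF f k that, of "(- (fst \<gamma> - x), 0)"] T0[of "fst \<gamma> - x"] by simp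
    qed
    have reg: "?T z = ?c" if z: "\<forall>\<gamma>\<in>\<Gamma>. \<bar>snd z + snd \<gamma>\<bar> \<noteq> a" for z
    proof (rule ccontr)
      assume ne: "?T z \<noteq> ?c"
      have "isCont ?T z" using torus_sum_regular(3)[OF f k z, of "fst z"] by simp
      from continuous_at_avoid[OF this ne] obtain e where e: "e > 0" "\<forall>y. dist z y < e \<longrightarrow> ?T y \<noteq> ?c" by blast
      \<comment> \<open>The point \<open>z\<close> is approached vertically, with
        \<open>fst z\<close> fixed: the value of the sum is known at every height in the projection
        of the lattice, whatever the first coordinate is.\<close>
      obtain \<gamma> where \<gamma>: "\<gamma> \<in> \<Gamma>" "snd z < snd \<gamma>" "snd \<gamma> < snd z + e"
        using dense_point[of "snd z" "snd z + e"] e(1) by auto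
      have "dist z (fst z, snd \<gamma>) < e" using \<gamma> by (simp add: dist_prod_def dist_real_def)
      then show False using e(2) T\<gamma>[OF \<gamma>(1)] by blast
    qed
    have "(\<integral>z. indicator cell z *\<^sub>R ((?T z - ?c) * cis (- (2 * pi * (\<eta> \<bullet> z)))) \<partial>lborel) = 0"
    proof (rule integral_eq_zero_AE)
      show "AE z in lborel. indicator cell z *\<^sub>R ((?T z - ?c) * cis (- (2 * pi * (\<eta> \<bullet> z)))) = 0"
        using AE_regular[of a] by eventually_elim (simp add: reg)
    qed
    then show ?thesis unfolding defect_coefficient[OF f k \<eta>] using cell_positive by simp
  qed
  moreover obtain K where K: "\<forall>\<omega>. norm (defect \<eta> \<omega>) \<le> K" using defect_regular(2)[of \<eta>] by (elim exE)
  ultimately show ?thesis by (intro continuous_zero_by_testing[OF defect_regular(1) K[rule_format]])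
qed

lemma reproducing_of_defect:
  assumes *: "\<And>\<eta>. \<eta> \<in> dual_lattice \<Gamma> \<Longrightarrow> AE \<omega> in lebesgue. defect \<eta> \<omega> = 0"
    and generic: "\<forall>\<gamma>\<in>\<Gamma>. \<bar>snd \<gamma>\<bar> \<noteq> a"
    and f: "f \<in> test_functions" and k: "k \<in> test_functions"
  shows "torus_sum \<Delta> a L g h f k 0 = L2_inner f k"
proof -
  let ?T = "torus_sum \<Delta> a L g h f k" and ?c = "L2_inner f k"
  obtain K where K: "\<forall>z. norm (?T z) \<le> K" using torus_sum_regular(1)[OF f k] by (elim exE)
  note Tm [measurable] = torus_sum_regular(2)[OF f k]
  have "?T 0 - ?c = 0"
  proof (rule fourier_coefficients_unique[where H = "\<lambda>z. ?T z - ?c" and M = "K + norm ?c"])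
    show "(\<lambda>z. ?T z - ?c) \<in> borel_measurable borel" by measurable
    show "norm (?T z - ?c) \<le> K + norm ?c" for z
      using norm_triangle_ineq4[of "?T z" ?c] K[rule_format, of z] by linarith
    show "?T (z + \<gamma>) - ?c = ?T z - ?c" if "\<gamma> \<in> \<Gamma>" for z \<gamma>
      unfolding torus_sum_regular(4)[OF f k that] ..
    show "isCont (\<lambda>z. ?T z - ?c) 0"
      using torus_sum_regular(3)[OF f k, of 0 0] generic by (intro continuous_diff continuous_const) (simp add: zero_prod_def)
    fix \<eta> assume "\<eta> \<in> dual_lattice \<Gamma>"
    \<comment> \<open>The uniqueness theorem tests against the character of \<eta>, whereas
      coefficients carry the conjugate character; the dual lattice is symmetric, so the hypothesis
      is used at \<open>- \<eta>\<close>.\<close>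
    then have \<eta>: "- \<eta> \<in> dual_lattice \<Gamma>" by (rule dual_lattice_neg)
    have Wm: "defect (- \<eta>) \<in> borel_measurable borel"
      by (rule borel_measurable_continuous_onI) (simp add: continuous_on_eq_continuous_at defect_regular(1))
    let ?v = "\<lambda>\<omega>. fourier f \<omega> * cnj (fourier k (\<omega> - fst (- \<eta>)))"
    have vm: "?v \<in> borel_measurable lborel" by (rule borel_measurable_integrable[OF fourier_product(1)[OF f k]])
    have "(\<integral>\<omega>. ?v \<omega> * defect (- \<eta>) \<omega> \<partial>lborel) = (\<integral>\<omega>. ?v \<omega> * defect (- \<eta>) \<omega> \<partial>lebesgue)"
      by (rule integral_completion[symmetric]) (use Wm vm in measurable)
    also have "\<dots> = 0"
      by (rule integral_eq_zero_AE) (use *[OF \<eta>] in eventually_elim, simp)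
    finally show "(\<integral>z. indicator cell z *\<^sub>R ((?T z - ?c) * cis (2 * pi * (\<eta> \<bullet> z))) \<partial>lborel) = 0"
      using defect_coefficient[OF f k \<eta>] by simp
  qed
  then show ?thesis by simp
qed

end

end

section \<open>Gabor systems over model sets\<close>

text \<open>Windows in the amalgam space are only Lebesgue measurable. Changing them on a null set
  affects neither Fourier transforms nor inner products, so the analysis may be carried out for
  Borel functions.\<close>

lemma borel_representative:
  fixes g :: "'a::euclidean_space \<Rightarrow> complex"
  assumes "g \<in> borel_measurable lebesgue"
  obtains g' where "g' \<in> borel_measurable borel" "AE x in lebesgue. g x = g' x"
proof -
  have "(\<lambda>x. Re (g x)) \<in> borel_measurable lebesgue" "(\<lambda>x. Im (g x)) \<in> borel_measurable lebesgue"
    using assms by measurable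
  from completion_ex_borel_measurable_real[OF this(1)] completion_ex_borel_measurable_real[OF this(2)]
  obtain u v where uv: "u \<in> borel_measurable lborel" "v \<in> borel_measurable lborel"
    and ae: "AE x in lborel. Re (g x) = u x" "AE x in lborel. Im (g x) = v x" by blast
  have "AE x in lborel. g x = of_real (u x) + \<i> * of_real (v x)"
    using ae by eventually_elim (simp add: complex_eq_iff)
  moreover have "(\<lambda>x. of_real (u x) + \<i> * of_real (v x)) \<in> borel_measurable borel" using uv by simp
  ultimately show thesis using AE_completion that by blast
qed

lemma AE_lebesgue_translate:
  fixes P :: "'a::euclidean_space \<Rightarrow> bool"
  assumes "AE x in lebesgue. P x"
  shows "AE x in lebesgue. P (x - a)"
proof -
  obtain N where N: "{x \<in> space lebesgue. \<not> P x} \<subseteq> N" "emeasure lebesgue N = 0" "N \<in> sets lebesgue"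
    using assms by (rule AE_E)
  then have "negligible ((+) a ` N)" by (intro negligible_translation) (simp add: negligible_iff_null_sets null_sets_def N)
  moreover have "{x \<in> space lebesgue. \<not> P (x - a)} \<subseteq> (+) a ` N"
  proof
    fix x assume "x \<in> {x \<in> space lebesgue. \<not> P (x - a)}"
    then have "x - a \<in> N" using N(1) by auto
    then show "x \<in> (+) a ` N" by (rule rev_image_eqI) simp
  qed
  ultimately show ?thesis by (intro AE_I') (auto simp: negligible_iff_null_sets)
qed

lemma L2_inner_cong_AE:
  assumes "f \<in> L2" "u \<in> L2" "v \<in> L2" "AE x in lebesgue. u x = v x"
  shows "L2_inner f u = L2_inner f v"
  unfolding L2_inner_def
proof (rule integral_cong_AE)
  show "(\<lambda>x. f x * cnj (u x)) \<in> borel_measurable lebesgue" "(\<lambda>x. f x * cnj (v x)) \<in> borel_measurable lebesgue"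
    using L2_inner_integrable[OF assms(1,2)] L2_inner_integrable[OF assms(1,3)] by (auto intro: borel_measurable_integrable)
  show "AE x in lebesgue. f x * cnj (u x) = f x * cnj (v x)" using assms(4) by eventually_elim simp
qed

lemma fourier_cong_AE:
  fixes g g' :: "'a::euclidean_space \<Rightarrow> complex"
  assumes [measurable]: "g \<in> borel_measurable lebesgue" and g': "g' \<in> borel_measurable borel" and ae: "AE x in lebesgue. g x = g' x"
  shows "fourier g = fourier g'"
proof
  fix \<omega> :: 'a
  have e [measurable]: "(\<lambda>t. cis (- 2 * pi * (t \<bullet> \<omega>))) \<in> borel_measurable lebesgue"
    by (rule measurable_completion) simp
  have [measurable]: "g' \<in> borel_measurable lebesgue" by (rule measurable_completion) (simp add: g')
  show "fourier g \<omega> = fourier g' \<omega>" unfolding fourier_def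
  proof (rule integral_cong_AE)
    show "AE t in lebesgue. g t * cis (- 2 * pi * (t \<bullet> \<omega>)) = g' t * cis (- 2 * pi * (t \<bullet> \<omega>))"
      using ae by eventually_elim simp
  qed measurable
qed

text \<open>The local norms of the original window serve as majorant, since they are not affected by
  the change on a null set.\<close>

lemma amalgam_of_Wiener_amalgam:
  fixes g g' :: "'a::euclidean_space \<Rightarrow> complex"
  assumes g: "g \<in> Wiener_amalgam 2 1" and g' [measurable]: "g' \<in> borel_measurable borel" and ae: "AE x in lebesgue. g x = g' x"
  shows "amalgam g' (\<lambda>k. Lp_norm 2 (\<lambda>x. g x * indicator (cube k 1) x))"
  unfolding amalgam_def
proof (intro conjI ballI)
  let ?w = "\<lambda>k. Lp_norm 2 (\<lambda>x. g x * indicator (cube k 1) x)"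
  have gm [measurable]: "g \<in> borel_measurable lebesgue"
    and gi: "\<And>k. k \<in> integer_points \<Longrightarrow> integrable lebesgue (\<lambda>x. norm (g x * indicator (cube k 1) x) powr 2)"
    and gs: "(\<lambda>k. ?w k powr 1) summable_on integer_points"
    using g by (auto simp: Wiener_amalgam_def)
  show "g' \<in> borel_measurable borel" by (rule g')
  have w0: "0 \<le> ?w k" for k by (simp add: Lp_norm_def)
  show "?w summable_on integer_points" using gs w0 by simp
  fix k :: 'a assume k: "k \<in> integer_points"
  show "0 \<le> ?w k" by (rule w0)
  have [measurable]: "cube k 1 \<in> sets borel" unfolding cube_eq_cbox[of 1, simplified] by simp
  have i: "integrable lebesgue (\<lambda>x. (norm (g x * indicator (cube k 1) x))\<^sup>2)" using gi[OF k] by simp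
  have e: "AE x in lebesgue. (norm (g x * indicator (cube k 1) x))\<^sup>2 = (norm (indicator (cube k 1) x *\<^sub>R g' x))\<^sup>2"
    using ae by eventually_elim (simp add: indicator_def)
  have m: "(\<lambda>x. (norm (indicator (cube k 1) x *\<^sub>R g' x))\<^sup>2) \<in> borel_measurable borel" by measurable
  have m': "(\<lambda>x. (norm (indicator (cube k 1) x *\<^sub>R g' x))\<^sup>2) \<in> borel_measurable lebesgue"
    by (rule measurable_completion) (use m in simp)
  note mg = borel_measurable_integrable[OF i]
  have "integrable lebesgue (\<lambda>x. (norm (indicator (cube k 1) x *\<^sub>R g' x))\<^sup>2)"
    using i integrable_cong_AE[OF mg m' e] by (rule iffD1[rotated])
  then show "integrable lborel (\<lambda>x. (norm (indicator (cube k 1) x *\<^sub>R g' x))\<^sup>2)"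
    using m by (subst (asm) integrable_completion) simp_all
  have "(\<integral>x. (norm (indicator (cube k 1) x *\<^sub>R g' x))\<^sup>2 \<partial>lborel) = (\<integral>x. (norm (indicator (cube k 1) x *\<^sub>R g' x))\<^sup>2 \<partial>lebesgue)"
    using m by (intro integral_completion[symmetric]) simp
  also have "\<dots> = sqnorm (\<lambda>x. g x * indicator (cube k 1) x)"
    unfolding sqnorm_def by (rule integral_cong_AE[OF mg m' e, symmetric])
  also have "\<dots> = (?w k)\<^sup>2" by (simp add: Lp_norm_2)
  finally show "(\<integral>x. (norm (indicator (cube k 1) x *\<^sub>R g' x))\<^sup>2 \<partial>lborel) \<le> (?w k)\<^sup>2" by simp
qed

lemma symmetric_compact_interval:
  fixes \<Omega> :: "real set"
  assumes "compact \<Omega>" "is_interval \<Omega>" "interior \<Omega> \<noteq> {}" "uminus ` \<Omega> = \<Omega>"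
  obtains a where "a > 0" "\<Omega> = {- a..a}"
proof -
  obtain u v where uv: "\<Omega> = {u..v}"
    using connected_compact_interval_1[of \<Omega>] assms(1,2) by (auto simp: is_interval_connected_1)
  then have "u < v" using assms(3) by (auto simp: interior_atLeastAtMost_real)
  moreover have "{- v..- u} = {u..v}" using assms(4) by (simp add: uv)
  ultimately have "u = - v" by (auto simp: atLeastatMost_subset_iff dest!: equalityD1)
  then show thesis using that[of v] uv \<open>u < v\<close> by simp
qed

context cut_and_project
begin

text \<open>The two Bessel bounds make the weak expansion summable over all triples of generator,
  translation and modulation, which permits iterated summation. The innermost sum is
  \<open>corr_series\<close>, and summing it over the model set gives the periodization at the
  origin.\<close>

lemma Gabor_expansion_eq_torus_sum:
  assumes bg: "Bessel_sequence ({1..L} \<times> model_set \<Gamma> {- a..a} \<times> \<Delta>) (gabor g)"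
    and bh: "Bessel_sequence ({1..L} \<times> model_set \<Gamma> {- a..a} \<times> \<Delta>) (gabor h)"
    and g: "\<And>l. l \<in> {1..L} \<Longrightarrow> square_integrable (g' l) \<and> (AE x in lebesgue. g l x = g' l x)"
    and h: "\<And>l. l \<in> {1..L} \<Longrightarrow> square_integrable (h' l) \<and> (AE x in lebesgue. h l x = h' l x)"
    and f: "f \<in> test_functions" and k: "k \<in> test_functions"
  shows "(\<Sum>\<^sub>\<infinity>j\<in>{1..L} \<times> model_set \<Gamma> {- a..a} \<times> \<Delta>. L2_inner f (gabor g j) * L2_inner (gabor h j) k) =
    torus_sum \<Delta> a L g' h' f k 0"
proof -
  let ?M = "model_set \<Gamma> {- a..a}"
  let ?I = "{1..L} \<times> ?M \<times> \<Delta>"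
  have corr: "L2_inner u (gabor e (l, x, \<beta>)) = correlation u e' x \<beta>"
    if u: "u \<in> test_functions" and b: "Bessel_sequence ?I (gabor e)" and j: "(l, x, \<beta>) \<in> ?I"
      and e': "square_integrable e'" and ae: "AE x in lebesgue. e l x = e' x" for u e e' l x \<beta>
    unfolding correlation_def
  proof (rule L2_inner_cong_AE)
    show "u \<in> L2" by (rule test_function_L2[OF u])
    show "gabor e (l, x, \<beta>) \<in> L2" using b j unfolding Bessel_sequence_def by blast
    show "transl x (modul \<beta> e') \<in> L2" by (rule gabor_element_L2[OF e'])
    show "AE t in lebesgue. gabor e (l, x, \<beta>) t = transl x (modul \<beta> e') t"
      using AE_lebesgue_translate[OF ae, of x] by eventually_elim (simp add: gabor_def transl_def modul_def)
  qed
  let ?t = "\<lambda>j. L2_inner f (gabor g j) * L2_inner (gabor h j) k"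
  have summable: "?t summable_on ?I"
  proof -
    obtain B where B: "B \<ge> 0" "\<And>u. u \<in> L2 \<Longrightarrow> l2_bound ?I (B * sqnorm u) (\<lambda>j. L2_inner u (gabor g j))"
      by (rule Bessel_l2_bound[OF bg]) (rule that, assumption, blast)
    obtain B' where B': "B' \<ge> 0" "\<And>u. u \<in> L2 \<Longrightarrow> l2_bound ?I (B' * sqnorm u) (\<lambda>j. L2_inner u (gabor h j))"
      by (rule Bessel_l2_bound[OF bh]) (rule that, assumption, blast)
    have 1: "l2_bound ?I (B * sqnorm f) (\<lambda>j. L2_inner f (gabor g j))" by (rule B(2)[OF test_function_L2[OF f]])
    have 2: "l2_bound ?I (B' * sqnorm k) (\<lambda>j. L2_inner (gabor h j) k)"
    proof (rule l2_bound_norm_cong[OF B'(2)[OF test_function_L2[OF k]]])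
      show "norm (L2_inner (gabor h j) k) = norm (L2_inner k (gabor h j))" for j
        by (subst L2_inner_commute) simp
    qed
    show ?thesis by (rule l2_bound_product(2)[OF 1 2])
  qed
  have inner: "(\<Sum>\<^sub>\<infinity>p\<in>?M \<times> \<Delta>. ?t (l, p)) = torus_series \<Delta> a f k (g' l) (h' l) 0" if l: "l \<in> {1..L}" for l
  proof -
    have s: "(\<lambda>p. ?t (l, p)) summable_on ?M \<times> \<Delta>"
      using summable_on_SigmaD1[of "\<lambda>l p. ?t (l, p)" "{1..L}" "\<lambda>_. ?M \<times> \<Delta>" l] summable l by (simp add: case_prod_unfold)
    have "(\<Sum>\<^sub>\<infinity>p\<in>?M \<times> \<Delta>. ?t (l, p)) = (\<Sum>\<^sub>\<infinity>x\<in>?M. \<Sum>\<^sub>\<infinity>\<beta>\<in>\<Delta>. ?t (l, x, \<beta>))"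
      by (rule infsum_Sigma_banach[OF s, symmetric])
    also have "\<dots> = (\<Sum>\<^sub>\<infinity>x\<in>?M. corr_series \<Delta> f k (g' l) (h' l) x)"
      unfolding corr_series_def
    proof (intro infsum_cong)
      fix x \<beta> assume "x \<in> ?M" "\<beta> \<in> \<Delta>"
      then have j: "(l, x, \<beta>) \<in> ?I" using l by simp
      have "L2_inner (gabor h (l, x, \<beta>)) k = cnj (L2_inner k (gabor h (l, x, \<beta>)))" by (rule L2_inner_commute)
      then show "?t (l, x, \<beta>) = correlation f (g' l) x \<beta> * cnj (correlation k (h' l) x \<beta>)"
        using corr[OF f bg j conjunct1[OF g[OF l]] conjunct2[OF g[OF l]]]
          corr[OF k bh j conjunct1[OF h[OF l]] conjunct2[OF h[OF l]]] by simp
    qed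
    also have "\<dots> = torus_series \<Delta> a f k (g' l) (h' l) 0" by (rule torus_series_zero[symmetric])
    finally show ?thesis .
  qed
  have "(\<Sum>\<^sub>\<infinity>j\<in>?I. ?t j) = (\<Sum>\<^sub>\<infinity>l\<in>{1..L}. \<Sum>\<^sub>\<infinity>p\<in>?M \<times> \<Delta>. ?t (l, p))"
    by (rule infsum_Sigma_banach[OF summable, symmetric])
  also have "\<dots> = torus_sum \<Delta> a L g' h' f k 0"
    unfolding torus_sum_def infsum_finite[OF finite_atLeastAtMost] by (rule sum.cong[OF refl]) (rule inner)
  finally show ?thesis .
qed

end

theorem corollary5p3:
  fixes \<Gamma> :: "((real ^ 'm) \<times> real) set"
    and \<Omega> :: "real set"
    and \<Delta> :: "(real ^ 'm) set"
    and \<epsilon> :: real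
    and L :: nat
    and g h :: "nat \<Rightarrow> real ^ 'm \<Rightarrow> complex"
  assumes "is_lattice \<Gamma>"
    and "inj_on fst \<Gamma>" and "closure (fst ` \<Gamma>) = UNIV"
    and "inj_on snd \<Gamma>" and "closure (snd ` \<Gamma>) = UNIV"
    and "compact \<Omega>" and "is_interval \<Omega>" and "interior \<Omega> \<noteq> {}"
    and "uminus ` \<Omega> = \<Omega>"
    and "snd ` \<Gamma> \<inter> frontier \<Omega> = {}"
    and "snd ` dual_lattice \<Gamma> \<inter> frontier \<Omega> = {}"
    and "relatively_dense \<Delta>" and "uniform_discrete \<Delta>"
    and "0 < \<epsilon>" and "\<epsilon> < 1"
    and "\<forall>l\<in>{1..L}. g l \<in> Wiener_amalgam 2 1 \<and> h l \<in> Wiener_amalgam 2 1"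
    and "Bessel_sequence ({1..L} \<times> model_set \<Gamma> \<Omega> \<times> \<Delta>) (gabor g)"
    and "Bessel_sequence ({1..L} \<times> model_set \<Gamma> \<Omega> \<times> \<Delta>) (gabor h)"
  shows "dual_system ({1..L} \<times> model_set \<Gamma> \<Omega> \<times> \<Delta>) (gabor h) (gabor g) \<longleftrightarrow>
    (\<forall>\<eta>\<in>dual_lattice \<Gamma>. AE t in lebesgue.
      of_real (point_density (model_set \<Gamma> \<Omega>)) * Phi \<epsilon> \<Omega> (- snd \<eta>) *
        (\<Sum>l=1..L. \<Sum>\<^sub>\<infinity>\<beta>\<in>\<Delta>. cnj (fourier (g l) (t - \<beta>)) * fourier (h l) (t - \<beta> - fst \<eta>))
      = (if \<eta> = 0 then 1 else 0))"
proof -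
  obtain B where B: "independent B" "span B = UNIV" "\<Gamma> = range (\<lambda>c. \<Sum>b\<in>B. of_int (c b) *\<^sub>R b)"
    using assms(1) unfolding is_lattice_def by blast
  have "\<exists>d. (\<forall>b\<in>B. \<forall>c\<in>B. d b \<bullet> c = (if b = c then 1 else 0)) \<and> (\<forall>z. z = (\<Sum>b\<in>B. (d b \<bullet> z) *\<^sub>R b)) \<and> finite B"
  proof (rule dual_basis_exists[OF B(1,2)])
    fix d :: "(real ^ 'm) \<times> real \<Rightarrow> (real ^ 'm) \<times> real"
    assume 1: "\<And>b c. b \<in> B \<Longrightarrow> c \<in> B \<Longrightarrow> d b \<bullet> c = (if b = c then 1 else 0)"
      and 2: "\<And>z. z = (\<Sum>b\<in>B. (d b \<bullet> z) *\<^sub>R b)" and 3: "finite B"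
    show ?thesis by (intro exI[of _ d] conjI ballI allI 3) (rule 1, assumption, assumption, rule 2)
  qed
  then obtain d where d: "\<forall>b\<in>B. \<forall>c\<in>B. d b \<bullet> c = (if b = c then 1 else 0)" "\<forall>z. z = (\<Sum>b\<in>B. (d b \<bullet> z) *\<^sub>R b)" "finite B"
    by (elim exE conjE)
  interpret cut_and_project \<Gamma> B d
  proof
    show "finite B" by (rule d(3))
    show "d b \<bullet> c = (if b = c then 1 else 0)" if "b \<in> B" "c \<in> B" for b c using d(1) that by blast
    show "z = (\<Sum>b\<in>B. (d b \<bullet> z) *\<^sub>R b)" for z by (rule spec[OF d(2)])
    show "\<Gamma> = range (\<lambda>c. \<Sum>b\<in>B. of_int (c b) *\<^sub>R b)" by (rule B(3))
    show "inj_on fst \<Gamma>" "closure (snd ` \<Gamma>) = UNIV" by (rule assms)+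
  qed
  obtain a where a: "a > 0" "\<Omega> = {- a..a}" by (rule symmetric_compact_interval[OF assms(6-9)])
  have generic: "\<forall>\<gamma>\<in>\<Gamma>. \<bar>snd \<gamma>\<bar> \<noteq> a"
  proof
    fix \<gamma> assume "\<gamma> \<in> \<Gamma>"
    moreover have "frontier \<Omega> = {- a, a}" using a by (simp add: frontier_def)
    ultimately have "snd \<gamma> \<notin> {- a, a}" using assms(10) by blast
    then show "\<bar>snd \<gamma>\<bar> \<noteq> a" by (auto simp: abs_if)
  qed
  have rep: "\<exists>e'. e' \<in> borel_measurable borel \<and> (AE x in lebesgue. e x = e' x)" if "e \<in> Wiener_amalgam 2 1" for e :: "real ^ 'm \<Rightarrow> complex"
  proof -
    have "e \<in> borel_measurable lebesgue" using that by (simp add: Wiener_amalgam_def)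
    then show ?thesis by (rule borel_representative) (rule exI, rule conjI)
  qed
  have mem: "g l \<in> Wiener_amalgam 2 1" "h l \<in> Wiener_amalgam 2 1" if "l \<in> {1..L}" for l
    using bspec[OF assms(16) that] by simp_all
  have "\<forall>l\<in>{1..L}. \<exists>e'. e' \<in> borel_measurable borel \<and> (AE x in lebesgue. g l x = e' x)"
    "\<forall>l\<in>{1..L}. \<exists>e'. e' \<in> borel_measurable borel \<and> (AE x in lebesgue. h l x = e' x)"
    by (intro ballI rep mem; assumption)+
  from bchoice[OF this(1)] bchoice[OF this(2)] obtain g' h'
    where g': "\<forall>l\<in>{1..L}. g' l \<in> borel_measurable borel \<and> (AE x in lebesgue. g l x = g' l x)"
      and h': "\<forall>l\<in>{1..L}. h' l \<in> borel_measurable borel \<and> (AE x in lebesgue. h l x = h' l x)" by (elim exE)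
  have ag: "amalgam (g' l) (\<lambda>k. Lp_norm 2 (\<lambda>x. g l x * indicator (cube k 1) x))" if "l \<in> {1..L}" for l
    by (rule amalgam_of_Wiener_amalgam[OF mem(1)[OF that] conjunct1[OF bspec[OF g' that]] conjunct2[OF bspec[OF g' that]]])
  have ah: "amalgam (h' l) (\<lambda>k. Lp_norm 2 (\<lambda>x. h l x * indicator (cube k 1) x))" if "l \<in> {1..L}" for l
    by (rule amalgam_of_Wiener_amalgam[OF mem(2)[OF that] conjunct1[OF bspec[OF h' that]] conjunct2[OF bspec[OF h' that]]])
  let ?I = "{1..L} \<times> model_set \<Gamma> \<Omega> \<times> \<Delta>"
  note reg = assms(13) a(1) ag ah
  have "dual_system ?I (gabor h) (gabor g) \<longleftrightarrow>
      (\<forall>f\<in>test_functions. \<forall>k\<in>test_functions. torus_sum \<Delta> a L g' h' f k 0 = L2_inner f k)"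
    unfolding dual_system_iff_weak[OF assms(18,17)]
  proof (intro ball_cong refl)
    fix f k :: "real ^ 'm \<Rightarrow> complex" assume fk: "f \<in> test_functions" "k \<in> test_functions"
    have "(\<Sum>\<^sub>\<infinity>j\<in>?I. L2_inner f (gabor g j) * L2_inner (gabor h j) k) = torus_sum \<Delta> a L g' h' f k 0"
      unfolding a(2)
    proof (rule Gabor_expansion_eq_torus_sum[OF _ _ _ _ fk])
      show "square_integrable (g' l) \<and> (AE x in lebesgue. g l x = g' l x)" if "l \<in> {1..L}" for l
        by (rule conjI[OF amalgam_square_integrable[OF ag[OF that]] conjunct2[OF bspec[OF g' that]]])
      show "square_integrable (h' l) \<and> (AE x in lebesgue. h l x = h' l x)" if "l \<in> {1..L}" for l
        by (rule conjI[OF amalgam_square_integrable[OF ah[OF that]] conjunct2[OF bspec[OF h' that]]])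
    qed (use assms(17,18) a(2) in simp_all)
    then show "((\<Sum>\<^sub>\<infinity>j\<in>?I. L2_inner f (gabor g j) * L2_inner (gabor h j) k) = L2_inner f k) \<longleftrightarrow> torus_sum \<Delta> a L g' h' f k 0 = L2_inner f k"
      by (simp only:)
  qed
  \<comment> \<open>From the reproducing identity the defect vanishes at every point; in the
    converse direction vanishing almost everywhere is enough, because the defect enters only through
    integrals.\<close>
  also have "\<dots> \<longleftrightarrow> (\<forall>\<eta>\<in>dual_lattice \<Gamma>. AE t in lebesgue. defect \<Delta> a L g' h' \<eta> t = 0)"
  proof (intro iffI ballI)
    assume *: "\<forall>f\<in>test_functions. \<forall>k\<in>test_functions. torus_sum \<Delta> a L g' h' f k 0 = L2_inner f k"
    fix \<eta> assume \<eta>: "\<eta> \<in> dual_lattice \<Gamma>"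
    have "defect \<Delta> a L g' h' \<eta> t = 0" for t by (rule defect_zero[OF reg _ \<eta>]) (assumption | rule *[rule_format])+
    then show "AE t in lebesgue. defect \<Delta> a L g' h' \<eta> t = 0" by (intro AE_I2)
  next
    assume *: "\<forall>\<eta>\<in>dual_lattice \<Gamma>. AE t in lebesgue. defect \<Delta> a L g' h' \<eta> t = 0"
    fix f k :: "real ^ 'm \<Rightarrow> complex" assume fk: "f \<in> test_functions" "k \<in> test_functions"
    show "torus_sum \<Delta> a L g' h' f k 0 = L2_inner f k"
      by (rule reproducing_of_defect[OF reg _ generic fk]) (assumption | rule *[rule_format])+
  qed
  also have "\<dots> \<longleftrightarrow> (\<forall>\<eta>\<in>dual_lattice \<Gamma>. AE t in lebesgue.
      of_real (point_density (model_set \<Gamma> \<Omega>)) * Phi \<epsilon> \<Omega> (- snd \<eta>) *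
        (\<Sum>l=1..L. \<Sum>\<^sub>\<infinity>\<beta>\<in>\<Delta>. cnj (fourier (g l) (t - \<beta>)) * fourier (h l) (t - \<beta> - fst \<eta>))
      = (if \<eta> = 0 then 1 else 0))"
  proof (intro ball_cong refl)
    fix \<eta> :: "(real ^ 'm) \<times> real"
    \<comment> \<open>The transforms of a window and of its Borel representative agree at every
      frequency, so the two sums over \<Delta> coincide for every \<open>t\<close> and no null set
      has to be tracked through the infinite sum.\<close>
    have F: "fourier (g l) = fourier (g' l)" "fourier (h l) = fourier (h' l)" if "l \<in> {1..L}" for l
    proof -
      have "g l \<in> borel_measurable lebesgue" "h l \<in> borel_measurable lebesgue"
        using mem[OF that] by (simp_all add: Wiener_amalgam_def)
      from fourier_cong_AE[OF this(1) conjunct1[OF bspec[OF g' that]] conjunct2[OF bspec[OF g' that]]]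
        fourier_cong_AE[OF this(2) conjunct1[OF bspec[OF h' that]] conjunct2[OF bspec[OF h' that]]]
      show "fourier (g l) = fourier (g' l)" "fourier (h l) = fourier (h' l)" .
    qed
    have "(\<Sum>l=1..L. \<Sum>\<^sub>\<infinity>\<beta>\<in>\<Delta>. cnj (fourier (g l) (t - \<beta>)) * fourier (h l) (t - \<beta> - fst \<eta>)) = cross_sum \<Delta> L g' h' (fst \<eta>) t" for t
      unfolding cross_sum_def cross_series_def by (rule sum.cong[OF refl]) (simp only: F)
    then show "(AE t in lebesgue. defect \<Delta> a L g' h' \<eta> t = 0) \<longleftrightarrow> (AE t in lebesgue.
        of_real (point_density (model_set \<Gamma> \<Omega>)) * Phi \<epsilon> \<Omega> (- snd \<eta>) *
          (\<Sum>l=1..L. \<Sum>\<^sub>\<infinity>\<beta>\<in>\<Delta>. cnj (fourier (g l) (t - \<beta>)) * fourier (h l) (t - \<beta> - fst \<eta>))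
        = (if \<eta> = 0 then 1 else 0))"
      unfolding a(2) point_density_model_set[OF a(1)] Phi_eq[OF a(1) assms(14,15)]
      by (simp only: defect_def[OF reg] right_minus_eq)
  qed
  finally show ?thesis .
qed

end
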